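(* Let $\lambda,\mu\in DP$ be such that $D_{\lambda/\mu}$ is basic, let $\nu\in DP$ and $k\in\mathbb{N}$. Then $Q_{\lambda/\mu}=k\cdot Q_\nu$ if and only if $\lambda,\mu,\nu,k$ satisfy one of the following: (i) $\lambda$ arbitrary, $\mu=\emptyset$, $\nu=\lambda$ and $k=1$; (ii) $\lambda=(r,r-1,\ldots,1)$ for some $r$, $0<\ell(\mu)<r-1$, $\nu=\lambda\setminus\mu$ and $k=1$; (iii) $\lambda=(p+q+r,p+q+r-1,p+q+r-2,\ldots,p)$ (all integers from $p+q+r$ down to $p$), $\mu=(q,q-1,\ldots,1)$ with $p,q,r\ge 1$, $\nu=(p+r+q,p+r+q-1,\ldots,p+q+1,p+q,p+q-2,p+q-4,\ldots,\max\{p-q,q+2-p\})$ (consecutive integers from $p+q+r$ down to $p+q$, then decreasing in steps of $2$ down to $\max\{p-q,q+2-p\}$), and $k=1$; (iv) $\lambda=(p+q,p+q-1,\ldots,p+1,p)$, $\mu=(q,q-1,\ldots,1)$ with $p,q\ge1$, $\nu=(p+q,p+q-2,p+q-4,\ldots,\max\{p-q,q-p+2\})$ (decreasing in steps of $2$), and $k=1$; (v) $\lambda=(r+2,r,r-1,\ldots,1)$, $\mu=(r+1)$, $\nu=(r+1,r-1,r-2,\ldots,1)$ for some $r\ge1$, and $k=2$.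
   Context: $DP$ is the set of partitions with distinct parts $\lambda=(\lambda_1>\lambda_2>\dots>\lambda_n>0)$, including the empty partition $\emptyset$; $\ell(\lambda)=n$. The shifted diagram is $D_\lambda=\{(i,j):1\le i\le\ell(\lambda),\ i\le j\le i+\lambda_i-1\}$ (row $i$, column $j$). For $D_\mu\subseteq D_\lambda$, $D_{\lambda/\mu}=D_\lambda\setminus D_\mu$. Alphabet $\mathcal A=\{1'<1<2'<2<\cdots\}$. A tableau of shape $D$ is a map $T:D\to\mathcal A$, weakly increasing along rows (left to right) and columns (top to bottom), with each unmarked letter $k$ at most once per column and each marked letter $k'$ at most once per row. Its content is $c(T)=(c_1,c_2,\ldots)$, $c_i$ the number of entries equal to $i$ or $i'$. The skew Schur $Q$-function is $Q_{\lambda/\mu}=\sum_T x^{c(T)}$ over all tableaux of shape $D_{\lambda/\mu}$ (with $x^c=x_1^{c_1}x_2^{c_2}\cdots$), and $Q_\lambda=Q_{\lambda/\emptyset}$. $D_{\lambda/\mu}$ is called basic if $D_\mu\subseteq D_\lambda$, $\ell(\lambda)>\ell(\mu)$, and $\lambda_i>\mu_i$ and $\lambda_{i+1}\ge\mu_i-1$ for all $1\le i\le\ell(\mu)$. If every part of $\mu$ is a part of $\lambda$, $\lambda\setminus\mu$ denotes the partition obtained from $\lambda$ by removing the parts of $\mu$. *)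

theory Defs
  imports Main
begin

definition is_DP :: "nat list \<Rightarrow> bool" where
  "is_DP lam \<longleftrightarrow> sorted_wrt (>) lam \<and> (\<forall>x\<in>set lam. 0 < x)"

definition part :: "nat list \<Rightarrow> nat \<Rightarrow> nat" where
  "part lam i = (if 1 \<le> i \<and> i \<le> length lam then lam ! (i - 1) else 0)"

definition shifted_diagram :: "nat list \<Rightarrow> (nat \<times> nat) set" where
  "shifted_diagram lam =
     {(i, j). 1 \<le> i \<and> i \<le> length lam \<and> i \<le> j \<and> j + 1 \<le> i + part lam i}"

definition skew_diagram :: "nat list \<Rightarrow> nat list \<Rightarrow> (nat \<times> nat) set" where
  "skew_diagram lam mu = shifted_diagram lam - shifted_diagram mu"

text \<open>Alphabet 1' < 1 < 2' < 2 < ... encoded as positive naturals: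
  k' is encoded as 2k-1, k as 2k. The encoding is order preserving.\<close>

definition is_marked :: "nat \<Rightarrow> bool" where
  "is_marked a \<longleftrightarrow> odd a"

definition letter_num :: "nat \<Rightarrow> nat" where
  "letter_num a = (a + 1) div 2"

definition is_tableau :: "(nat \<times> nat) set \<Rightarrow> (nat \<times> nat \<Rightarrow> nat) \<Rightarrow> bool" where
  "is_tableau D T \<longleftrightarrow>
     (\<forall>x\<in>D. 1 \<le> T x) \<and> (\<forall>x. x \<notin> D \<longrightarrow> T x = 0) \<and>
     (\<forall>i j j'. (i, j) \<in> D \<and> (i, j') \<in> D \<and> j \<le> j' \<longrightarrow> T (i, j) \<le> T (i, j')) \<and>
     (\<forall>i i' j. (i, j) \<in> D \<and> (i', j) \<in> D \<and> i \<le> i' \<longrightarrow> T (i, j) \<le> T (i', j)) \<and>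
     (\<forall>i i' j. (i, j) \<in> D \<and> (i', j) \<in> D \<and> i \<noteq> i' \<and> \<not> is_marked (T (i, j))
          \<longrightarrow> T (i, j) \<noteq> T (i', j)) \<and>
     (\<forall>i j j'. (i, j) \<in> D \<and> (i, j') \<in> D \<and> j \<noteq> j' \<and> is_marked (T (i, j))
          \<longrightarrow> T (i, j) \<noteq> T (i, j'))"

definition content :: "(nat \<times> nat) set \<Rightarrow> (nat \<times> nat \<Rightarrow> nat) \<Rightarrow> nat \<Rightarrow> nat" where
  "content D T = (\<lambda>i. card {x\<in>D. letter_num (T x) = i})"

text \<open>The Schur Q-function of shape D as its coefficient function: the coefficient of
  the monomial x^c (c :: nat \<Rightarrow> nat, exponent of x_i is c i, i \<ge> 1) is the number of
  tableaux of shape D with content c.\<close>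
definition Qcoeff :: "(nat \<times> nat) set \<Rightarrow> (nat \<Rightarrow> nat) \<Rightarrow> nat" where
  "Qcoeff D c = card {T. is_tableau D T \<and> content D T = c}"

definition basic :: "nat list \<Rightarrow> nat list \<Rightarrow> bool" where
  "basic lam mu \<longleftrightarrow> shifted_diagram mu \<subseteq> shifted_diagram lam \<and> length lam > length mu \<and>
     (\<forall>i. 1 \<le> i \<and> i \<le> length mu \<longrightarrow>
        part lam i > part mu i \<and> int (part lam (i + 1)) \<ge> int (part mu i) - 1)"

definition stair :: "nat \<Rightarrow> nat list" where
  "stair r = rev [1..<r + 1]"

definition down_from_to :: "nat \<Rightarrow> nat \<Rightarrow> nat list" where
  "down_from_to b a = rev [a..<b + 1]"

text \<open>(a, a-2, a-4, ..., b), assuming a \<ge> b of the same parity.\<close>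
definition steps2 :: "nat \<Rightarrow> nat \<Rightarrow> nat list" where
  "steps2 a b = map (\<lambda>t. a - 2 * t) [0..<(a - b) div 2 + 1]"

definition remove_parts :: "nat list \<Rightarrow> nat list \<Rightarrow> nat list" where
  "remove_parts lam mu = filter (\<lambda>x. x \<notin> set mu) lam"

end

(*
A partition with distinct parts is encoded by its height function d |-> number of parts > d, i.e. by
the number of boxes on the diagonal d of its shifted diagram.  Removing all letters k', k from a
tableau removes a strip (at most one box per diagonal), and the number of ways to mark the letters
is 2 to the number of runs of diagonals of the strip; so Q_{lambda/mu} becomes a weighted count of
chains of strips from mu to lambda.

The identities.  Complementation in a staircase (h(d) |-> n - d - h(d)) reverses chains, and strips of
different sizes commute (Yang-Baxter), hence Q_{lambda/mu} = Q_{mu^c/lambda^c}; this gives (ii).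
With the Cauchy relation between adding and removing strips one computes the product of the Q-functions
of two staircases a >= b: it is the Q-function of (a+b, a+b-2, ..., a-b+2, a-b, a-b-1, ..., 1).
Complementing gives (iii) and (iv); (v) comes in the same way from the square of a single row.

Necessity.  Write g = lambda - mu for the gap of the height functions.  Filling greedily, the
lexicographically leading content of Q_{lambda/mu} has t-th entry #{d. g(d) >= t}, and after it has been
split off t times the shape min(mu + t, lambda) is left.  If Q_{lambda/mu} = k Q_nu then these data agree
with those of nu, whence every coefficient close to the leading one is, relative to the leading one,
bounded by the value that straight shapes allow: at most 2^(j+1) - 2 for the content
(n_1 - 1, n_2, ..., n_j, n_(j+1) + 1, n_(j+2), ...).  Its fillings are paths of a single missing box through
the levels, and local patterns of the boundary word that force more paths are thereby excluded.
What survives are exactly the five families.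
*)
theory Submission
  imports Defs Complex_Main
begin

text \<open>No ring of symmetric functions is built. A Q-function is the table of its coefficients
  \<open>chain_sum\<close>, and multiplication by the Q-function of k means applying a linear
  combination of words in the strip operators that creates k from the empty shape. Since the
  operators commute, the empty shape is a cyclic vector, and such a combination acts the same way
  whichever representative is chosen. Commutation and the Cauchy relation are identities between
  sums over a middle shape. Both are evaluated as two-state transfer matrices along the diagonals,
  so that a local intertwiner suffices. The bound 2^(j+1) - 2 is 2 + 4 + ... + 2^j. In a straight
  shape whose rows 2, ..., j decrease by one, a missing box can wait only at the end of row 1; once
  it has left, it must go down one row per step, each step costing a factor of at most 2. Some
  excluded patterns exceed the bound by only one. Proportionality to a straight shape survives both
  greedy filling, which lowers all gaps, and complementation, which exchanges the letters N and B.
  The first brings every pattern down to gap one, the second supplies mirror images.\<close>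

section \<open>Height functions, strips and chain sums\<close>

definition height_fn :: "(nat \<Rightarrow> nat) \<Rightarrow> bool" where
  "height_fn h \<longleftrightarrow> (\<forall>d. h (Suc d) \<le> h d \<and> h d \<le> Suc (h (Suc d))) \<and> (\<exists>n. h n = 0)"

definition strip :: "(nat \<Rightarrow> nat) \<Rightarrow> (nat \<Rightarrow> nat) \<Rightarrow> bool" where
  "strip h h' \<longleftrightarrow> (\<forall>d. h d \<le> h' d \<and> h' d \<le> Suc (h d))"

definition added :: "(nat \<Rightarrow> nat) \<Rightarrow> (nat \<Rightarrow> nat) \<Rightarrow> nat set" where
  "added h h' = {d. h d < h' d}"

definition runs :: "nat set \<Rightarrow> nat" where
  "runs S = card {d \<in> S. Suc d \<notin> S}"

definition below :: "(nat \<Rightarrow> nat) \<Rightarrow> (nat \<Rightarrow> nat) set" where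
  "below h = {r. height_fn r \<and> r \<le> h}"

text \<open>This is the coefficient of x^c in a one-variable skew Q-function: in each run exactly
  one box has a free mark. Values are real because later identities divide and compare
  polynomials.\<close>

definition strip_weight :: "nat \<Rightarrow> (nat \<Rightarrow> nat) \<Rightarrow> (nat \<Rightarrow> nat) \<Rightarrow> real" where
  "strip_weight c h h' = (if strip h h' \<and> card (added h h') = c then 2 ^ runs (added h h') else 0)"

primrec chain_sum :: "nat list \<Rightarrow> (nat \<Rightarrow> nat) \<Rightarrow> (nat \<Rightarrow> nat) \<Rightarrow> real" where
  "chain_sum [] h h' = of_bool (h = h')"
| "chain_sum (c # cs) h h' = (\<Sum>r\<in>below h'. strip_weight c h r * chain_sum cs r h')"

lemma height_fnD: "height_fn h \<Longrightarrow> h (Suc d) \<le> h d" "height_fn h \<Longrightarrow> h d \<le> Suc (h (Suc d))"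
  by (auto simp: height_fn_def)

lemma height_fn_antimono: "height_fn h \<Longrightarrow> d \<le> e \<Longrightarrow> h e \<le> h d"
  by (rule lift_Suc_antimono_le[of h]) (auto simp: height_fnD)

lemma height_fn_slope: "height_fn h \<Longrightarrow> h d \<le> h (d + k) + k"
proof (induction k)
  case (Suc k)
  then show ?case using height_fnD(2)[of h "d + k"] by simp
qed simp

lemma height_fn_zero: "height_fn h \<Longrightarrow> \<exists>n. \<forall>d\<ge>n. h d = 0"
  unfolding height_fn_def using height_fn_antimono[of h] by (metis height_fn_def le_zero_eq)

lemma finite_le_height_fn:
  assumes "height_fn h" shows "finite {r. r \<le> h}"
proof -
  obtain n where n: "\<And>d. d \<ge> n \<Longrightarrow> h d = 0" using height_fn_zero[OF assms] by blast
  have "{r. r \<le> h} \<subseteq> {f. \<forall>x. (x \<in> {..<n} \<longrightarrow> f x \<in> {..h 0}) \<and> (x \<notin> {..<n} \<longrightarrow> f x = 0)}"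
  proof
    fix r assume "r \<in> {r. r \<le> h}"
    then have r: "r x \<le> h x" for x by (auto simp: le_fun_def)
    have "r x \<le> h 0" for x using r[of x] height_fn_antimono[OF assms, of 0 x] by linarith
    moreover have "r x = 0" if "x \<ge> n" for x using r[of x] n[OF that] by simp
    ultimately show "r \<in> {f. \<forall>x. (x \<in> {..<n} \<longrightarrow> f x \<in> {..h 0}) \<and> (x \<notin> {..<n} \<longrightarrow> f x = 0)}" by auto
  qed
  then show ?thesis by (rule finite_subset) (rule finite_set_of_finite_funs, auto)
qed

lemma finite_below[simp]: "height_fn h \<Longrightarrow> finite (below h)"
  using finite_le_height_fn[of h] by (auto simp: below_def intro: finite_subset[rotated])

lemma belowD: "r \<in> below h \<Longrightarrow> height_fn r" "r \<in> below h \<Longrightarrow> r d \<le> h d"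
  by (auto simp: below_def le_fun_def)

lemma belowI: "height_fn r \<Longrightarrow> (\<And>d. r d \<le> h d) \<Longrightarrow> r \<in> below h"
  by (auto simp: below_def le_fun_def)

lemma below_refl[simp]: "height_fn h \<Longrightarrow> h \<in> below h" by (simp add: below_def)

lemma below_trans: "r \<in> below s \<Longrightarrow> s \<in> below t \<Longrightarrow> r \<in> below t"
  by (auto simp: below_def)

lemma stripD: "strip h h' \<Longrightarrow> h d \<le> h' d" "strip h h' \<Longrightarrow> h' d \<le> Suc (h d)"
  by (auto simp: strip_def)

lemma strip_weight_nonneg[simp]: "0 \<le> strip_weight c h h'" by (simp add: strip_weight_def)

lemma chain_sum_nonneg[simp]: "0 \<le> chain_sum cs h h'"
  by (induction cs arbitrary: h) (auto intro!: sum_nonneg)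

lemma strip_weight_zero: "\<not> h \<le> h' \<Longrightarrow> strip_weight c h h' = 0"
  by (auto simp: strip_weight_def strip_def le_fun_def)

lemma chain_sum_zero: "\<not> h \<le> h' \<Longrightarrow> chain_sum cs h h' = 0"
proof (induction cs arbitrary: h)
  case (Cons c cs)
  have "strip_weight c h r * chain_sum cs r h' = 0" if "r \<in> below h'" for r
    using that Cons.prems strip_weight_zero[of h r c] by (auto simp: below_def)
  then show ?case by (auto intro!: sum.neutral)
qed auto

lemma chain_sum_append:
  assumes "height_fn h'" "height_fn h"
  shows "chain_sum (cs @ ds) h h' = (\<Sum>r\<in>below h'. chain_sum cs h r * chain_sum ds r h')"
  using assms(2)
proof (induction cs arbitrary: h)
  case Nil
  have "(\<Sum>r\<in>below h'. chain_sum [] h r * chain_sum ds r h') = (\<Sum>r\<in>below h'. if r = h then chain_sum ds r h' else 0)"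
    by (rule sum.cong) auto
  also have "\<dots> = chain_sum ds h h'"
    using Nil assms chain_sum_zero[of h h' ds] by (cases "h \<in> below h'") (auto, auto simp: below_def)
  finally show ?case by simp
next
  case (Cons c cs)
  have "chain_sum ((c # cs) @ ds) h h' = (\<Sum>r\<in>below h'. strip_weight c h r * (\<Sum>s\<in>below h'. chain_sum cs r s * chain_sum ds s h'))"
    using Cons by (auto intro!: sum.cong simp: belowD)
  also have "\<dots> = (\<Sum>s\<in>below h'. (\<Sum>r\<in>below h'. strip_weight c h r * chain_sum cs r s) * chain_sum ds s h')"
    by (simp add: sum_distrib_left sum_distrib_right mult.assoc) (rule sum.swap)
  also have "\<dots> = (\<Sum>s\<in>below h'. chain_sum (c # cs) h s * chain_sum ds s h')"
  proof (rule sum.cong[OF refl])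
    fix s assume s: "s \<in> below h'"
    have "(\<Sum>r\<in>below h'. strip_weight c h r * chain_sum cs r s) = (\<Sum>r\<in>below s. strip_weight c h r * chain_sum cs r s)"
      by (rule sum.mono_neutral_right)
         (use s assms chain_sum_zero finite_below[OF assms(1)] in \<open>auto simp: below_def intro: order_trans\<close>)
    then show "(\<Sum>r\<in>below h'. strip_weight c h r * chain_sum cs r s) * chain_sum ds s h' = chain_sum (c # cs) h s * chain_sum ds s h'" by simp
  qed
  finally show ?case .
qed

lemma finite_added: "height_fn h' \<Longrightarrow> finite (added h h')"
proof -
  assume "height_fn h'"
  then obtain n where n: "\<And>d. d \<ge> n \<Longrightarrow> h' d = 0" using height_fn_zero by blast
  have "added h h' \<subseteq> {..<n}"
  proof
    fix d assume "d \<in> added h h'"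
    then show "d \<in> {..<n}" using n[of d] by (cases "d < n") (auto simp: added_def)
  qed
  then show ?thesis by (rule finite_subset) simp
qed

text \<open>\<open>Suc\<close> maps the elements that have a successor in S onto those that have a
  predecessor, so runs may be counted at either end. The marks of a tableau are free at the left
  ends.\<close>

lemma runs_left:
  assumes "finite S"
  shows "runs S = card {d \<in> S. d = 0 \<or> d - 1 \<notin> S}"
proof -
  have e: "card {d \<in> S. Suc d \<in> S} = card {d \<in> S. d \<noteq> 0 \<and> d - 1 \<in> S}"
  proof (rule bij_betw_same_card[of Suc])
    have "{d \<in> S. d \<noteq> 0 \<and> d - 1 \<in> S} \<subseteq> Suc ` {d \<in> S. Suc d \<in> S}"
    proof
      fix d assume "d \<in> {d \<in> S. d \<noteq> 0 \<and> d - 1 \<in> S}"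
      then show "d \<in> Suc ` {d \<in> S. Suc d \<in> S}" by (intro image_eqI[of _ _ "d - 1"]) auto
    qed
    then show "bij_betw Suc {d \<in> S. Suc d \<in> S} {d \<in> S. d \<noteq> 0 \<and> d - 1 \<in> S}"
      by (auto simp: bij_betw_def)
  qed
  have "{d \<in> S. Suc d \<notin> S} = S - {d \<in> S. Suc d \<in> S}" by auto
  moreover have "{d \<in> S. d = 0 \<or> d - 1 \<notin> S} = S - {d \<in> S. d \<noteq> 0 \<and> d - 1 \<in> S}" by auto
  ultimately show ?thesis unfolding runs_def using e assms by (simp add: card_Diff_subset)
qed

section \<open>Two-state transfer matrices along the diagonals\<close>

text \<open>\<open>i\<close> weighs the bit on diagonal 0, \<open>s d\<close> the pair of bits on
  the diagonals d and d + 1, and b is the bit on the last diagonal.\<close>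

primrec column_sum :: "(bool \<Rightarrow> real) \<Rightarrow> (nat \<Rightarrow> bool \<Rightarrow> bool \<Rightarrow> real) \<Rightarrow> nat \<Rightarrow> bool \<Rightarrow> real" where
  "column_sum i s 0 b = i b"
| "column_sum i s (Suc d) b = column_sum i s d False * s d False b + column_sum i s d True * s d True b"

lemma column_sum_sum:
  "column_sum i s n b = (\<Sum>B\<in>{B. B \<subseteq> {..n} \<and> (n \<in> B \<longleftrightarrow> b)}. i (0 \<in> B) * (\<Prod>d<n. s d (d \<in> B) (Suc d \<in> B)))"
proof (induction n arbitrary: b)
  case 0
  have "{B. B \<subseteq> {..0::nat} \<and> (0 \<in> B \<longleftrightarrow> b)} = {if b then {0} else {}}"
    by (auto simp: subset_singleton_iff atMost_0)
  then show ?case by simp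
next
  case (Suc n)
  let ?w = "\<lambda>B. i (0 \<in> B) * (\<Prod>d<n. s d (d \<in> B) (Suc d \<in> B))"
  let ?w' = "\<lambda>B. i (0 \<in> B) * (\<Prod>d<Suc n. s d (d \<in> B) (Suc d \<in> B))"
  define e where "e B = (if b then insert (Suc n) B else B)" for B
  have img: "{B. B \<subseteq> {..Suc n} \<and> (Suc n \<in> B \<longleftrightarrow> b)} = e ` {B. B \<subseteq> {..n}}"
  proof (intro equalityI subsetI)
    fix B assume B: "B \<in> {B. B \<subseteq> {..Suc n} \<and> (Suc n \<in> B \<longleftrightarrow> b)}"
    have "B = e (B - {Suc n})" using B by (auto simp: e_def)
    moreover have "B - {Suc n} \<subseteq> {..n}" using B by (auto simp: le_Suc_eq)
    ultimately show "B \<in> e ` {B. B \<subseteq> {..n}}" by blast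
  qed (auto simp: e_def split: if_splits)
  have inj: "inj_on e {B. B \<subseteq> {..n}}"
  proof (rule inj_onI)
    fix A B assume "A \<in> {B. B \<subseteq> {..n}}" "B \<in> {B. B \<subseteq> {..n}}" "e A = e B"
    moreover from this have "Suc n \<notin> A" "Suc n \<notin> B" by auto
    ultimately show "A = B" unfolding e_def by (metis insert_ident)
  qed
  have w: "?w' (e B) = ?w B * s n (n \<in> B) b" if "B \<subseteq> {..n}" for B
  proof -
    have "(\<Prod>d<n. s d (d \<in> e B) (Suc d \<in> e B)) = (\<Prod>d<n. s d (d \<in> B) (Suc d \<in> B))"
      by (rule prod.cong) (auto simp: e_def)
    moreover have "Suc n \<in> e B \<longleftrightarrow> b" using that by (auto simp: e_def)
    moreover have "n \<in> e B \<longleftrightarrow> n \<in> B" "0 \<in> e B \<longleftrightarrow> 0 \<in> B" by (auto simp: e_def)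
    ultimately show ?thesis by simp
  qed
  have "(\<Sum>B\<in>{B. B \<subseteq> {..Suc n} \<and> (Suc n \<in> B \<longleftrightarrow> b)}. ?w' B) = (\<Sum>B\<in>{B. B \<subseteq> {..n}}. ?w B * s n (n \<in> B) b)"
    unfolding img by (subst sum.reindex[OF inj]) (use w in \<open>auto intro!: sum.cong\<close>)
  also have "{B. B \<subseteq> {..n}} = {B. B \<subseteq> {..n} \<and> (n \<in> B \<longleftrightarrow> False)} \<union> {B. B \<subseteq> {..n} \<and> (n \<in> B \<longleftrightarrow> True)}" by auto
  also have "(\<Sum>B\<in>\<dots>. ?w B * s n (n \<in> B) b) =
      (\<Sum>B\<in>{B. B \<subseteq> {..n} \<and> (n \<in> B \<longleftrightarrow> False)}. ?w B * s n False b) + (\<Sum>B\<in>{B. B \<subseteq> {..n} \<and> (n \<in> B \<longleftrightarrow> True)}. ?w B * s n True b)"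
    by (subst sum.union_disjoint) (auto intro!: arg_cong2[of _ _ _ _ "(+)"] sum.cong)
  also have "\<dots> = column_sum i s (Suc n) b" using Suc by (simp add: sum_distrib_right)
  finally show ?case by simp
qed

lemma prod_pow_card:
  fixes x :: real and S :: "nat set" assumes "S \<subseteq> {..n}"
  shows "x ^ card S = (\<Prod>d\<le>n. if d \<in> S then x else 1)"
proof -
  have "(\<Prod>d\<le>n. if d \<in> S then x else 1) = (\<Prod>d\<in>{d\<in>{..n}. d \<in> S}. x)"
    using prod.inter_filter[of "{..n}" "\<lambda>_. x" "\<lambda>d. d \<in> S"] by simp
  moreover have "{d\<in>{..n}. d \<in> S} = S" using assms by auto
  ultimately show ?thesis by simp
qed

lemma prod_atMost_shift0: "(\<Prod>d\<le>n. f d) = f 0 * (\<Prod>d<n. f (Suc d))" for f :: "nat \<Rightarrow> real"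
  by (simp add: lessThan_Suc_atMost[symmetric] prod.lessThan_Suc_shift del: prod.lessThan_Suc)

text \<open>Counting a run at its right end turns the weight into a product over pairs of
  neighbouring diagonals, the form that \<open>column_sum\<close> can evaluate.\<close>

lemma pow_runs:
  assumes "S \<subseteq> {..<n}"
  shows "(2::real) ^ runs S = (\<Prod>d<n. if d \<in> S \<and> Suc d \<notin> S then 2 else 1)"
proof -
  have "(\<Prod>d<n. if d \<in> S \<and> Suc d \<notin> S then 2 else 1) = (\<Prod>d\<in>{d\<in>{..<n}. d \<in> S \<and> Suc d \<notin> S}. 2::real)"
    by (subst prod.inter_filter) auto
  moreover have "{d\<in>{..<n}. d \<in> S \<and> Suc d \<notin> S} = {d \<in> S. Suc d \<notin> S}" using assms by auto
  ultimately show ?thesis by (simp add: runs_def)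
qed

section \<open>Commutation of strips\<close>

text \<open>With outer heights k, l on one diagonal and k', l' on the next, the middle shape has
  heights k + b and k' + b'. The conditions say that it is a height function and that l' exceeds it
  by a strip; the factors 2 record a run ending in either strip, x and y the boxes on the new
  diagonal.\<close>

definition ystep :: "real \<Rightarrow> real \<Rightarrow> nat \<Rightarrow> nat \<Rightarrow> nat \<Rightarrow> nat \<Rightarrow> bool \<Rightarrow> bool \<Rightarrow> real" where
  "ystep x y k k' l l' b b' =
     (if k' + of_bool b' \<le> k + of_bool b \<and> k + of_bool b \<le> Suc (k' + of_bool b')
       \<and> k' + of_bool b' \<le> l' \<and> l' \<le> Suc (k' + of_bool b')
     then (if b \<and> \<not> b' then 2 else 1) * (if k + of_bool b < l \<and> \<not> k' + of_bool b' < l' then 2 else 1)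
        * (if b' then x else 1) * (if k' + of_bool b' < l' then y else 1) else 0)"

definition yinit :: "real \<Rightarrow> real \<Rightarrow> nat \<Rightarrow> nat \<Rightarrow> bool \<Rightarrow> real" where
  "yinit x y k l b = (if k + of_bool b \<le> l \<and> l \<le> Suc (k + of_bool b)
     then (if b then x else 1) * (if k + of_bool b < l then y else 1) else 0)"

text \<open>Both sides of the commutation are transfer-matrix sums over the diagonals, whose state is the bit
  "a box is added in the first step". This relation between the two partial sums, a Yang--Baxter intertwiner
  depending only on the number of boxes \<open>l - k\<close> on the current diagonal, is propagated from diagonal to diagonal.\<close>

definition yinv :: "real \<Rightarrow> real \<Rightarrow> nat \<Rightarrow> nat \<Rightarrow> (bool \<Rightarrow> real) \<Rightarrow> (bool \<Rightarrow> real) \<Rightarrow> bool" where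
  "yinv x y k l f g \<longleftrightarrow>
    (l = k \<longrightarrow> g False = f False \<and> f True = 0 \<and> g True = 0) \<and>
    (l = k + 1 \<longrightarrow> (x + y) * g False = (x - y) * f True + 2 * x * f False
        \<and> (x + y) * g True = 2 * y * f True + (y - x) * f False) \<and>
    (l = k + 2 \<longrightarrow> g True = f True \<and> f False = 0 \<and> g False = 0) \<and>
    (l < k \<or> l > k + 2 \<longrightarrow> (\<forall>b. f b = 0 \<and> g b = 0))"

lemma yinv_init: "yinv x y k l (yinit x y k l) (yinit y x k l)"
  by (auto simp: yinv_def yinit_def algebra_simps)

text \<open>The bit is forced unless l = k + 1, so every case is a small linear identity. A forced
  diagonal entered from l = k + 1 sees only \<open>f False + f True\<close>, which the relation
  preserves.\<close>

lemma yinv_step: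
  assumes "yinv x y k l f g" "k = k' \<or> k = Suc k'" "l = l' \<or> l = Suc l'" "x + y \<noteq> 0"
  shows "yinv x y k' l' (\<lambda>b'. f False * ystep x y k k' l l' False b' + f True * ystep x y k k' l l' True b')
     (\<lambda>b'. g False * ystep y x k k' l l' False b' + g True * ystep y x k k' l l' True b')"
proof -
  consider "l' < k'" | "l' = k'" | "l' = k' + 1" | "l' = k' + 2" | "l' > k' + 2" by linarith
  then show ?thesis
  proof cases
    case 1 then show ?thesis by (simp add: yinv_def ystep_def)
  next
    case 2
    from assms(2,3) show ?thesis
    proof (elim disjE)
      assume "k = k'" "l = l'" then show ?thesis using assms(1) 2 by (simp add: yinv_def ystep_def)
    next
      assume "k = Suc k'" "l = l'" then show ?thesis using assms(1) 2 by (simp add: yinv_def ystep_def)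
    next
      assume a: "k = k'" "l = Suc l'"
      then have "(x + y) * (g False + g True) = (x + y) * (f False + f True)"
        using assms(1) 2 by (simp add: yinv_def algebra_simps)
      then have "g False + g True = f False + f True" using assms(4) by simp
      then show ?thesis using a assms(1) 2 by (simp add: yinv_def ystep_def)
    next
      assume "k = Suc k'" "l = Suc l'" then show ?thesis using assms(1) 2 by (simp add: yinv_def ystep_def)
    qed
  next
    case 3
    from assms(2,3) show ?thesis
    proof (elim disjE)
      assume a: "k = k'" "l = l'"
      then have e: "(x + y) * g False = (x - y) * f True + 2 * x * f False"
        "(x + y) * g True = 2 * y * f True + (y - x) * f False" using assms(1) 3 by (simp_all add: yinv_def)
      have "(x + y) * (x * g False + 2 * x * g True) = x * ((x + y) * g False) + 2 * x * ((x + y) * g True)"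
        "(x + y) * (y * g True) = y * ((x + y) * g True)" by (simp_all add: algebra_simps)
      then show ?thesis using a assms(1) 3 unfolding e by (simp add: yinv_def ystep_def algebra_simps)
    next
      assume a: "k = Suc k'" "l = l'"
      then show ?thesis using assms(1) 3 by (simp add: yinv_def ystep_def algebra_simps)
    next
      assume a: "k = k'" "l = Suc l'"
      then show ?thesis using assms(1) 3 by (simp add: yinv_def ystep_def algebra_simps)
    next
      assume a: "k = Suc k'" "l = Suc l'"
      then have e: "(x + y) * g False = (x - y) * f True + 2 * x * f False"
        "(x + y) * g True = 2 * y * f True + (y - x) * f False" using assms(1) 3 by (simp_all add: yinv_def)
      have "(x + y) * (2 * y * g False + y * g True) = 2 * y * ((x + y) * g False) + y * ((x + y) * g True)"
        "(x + y) * (x * g False) = x * ((x + y) * g False)" by (simp_all add: algebra_simps)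
      then show ?thesis using a assms(1) 3 unfolding e by (simp add: yinv_def ystep_def algebra_simps)
    qed
  next
    case 4
    from assms(2,3) show ?thesis
    proof (elim disjE)
      assume a: "k = Suc k'" "l = l'"
      then have "(x + y) * (g False + g True) = (x + y) * (f False + f True)"
        using assms(1) 4 by (simp add: yinv_def algebra_simps)
      then have "g False + g True = f False + f True" using assms(4) by simp
      then show ?thesis using a assms(1) 4 by (simp add: yinv_def ystep_def distrib_right[symmetric] distrib_left[symmetric] mult.commute)
    qed (use assms(1) 4 in \<open>simp_all add: yinv_def ystep_def\<close>)
  next
    case 5
    from assms(2,3) 5 assms(1) show ?thesis by (elim disjE) (auto simp: yinv_def ystep_def)
  qed
qed

lemma yang_baxter:
  assumes "height_fn k" "height_fn l" "x > 0" "y > 0"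
  shows "yinv x y (k d) (l d)
    (column_sum (yinit x y (k 0) (l 0)) (\<lambda>d. ystep x y (k d) (k (Suc d)) (l d) (l (Suc d))) d)
    (column_sum (yinit y x (k 0) (l 0)) (\<lambda>d. ystep y x (k d) (k (Suc d)) (l d) (l (Suc d))) d)"
proof (induction d)
  case 0
  then show ?case using yinv_init by (simp add: column_sum.simps(1)[abs_def] eta_contract_eq cong: if_cong)
next
  case (Suc d)
  have k: "k d = k (Suc d) \<or> k d = Suc (k (Suc d))" using height_fnD[OF assms(1), of d] by linarith
  have l: "l d = l (Suc d) \<or> l d = Suc (l (Suc d))" using height_fnD[OF assms(2), of d] by linarith
  from yinv_step[OF Suc k l] assms(3,4) show ?case by simp
qed

definition ysum :: "real \<Rightarrow> real \<Rightarrow> (nat \<Rightarrow> nat) \<Rightarrow> (nat \<Rightarrow> nat) \<Rightarrow> real" where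
  "ysum x y k l = (\<Sum>r\<in>{r\<in>below l. strip k r \<and> strip r l}.
     2 ^ runs (added k r) * 2 ^ runs (added r l) * x ^ card (added k r) * y ^ card (added r l))"

text \<open>A middle shape is determined by the set of diagonals on which the first strip has a box,
  and a set of bits that satisfies all local conditions comes from a middle shape; all other sets
  have weight zero. As every height vanishes from n on, the last bit is
  \<open>False\<close>.\<close>

lemma ysum_column_sum:
  assumes "height_fn k" "height_fn l" and n: "\<And>d. d \<ge> n \<Longrightarrow> k d = 0 \<and> l d = 0"
  shows "ysum x y k l =
    column_sum (yinit x y (k 0) (l 0)) (\<lambda>d. ystep x y (k d) (k (Suc d)) (l d) (l (Suc d))) n False"
proof -
  define s where "s = (\<lambda>d. ystep x y (k d) (k (Suc d)) (l d) (l (Suc d)))"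
  define i where "i = yinit x y (k 0) (l 0)"
  define w where "w B = i (0 \<in> B) * (\<Prod>d<n. s d (d \<in> B) (Suc d \<in> B))" for B
  define R where "R = {r\<in>below l. strip k r \<and> strip r l}"
  define S where "S = {B. B \<subseteq> {..n} \<and> (n \<in> B \<longleftrightarrow> False)}"
  define f where "f B = (\<lambda>d. k d + of_bool (d \<in> B))" for B :: "nat set"
  have inS: "added k r \<in> S" and fr: "f (added k r) = r" if "r \<in> R" for r
  proof -
    have r: "height_fn r" "r d \<le> l d" "strip k r" "strip r l" for d using that by (auto simp: R_def belowD)
    have z: "r d = 0" if "d \<ge> n" for d using r(2)[of d] n[OF that] by simp
    have "d < n" if "d \<in> added k r" for d
    proof (rule ccontr)
      assume "\<not> d < n" then show False using that z[of d] by (simp add: added_def)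
    qed
    then show "added k r \<in> S" by (auto simp: S_def intro: less_imp_le)
    show "f (added k r) = r"
    proof
      fix d show "f (added k r) d = r d" using stripD[OF r(3), of d] by (auto simp: f_def added_def)
    qed
  qed
  have wR: "w (added k r) = 2 ^ runs (added k r) * 2 ^ runs (added r l) * x ^ card (added k r) * y ^ card (added r l)"
    if "r \<in> R" for r
  proof -
    have r: "height_fn r" "\<And>d. r d \<le> l d" "strip k r" "strip r l" using that by (auto simp: R_def belowD)
    have z: "r d = 0" if "d \<ge> n" for d using r(2)[of d] n[OF that] by simp
    have sub: "added k r \<subseteq> {..<n}" "added r l \<subseteq> {..<n}"
      using z n by (auto simp: added_def not_le[symmetric])
    then have sub': "added k r \<subseteq> {..n}" "added r l \<subseteq> {..n}" by auto
    have e: "k d + of_bool (d \<in> added k r) = r d" for d using fun_cong[OF fr[OF that], of d] by (simp add: f_def)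
    have "s d (d \<in> added k r) (Suc d \<in> added k r) =
       (if d \<in> added k r \<and> Suc d \<notin> added k r then 2 else 1) * (if d \<in> added r l \<and> Suc d \<notin> added r l then 2 else 1)
        * (if Suc d \<in> added k r then x else 1) * (if Suc d \<in> added r l then y else 1)" for d
      unfolding s_def ystep_def e using height_fnD[OF r(1), of d] stripD[OF r(4), of "Suc d"] by (simp add: added_def)
    moreover have "i (0 \<in> added k r) = (if 0 \<in> added k r then x else 1) * (if 0 \<in> added r l then y else 1)"
      unfolding i_def yinit_def e using stripD[OF r(4), of 0] by (simp add: added_def)
    ultimately show ?thesis unfolding w_def pow_runs[OF sub(1)] pow_runs[OF sub(2)]
        prod_pow_card[OF sub'(1)] prod_pow_card[OF sub'(2)] prod_atMost_shift0
      by (simp add: prod.distrib mult_ac)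
  qed
  have w0: "w B = 0" if B: "B \<in> S" "B \<notin> added k ` R" for B
  proof (rule ccontr)
    assume w: "w B \<noteq> 0"
    have st: "s d (d \<in> B) (Suc d \<in> B) \<noteq> 0" if "d < n" for d using w that by (auto simp: w_def)
    have i0: "i (0 \<in> B) \<noteq> 0" using w by (auto simp: w_def)
    have Bn: "d < n" if "d \<in> B" for d using that B(1) by (auto simp: S_def le_less)
    have fz: "f B d = 0" if "d \<ge> n" for d using Bn[of d] n[OF that] that by (auto simp: f_def)
    have a: "f B (Suc d) \<le> f B d \<and> f B d \<le> Suc (f B (Suc d))" for d
      using st[of d] fz[of d] fz[of "Suc d"] by (cases "d < n") (auto simp: s_def ystep_def f_def split: if_splits)
    have height_fn: "height_fn (f B)" using a fz by (auto simp: height_fn_def)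
    have b: "f B d \<le> l d \<and> l d \<le> Suc (f B d)" for d
    proof (cases d)
      case 0 then show ?thesis using i0 by (auto simp: i_def yinit_def f_def split: if_splits)
    next
      case (Suc d')
      then show ?thesis using st[of d'] fz[of d] n[of d]
        by (cases "d' < n") (auto simp: s_def ystep_def f_def split: if_splits)
    qed
    have "f B \<in> R" using height_fn b by (auto simp: R_def strip_def intro!: belowI) (auto simp: f_def)
    moreover have "added k (f B) = B" by (auto simp: added_def f_def)
    ultimately show False using B(2) by force
  qed
  have "column_sum i s n False = (\<Sum>B\<in>S. w B)" by (simp add: column_sum_sum S_def w_def)
  also have "\<dots> = (\<Sum>B\<in>added k ` R. w B)"
    by (rule sum.mono_neutral_right) (use inS w0 in \<open>auto simp: S_def\<close>)
  also have "\<dots> = (\<Sum>r\<in>R. w (added k r))"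
    by (subst sum.reindex) (auto intro: inj_on_inverseI[of _ f] simp: fr)
  also have "\<dots> = ysum x y k l" unfolding ysum_def R_def[symmetric] by (rule sum.cong) (simp_all add: wR)
  finally show ?thesis by (simp add: i_def s_def)
qed

text \<open>On a diagonal where both outer shapes have ended, the invariant reduces to
  \<open>g False = f False\<close>.\<close>

lemma ysum_commute:
  assumes "height_fn k" "height_fn l" "x > 0" "y > 0"
  shows "ysum x y k l = ysum y x k l"
proof -
  obtain n1 n2 where n: "\<And>d. d \<ge> n1 \<Longrightarrow> k d = 0" "\<And>d. d \<ge> n2 \<Longrightarrow> l d = 0"
    using height_fn_zero assms by metis
  define n where "n = max n1 n2"
  have n': "\<And>d. d \<ge> n \<Longrightarrow> k d = 0 \<and> l d = 0" using n by (auto simp: n_def)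
  from yang_baxter[OF assms, of n] n'[of n] show ?thesis
    by (simp add: ysum_column_sum[OF assms(1,2) n'] yinv_def)
qed

section \<open>From generating functions to strips of fixed size\<close>

text \<open>The generating functions are compared at positive arguments only, since the intertwiners
  require x + y or 1 + t * y to be nonzero.\<close>

lemma polyfun_pos_eq:
  fixes a b :: "nat \<Rightarrow> real"
  assumes "\<And>x. x > 0 \<Longrightarrow> (\<Sum>i\<le>n. a i * x ^ i) = (\<Sum>i\<le>n. b i * x ^ i)" "i \<le> n"
  shows "a i = b i"
proof (rule ccontr)
  assume "a i \<noteq> b i"
  then have "finite {z::real. (\<Sum>i\<le>n. (a i - b i) * z ^ i) = 0}"
    using polyfun_finite_roots[of "\<lambda>i. a i - b i" n] assms(2) by force
  moreover have "{0<..<1::real} \<subseteq> {z. (\<Sum>i\<le>n. (a i - b i) * z ^ i) = 0}"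
    using assms(1) by (auto simp: left_diff_distrib sum_subtractf)
  ultimately have "finite {0<..<1::real}" using finite_subset by blast
  then show False using infinite_Ioo[of "0::real" 1] by simp
qed

lemma card_added_le:
  assumes "height_fn l" "\<And>d. d \<ge> n \<Longrightarrow> l d = 0" shows "card (added k l) \<le> n"
proof -
  have "added k l \<subseteq> {..<n}" using assms(2) by (auto simp: added_def not_le[symmetric])
  from card_mono[OF _ this] show ?thesis by simp
qed

lemma ysum_strip_weight:
  assumes "height_fn l" "\<And>d. d \<ge> n \<Longrightarrow> l d = 0"
  shows "ysum x y k l = (\<Sum>c\<le>n. (\<Sum>d\<le>n. (\<Sum>r\<in>below l. strip_weight c k r * strip_weight d r l) * y ^ d) * x ^ c)"
proof -
  have rl: "card (added k r) \<le> n" if "r \<in> below l" for r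
    by (rule card_added_le[OF belowD(1)[OF that]]) (use belowD(2)[OF that] assms(2) in \<open>metis le_zero_eq\<close>)
  have "(\<Sum>c\<le>n. (\<Sum>d\<le>n. (\<Sum>r\<in>below l. strip_weight c k r * strip_weight d r l) * y ^ d) * x ^ c)
      = (\<Sum>c\<le>n. \<Sum>d\<le>n. \<Sum>r\<in>below l. (strip_weight c k r * x ^ c) * (strip_weight d r l * y ^ d))"
    by (simp add: sum_distrib_left sum_distrib_right mult_ac)
  also have "\<dots> = (\<Sum>c\<le>n. \<Sum>r\<in>below l. \<Sum>d\<le>n. (strip_weight c k r * x ^ c) * (strip_weight d r l * y ^ d))"
    by (intro sum.cong refl) (rule sum.swap)
  also have "\<dots> = (\<Sum>r\<in>below l. \<Sum>c\<le>n. \<Sum>d\<le>n. (strip_weight c k r * x ^ c) * (strip_weight d r l * y ^ d))"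
    by (rule sum.swap)
  also have "\<dots> = (\<Sum>r\<in>below l. (\<Sum>c\<le>n. strip_weight c k r * x ^ c) * (\<Sum>d\<le>n. strip_weight d r l * y ^ d))"
    by (simp add: sum_product)
  also have "\<dots> = (\<Sum>r\<in>below l. if strip k r \<and> strip r l then
     2 ^ runs (added k r) * 2 ^ runs (added r l) * x ^ card (added k r) * y ^ card (added r l) else 0)"
  proof (rule sum.cong[OF refl])
    fix r assume r: "r \<in> below l"
    have strip_weight: "(\<Sum>c\<le>n. strip_weight c h h' * u ^ c) = (if strip h h' then 2 ^ runs (added h h') * u ^ card (added h h') else 0)"
      if "card (added h h') \<le> n" for u h h'
    proof -
      have "(\<Sum>c\<le>n. strip_weight c h h' * u ^ c) =
        (\<Sum>c\<le>n. if c = card (added h h') then (if strip h h' then 2 ^ runs (added h h') * u ^ card (added h h') else 0) else 0)"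
        by (rule sum.cong) (auto simp: strip_weight_def)
      then show ?thesis using that by simp
    qed
    show "(\<Sum>c\<le>n. strip_weight c k r * x ^ c) * (\<Sum>d\<le>n. strip_weight d r l * y ^ d) = (if strip k r \<and> strip r l then
     2 ^ runs (added k r) * 2 ^ runs (added r l) * x ^ card (added k r) * y ^ card (added r l) else 0)"
      using strip_weight[OF rl[OF r]] strip_weight[OF card_added_le[OF assms]] by simp
  qed
  also have "\<dots> = ysum x y k l" unfolding ysum_def using assms(1) by (simp add: sum.If_cases Int_def)
  finally show ?thesis by simp
qed

lemma strip_weight_commute:
  assumes "height_fn k" "height_fn l"
  shows "(\<Sum>r\<in>below l. strip_weight c k r * strip_weight d r l) = (\<Sum>r\<in>below l. strip_weight d k r * strip_weight c r l)"
proof -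
  obtain n where n: "\<And>d. d \<ge> n \<Longrightarrow> l d = 0" using height_fn_zero assms(2) by metis
  define V where "V c d = (\<Sum>r\<in>below l. strip_weight c k r * strip_weight d r l)" for c d
  have sw: "ysum x y k l = ysum y x k l" if "x > 0" "y > 0" for x y using ysum_commute[OF assms that] .
  have yw: "ysum x y k l = (\<Sum>c\<le>n. (\<Sum>d\<le>n. V c d * y ^ d) * x ^ c)" for x y
    unfolding V_def by (rule ysum_strip_weight[OF assms(2) n])
  have eq: "(\<Sum>c\<le>n. (\<Sum>d\<le>n. V c d * y ^ d) * x ^ c) = (\<Sum>c\<le>n. (\<Sum>d\<le>n. V d c * y ^ d) * x ^ c)"
    if "x > 0" "y > 0" for x y
  proof -
    have "(\<Sum>c\<le>n. (\<Sum>d\<le>n. V c d * y ^ d) * x ^ c) = (\<Sum>c\<le>n. (\<Sum>d\<le>n. V c d * x ^ d) * y ^ c)"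
      using sw[OF that] by (simp add: yw)
    also have "\<dots> = (\<Sum>c\<le>n. (\<Sum>d\<le>n. V d c * y ^ d) * x ^ c)"
      unfolding sum_distrib_right by (subst sum.swap) (simp add: mult_ac)
    finally show ?thesis .
  qed
  have V: "V c d = V d c" if "c \<le> n" "d \<le> n" for c d
  proof (rule polyfun_pos_eq[OF _ that(2)])
    fix y :: real assume y: "y > 0"
    show "(\<Sum>d\<le>n. V c d * y ^ d) = (\<Sum>d\<le>n. V d c * y ^ d)"
      by (rule polyfun_pos_eq[OF _ that(1)]) (rule eq[OF _ y])
  qed
  have z: "strip_weight e h r = 0" if "e > n" "r \<in> below l" for e h r
  proof -
    have "card (added h r) \<le> n" by (rule card_added_le[OF belowD(1)[OF that(2)]]) (use belowD(2)[OF that(2)] n in \<open>metis le_zero_eq\<close>)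
    then show ?thesis using that(1) by (simp add: strip_weight_def)
  qed
  show ?thesis
  proof (cases "c \<le> n \<and> d \<le> n")
    case True then show ?thesis using V by (simp add: V_def)
  next
    case False
    then show ?thesis using z assms(2) by (auto simp: not_le intro!: sum.neutral)
  qed
qed

section \<open>Symmetry of chain sums in the content\<close>

lemma chain_sum_swap:
  assumes "height_fn l" "height_fn k"
  shows "chain_sum (c # d # cs) k l = chain_sum (d # c # cs) k l"
proof -
  have e: "chain_sum (c # d # cs) k l = (\<Sum>s\<in>below l. (\<Sum>r\<in>below s. strip_weight c k r * strip_weight d r s) * chain_sum cs s l)" for c d
  proof -
    have "chain_sum (c # d # cs) k l = (\<Sum>s\<in>below l. (\<Sum>r\<in>below l. strip_weight c k r * strip_weight d r s) * chain_sum cs s l)"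
      by (simp add: sum_distrib_left sum_distrib_right mult.assoc) (rule sum.swap)
    also have "\<dots> = (\<Sum>s\<in>below l. (\<Sum>r\<in>below s. strip_weight c k r * strip_weight d r s) * chain_sum cs s l)"
    proof (rule sum.cong[OF refl], rule arg_cong2[of _ _ _ _ "(*)", OF _ refl])
      fix s assume "s \<in> below l"
      then show "(\<Sum>r\<in>below l. strip_weight c k r * strip_weight d r s) = (\<Sum>r\<in>below s. strip_weight c k r * strip_weight d r s)"
        by (intro sum.mono_neutral_right) (use assms finite_below[OF assms(1)] strip_weight_zero in \<open>auto simp: below_def\<close>)
    qed
    finally show ?thesis .
  qed
  show ?thesis unfolding e using strip_weight_commute[OF assms(2)] by (intro sum.cong refl) (simp add: belowD)
qed

lemma chain_sum_Cons_cong: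
  "(\<And>r. height_fn r \<Longrightarrow> chain_sum cs r l = chain_sum ds r l) \<Longrightarrow> chain_sum (c # cs) k l = chain_sum (c # ds) k l"
  by (auto intro!: sum.cong simp: belowD)

lemma chain_sum_move:
  assumes "height_fn l" "height_fn k" shows "chain_sum (cs @ c # ds) k l = chain_sum (c # cs @ ds) k l"
  using assms(2)
proof (induction cs arbitrary: k)
  case (Cons e cs)
  have "chain_sum ((e # cs) @ c # ds) k l = chain_sum (e # c # cs @ ds) k l"
    unfolding append_Cons by (rule chain_sum_Cons_cong) (rule Cons.IH)
  also have "\<dots> = chain_sum (c # e # cs @ ds) k l" by (rule chain_sum_swap[OF assms(1) Cons.prems])
  finally show ?case by simp
qed simp

lemma chain_sum_rev:
  assumes "height_fn l" "height_fn k" shows "chain_sum (rev cs) k l = chain_sum cs k l"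
  using assms(2)
proof (induction cs arbitrary: k)
  case (Cons c cs)
  have "chain_sum (rev (c # cs)) k l = chain_sum (c # rev cs) k l" using chain_sum_move[OF assms(1) Cons.prems, of "rev cs" c "[]"] by simp
  also have "\<dots> = chain_sum (c # cs) k l" by (rule chain_sum_Cons_cong) (rule Cons.IH)
  finally show ?case .
qed simp

lemma chain_sum_append_commute:
  assumes "height_fn l" "height_fn k" shows "chain_sum (cs @ ds) k l = chain_sum (ds @ cs) k l"
  using assms(2)
proof (induction cs arbitrary: k)
  case (Cons c cs)
  have "chain_sum ((c # cs) @ ds) k l = chain_sum (c # ds @ cs) k l"
    unfolding append_Cons by (rule chain_sum_Cons_cong) (rule Cons.IH)
  also have "\<dots> = chain_sum (ds @ c # cs) k l" by (rule chain_sum_move[OF assms(1) Cons.prems, symmetric])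
  finally show ?case .
qed simp

section \<open>Complementation\<close>

text \<open>For a shape inside the staircase this is the height function of the partition whose
  parts are the numbers in {1..n} that are not parts of h.\<close>

definition complement :: "nat \<Rightarrow> (nat \<Rightarrow> nat) \<Rightarrow> nat \<Rightarrow> nat" where
  "complement n h d = (n - d) - h d"

definition staircase :: "nat \<Rightarrow> nat \<Rightarrow> nat" where "staircase n d = n - d"

lemma height_fn_staircase[simp]: "height_fn (staircase n)" by (auto simp: height_fn_def staircase_def intro: exI[of _ n])

lemma height_fn_complement: assumes "h \<in> below (staircase n)" shows "height_fn (complement n h)"
  unfolding height_fn_def
proof (intro conjI allI exI[of _ n])
  fix d
  have h: "h d \<le> n - d" "h (Suc d) \<le> n - Suc d" "h (Suc d) \<le> h d" "h d \<le> Suc (h (Suc d))"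
    using belowD[OF assms] height_fnD[of h d] by (auto simp: staircase_def)
  show "complement n h (Suc d) \<le> complement n h d" "complement n h d \<le> Suc (complement n h (Suc d))"
    using h by (auto simp: complement_def)
qed (simp add: complement_def)

lemma complement_below[simp]: "h \<in> below (staircase n) \<Longrightarrow> complement n h \<in> below (staircase n)"
  by (auto intro: belowI height_fn_complement simp: complement_def staircase_def)

lemma complement_complement[simp]: "h \<in> below (staircase n) \<Longrightarrow> complement n (complement n h) = h"
  using belowD(2)[of h "staircase n"] by (auto simp: complement_def staircase_def fun_eq_iff simp del: diff_diff_left)

lemma complement_strip_weight:
  assumes "h \<in> below (staircase n)" "h' \<in> below (staircase n)"
  shows "strip_weight c (complement n h') (complement n h) = strip_weight c h h'"
proof -
  have a: "h d \<le> n - d" "h' d \<le> n - d" for d using belowD(2)[OF assms(1), of d] belowD(2)[OF assms(2), of d] by (auto simp: staircase_def)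
  have "complement n h' d \<le> complement n h d \<and> complement n h d \<le> Suc (complement n h' d) \<longleftrightarrow> h d \<le> h' d \<and> h' d \<le> Suc (h d)" for d
    using a[of d] by (auto simp: complement_def)
  then have "strip (complement n h') (complement n h) = strip h h'" by (simp add: strip_def)
  moreover have "complement n h' d < complement n h d \<longleftrightarrow> h d < h' d" for d
    using a[of d] by (auto simp: complement_def)
  then have "added (complement n h') (complement n h) = added h h'" by (simp add: added_def)
  ultimately show ?thesis by (simp add: strip_weight_def)
qed

lemma complement_chain_sum_rev:
  assumes "h \<in> below (staircase n)" "h' \<in> below (staircase n)"
  shows "chain_sum cs h h' = chain_sum (rev cs) (complement n h') (complement n h)"
  using assms(1)
proof (induction cs arbitrary: h)
  case Nil
  have "complement n h' = complement n h \<longleftrightarrow> h = h'"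
    using complement_complement[OF Nil] complement_complement[OF assms(2)] by force
  then show ?case by simp
next
  case (Cons c cs)
  let ?B = "below (staircase n)"
  have f: "finite ?B" by simp
  have z: "chain_sum cs r h' = 0" if "r \<notin> below h'" "height_fn r" for r using that chain_sum_zero[of r h' cs] by (auto simp: below_def)
  have "chain_sum (c # cs) h h' = (\<Sum>r\<in>?B. strip_weight c h r * chain_sum cs r h')"
    unfolding chain_sum.simps by (rule sum.mono_neutral_left)
      (use f z assms(2) in \<open>auto intro: below_trans simp: belowD\<close>)
  also have "\<dots> = (\<Sum>r\<in>?B. chain_sum (rev cs) (complement n h') (complement n r) * strip_weight c (complement n r) (complement n h))"
    using Cons by (intro sum.cong refl) (simp add: complement_strip_weight)
  also have "\<dots> = (\<Sum>r\<in>complement n ` ?B. chain_sum (rev cs) (complement n h') r * strip_weight c r (complement n h))"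
    by (subst sum.reindex) (auto intro: inj_on_inverseI[of _ "complement n"])
  also have "complement n ` ?B = ?B"
  proof (intro equalityI subsetI)
    fix r assume "r \<in> ?B" then show "r \<in> complement n ` ?B" by (intro image_eqI[of _ _ "complement n r"]) auto
  qed auto
  also have "(\<Sum>r\<in>?B. chain_sum (rev cs) (complement n h') r * strip_weight c r (complement n h)) =
     (\<Sum>r\<in>below (complement n h). chain_sum (rev cs) (complement n h') r * strip_weight c r (complement n h))"
    by (rule sum.mono_neutral_right)
      (use f strip_weight_zero Cons.prems complement_below in \<open>auto simp: below_def intro: order_trans\<close>)
  also have "\<dots> = chain_sum (rev cs @ [c]) (complement n h') (complement n h)"
  proof -
    have one: "chain_sum [c] r (complement n h) = strip_weight c r (complement n h)" for r
    proof -
      have "chain_sum [c] r (complement n h) = (\<Sum>s\<in>below (complement n h). if s = complement n h then strip_weight c r s else 0)" by (simp add: of_bool_def if_distrib cong: if_cong)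
      then show ?thesis using height_fn_complement[OF Cons.prems] by simp
    qed
    show ?thesis using height_fn_complement Cons.prems assms(2) by (simp add: chain_sum_append one)
  qed
  finally show ?case by simp
qed

text \<open>Complementation reverses inclusions and hence the content as well; symmetry in the
  content undoes the second reversal.\<close>

lemma complement_chain_sum:
  assumes "h \<in> below (staircase n)" "h' \<in> below (staircase n)"
  shows "chain_sum cs (complement n h') (complement n h) = chain_sum cs h h'"
  using complement_chain_sum_rev[OF assms, of "cs"] chain_sum_rev[of "complement n h" "complement n h'" cs] height_fn_complement assms by simp

section \<open>The Cauchy relation\<close>

text \<open>Only runs that do not start on the main diagonal count. A strip with a box on diagonal 0
  adds a part, so \<open>P_weight\<close> is \<open>strip_weight\<close> divided by 2 to the growth
  in length: the normalisation of the Schur P-functions, dual to the Q-functions.\<close>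

definition left_runs :: "nat set \<Rightarrow> nat" where
  "left_runs S = card {d. d \<notin> S \<and> Suc d \<in> S}"

definition P_weight :: "nat \<Rightarrow> (nat \<Rightarrow> nat) \<Rightarrow> (nat \<Rightarrow> nat) \<Rightarrow> real" where
  "P_weight c h h' = (if strip h h' \<and> card (added h h') = c then 2 ^ left_runs (added h h') else 0)"

text \<open>One bit and one weight serve both orders. Going up, the middle shape is k + b above k
  and r; going down, it is r - b below both, and its distance from k is again k + b - r. Only the
  condition that the middle shape be a height function differs, as \<open>cup\<close> and
  \<open>cdown\<close> show.\<close>

definition cinit :: "real \<Rightarrow> real \<Rightarrow> nat \<Rightarrow> nat \<Rightarrow> bool \<Rightarrow> real" where
  "cinit t y k r b = (if r \<le> k + of_bool b \<and> k + of_bool b \<le> Suc r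
     then (if b then y else 1) * (if r < k + of_bool b then t else 1) else 0)"

definition cweight :: "real \<Rightarrow> real \<Rightarrow> nat \<Rightarrow> nat \<Rightarrow> nat \<Rightarrow> nat \<Rightarrow> bool \<Rightarrow> bool \<Rightarrow> real" where
  "cweight t y k k' r r' b b' = (if r' \<le> k' + of_bool b' \<and> k' + of_bool b' \<le> Suc r'
     then (if b \<and> \<not> b' then 2 else 1) * (if \<not> r < k + of_bool b \<and> r' < k' + of_bool b' then 2 else 1)
        * (if b' then y else 1) * (if r' < k' + of_bool b' then t else 1) else 0)"

definition cup :: "real \<Rightarrow> real \<Rightarrow> nat \<Rightarrow> nat \<Rightarrow> nat \<Rightarrow> nat \<Rightarrow> bool \<Rightarrow> bool \<Rightarrow> real" where
  "cup t y k k' r r' b b' = (if k' + of_bool b' \<le> k + of_bool b \<and> k + of_bool b \<le> Suc (k' + of_bool b')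
     then cweight t y k k' r r' b b' else 0)"

definition cdown :: "real \<Rightarrow> real \<Rightarrow> nat \<Rightarrow> nat \<Rightarrow> nat \<Rightarrow> nat \<Rightarrow> bool \<Rightarrow> bool \<Rightarrow> real" where
  "cdown t y k k' r r' b b' = (if r' + of_bool b \<le> r + of_bool b' \<and> r + of_bool b' \<le> Suc (r' + of_bool b)
     then cweight t y k k' r r' b b' else 0)"

text \<open>The analogous intertwiner between "add, then remove" and "remove, then add", with \<open>u = t * y\<close>.\<close>

definition cinv :: "real \<Rightarrow> nat \<Rightarrow> nat \<Rightarrow> (bool \<Rightarrow> real) \<Rightarrow> (bool \<Rightarrow> real) \<Rightarrow> bool" where
  "cinv u k r f g \<longleftrightarrow>
    (r = k \<longrightarrow> (1 + u) * f False = (1 - u) * g False + 2 * g True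
        \<and> (1 + u) * f True = 2 * u * g False + (u - 1) * g True) \<and>
    (r = k + 1 \<longrightarrow> f True = g True \<and> f False = 0 \<and> g False = 0) \<and>
    (k = r + 1 \<longrightarrow> f False = g False \<and> f True = 0 \<and> g True = 0) \<and>
    (r > k + 1 \<or> k > r + 1 \<longrightarrow> (\<forall>b. f b = 0 \<and> g b = 0))"

lemma cinv_init: "cinv (t * y) k r (cinit t y k r) (cinit t y k r)"
  by (auto simp: cinv_def cinit_def algebra_simps)

text \<open>Here the bit is free only for r = k, and again the sum of the two components is
  preserved there; this settles the transitions into forced diagonals.\<close>

lemma cinv_step:
  assumes "cinv (t * y) k r f g" "k = k' \<or> k = Suc k'" "r = r' \<or> r = Suc r'" "1 + t * y \<noteq> 0"
  shows "cinv (t * y) k' r' (\<lambda>b'. f False * cup t y k k' r r' False b' + f True * cup t y k k' r r' True b')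
     (\<lambda>b'. g False * cdown t y k k' r r' False b' + g True * cdown t y k k' r r' True b')"
proof -
  define u where "u = t * y"
  have inv: "cinv u k r f g" "1 + u \<noteq> 0" using assms by (simp_all add: u_def)
  consider "r' > k' + 1 \<or> k' > r' + 1" | "r' = k'" | "r' = k' + 1" | "k' = r' + 1" by linarith
  then show ?thesis
  proof cases
    case 1
    then have "\<not> (r' \<le> k' + of_bool b' \<and> k' + of_bool b' \<le> Suc r')" for b' by (cases b') auto
    then have "cweight t y k k' r r' b b' = 0" for b b' unfolding cweight_def by (rule if_not_P)
    then have "cup t y k k' r r' b b' = 0" "cdown t y k k' r r' b b' = 0" for b b' by (simp_all add: cup_def cdown_def)
    then show ?thesis using 1 by (auto simp: cinv_def)
  next
    case 2
    from assms(2,3) show ?thesis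
    proof (elim disjE)
      assume a: "k = k'" "r = r'"
      then have e: "(1 + u) * f False = (1 - u) * g False + 2 * g True"
        "(1 + u) * f True = 2 * u * g False + (u - 1) * g True" using inv(1) 2 by (simp_all add: cinv_def)
      have "(1 + u) * (f False + 2 * f True) = (1 + u) * f False + 2 * ((1 + u) * f True)"
        "(1 + u) * (u * f True) = u * ((1 + u) * f True)" by (simp_all add: algebra_simps)
      then show ?thesis using a 2 unfolding e by (simp add: cinv_def cup_def cdown_def cweight_def u_def algebra_simps)
    next
      assume a: "k = Suc k'" "r = Suc r'"
      then have e: "(1 + u) * f False = (1 - u) * g False + 2 * g True"
        "(1 + u) * f True = 2 * u * g False + (u - 1) * g True" using inv(1) 2 by (simp_all add: cinv_def)
      have "(1 + u) * (u * (f True + 2 * f False)) = u * ((1 + u) * f True + 2 * ((1 + u) * f False))"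
        by (simp add: algebra_simps)
      also have "\<dots> = 2 * u * (g False + 2 * g True) + (u - 1) * (u * g True)"
        unfolding e by (simp add: algebra_simps)
      finally have "(1 + u) * (u * (f True + 2 * f False)) = 2 * u * (g False + 2 * g True) + (u - 1) * (u * g True)" .
      moreover have "(1 + u) * f False = (1 - u) * (g False + 2 * g True) + 2 * (u * g True)"
        unfolding e by (simp add: algebra_simps)
      ultimately show ?thesis using a 2 by (simp add: cinv_def cup_def cdown_def cweight_def u_def algebra_simps)
    next
      assume a: "k = Suc k'" "r = r'"
      then show ?thesis using inv 2 by (simp add: cinv_def cup_def cdown_def cweight_def u_def algebra_simps)
    next
      assume a: "k = k'" "r = Suc r'"
      then show ?thesis using inv 2 by (simp add: cinv_def cup_def cdown_def cweight_def u_def algebra_simps)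
    qed
  next
    case 3
    from assms(2,3) show ?thesis
    proof (elim disjE)
      assume a: "k = Suc k'" "r = r'"
      then have "(1 + u) * (f False + f True) = (1 + u) * (g False + g True)"
        using inv(1) 3 by (simp add: cinv_def algebra_simps)
      then have "f False + f True = g False + g True" using inv(2) by simp
      then show ?thesis using a 3 by (simp add: cinv_def cup_def cdown_def cweight_def distrib_right[symmetric])
    qed (use inv 3 in \<open>simp_all add: cinv_def cup_def cdown_def cweight_def\<close>)
  next
    case 4
    from assms(2,3) show ?thesis
    proof (elim disjE)
      assume a: "k = k'" "r = Suc r'"
      then have "(1 + u) * (f False + f True) = (1 + u) * (g False + g True)"
        using inv(1) 4 by (simp add: cinv_def algebra_simps)
      then have "f False + f True = g False + g True" using inv(2) by simp
      then show ?thesis using a 4 by (simp add: cinv_def cup_def cdown_def cweight_def distrib_right[symmetric])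
    qed (use inv 4 in \<open>simp_all add: cinv_def cup_def cdown_def cweight_def\<close>)
  qed
qed

context
  fixes t y :: real and k r :: "nat \<Rightarrow> nat"
  assumes k: "height_fn k" and r: "height_fn r"
begin

definition "zup = column_sum (cinit t y (k 0) (r 0)) (\<lambda>d. cup t y (k d) (k (Suc d)) (r d) (r (Suc d)))"
definition "zdown = column_sum (cinit t y (k 0) (r 0)) (\<lambda>d. cdown t y (k d) (k (Suc d)) (r d) (r (Suc d)))"

lemma cauchy_local:
  assumes "t > 0" "y > 0"
  shows "cinv (t * y) (k d) (r d) (zup d) (zdown d)"
proof (induction d)
  case 0
  then show ?case using cinv_init by (simp add: zup_def zdown_def eta_contract_eq cinv_def)
next
  case (Suc d)
  have "k d = k (Suc d) \<or> k d = Suc (k (Suc d))" "r d = r (Suc d) \<or> r d = Suc (r (Suc d))"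
    using height_fnD[OF k, of d] height_fnD[OF r, of d] by linarith+
  moreover have "t * y > 0" using assms by simp
  ultimately show ?case using cinv_step[OF Suc] by (simp add: zup_def zdown_def)
qed

lemma pow_left_runs:
  assumes "S \<subseteq> {..<n}"
  shows "(2::real) ^ left_runs S = (\<Prod>d<n. if d \<notin> S \<and> Suc d \<in> S then 2 else 1)"
proof -
  have "(\<Prod>d<n. if d \<notin> S \<and> Suc d \<in> S then 2 else 1) = (\<Prod>d\<in>{d\<in>{..<n}. d \<notin> S \<and> Suc d \<in> S}. 2::real)"
    by (subst prod.inter_filter) auto
  moreover have "{d\<in>{..<n}. d \<notin> S \<and> Suc d \<in> S} = {d. d \<notin> S \<and> Suc d \<in> S}" using assms by auto
  ultimately show ?thesis by (simp add: left_runs_def)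
qed

definition upw where "upw l = 2 ^ runs (added k l) * 2 ^ left_runs (added r l) * y ^ card (added k l) * t ^ card (added r l)"
definition dnw where "dnw s = 2 ^ runs (added s r) * 2 ^ left_runs (added s k) * y ^ card (added s r) * t ^ card (added s k)"

text \<open>A shape above k and r may extend past both, so there is no natural last diagonal.
  Stopping at n with bit \<open>False\<close> restricts the sum to shapes inside
  \<open>staircase n\<close>.\<close>

lemma zup_sum:
  assumes n: "\<And>d. d \<ge> n \<Longrightarrow> k d = 0 \<and> r d = 0"
  shows "zup n False = (\<Sum>l\<in>{l\<in>below (staircase n). strip k l \<and> strip r l}. upw l)"
proof -
  define s where "s = (\<lambda>d. cup t y (k d) (k (Suc d)) (r d) (r (Suc d)))"
  define i where "i = cinit t y (k 0) (r 0)"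
  define w where "w B = i (0 \<in> B) * (\<Prod>d<n. s d (d \<in> B) (Suc d \<in> B))" for B
  define R where "R = {l\<in>below (staircase n). strip k l \<and> strip r l}"
  define S where "S = {B. B \<subseteq> {..n} \<and> (n \<in> B \<longleftrightarrow> False)}"
  define f where "f B = (\<lambda>d. k d + of_bool (d \<in> B))" for B :: "nat set"
  have inS: "added k l \<in> S" and fr: "f (added k l) = l" and wR: "w (added k l) = upw l" if "l \<in> R" for l
  proof -
    have l: "height_fn l" "l d \<le> n - d" "strip k l" "strip r l" for d using that by (auto simp: R_def staircase_def dest: belowD)
    have z: "l d = 0" if "d \<ge> n" for d using l(2)[of d] that by simp
    have sub: "added k l \<subseteq> {..<n}" "added r l \<subseteq> {..<n}"
      using z by (auto simp: added_def not_le[symmetric])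
    then have sub': "added k l \<subseteq> {..n}" "added r l \<subseteq> {..n}" by auto
    show "added k l \<in> S" using sub sub' by (auto simp: S_def)
    show fl: "f (added k l) = l"
    proof
      fix d show "f (added k l) d = l d" using stripD[OF l(3), of d] by (auto simp: f_def added_def)
    qed
    have e: "k d + of_bool (d \<in> added k l) = l d" for d using fun_cong[OF fl, of d] by (simp add: f_def)
    have "s d (d \<in> added k l) (Suc d \<in> added k l) =
       (if d \<in> added k l \<and> Suc d \<notin> added k l then 2 else 1) * (if d \<notin> added r l \<and> Suc d \<in> added r l then 2 else 1)
        * (if Suc d \<in> added k l then y else 1) * (if Suc d \<in> added r l then t else 1)" for d
      unfolding s_def cup_def cweight_def e using height_fnD[OF l(1), of d] stripD[OF l(4), of "Suc d"] by (simp add: added_def)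
    moreover have "i (0 \<in> added k l) = (if 0 \<in> added k l then y else 1) * (if 0 \<in> added r l then t else 1)"
      unfolding i_def cinit_def e using stripD[OF l(4), of 0] by (simp add: added_def)
    ultimately show "w (added k l) = upw l" unfolding w_def upw_def pow_runs[OF sub(1)] pow_left_runs[OF sub(2)]
        prod_pow_card[OF sub'(1)] prod_pow_card[OF sub'(2)] prod_atMost_shift0
      by (simp add: prod.distrib mult_ac)
  qed
  have w0: "w B = 0" if B: "B \<in> S" "B \<notin> added k ` R" for B
  proof (rule ccontr)
    assume w: "w B \<noteq> 0"
    have st: "s d (d \<in> B) (Suc d \<in> B) \<noteq> 0" if "d < n" for d using w that by (auto simp: w_def)
    have i0: "i (0 \<in> B) \<noteq> 0" using w by (auto simp: w_def)
    have Bn: "d < n" if "d \<in> B" for d using that B(1) by (auto simp: S_def le_less)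
    have fz: "f B d = 0" if "d \<ge> n" for d using Bn[of d] n[OF that] that by (auto simp: f_def)
    have a: "f B (Suc d) \<le> f B d \<and> f B d \<le> Suc (f B (Suc d))" for d
      using st[of d] fz[of d] fz[of "Suc d"] by (cases "d < n") (auto simp: s_def cup_def f_def split: if_splits)
    have height_fn: "height_fn (f B)" using a fz by (auto simp: height_fn_def)
    have b: "r d \<le> f B d \<and> f B d \<le> Suc (r d)" for d
    proof (cases d)
      case 0 then show ?thesis using i0 by (auto simp: i_def cinit_def f_def split: if_splits)
    next
      case (Suc d')
      then show ?thesis using st[of d'] fz[of d] n[of d]
        by (cases "d' < n") (auto simp: s_def cup_def cweight_def f_def split: if_splits)
    qed
    have "f B d \<le> n - d" for d using height_fn_slope[OF height_fn, of d "n - d"] fz[of n] fz[of d] by (cases "d \<le> n") auto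
    then have "f B \<in> R" using height_fn b by (auto simp: R_def strip_def staircase_def intro!: belowI) (auto simp: f_def)
    moreover have "added k (f B) = B" by (auto simp: added_def f_def)
    ultimately show False using B(2) by force
  qed
  have "column_sum i s n False = (\<Sum>B\<in>S. w B)" by (simp add: column_sum_sum S_def w_def)
  also have "\<dots> = (\<Sum>B\<in>added k ` R. w B)"
    by (rule sum.mono_neutral_right) (use inS w0 in \<open>auto simp: S_def\<close>)
  also have "\<dots> = (\<Sum>l\<in>R. w (added k l))"
    by (subst sum.reindex) (auto intro: inj_on_inverseI[of _ f] simp: fr)
  also have "\<dots> = (\<Sum>l\<in>R. upw l)" by (rule sum.cong) (simp_all add: wR)
  finally show ?thesis by (simp add: i_def s_def zup_def R_def)
qed

lemma zdown_sum:
  assumes n: "\<And>d. d \<ge> n \<Longrightarrow> k d = 0 \<and> r d = 0"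
  shows "zdown n False = (\<Sum>l\<in>{l\<in>below (staircase n). strip l k \<and> strip l r}. dnw l)"
proof -
  define s where "s = (\<lambda>d. cdown t y (k d) (k (Suc d)) (r d) (r (Suc d)))"
  define i where "i = cinit t y (k 0) (r 0)"
  define w where "w B = i (0 \<in> B) * (\<Prod>d<n. s d (d \<in> B) (Suc d \<in> B))" for B
  define R where "R = {l\<in>below (staircase n). strip l k \<and> strip l r}"
  define S where "S = {B. B \<subseteq> {..n} \<and> (n \<in> B \<longleftrightarrow> False)}"
  define f where "f B = (\<lambda>d. r d - of_bool (d \<in> B))" for B :: "nat set"
  define D where "D l = added l r" for l
  have inS: "D l \<in> S" and fr: "f (D l) = l" and wR: "w (D l) = dnw l" if "l \<in> R" for l
  proof -
    have l: "height_fn l" "l d \<le> n - d" "strip l k" "strip l r" for d using that by (auto simp: R_def staircase_def dest: belowD)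
    have sub: "added l r \<subseteq> {..<n}" "added l k \<subseteq> {..<n}"
      using n by (auto simp: added_def not_le[symmetric])
    then have sub': "added l r \<subseteq> {..n}" "added l k \<subseteq> {..n}" by auto
    show "D l \<in> S" using sub sub' by (auto simp: S_def D_def)
    show fl: "f (D l) = l"
    proof
      fix d show "f (D l) d = l d" using stripD[OF l(4), of d] by (auto simp: f_def D_def added_def)
    qed
    have e: "r d = l d + of_bool (d \<in> added l r)" for d using stripD[OF l(4), of d] by (auto simp: added_def)
    have k1: "k d = l d + of_bool (d \<in> added l k)" for d using stripD[OF l(3), of d] by (auto simp: added_def)
    have "s d (d \<in> D l) (Suc d \<in> D l) =
       (if d \<in> added l r \<and> Suc d \<notin> added l r then 2 else 1) * (if d \<notin> added l k \<and> Suc d \<in> added l k then 2 else 1)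
        * (if Suc d \<in> added l r then y else 1) * (if Suc d \<in> added l k then t else 1)" for d
      unfolding s_def cdown_def cweight_def D_def using height_fnD[OF l(1), of d] e[of d] k1[of d] e[of "Suc d"] k1[of "Suc d"] by simp
    moreover have "i (0 \<in> D l) = (if 0 \<in> added l r then y else 1) * (if 0 \<in> added l k then t else 1)"
      unfolding i_def cinit_def D_def using e[of 0] k1[of 0] by simp
    ultimately show "w (D l) = dnw l" unfolding w_def dnw_def pow_runs[OF sub(1)] pow_left_runs[OF sub(2)]
        prod_pow_card[OF sub'(1)] prod_pow_card[OF sub'(2)] prod_atMost_shift0
      by (simp add: prod.distrib mult_ac)
  qed
  have w0: "w B = 0" if B: "B \<in> S" "B \<notin> D ` R" for B
  proof (rule ccontr)
    assume w: "w B \<noteq> 0"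
    have st: "s d (d \<in> B) (Suc d \<in> B) \<noteq> 0" if "d < n" for d using w that by (auto simp: w_def)
    have i0: "i (0 \<in> B) \<noteq> 0" using w by (auto simp: w_def)
    have Bn: "d < n" if "d \<in> B" for d using that B(1) by (auto simp: S_def le_less)
    have sl: "r (Suc d) + of_bool (d \<in> B) \<le> r d + of_bool (Suc d \<in> B) \<and>
       r d + of_bool (Suc d \<in> B) \<le> Suc (r (Suc d) + of_bool (d \<in> B))" for d
      using st[of d] Bn[of d] Bn[of "Suc d"] n[of d] n[of "Suc d"]
      by (cases "d < n") (auto simp: s_def cdown_def split: if_splits)
    \<comment> \<open>Removing a box where r is already zero would force, by the slope condition, a
      removal on every later diagonal, although bits stop at n.\<close>
    have pos: "r d > 0" if "d \<in> B" for d
    proof (rule ccontr)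
      assume "\<not> r d > 0"
      then have z: "r d = 0" by simp
      have "d + j \<in> B" for j
      proof (induction j)
        case (Suc j)
        have "r (d + j) = 0" "r (Suc (d + j)) = 0" using height_fn_antimono[OF r, of d] z by (metis le_add1 le_zero_eq le_SucI)+
        then show ?case using sl[of "d + j"] Suc by (auto split: if_splits simp: of_bool_def)
      qed (use that in simp)
      from Bn[OF this[of n]] show False by simp
    qed
    have e: "r d = f B d + of_bool (d \<in> B)" for d using pos[of d] by (auto simp: f_def)
    have a: "f B (Suc d) \<le> f B d \<and> f B d \<le> Suc (f B (Suc d))" for d using sl[of d] e[of d] e[of "Suc d"] by linarith
    have "f B n = 0" using n[of n] by (simp add: f_def)
    then have height_fn: "height_fn (f B)" using a by (auto simp: height_fn_def)
    have c: "r d \<le> k d + of_bool (d \<in> B) \<and> k d + of_bool (d \<in> B) \<le> Suc (r d)" for d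
    proof (cases d)
      case 0 then show ?thesis using i0 by (simp add: i_def cinit_def split: if_splits)
    next
      case (Suc d')
      show ?thesis
      proof (cases "d' < n")
        case True then show ?thesis using st[of d'] Suc by (simp add: s_def cdown_def cweight_def split: if_splits)
      next
        case False then show ?thesis using n[of d] Suc Bn[of d] by auto
      qed
    qed
    have b: "f B d \<le> k d \<and> k d \<le> Suc (f B d)" for d using c[of d] e[of d] by linarith
    have "f B d \<le> n - d" for d using height_fn_slope[OF height_fn, of d "n - d"] n[of n] n[of d] by (cases "d \<le> n") (auto simp: f_def)
    moreover have "f B d \<le> r d \<and> r d \<le> Suc (f B d)" for d using e[of d] by auto
    ultimately have "f B \<in> R" using height_fn b by (auto simp: R_def strip_def staircase_def intro!: belowI)
    moreover have "D (f B) = B"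
    proof (intro set_eqI)
      fix d show "d \<in> D (f B) \<longleftrightarrow> d \<in> B" using e[of d] by (auto simp: D_def added_def)
    qed
    ultimately show False using B(2) by force
  qed
  have "column_sum i s n False = (\<Sum>B\<in>S. w B)" by (simp add: column_sum_sum S_def w_def)
  also have "\<dots> = (\<Sum>B\<in>D ` R. w B)"
    by (rule sum.mono_neutral_right) (use inS w0 in \<open>auto simp: S_def\<close>)
  also have "\<dots> = (\<Sum>l\<in>R. w (D l))"
    by (subst sum.reindex) (auto intro: inj_on_inverseI[of _ f] simp: fr)
  also have "\<dots> = (\<Sum>l\<in>R. dnw l)" by (rule sum.cong) (simp_all add: wR)
  finally show ?thesis by (simp add: i_def s_def zdown_def R_def)
qed

end

section \<open>Coefficients of the Cauchy relation\<close>

lemma bigrade: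
  fixes F G :: "'a \<Rightarrow> real"
  assumes "\<And>l. l \<in> X \<Longrightarrow> p l \<le> L \<and> q l \<le> L"
  shows "(\<Sum>l\<in>X. F l * G l * y ^ p l * t ^ q l) =
    (\<Sum>c\<le>L. (\<Sum>m\<le>L. (\<Sum>l\<in>X. (if p l = c then F l else 0) * (if q l = m then G l else 0)) * t ^ m) * y ^ c)"
proof -
  have one: "(\<Sum>c\<le>L. (if a = c then h else 0) * z ^ c) = h * z ^ a" if "a \<le> L" for a and h z :: real
  proof -
    have "(\<Sum>c\<le>L. (if a = c then h else 0) * z ^ c) = (\<Sum>c\<le>L. if c = a then h * z ^ a else 0)"
      by (rule sum.cong) auto
    then show ?thesis using that by simp
  qed
  have "(\<Sum>c\<le>L. (\<Sum>m\<le>L. (\<Sum>l\<in>X. (if p l = c then F l else 0) * (if q l = m then G l else 0)) * t ^ m) * y ^ c)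
     = (\<Sum>c\<le>L. \<Sum>m\<le>L. \<Sum>l\<in>X. ((if p l = c then F l else 0) * y ^ c) * ((if q l = m then G l else 0) * t ^ m))"
    by (simp add: sum_distrib_left sum_distrib_right mult_ac)
  also have "\<dots> = (\<Sum>c\<le>L. \<Sum>l\<in>X. \<Sum>m\<le>L. ((if p l = c then F l else 0) * y ^ c) * ((if q l = m then G l else 0) * t ^ m))"
    by (intro sum.cong refl) (rule sum.swap)
  also have "\<dots> = (\<Sum>l\<in>X. \<Sum>c\<le>L. \<Sum>m\<le>L. ((if p l = c then F l else 0) * y ^ c) * ((if q l = m then G l else 0) * t ^ m))"
    by (rule sum.swap)
  also have "\<dots> = (\<Sum>l\<in>X. (\<Sum>c\<le>L. (if p l = c then F l else 0) * y ^ c) * (\<Sum>m\<le>L. (if q l = m then G l else 0) * t ^ m))"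
    by (simp only: sum_product)
  also have "\<dots> = (\<Sum>l\<in>X. F l * G l * y ^ p l * t ^ q l)"
    using assms by (intro sum.cong refl) (simp add: one)
  finally show ?thesis by simp
qed

lemma staircaseD: "l \<in> below (staircase n) \<Longrightarrow> l d \<le> n - d"
  using belowD(2)[of l "staircase n" d] by (simp add: staircase_def)

lemma card_added_staircase:
  assumes "l \<in> below (staircase n)" shows "card (added k l) \<le> n"
proof (rule card_added_le[OF belowD(1)[OF assms]])
  fix d assume "n \<le> d" then show "l d = 0" using staircaseD[OF assms, of d] by simp
qed

lemma strip_weight_stc0: "b \<in> below (staircase L) \<Longrightarrow> c > L \<Longrightarrow> strip_weight c a b = 0"
  using card_added_staircase[of b L a] by (auto simp: strip_weight_def)

lemma below_staircase_mono: "n \<le> K \<Longrightarrow> below (staircase n) \<subseteq> below (staircase K)"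
  by (auto simp: below_def staircase_def le_fun_def) (meson diff_le_mono le_trans)

lemma P_weight_stc0: "b \<in> below (staircase L) \<Longrightarrow> c > L \<Longrightarrow> P_weight c a b = 0"
  using card_added_staircase[of b L a] by (auto simp: P_weight_def)

definition up_down :: "nat \<Rightarrow> (nat \<Rightarrow> nat) \<Rightarrow> (nat \<Rightarrow> nat) \<Rightarrow> nat \<Rightarrow> nat \<Rightarrow> real" where
  "up_down K k r c m = (\<Sum>l\<in>below (staircase K). strip_weight c k l * P_weight m r l)"

definition down_up :: "nat \<Rightarrow> (nat \<Rightarrow> nat) \<Rightarrow> (nat \<Rightarrow> nat) \<Rightarrow> nat \<Rightarrow> nat \<Rightarrow> real" where
  "down_up K k r c m = (\<Sum>s\<in>below (staircase K). P_weight m s k * strip_weight c s r)"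

definition shift_both :: "(nat \<Rightarrow> nat \<Rightarrow> real) \<Rightarrow> nat \<Rightarrow> nat \<Rightarrow> real" where
  "shift_both F c m = (if c = 0 \<or> m = 0 then 0 else F (c - 1) (m - 1))"

lemma shf_sum:
  "(t * y) * (\<Sum>c\<le>L. (\<Sum>m\<le>L. F c m * t ^ m) * y ^ c) = (\<Sum>c\<le>Suc L. (\<Sum>m\<le>Suc L. shift_both F c m * t ^ m) * y ^ c)"
proof -
  have "(\<Sum>c\<le>Suc L. (\<Sum>m\<le>Suc L. shift_both F c m * t ^ m) * y ^ c) = (\<Sum>c\<le>L. (\<Sum>m\<le>L. F c m * t ^ Suc m) * y ^ Suc c)"
    unfolding sum.atMost_Suc_shift[of _ L] by (simp add: shift_both_def)
  then show ?thesis by (simp add: sum_distrib_left mult_ac)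
qed

text \<open>Past the ends of k and r, one more diagonal changes the upward sum to
  \<open>f False + 2 * f True\<close>. Eliminating \<open>f True\<close> with the intertwiner gives
  F_(K+1) = u F_K + (1 + u) G_K, a recursion in the cutoff K.\<close>

lemma cauchy_up_down:
  assumes k: "k \<in> below (staircase n)" and r: "r \<in> below (staircase n)" and K: "K \<ge> n"
  shows "up_down (Suc K) k r c m = shift_both (up_down K k r) c m + down_up K k r c m + shift_both (down_up K k r) c m"
proof -
  have height_fn: "height_fn k" "height_fn r" using k r belowD by auto
  have z: "k d = 0 \<and> r d = 0" if "d \<ge> n" for d using belowD(2)[OF k, of d] belowD(2)[OF r, of d] that by (auto simp: staircase_def)
  have z': "\<And>d. d \<ge> K \<Longrightarrow> k d = 0 \<and> r d = 0" "\<And>d. d \<ge> Suc K \<Longrightarrow> k d = 0 \<and> r d = 0" using z K by auto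
  have up: "(\<Sum>l\<in>{l\<in>below (staircase L). strip k l \<and> strip r l}. upw t y k r l) =
      (\<Sum>c\<le>L. (\<Sum>m\<le>L. up_down L k r c m * t ^ m) * y ^ c)" for L t y
  proof -
    have "(\<Sum>l\<in>{l\<in>below (staircase L). strip k l \<and> strip r l}. upw t y k r l) =
      (\<Sum>l\<in>below (staircase L). (if strip k l then 2 ^ runs (added k l) else 0) * (if strip r l then 2 ^ left_runs (added r l) else 0)
        * y ^ card (added k l) * t ^ card (added r l))"
      by (rule sum.mono_neutral_cong_left) (auto simp: upw_def[OF height_fn])
    also have "\<dots> = (\<Sum>c\<le>L. (\<Sum>m\<le>L. up_down L k r c m * t ^ m) * y ^ c)"
      by (subst bigrade[where L = L]) (auto simp: card_added_staircase up_down_def strip_weight_def P_weight_def intro!: sum.cong)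
    finally show ?thesis .
  qed
  have dn: "(\<Sum>l\<in>{l\<in>below (staircase K). strip l k \<and> strip l r}. dnw t y k r l) =
      (\<Sum>c\<le>K. (\<Sum>m\<le>K. down_up K k r c m * t ^ m) * y ^ c)" for t y
  proof -
    have b: "k \<in> below (staircase K)" "r \<in> below (staircase K)" using k r below_staircase_mono[OF K] by auto
    have "(\<Sum>l\<in>{l\<in>below (staircase K). strip l k \<and> strip l r}. dnw t y k r l) =
      (\<Sum>l\<in>below (staircase K). (if strip l r then 2 ^ runs (added l r) else 0) * (if strip l k then 2 ^ left_runs (added l k) else 0)
        * y ^ card (added l r) * t ^ card (added l k))"
      by (rule sum.mono_neutral_cong_left) (auto simp: dnw_def[OF height_fn])
    also have "\<dots> = (\<Sum>c\<le>K. (\<Sum>m\<le>K. down_up K k r c m * t ^ m) * y ^ c)"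
      by (subst bigrade[where L = K]) (use b in \<open>auto simp: card_added_staircase down_up_def strip_weight_def P_weight_def intro!: sum.cong\<close>)
    finally show ?thesis .
  qed
  have dn': "(\<Sum>c\<le>K. (\<Sum>m\<le>K. down_up K k r c m * t ^ m) * y ^ c) = (\<Sum>c\<le>Suc K. (\<Sum>m\<le>Suc K. down_up K k r c m * t ^ m) * y ^ c)" for t y
  proof -
    have b: "k \<in> below (staircase K)" "r \<in> below (staircase K)" using k r below_staircase_mono[OF K] by auto
    have "down_up K k r (Suc K) m = 0" "down_up K k r m (Suc K) = 0" for m
      unfolding down_up_def using strip_weight_stc0[OF b(2)] P_weight_stc0[OF b(1)] by (auto intro!: sum.neutral)
    then show ?thesis by simp
  qed
  have main: "(\<Sum>c\<le>Suc K. (\<Sum>m\<le>Suc K. up_down (Suc K) k r c m * t ^ m) * y ^ c) =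
     (\<Sum>c\<le>Suc K. (\<Sum>m\<le>Suc K. (shift_both (up_down K k r) c m + down_up K k r c m + shift_both (down_up K k r) c m) * t ^ m) * y ^ c)"
    if p: "t > 0" "y > 0" for t y
  proof -
    define u where "u = t * y"
    let ?f = "zup t y k r" and ?g = "zdown t y k r"
    have u: "u > 0" using p by (simp add: u_def)
    have "cinv u 0 0 (?f K) (?g K)" using cauchy_local[OF height_fn p, of K] z'(1)[of K] by (simp add: u_def)
    then have e: "(1 + u) * ?f K False = (1 - u) * ?g K False + 2 * ?g K True"
      "(1 + u) * ?f K True = 2 * u * ?g K False + (u - 1) * ?g K True" by (simp_all add: cinv_def)
    have "(1 + u) * ((1 - u) * ?f K False + 2 * ?f K True) =
      (1 - u) * ((1 + u) * ?f K False) + 2 * ((1 + u) * ?f K True)" by (simp add: algebra_simps)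
    also have "\<dots> = (1 + u) * ((1 + u) * ?g K False)" unfolding e by (simp add: algebra_simps)
    finally have "(1 - u) * ?f K False + 2 * ?f K True = (1 + u) * ?g K False" using u by simp
    moreover have "?f (Suc K) False = ?f K False + 2 * ?f K True"
      using z'(1)[of K] z'(1)[of "Suc K"] by (simp add: zup_def[OF height_fn] cup_def cweight_def)
    ultimately have "?f (Suc K) False = u * ?f K False + ?g K False + u * ?g K False" by (simp add: algebra_simps)
    moreover have "?f (Suc K) False = (\<Sum>c\<le>Suc K. (\<Sum>m\<le>Suc K. up_down (Suc K) k r c m * t ^ m) * y ^ c)"
      unfolding up[symmetric] by (rule zup_sum[OF height_fn]) (rule z'(2))
    moreover have "?f K False = (\<Sum>c\<le>K. (\<Sum>m\<le>K. up_down K k r c m * t ^ m) * y ^ c)"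
      unfolding up[symmetric] by (rule zup_sum[OF height_fn]) (rule z'(1))
    moreover have "?g K False = (\<Sum>c\<le>K. (\<Sum>m\<le>K. down_up K k r c m * t ^ m) * y ^ c)"
      unfolding dn[symmetric] by (rule zdown_sum[OF height_fn]) (rule z'(1))
    ultimately have "(\<Sum>c\<le>Suc K. (\<Sum>m\<le>Suc K. up_down (Suc K) k r c m * t ^ m) * y ^ c) =
       (\<Sum>c\<le>Suc K. (\<Sum>m\<le>Suc K. shift_both (up_down K k r) c m * t ^ m) * y ^ c) +
       (\<Sum>c\<le>Suc K. (\<Sum>m\<le>Suc K. down_up K k r c m * t ^ m) * y ^ c) +
       (\<Sum>c\<le>Suc K. (\<Sum>m\<le>Suc K. shift_both (down_up K k r) c m * t ^ m) * y ^ c)"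
      unfolding shf_sum[symmetric] u_def dn'[symmetric] by (simp only:)
    then show ?thesis by (simp only: distrib_right sum.distrib)
  qed
  have "up_down (Suc K) k r c m = shift_both (up_down K k r) c m + down_up K k r c m + shift_both (down_up K k r) c m" if cm: "c \<le> Suc K" "m \<le> Suc K"
  proof (rule polyfun_pos_eq[OF _ cm(2)])
    fix t :: real assume t: "t > 0"
    show "(\<Sum>i\<le>Suc K. up_down (Suc K) k r c i * t ^ i) =
      (\<Sum>i\<le>Suc K. (shift_both (up_down K k r) c i + down_up K k r c i + shift_both (down_up K k r) c i) * t ^ i)"
      by (rule polyfun_pos_eq[OF _ cm(1)]) (rule main[OF t])
  qed
  moreover have "up_down (Suc K) k r c m = 0 \<and> shift_both (up_down K k r) c m = 0 \<and> down_up K k r c m = 0 \<and> shift_both (down_up K k r) c m = 0"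
    if "\<not> (c \<le> Suc K \<and> m \<le> Suc K)"
  proof -
    have b: "k \<in> below (staircase K)" "r \<in> below (staircase K)" using k r below_staircase_mono[OF K] by auto
    have D: "down_up K k r c m = 0" if "c > K \<or> m > K" for c m
      unfolding down_up_def using that strip_weight_stc0[OF b(2)] P_weight_stc0[OF b(1)] by (auto intro!: sum.neutral)
    have U: "up_down L k r c m = 0" if "c > L \<or> m > L" for c m L
      unfolding up_down_def using that strip_weight_stc0[of _ L c] P_weight_stc0[of _ L m] by (auto intro!: sum.neutral)
    have o: "Suc K < c \<or> Suc K < m" using that by linarith
    then have "K < c \<or> K < m" "K < c - 1 \<or> K < m - 1" by linarith+
    then show ?thesis using U[OF o] U[of K "c - 1" "m - 1"] D[of c m] D[of "c - 1" "m - 1"]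
      by (simp add: shift_both_def)
  qed
  ultimately show ?thesis by (cases "c \<le> Suc K \<and> m \<le> Suc K") simp_all
qed

text \<open>A strip of c boxes on k cannot get past diagonal n + c: it would have to occupy all of
  n, ..., n + c.\<close>

lemma up_down_stable:
  assumes k: "k \<in> below (staircase n)" and K: "K \<ge> n + c"
  shows "up_down K k r c m = up_down (n + c) k r c m"
proof -
  have "strip_weight c k l = 0" if "l \<in> below (staircase K)" "l \<notin> below (staircase (n + c))" for l
  proof (rule ccontr)
    assume "strip_weight c k l \<noteq> 0"
    then have s: "strip k l" "card (added k l) = c" by (auto simp: strip_weight_def split: if_splits)
    have l: "height_fn l" using that(1) belowD by blast
    have "l (n + c) \<noteq> 0"
    proof
      assume "l (n + c) = 0"
      then have "l d \<le> staircase (n + c) d" for d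
        using height_fn_slope[OF l, of d "n + c - d"] height_fn_antimono[OF l, of "n + c" d] by (cases "d \<le> n + c") (auto simp: staircase_def)
      then show False using that(2) l by (auto simp: below_def le_fun_def)
    qed
    then have "l d > 0" if "d \<in> {n..n + c}" for d using height_fn_antimono[OF l, of d "n + c"] that by auto
    moreover have "k d = 0" if "d \<ge> n" for d using belowD(2)[OF k, of d] that by (simp add: staircase_def)
    ultimately have "{n..n + c} \<subseteq> added k l" by (auto simp: added_def)
    then have "card {n..n + c} \<le> card (added k l)" by (rule card_mono[OF finite_added[OF l]])
    then show False using s by simp
  qed
  then show ?thesis unfolding up_down_def
    by (intro sum.mono_neutral_right) (use below_staircase_mono[OF K] in auto)
qed

text \<open>The coefficients of \<open>(1 + u) / (1 - u)\<close>.\<close>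

definition cauchy_coeff :: "nat \<Rightarrow> real" where "cauchy_coeff j = (if j = 0 then 1 else 2)"

text \<open>For a stable cutoff the recursion reads F = u F + (1 + u) G. Unrolling it along the size
  c produces the coefficients of (1 + u) / (1 - u).\<close>

lemma cauchy_strip_weight:
  assumes k: "k \<in> below (staircase n)" and r: "r \<in> below (staircase n)" and K: "K \<ge> n + c"
  shows "up_down K k r c m = (\<Sum>j\<le>min c m. cauchy_coeff j * down_up K k r (c - j) (m - j))"
  using K
proof (induction c arbitrary: m K)
  case 0
  have "up_down K k r 0 m = up_down (Suc K) k r 0 m" using up_down_stable[OF k, of 0 K] up_down_stable[OF k, of 0 "Suc K"] 0 by simp
  also have "\<dots> = down_up K k r 0 m" using cauchy_up_down[OF k r, of K 0 m] 0 by (simp add: shift_both_def)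
  finally show ?case by (simp add: cauchy_coeff_def)
next
  case (Suc c)
  have e: "up_down K k r (Suc c) m = shift_both (up_down K k r) (Suc c) m + down_up K k r (Suc c) m + shift_both (down_up K k r) (Suc c) m"
    using cauchy_up_down[OF k r, of K "Suc c" m] up_down_stable[OF k, of "Suc c" K] up_down_stable[OF k, of "Suc c" "Suc K"] Suc.prems by simp
  show ?case
  proof (cases m)
    case 0 then show ?thesis using e by (simp add: shift_both_def cauchy_coeff_def)
  next
    case (Suc m')
    have "up_down K k r c m' = (\<Sum>j\<le>min c m'. cauchy_coeff j * down_up K k r (c - j) (m' - j))" using Suc.IH Suc.prems by simp
    also have "\<dots> = cauchy_coeff 0 * down_up K k r c m' + (\<Sum>j<min c m'. cauchy_coeff (Suc j) * down_up K k r (c - Suc j) (m' - Suc j))"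
      by (simp add: lessThan_Suc_atMost[symmetric] sum.lessThan_Suc_shift del: sum.lessThan_Suc)
    finally have i: "up_down K k r c m' = down_up K k r c m' + (\<Sum>j<min c m'. 2 * down_up K k r (c - Suc j) (m' - Suc j))"
      by (simp add: cauchy_coeff_def)
    have "(\<Sum>j\<le>min (Suc c) m. cauchy_coeff j * down_up K k r (Suc c - j) (m - j)) =
      down_up K k r (Suc c) m + 2 * down_up K k r c m' + (\<Sum>j<min c m'. 2 * down_up K k r (c - Suc j) (m' - Suc j))"
      using Suc by (simp add: lessThan_Suc_atMost[symmetric] sum.lessThan_Suc_shift cauchy_coeff_def del: sum.lessThan_Suc)
    then show ?thesis using e i Suc by (simp add: shift_both_def)
  qed
qed

section \<open>Linear combinations of words in the strip operators\<close>

definition comb_sum :: "(real \<times> nat list) list \<Rightarrow> (nat \<Rightarrow> nat) \<Rightarrow> (nat \<Rightarrow> nat) \<Rightarrow> real" where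
  "comb_sum a k l = (\<Sum>(r, w)\<leftarrow>a. r * chain_sum w k l)"

lemma comb_sum_Nil[simp]: "comb_sum [] k l = 0" by (simp add: comb_sum_def)
lemma comb_sum_Cons[simp]: "comb_sum ((r, w) # a) k l = r * chain_sum w k l + comb_sum a k l" by (simp add: comb_sum_def)
lemma comb_sum_append[simp]: "comb_sum (a @ b) k l = comb_sum a k l + comb_sum b k l" by (simp add: comb_sum_def)
lemma comb_sum_scale: "comb_sum (map (\<lambda>(s, w). (r * s, w)) a) k l = r * comb_sum a k l"
  by (induction a) (auto simp: algebra_simps)

lemma comb_sum_zero: "\<not> k \<le> l \<Longrightarrow> comb_sum a k l = 0"
  by (induction a) (auto simp: chain_sum_zero)

lemma comb_sum_sum:
  assumes "finite S"
  shows "\<exists>a. \<forall>k l. comb_sum a k l = (\<Sum>s\<in>S. c s * comb_sum (b s) k l)"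
  using assms
proof induction
  case empty then show ?case by (intro exI[of _ "[]"]) simp
next
  case (insert s S)
  then obtain a where "\<forall>k l. comb_sum a k l = (\<Sum>s\<in>S. c s * comb_sum (b s) k l)" by blast
  then show ?case using insert by (intro exI[of _ "map (\<lambda>(r, w). (c s * r, w)) (b s) @ a"]) (simp add: comb_sum_scale)
qed

definition comb_mult :: "(real \<times> nat list) list \<Rightarrow> (real \<times> nat list) list \<Rightarrow> (real \<times> nat list) list" where
  "comb_mult a b = concat (map (\<lambda>(r, v). map (\<lambda>(s, w). (r * s, v @ w)) b) a)"

lemma comb_sum_comb_mult:
  assumes "height_fn k" "height_fn l"
  shows "comb_sum (comb_mult a b) k l = (\<Sum>s\<in>below l. comb_sum a k s * comb_sum b s l)"
proof -
  have 1: "comb_sum (map (\<lambda>(s, w). (r * s, v @ w)) b) k l = (\<Sum>s\<in>below l. r * chain_sum v k s * comb_sum b s l)" for r v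
  proof (induction b)
    case (Cons x b)
    obtain t w where x: "x = (t, w)" by (cases x)
    show ?case using Cons x chain_sum_append[OF assms(2,1)]
      by (simp add: distrib_left sum.distrib sum_distrib_left mult_ac)
  qed simp
  show ?thesis
  proof (induction a)
    case Nil then show ?case by (simp add: comb_mult_def)
  next
    case (Cons x a)
    obtain r v where x: "x = (r, v)" by (cases x)
    show ?case using Cons x 1[of r v] by (simp add: comb_mult_def distrib_right sum.distrib)
  qed
qed

lemma comb_sum_comb_mult_commute:
  assumes "height_fn k" "height_fn l" shows "comb_sum (comb_mult a b) k l = comb_sum (comb_mult b a) k l"
proof -
  have 1: "comb_sum (map (\<lambda>(s, w). (r * s, v @ w)) b) k l = comb_sum (comb_mult b [(r, v)]) k l" for r v
    using chain_sum_append_commute[OF assms(2,1)] by (induction b) (auto simp: comb_mult_def mult_ac)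
  have 2: "comb_sum (comb_mult b (x # a)) k l = comb_sum (comb_mult b [x]) k l + comb_sum (comb_mult b a) k l" for x a
    using assms by (cases x) (simp add: comb_sum_comb_mult distrib_left sum.distrib del: comb_mult_def)
  have 0: "comb_sum (comb_mult b []) k l = 0" using assms by (simp add: comb_sum_comb_mult)
  show ?thesis
  proof (induction a)
    case Nil then show ?case using 0 by (simp add: comb_mult_def)
  next
    case (Cons x a)
    obtain r v where x: "x = (r, v)" by (cases x)
    show ?case using Cons 1[of r v] 2[of x a] x by (simp add: comb_mult_def)
  qed
qed

lemma complement_comb_sum:
  assumes "h \<in> below (staircase n)" "h' \<in> below (staircase n)"
  shows "comb_sum a (complement n h') (complement n h) = comb_sum a h h'"
  by (induction a) (auto simp: complement_chain_sum[OF assms])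

lemma stc0[simp]: "staircase 0 d = 0" by (simp add: staircase_def)

section \<open>Size and largest part\<close>

definition width :: "(nat \<Rightarrow> nat) \<Rightarrow> nat" where "width l = (LEAST d. l d = 0)"

lemma width_iff: assumes "height_fn l" shows "l d = 0 \<longleftrightarrow> width l \<le> d"
proof
  assume "width l \<le> d"
  moreover have "l (width l) = 0" unfolding width_def using assms by (auto simp: height_fn_def intro: LeastI)
  ultimately show "l d = 0" using height_fn_antimono[OF assms, of "width l" d] by simp
qed (simp add: width_def Least_le)

lemma below_staircase_iff: "height_fn l \<Longrightarrow> l \<in> below (staircase n) \<longleftrightarrow> width l \<le> n"
proof -
  assume a: "height_fn l"
  have "l d \<le> n - d" if "width l \<le> n" for d
    using height_fn_slope[OF a, of d "n - d"] width_iff[OF a, of n] width_iff[OF a, of d] that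
    by (cases "d \<le> n") auto
  moreover have "width l \<le> n" if "l \<in> below (staircase n)" using staircaseD[OF that, of n] width_iff[OF a, of n] by simp
  ultimately show ?thesis using a by (auto simp: below_def le_fun_def staircase_def)
qed

lemma strip_staircase:
  assumes "k \<in> below (staircase n)" "height_fn l" "strip k l"
  shows "l \<in> below (staircase (n + card (added k l)))"
proof (rule ccontr)
  assume "l \<notin> below (staircase (n + card (added k l)))"
  then have t: "width l > n + card (added k l)" using below_staircase_iff[OF assms(2)] by simp
  have "d \<in> added k l" if "d \<in> {n..n + card (added k l)}" for d
    using that t width_iff[OF assms(2), of d] staircaseD[OF assms(1), of d] by (auto simp: added_def)
  then have "card {n..n + card (added k l)} \<le> card (added k l)" by (intro card_mono finite_added assms) auto
  then show False by simp
qed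

lemma strip_weight_staircase: "strip_weight c k l \<noteq> 0 \<Longrightarrow> k \<in> below (staircase n) \<Longrightarrow> height_fn l \<Longrightarrow> l \<in> below (staircase (n + c))"
  using strip_staircase[of k n l] by (auto simp: strip_weight_def split: if_splits)

lemma chain_sum_staircase: "chain_sum w k l \<noteq> 0 \<Longrightarrow> k \<in> below (staircase n) \<Longrightarrow> height_fn l \<Longrightarrow> l \<in> below (staircase (n + sum_list w))"
proof (induction w arbitrary: k n)
  case (Cons c w)
  then obtain r where r: "r \<in> below l" "strip_weight c k r * chain_sum w r l \<noteq> 0"
    by (metis (no_types, lifting) chain_sum.simps(2) sum.neutral)
  then have "r \<in> below (staircase (n + c))" using strip_weight_staircase[of c k r n] Cons.prems belowD by auto
  from Cons.IH[OF _ this] r Cons.prems show ?case by (auto simp: add.assoc)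
qed (auto split: if_splits)

definition psize :: "(nat \<Rightarrow> nat) \<Rightarrow> nat" where "psize l = sum l {..<width l}"

lemma psize_eq: assumes "height_fn l" "width l \<le> n" shows "psize l = sum l {..<n}"
  unfolding psize_def by (rule sum.mono_neutral_left) (use assms width_iff[OF assms(1)] in auto)

lemma strip_width: assumes "height_fn k" "height_fn l" "\<And>d. k d \<le> l d" shows "width k \<le> width l"
  using assms(3)[of "width l"] width_iff[OF assms(2), of "width l"] width_iff[OF assms(1), of "width l"] by simp

lemma psize_strip:
  assumes "height_fn k" "height_fn l" "strip k l" shows "psize l = psize k + card (added k l)"
proof -
  have t: "width k \<le> width l" using strip_width[OF assms(1,2)] stripD[OF assms(3)] by blast
  have "l d = k d + of_bool (d \<in> added k l)" for d using stripD[OF assms(3), of d] by (auto simp: added_def)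
  then have "psize l = sum k {..<width l} + (\<Sum>d<width l. of_bool (d \<in> added k l))"
    by (simp add: psize_def sum.distrib)
  also have "(\<Sum>d<width l. of_bool (d \<in> added k l)) = card ({..<width l} \<inter> added k l)"
    by (simp add: of_bool_def sum.If_cases)
  also have "{..<width l} \<inter> added k l = added k l"
  proof -
    have "d < width l" if "d \<in> added k l" for d using that width_iff[OF assms(2), of d] by (auto simp: added_def not_le[symmetric])
    then show ?thesis by auto
  qed
  finally show ?thesis using psize_eq[OF assms(1) t] by simp
qed

lemma width_le_psize: assumes "height_fn l" shows "width l \<le> psize l"
proof -
  have "(\<Sum>d<width l. 1) \<le> sum l {..<width l}"
    by (rule sum_mono) (use width_iff[OF assms] in \<open>metis lessThan_iff less_one not_le\<close>)
  then show ?thesis by (simp add: psize_def)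
qed

text \<open>One box less on every nonempty diagonal means that the largest part is deleted.\<close>

definition tail :: "(nat \<Rightarrow> nat) \<Rightarrow> nat \<Rightarrow> nat" where "tail l d = l d - 1"

lemma height_fn_tail: "height_fn l \<Longrightarrow> height_fn (tail l)"
proof -
  assume a: "height_fn l"
  obtain n where "l n = 0" using a by (auto simp: height_fn_def)
  then have "tail l n = 0" by (simp add: tail_def)
  moreover have "tail l (Suc d) \<le> tail l d \<and> tail l d \<le> Suc (tail l (Suc d))" for d
    using height_fnD[OF a, of d] unfolding tail_def by linarith
  ultimately show "height_fn (tail l)" unfolding height_fn_def by blast
qed

lemma strip_tail: "strip (tail l) l" by (auto simp: strip_def tail_def)

lemma added_tail: "height_fn l \<Longrightarrow> added (tail l) l = {..<width l}"
proof -
  assume a: "height_fn l"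
  show ?thesis
  proof (rule set_eqI)
    fix d show "d \<in> added (tail l) l \<longleftrightarrow> d \<in> {..<width l}"
      unfolding added_def tail_def mem_Collect_eq lessThan_iff using width_iff[OF a, of d] by linarith
  qed
qed

text \<open>This gives triangularity with respect to \<open>width\<close>: every other shape
  obtained from the tail by a strip of the same size has a larger largest part.\<close>

lemma tail_unique:
  assumes "height_fn l" "height_fn l'" "strip (tail l) l'" "card (added (tail l) l') = width l" "width l' \<le> width l"
  shows "l' = l"
proof -
  have "added (tail l) l' \<subseteq> {..<width l}"
  proof
    fix d assume "d \<in> added (tail l) l'"
    then have "l' d \<noteq> 0" by (simp add: added_def)
    then show "d \<in> {..<width l}" using width_iff[OF assms(2), of d] assms(5) by simp
  qed
  then have e: "added (tail l) l' = {..<width l}" using assms(4) by (simp add: card_subset_eq)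
  show ?thesis
  proof
    fix d
    have "tail l d < l' d \<longleftrightarrow> d < width l" using e by (auto simp: added_def set_eq_iff)
    then show "l' d = l d" using stripD[OF assms(3), of d] width_iff[OF assms(1), of d]
      unfolding tail_def by linarith
  qed
qed

lemma runs_lessThan[simp]: "runs {..<m} = (if m = 0 then 0 else 1)"
proof (cases m)
  case (Suc j)
  then have "{d \<in> {..<m}. Suc d \<notin> {..<m}} = {j}" by auto
  then show ?thesis using Suc by (simp add: runs_def)
qed (simp add: runs_def)

lemma left_runs_lessThan[simp]: "left_runs {..<m} = 0"
proof -
  have "{d. d \<notin> {..<m} \<and> Suc d \<in> {..<m}} = {}" by auto
  then show ?thesis unfolding left_runs_def by (simp only: card.empty)
qed

section \<open>The vacuum vector is cyclic\<close>

text \<open>A linear combination of words represents a straight shape if, applied to the empty shape, it yields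
  precisely that shape; multiplying by its Q-function is then the same as applying the words.\<close>

definition represents :: "(real \<times> nat list) list \<Rightarrow> (nat \<Rightarrow> nat) \<Rightarrow> bool" where
  "represents a k \<longleftrightarrow> (\<forall>l. height_fn l \<longrightarrow> comb_sum a (staircase 0) l = of_bool (l = k))"

lemma sum_of_bool_below:
  assumes "height_fn l" "height_fn k" shows "(\<Sum>s\<in>below l. of_bool (s = k) * f s) = (if k \<le> l then f k else (0::real))"
proof -
  have "(\<Sum>s\<in>below l. of_bool (s = k) * f s) = (\<Sum>s\<in>below l. if s = k then f k else 0)"
    by (rule sum.cong) auto
  also have "\<dots> = (if k \<in> below l then f k else 0)" using assms(1) by simp
  finally show ?thesis using assms(2) by (simp add: below_def)
qed

lemma chain_sum_single: assumes "height_fn l" shows "chain_sum [c] k l = strip_weight c k l"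
proof -
  have "chain_sum [c] k l = (\<Sum>r\<in>below l. of_bool (r = l) * strip_weight c k r)" by (simp add: mult.commute)
  then show ?thesis using sum_of_bool_below[OF assms assms] by simp
qed

text \<open>A strip of size m = \<open>width l\<close> on the tail of l gives 2 times l, the strip
  being a single run, plus shapes of the same size with strictly larger width. The outer induction
  on size handles the tail, the inner one on size minus width the surplus shapes, which are
  subtracted after halving.\<close>

lemma represents_exists: assumes "height_fn l" shows "\<exists>a. represents a l"
proof -
  have "\<forall>l. height_fn l \<longrightarrow> psize l = p \<longrightarrow> (\<exists>a. represents a l)" for p
  proof (induction p rule: less_induct)
    case (less p)
    have "height_fn l \<Longrightarrow> psize l = p \<Longrightarrow> p - width l = q \<Longrightarrow> \<exists>a. represents a l" for q l
    proof (induction q arbitrary: l rule: less_induct)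
      case (less q)
      note outer = \<open>\<And>y. y < p \<Longrightarrow> \<forall>l. height_fn l \<longrightarrow> psize l = y \<longrightarrow> (\<exists>a. represents a l)\<close>
      show ?case
      proof (cases "width l = 0")
        case True
        then have "l = staircase 0" using width_iff[OF less.prems(1)] by (auto simp: fun_eq_iff)
        then have "represents [(1, [])] l" by (auto simp: represents_def)
        then show ?thesis by blast
      next
        case False
        define r m where "r = tail l" and "m = width l"
        have r: "height_fn r" "strip r l" "added r l = {..<m}" using less.prems(1) by (auto simp: r_def m_def height_fn_tail strip_tail added_tail)
        have pr: "p = psize r + m" using psize_strip[OF r(1) less.prems(1) r(2)] r(3) less.prems(2) by simp
        then obtain a where a: "represents a r" using outer r(1) False by (metis less_add_same_cancel1 m_def not_gr_zero)
        define S where "S = {s \<in> below (staircase p). strip r s \<and> card (added r s) = m \<and> s \<noteq> l}"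
        have "\<exists>b. represents b s" if "s \<in> S" for s
        proof -
          have s: "height_fn s" "strip r s" "card (added r s) = m" "s \<noteq> l" using that belowD by (auto simp: S_def)
          have ps: "psize s = p" using psize_strip[OF r(1) s(1,2)] s(3) pr by simp
          have "width s > m" using tail_unique[OF less.prems(1) s(1)] s by (auto simp: r_def m_def not_le[symmetric])
          moreover have "width s \<le> p" using width_le_psize[OF s(1)] ps by simp
          ultimately show ?thesis using less.IH[of "p - width s" s] s ps less.prems by (simp add: m_def)
        qed
        then obtain b where b: "\<And>s. s \<in> S \<Longrightarrow> represents (b s) s" by metis
        have fS: "finite S" by (simp add: S_def)
        from comb_sum_sum[OF fS, of "\<lambda>s. - strip_weight m r s / 2" b] obtain c where
          c: "comb_sum c k' l' = (\<Sum>s\<in>S. - strip_weight m r s / 2 * comb_sum (b s) k' l')" for k' l' by blast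
        define d where "d = map (\<lambda>(s, w). (1/2 * s, w)) (comb_mult a [(1, [m])]) @ c"
        have "comb_sum d (staircase 0) l' = of_bool (l' = l)" if l': "height_fn l'" for l'
        proof -
          have one: "chain_sum [m] s l' = strip_weight m s l'" for s by (rule chain_sum_single[OF l'])
          have "comb_sum (comb_mult a [(1, [m])]) (staircase 0) l' = (\<Sum>s\<in>below l'. of_bool (s = r) * strip_weight m s l')"
            using a l' one belowD by (auto simp: comb_sum_comb_mult represents_def simp del: chain_sum.simps intro!: sum.cong)
          also have "\<dots> = strip_weight m r l'" using sum_of_bool_below[OF l' r(1)] strip_weight_zero[of r l' m] by auto
          finally have 1: "comb_sum (comb_mult a [(1, [m])]) (staircase 0) l' = strip_weight m r l'" .
          have "comb_sum c (staircase 0) l' = (\<Sum>s\<in>S. if s = l' then - strip_weight m r l' / 2 else 0)"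
            unfolding c using b l' by (intro sum.cong refl) (auto simp: represents_def)
          then have 2: "comb_sum c (staircase 0) l' = (if l' \<in> S then - strip_weight m r l' / 2 else 0)" using fS by simp
          have "strip_weight m r l' = 0" if "l' \<notin> S" "l' \<noteq> l"
          proof (rule ccontr)
            assume w: "strip_weight m r l' \<noteq> 0"
            then have "strip r l'" "card (added r l') = m" by (auto simp: strip_weight_def split: if_splits)
            moreover from this have "width l' \<le> p" using width_le_psize[OF l'] psize_strip[OF r(1) l'] pr by simp
            ultimately show False using that l' by (simp add: S_def below_staircase_iff)
          qed
          moreover have "strip_weight m r l = 2" using r False by (simp add: strip_weight_def m_def)
          moreover have "l \<notin> S" by (simp add: S_def)
          moreover have "comb_sum d (staircase 0) l' = 1/2 * comb_sum (comb_mult a [(1, [m])]) (staircase 0) l' + comb_sum c (staircase 0) l'"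
            by (simp only: d_def comb_sum_append comb_sum_scale)
          ultimately show ?thesis using 1 2 by auto
        qed
        then show ?thesis unfolding represents_def by blast
      qed
    qed
    then show ?case by blast
  qed
  then show ?thesis using assms by blast
qed

lemma represents_comb_sum:
  assumes "represents a k" "height_fn k" "height_fn l"
  shows "comb_sum (comb_mult a b) (staircase 0) l = comb_sum b k l"
proof -
  have "comb_sum (comb_mult a b) (staircase 0) l = (\<Sum>s\<in>below l. of_bool (s = k) * comb_sum b s l)"
    using assms belowD by (auto simp: comb_sum_comb_mult represents_def intro!: sum.cong)
  then show ?thesis using sum_of_bool_below[OF assms(3,2)] comb_sum_zero by auto
qed

text \<open>A combination is determined by its action on the empty shape: acting on k it can, by
  commutativity, act first on the empty shape, after which k is created.\<close>

lemma comb_sum_ext: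
  assumes "\<And>l. height_fn l \<Longrightarrow> comb_sum a (staircase 0) l = comb_sum b (staircase 0) l" "height_fn k" "height_fn l"
  shows "comb_sum a k l = comb_sum b k l"
proof -
  obtain r where r: "represents r k" using represents_exists[OF assms(2)] by blast
  have "comb_sum c k l = (\<Sum>s\<in>below l. comb_sum c (staircase 0) s * comb_sum r s l)" for c
    using represents_comb_sum[OF r assms(2,3), of c] comb_sum_comb_mult_commute[of "staircase 0" l r c] assms(3) by (simp add: comb_sum_comb_mult)
  then show ?thesis using assms(1) belowD by (auto intro!: sum.cong)
qed

text \<open>In the product of the Q-functions of k and s the factors may be exchanged, so that k is
  created first and everything reached afterwards contains it.\<close>

lemma represents_zero:
  assumes "represents a k" "height_fn k" "height_fn s" "height_fn l" "\<not> k \<le> l"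
  shows "comb_sum a s l = 0"
proof -
  obtain r where r: "represents r s" using represents_exists[OF assms(3)] by blast
  have "comb_sum a s l = comb_sum (comb_mult a r) (staircase 0) l"
    using represents_comb_sum[OF r assms(3,4), of a] comb_sum_comb_mult_commute[of "staircase 0" l r a] assms(4) by simp
  also have "\<dots> = comb_sum r k l" by (rule represents_comb_sum[OF assms(1,2,4)])
  finally show ?thesis using comb_sum_zero[OF assms(5)] by simp
qed

text \<open>Complementation turns skewing by k into multiplication by the Q-function of k. A chain
  from the empty shape through k to the complement of h becomes one from h to the full staircase,
  which is cut after the letters of a.\<close>

lemma represents_complement:
  assumes "represents a k" "k \<in> below (staircase n)" "h \<in> below (staircase n)"
  shows "chain_sum cs k (complement n h) = (\<Sum>s\<in>below (staircase n). comb_sum a h s * chain_sum cs (staircase 0) (complement n s))"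
proof -
  have ch: "complement n h \<in> below (staircase n)" using assms(3) by simp
  have c0: "complement n (staircase 0) = staircase n" "complement n (staircase n) = staircase 0" "staircase 0 \<in> below (staircase n)"
    by (auto simp: complement_def staircase_def fun_eq_iff intro: belowI)
  have "chain_sum cs k (complement n h) = comb_sum (comb_mult a [(1, cs)]) (staircase 0) (complement n h)"
    using represents_comb_sum[OF assms(1), of "complement n h" "[(1, cs)]"] belowD[OF assms(2)] belowD[OF ch] by simp
  also have "\<dots> = comb_sum (comb_mult a [(1, cs)]) h (staircase n)"
    using complement_comb_sum[OF c0(3) ch, of "comb_mult a [(1, cs)]"] assms(3) c0 by simp
  also have "\<dots> = (\<Sum>s\<in>below (staircase n). comb_sum a h s * chain_sum cs s (staircase n))"
    using belowD[OF assms(3)] by (simp add: comb_sum_comb_mult)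
  also have "\<dots> = (\<Sum>s\<in>below (staircase n). comb_sum a h s * chain_sum cs (staircase 0) (complement n s))"
    using complement_chain_sum[of _ n "staircase n" cs] c0 by (intro sum.cong refl) simp
  finally show ?thesis .
qed

section \<open>Products of staircases\<close>

text \<open>All ways of taking i off the letters of a word, weighted by products of
  \<open>cauchy_coeff\<close>: this is what is left of the word when a strip being removed is
  commuted past it and absorbs i boxes.\<close>

primrec splittings :: "nat list \<Rightarrow> nat \<Rightarrow> (real \<times> nat list) list" where
  "splittings [] i = (if i = 0 then [(1, [])] else [])"
| "splittings (c # cs) i = concat (map (\<lambda>j. map (\<lambda>(r, w). (cauchy_coeff j * r, (c - j) # w)) (splittings cs (i - j))) [0..<Suc (min c i)])"

lemma comb_sum_concat: "comb_sum (concat xs) k l = (\<Sum>x\<leftarrow>xs. comb_sum x k l)"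
  by (induction xs) auto

lemma comb_sum_map_Cons: "comb_sum (map (\<lambda>(r, w). (q * r, c # w)) a) k l = q * (\<Sum>s\<in>below l. strip_weight c k s * comb_sum a s l)"
  by (induction a) (auto simp: sum_distrib_left sum.distrib algebra_simps)

lemma comb_sum_splittings_Cons:
  "comb_sum (splittings (c # cs) i) k l = (\<Sum>j\<le>min c i. cauchy_coeff j * (\<Sum>s\<in>below l. strip_weight (c - j) k s * comb_sum (splittings cs (i - j)) s l))"
  by (simp add: comb_sum_concat o_def comb_sum_map_Cons interv_sum_list_conv_sum_set_nat atLeast0LessThan lessThan_Suc_atMost del: upt_Suc)

lemma sum_below_extend:
  assumes "height_fn g" "l \<in> below g" "\<And>r. height_fn r \<Longrightarrow> \<not> r \<le> l \<Longrightarrow> f r = (0::real)"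
  shows "sum f (below l) = sum f (below g)"
proof (rule sum.mono_neutral_left)
  show "below l \<subseteq> below g" using assms(2) below_trans by blast
  show "\<forall>i\<in>below g - below l. f i = 0" using assms(3) by (auto simp: below_def)
qed (use assms(1) in simp)

lemma down_up_below:
  assumes "s \<in> below (staircase K)"
  shows "down_up K k s c m = (\<Sum>s'\<in>below s. P_weight m s' k * strip_weight c s' s)"
  unfolding down_up_def
proof (rule sum.mono_neutral_right)
  show "below s \<subseteq> below (staircase K)" using assms below_trans by blast
  show "\<forall>i\<in>below (staircase K) - below s. P_weight m i k * strip_weight c i s = 0" using strip_weight_zero by (auto simp: below_def)
qed simp

lemma sum_reindex_diag:
  fixes f :: "nat \<Rightarrow> nat \<Rightarrow> real"
  shows "(\<Sum>i\<le>m. \<Sum>j\<le>min c (m - i). f i j) = (\<Sum>l\<le>m. \<Sum>j\<le>min c l. f (l - j) j)"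
proof -
  have "(\<Sum>i\<le>m. \<Sum>j\<le>min c (m - i). f i j) = (\<Sum>(i, j)\<in>(SIGMA i:{..m}. {..min c (m - i)}). f i j)"
    by (rule sum.Sigma) auto
  also have "\<dots> = (\<Sum>(l, j)\<in>(SIGMA l:{..m}. {..min c l}). f (l - j) j)"
    by (rule sum.reindex_bij_witness[of _ "\<lambda>(l, j). (l - j, j)" "\<lambda>(i, j). (i + j, j)"]) auto
  also have "\<dots> = (\<Sum>l\<le>m. \<Sum>j\<le>min c l. f (l - j) j)" by (rule sum.Sigma[symmetric]) auto
  finally show ?thesis .
qed

lemma finite_below_staircase[simp]: "finite (below (staircase n))" by simp

text \<open>The Cauchy relation is applied letter by letter, each letter giving up some boxes to the
  removed strip. K is large enough for the cutoff to be irrelevant at every letter.\<close>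

lemma cauchy_word:
  assumes "k \<in> below (staircase n)" "r \<in> below (staircase n)" "K \<ge> n + sum_list cs"
  shows "(\<Sum>l\<in>below (staircase K). chain_sum cs k l * P_weight m r l) =
    (\<Sum>i\<le>m. \<Sum>s\<in>below r. P_weight (m - i) s k * comb_sum (splittings cs i) s r)"
  using assms
proof (induction cs arbitrary: k n m)
  case Nil
  have kK: "k \<in> below (staircase K)" using Nil below_staircase_mono[of n K] by auto
  have r: "height_fn r" "height_fn k" using Nil belowD by auto
  have "(\<Sum>l\<in>below (staircase K). chain_sum [] k l * P_weight m r l) = (\<Sum>l\<in>below (staircase K). of_bool (l = k) * P_weight m r l)"
    by (rule sum.cong) auto
  also have "\<dots> = (if k \<le> staircase K then P_weight m r k else 0)" by (rule sum_of_bool_below) (use r in auto)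
  finally have L: "(\<Sum>l\<in>below (staircase K). chain_sum [] k l * P_weight m r l) = P_weight m r k"
    using kK by (simp add: below_def)
  have "(\<Sum>i\<le>m. \<Sum>s\<in>below r. P_weight (m - i) s k * comb_sum (splittings [] i) s r) =
    (\<Sum>i\<le>m. if i = 0 then \<Sum>s\<in>below r. of_bool (s = r) * P_weight m s k else 0)"
    by (intro sum.cong refl) (auto simp: mult.commute)
  also have "\<dots> = (\<Sum>s\<in>below r. of_bool (s = r) * P_weight m s k)" by simp
  also have "\<dots> = P_weight m r k" using sum_of_bool_below[OF r(1) r(1), of "\<lambda>s. P_weight m s k"] by simp
  finally show ?case using L by simp
next
  case (Cons c cs)
  have K: "n + c \<le> K" "n \<le> K" using Cons.prems(3) by auto
  have kr: "height_fn k" "height_fn r" using Cons.prems belowD by auto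
  have rK: "r \<in> below (staircase K)" using Cons.prems(2) below_staircase_mono[OF K(2)] by auto
  have "(\<Sum>l\<in>below (staircase K). chain_sum (c # cs) k l * P_weight m r l) =
     (\<Sum>l\<in>below (staircase K). \<Sum>g\<in>below (staircase K). strip_weight c k g * (chain_sum cs g l * P_weight m r l))"
  proof (rule sum.cong[OF refl])
    fix l assume l: "l \<in> below (staircase K)"
    have "chain_sum (c # cs) k l = (\<Sum>g\<in>below (staircase K). strip_weight c k g * chain_sum cs g l)"
      unfolding chain_sum.simps by (rule sum_below_extend) (use l chain_sum_zero in auto)
    then show "chain_sum (c # cs) k l * P_weight m r l = (\<Sum>g\<in>below (staircase K). strip_weight c k g * (chain_sum cs g l * P_weight m r l))"
      by (simp add: sum_distrib_right mult.assoc)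
  qed
  also have "\<dots> = (\<Sum>g\<in>below (staircase K). strip_weight c k g * (\<Sum>l\<in>below (staircase K). chain_sum cs g l * P_weight m r l))"
    by (subst sum.swap) (simp add: sum_distrib_left)
  also have "\<dots> = (\<Sum>g\<in>below (staircase K). strip_weight c k g * (\<Sum>i\<le>m. \<Sum>s\<in>below r. P_weight (m - i) s g * comb_sum (splittings cs i) s r))"
  proof (rule sum.cong[OF refl])
    fix g assume g: "g \<in> below (staircase K)"
    show "strip_weight c k g * (\<Sum>l\<in>below (staircase K). chain_sum cs g l * P_weight m r l) =
       strip_weight c k g * (\<Sum>i\<le>m. \<Sum>s\<in>below r. P_weight (m - i) s g * comb_sum (splittings cs i) s r)"
    proof (cases "strip_weight c k g = 0")
      case False
      then have "g \<in> below (staircase (n + c))" using strip_weight_staircase[OF False Cons.prems(1)] belowD(1)[OF g] by blast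
      moreover have "r \<in> below (staircase (n + c))" using Cons.prems(2) below_staircase_mono[of n "n + c"] by auto
      ultimately show ?thesis using Cons.IH[of g "n + c" m] Cons.prems(3) by (simp add: add.assoc)
    qed simp
  qed
  also have "\<dots> = (\<Sum>i\<le>m. \<Sum>s\<in>below r. comb_sum (splittings cs i) s r * up_down K k s c (m - i))"
    unfolding up_down_def sum_distrib_left
    by (subst sum.swap, rule sum.cong[OF refl], subst sum.swap) (simp add: mult_ac)
  also have "\<dots> = (\<Sum>i\<le>m. \<Sum>s\<in>below r. comb_sum (splittings cs i) s r *
      (\<Sum>j\<le>min c (m - i). cauchy_coeff j * (\<Sum>s'\<in>below r. P_weight (m - i - j) s' k * strip_weight (c - j) s' s)))"
  proof (intro sum.cong refl arg_cong2[of _ _ _ _ "(*)"])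
    fix i s assume s: "s \<in> below r"
    have sn: "s \<in> below (staircase n)" "s \<in> below (staircase K)" using below_trans[OF s] Cons.prems(2) rK by auto
    have "(\<Sum>s'\<in>below s. P_weight m' s' k * strip_weight c' s' s) = (\<Sum>s'\<in>below r. P_weight m' s' k * strip_weight c' s' s)" for m' c'
      by (rule sum_below_extend) (use s kr strip_weight_zero in auto)
    then show "up_down K k s c (m - i) = (\<Sum>j\<le>min c (m - i). cauchy_coeff j * (\<Sum>s'\<in>below r. P_weight (m - i - j) s' k * strip_weight (c - j) s' s))"
      unfolding cauchy_strip_weight[OF Cons.prems(1) sn(1) K(1)] by (simp add: down_up_below[OF sn(2)])
  qed
  also have "\<dots> = (\<Sum>i\<le>m. \<Sum>j\<le>min c (m - i). \<Sum>s'\<in>below r. P_weight (m - (i + j)) s' k *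
       (cauchy_coeff j * (\<Sum>s\<in>below r. strip_weight (c - j) s' s * comb_sum (splittings cs i) s r)))"
    unfolding sum_distrib_left
    by (rule sum.cong[OF refl], subst sum.swap, rule sum.cong[OF refl], subst sum.swap) (simp add: mult_ac)
  also have "\<dots> = (\<Sum>l\<le>m. \<Sum>j\<le>min c l. \<Sum>s'\<in>below r. P_weight (m - (l - j + j)) s' k *
       (cauchy_coeff j * (\<Sum>s\<in>below r. strip_weight (c - j) s' s * comb_sum (splittings cs (l - j)) s r)))"
    by (rule sum_reindex_diag)
  also have "\<dots> = (\<Sum>l\<le>m. \<Sum>s'\<in>below r. P_weight (m - l) s' k * comb_sum (splittings (c # cs) l) s' r)"
    unfolding comb_sum_splittings_Cons sum_distrib_left
    by (rule sum.cong[OF refl], subst sum.swap) (intro sum.cong refl, simp)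
  finally show ?case .
qed

definition comb_splittings :: "(real \<times> nat list) list \<Rightarrow> nat \<Rightarrow> (real \<times> nat list) list" where
  "comb_splittings a i = concat (map (\<lambda>(r, w). map (\<lambda>(s, v). (r * s, v)) (splittings w i)) a)"

lemma comb_sum_comb_splittings: "comb_sum (comb_splittings a i) k l = (\<Sum>(r, w)\<leftarrow>a. r * comb_sum (splittings w i) k l)"
proof (induction a)
  case (Cons x a)
  then show ?case by (cases x) (simp add: comb_splittings_def comb_sum_scale)
qed (simp add: comb_splittings_def)

lemma cauchy_comb_sum:
  assumes "k \<in> below (staircase n)" "r \<in> below (staircase n)" "\<And>q w. (q, w) \<in> set a \<Longrightarrow> n + sum_list w \<le> K"
  shows "(\<Sum>l\<in>below (staircase K). comb_sum a k l * P_weight m r l) =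
    (\<Sum>i\<le>m. \<Sum>s\<in>below r. P_weight (m - i) s k * comb_sum (comb_splittings a i) s r)"
  using assms(3)
proof (induction a)
  case Nil then show ?case by (simp add: comb_splittings_def)
next
  case (Cons x a)
  obtain q w where x: "x = (q, w)" by (cases x)
  have "(\<Sum>l\<in>below (staircase K). comb_sum (x # a) k l * P_weight m r l) =
    q * (\<Sum>l\<in>below (staircase K). chain_sum w k l * P_weight m r l) + (\<Sum>l\<in>below (staircase K). comb_sum a k l * P_weight m r l)"
    using x by (simp add: distrib_right sum.distrib sum_distrib_left mult.assoc)
  also have "(\<Sum>l\<in>below (staircase K). chain_sum w k l * P_weight m r l) = (\<Sum>i\<le>m. \<Sum>s\<in>below r. P_weight (m - i) s k * comb_sum (splittings w i) s r)"
    by (rule cauchy_word[OF assms(1,2)]) (use Cons.prems x in auto)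
  also have "(\<Sum>l\<in>below (staircase K). comb_sum a k l * P_weight m r l) = (\<Sum>i\<le>m. \<Sum>s\<in>below r. P_weight (m - i) s k * comb_sum (comb_splittings a i) s r)"
    by (rule Cons.IH) (use Cons.prems in auto)
  also have "q * (\<Sum>i\<le>m. \<Sum>s\<in>below r. P_weight (m - i) s k * comb_sum (splittings w i) s r) +
      (\<Sum>i\<le>m. \<Sum>s\<in>below r. P_weight (m - i) s k * comb_sum (comb_splittings a i) s r) =
      (\<Sum>i\<le>m. \<Sum>s\<in>below r. P_weight (m - i) s k * comb_sum (comb_splittings (x # a) i) s r)"
    using x by (simp add: comb_sum_comb_splittings distrib_left sum.distrib sum_distrib_left mult_ac)
  finally show ?case .
qed

text \<open>Height function of \<open>(a+b, a+b-2, \<dots>, \<bar>a-b\<bar>+2, \<bar>a-b\<bar>, \<bar>a-b\<bar>-1, \<dots>, 1)\<close>.\<close>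

fun staircase_prod :: "nat \<Rightarrow> nat \<Rightarrow> nat \<Rightarrow> nat" where
  "staircase_prod 0 b = staircase b"
| "staircase_prod (Suc a) 0 = staircase (Suc a)"
| "staircase_prod (Suc a) (Suc b) = (\<lambda>d. staircase_prod a b d + of_bool (d < Suc (Suc (a + b))))"

lemma staircase_prod_props: "height_fn (staircase_prod a b) \<and> (\<forall>d. staircase_prod a b d = 0 \<longleftrightarrow> a + b \<le> d)"
proof (induction a b rule: staircase_prod.induct)
  case (3 a b)
  have z: "staircase_prod a b d = 0" if "d \<ge> a + b" for d using 3 that by blast
  have "staircase_prod (Suc a) (Suc b) (Suc d) \<le> staircase_prod (Suc a) (Suc b) d \<and> staircase_prod (Suc a) (Suc b) d \<le> Suc (staircase_prod (Suc a) (Suc b) (Suc d))" for d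
  proof (cases "d = Suc (a + b)")
    case True
    then have "staircase_prod a b d = 0" "staircase_prod a b (Suc d) = 0" using z by auto
    then show ?thesis by simp
  next
    case False then show ?thesis using 3 height_fnD[of "staircase_prod a b" d] by auto
  qed
  then show ?case using 3 by (auto simp: height_fn_def intro: exI[of _ "Suc (Suc (a + b))"])
qed (auto simp: staircase_def height_fn_staircase[unfolded staircase_def[abs_def]])

lemma width_staircase_prod: "width (staircase_prod a b) = a + b"
  using staircase_prod_props[of a b] width_iff[of "staircase_prod a b"] by (metis le_antisym le_refl)

lemma width_staircase[simp]: "width (staircase n) = n"
  using width_iff[of "staircase n"] height_fn_staircase by (metis diff_is_0_eq le_antisym le_refl staircase_def)

lemma tail_staircase: "tail (staircase (Suc a)) = staircase a" by (auto simp: tail_def staircase_def)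

lemma tail_stc0: "tail (staircase 0) = staircase 0" by (auto simp: tail_def)

text \<open>A staircase has a diagonals, so a strip in it with at least a boxes fills all of them.
  It is one run starting at 0, whose P-weight is 1.\<close>

lemma P_weight_staircase_big:
  assumes "m \<ge> a" "height_fn s" shows "P_weight m s (staircase a) = of_bool (m = a \<and> s = tail (staircase a))"
proof (cases "strip s (staircase a) \<and> card (added s (staircase a)) = m")
  case True
  have "added s (staircase a) \<subseteq> {..<a}" by (auto simp: added_def staircase_def)
  moreover from this have c: "m = a" using True assms card_mono[of "{..<a}" "added s (staircase a)"] by auto
  ultimately have e: "added s (staircase a) = {..<a}" using True by (simp add: card_subset_eq)
  have "s d = tail (staircase a) d" for d
  proof -
    have "d \<in> added s (staircase a) \<longleftrightarrow> d < a" using e by simp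
    then have "s d < a - d \<longleftrightarrow> d < a" by (simp add: added_def staircase_def)
    moreover have "s d \<le> a - d" "a - d \<le> Suc (s d)" using True stripD[of s "staircase a" d] by (simp_all add: staircase_def)
    ultimately show ?thesis unfolding tail_def staircase_def by linarith
  qed
  then have "s = tail (staircase a)" by blast
  then show ?thesis using True c e by (simp add: P_weight_def)
next
  case False
  have "strip (tail (staircase a)) (staircase a) \<and> card (added (tail (staircase a)) (staircase a)) = a"
    by (simp add: strip_tail added_tail)
  then have "\<not> (m = a \<and> s = tail (staircase a))" using False by blast
  then show ?thesis using False unfolding P_weight_def by (simp only: if_False of_bool_def)
qed

text \<open>Skewing a staircase by a row of length a leaves the next smaller staircase, and longer
  rows give zero. The Cauchy relation at the empty shape shows this for the representing
  combination.\<close>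

lemma comb_splittings_staircase:
  assumes "represents R (staircase a)" "m \<ge> a" "height_fn r"
  shows "comb_sum (comb_splittings R m) (staircase 0) r = of_bool (m = a \<and> r = tail (staircase a))"
proof -
  obtain n where n: "r \<in> below (staircase n)" using below_staircase_iff[OF assms(3)] by auto
  define K where "K = a + n + (\<Sum>x\<leftarrow>R. sum_list (snd x))"
  have s0: "staircase 0 \<in> below (staircase n)" by (auto intro: belowI)
  have r0: "staircase 0 \<in> below r" by (auto intro: belowI)
  have "n + sum_list w \<le> K" if "(q, w) \<in> set R" for q w
    using member_le_sum_list[of "sum_list w" "map (\<lambda>x. sum_list (snd x)) R"] that by (force simp: K_def)
  from cauchy_comb_sum[OF s0 n this, where m = m] have
    "(\<Sum>l\<in>below (staircase K). comb_sum R (staircase 0) l * P_weight m r l) =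
      (\<Sum>i\<le>m. \<Sum>s\<in>below r. P_weight (m - i) s (staircase 0) * comb_sum (comb_splittings R i) s r)" by simp
  moreover have "(\<Sum>l\<in>below (staircase K). comb_sum R (staircase 0) l * P_weight m r l) = P_weight m r (staircase a)"
  proof -
    have "(\<Sum>l\<in>below (staircase K). comb_sum R (staircase 0) l * P_weight m r l) = (\<Sum>l\<in>below (staircase K). of_bool (l = staircase a) * P_weight m r l)"
      using assms(1) belowD by (auto simp: represents_def intro!: sum.cong)
    also have "\<dots> = (if staircase a \<le> staircase K then P_weight m r (staircase a) else 0)" by (rule sum_of_bool_below) auto
    moreover have "staircase a \<le> staircase K" by (auto simp: le_fun_def staircase_def K_def)
    ultimately show ?thesis by simp
  qed
  moreover have "(\<Sum>i\<le>m. \<Sum>s\<in>below r. P_weight (m - i) s (staircase 0) * comb_sum (comb_splittings R i) s r) =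
     (\<Sum>i\<le>m. if i = m then \<Sum>s\<in>below r. of_bool (s = staircase 0) * comb_sum (comb_splittings R m) s r else 0)"
  proof (intro sum.cong refl)
    fix i assume "i \<in> {..m}"
    have "P_weight (m - i) s (staircase 0) = of_bool (m - i = 0 \<and> s = staircase 0)" if "s \<in> below r" for s
      using P_weight_staircase_big[of 0 "m - i" s] belowD[OF that] by (simp add: tail_stc0)
    then show "(\<Sum>s\<in>below r. P_weight (m - i) s (staircase 0) * comb_sum (comb_splittings R i) s r) =
      (if i = m then \<Sum>s\<in>below r. of_bool (s = staircase 0) * comb_sum (comb_splittings R m) s r else 0)"
      using \<open>i \<in> {..m}\<close> by (auto intro!: sum.neutral)
  qed
  moreover have "(\<Sum>s\<in>below r. of_bool (s = staircase 0) * comb_sum (comb_splittings R m) s r) = (if staircase 0 \<le> r then comb_sum (comb_splittings R m) (staircase 0) r else 0)"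
    by (rule sum_of_bool_below) (use assms in auto)
  moreover have "staircase 0 \<le> r" by (simp add: le_fun_def)
  ultimately show ?thesis using P_weight_staircase_big[OF assms(2,3)] by simp
qed

text \<open>The product is recovered from the shapes of largest width that occur in it: removing
  their first row leads to the product of the two next smaller staircases.\<close>

theorem staircase_product:
  assumes "represents R (staircase a)" "height_fn l"
  shows "comb_sum R (staircase b) l = of_bool (l = staircase_prod a b)"
  using assms
proof (induction a b arbitrary: R l rule: staircase_prod.induct)
  case (1 b)
  have "comb_sum R (staircase b) l = comb_sum [(1, [])] (staircase b) l"
    by (rule comb_sum_ext) (use 1 in \<open>auto simp: represents_def\<close>)
  then show ?case by auto
next
  case (2 a)
  then show ?case unfolding represents_def staircase_prod.simps by blast
next
  case (3 a b)
  define v where "v l = comb_sum R (staircase (Suc b)) l" for l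
  \<comment> \<open>Complemented in \<open>staircase (Suc a + b)\<close>, the second factor has
    height a on diagonal 0, so it cannot contain the first factor, which has height a + 1
    there.\<close>
  have small: "v l = 0" if l: "height_fn l" "width l < Suc a + Suc b" for l
  proof -
    define n where "n = Suc a + b"
    have ln: "l \<in> below (staircase n)" "staircase (Suc b) \<in> below (staircase n)" using l by (auto simp: below_staircase_iff n_def)
    have "v l = comb_sum R (complement n l) (complement n (staircase (Suc b)))" using complement_comb_sum[OF ln(2,1), of R] by (simp add: v_def)
    also have "\<dots> = 0"
    proof (rule represents_zero[OF 3(2)])
      have "staircase (Suc a) 0 = Suc a" "complement n (staircase (Suc b)) 0 = a" by (auto simp: staircase_def complement_def n_def)
      then show "\<not> staircase (Suc a) \<le> complement n (staircase (Suc b))" by (metis le_fun_def not_less_eq_eq le_refl)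
    qed (use ln height_fn_complement in auto)
    finally show ?thesis .
  qed
  define K where "K = Suc b + (\<Sum>x\<leftarrow>R. sum_list (snd x))"
  have Kw: "Suc b + sum_list w \<le> K" if "(q, w) \<in> set R" for q w
    using member_le_sum_list[of "sum_list w" "map (\<lambda>x. sum_list (snd x)) R"] that by (force simp: K_def)
  have vK: "l \<in> below (staircase K)" if "v l \<noteq> 0" "height_fn l" for l
  proof -
    have "\<exists>(q, w)\<in>set R. chain_sum w (staircase (Suc b)) l \<noteq> 0"
    proof (rule ccontr)
      assume "\<not> ?thesis"
      then have "comb_sum R (staircase (Suc b)) l = 0" unfolding comb_sum_def by (induction R) auto
      then show False using that by (simp add: v_def)
    qed
    then obtain q w where w: "(q, w) \<in> set R" "chain_sum w (staircase (Suc b)) l \<noteq> 0" by auto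
    from chain_sum_staircase[OF w(2) _ that(2), of "Suc b"] show ?thesis using below_staircase_mono[OF Kw[OF w(1)]] by auto
  qed
  \<comment> \<open>If l has maximal width in the support, no other shape of the support arises from
    the same tail by a strip of that size; removing a row of length m therefore isolates the
    coefficient of l.\<close>
  have key: "v l = (if width l = Suc a + Suc b then of_bool (tail l = staircase_prod a b) else 0)"
    if l: "height_fn l" "width l \<ge> Suc a + Suc b" and mx: "\<And>l'. height_fn l' \<Longrightarrow> v l' \<noteq> 0 \<Longrightarrow> width l' \<le> width l" for l
  proof -
    define m r where "m = width l" and "r = tail l"
    have r: "height_fn r" "strip r l" "added r l = {..<m}" using l by (auto simp: r_def m_def height_fn_tail strip_tail added_tail)
    define n where "n = Suc b + width r"
    define K' where "K' = n + m + K"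
    have rn: "staircase (Suc b) \<in> below (staircase n)" "r \<in> below (staircase n)" using r by (auto simp: below_staircase_iff n_def)
    have Kw': "n + sum_list w \<le> K'" if "(q, w) \<in> set R" for q w using Kw[OF that] by (simp add: K'_def)
    have lK: "l \<in> below (staircase K')" using l by (simp add: below_staircase_iff K'_def m_def)
    have "(\<Sum>l'\<in>below (staircase K'). v l' * P_weight m r l') = (\<Sum>l'\<in>below (staircase K'). if l' = l then v l else 0)"
    proof (rule sum.cong[OF refl])
      fix l' assume l': "l' \<in> below (staircase K')"
      have "P_weight m r l = 1" using r by (simp add: P_weight_def)
      moreover have "l' = l" if "v l' \<noteq> 0" "P_weight m r l' \<noteq> 0"
        by (rule tail_unique) (use that l l' mx belowD in \<open>auto simp: P_weight_def r_def m_def split: if_splits\<close>)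
      ultimately show "v l' * P_weight m r l' = (if l' = l then v l else 0)" by auto
    qed
    then have "v l = (\<Sum>l'\<in>below (staircase K'). v l' * P_weight m r l')" using lK by simp
    also have "\<dots> = (\<Sum>i\<le>m. \<Sum>s\<in>below r. P_weight (m - i) s (staircase (Suc b)) * comb_sum (comb_splittings R i) s r)"
      unfolding v_def by (rule cauchy_comb_sum[OF rn Kw'])
    also have "\<dots> = (\<Sum>i\<le>m. if i = Suc a then (if m = Suc a + Suc b then of_bool (r = staircase_prod a b) else 0) else 0)"
    proof (intro sum.cong refl)
      fix i assume i: "i \<in> {..m}"
      \<comment> \<open>The removed row is shared between the factors, which can lose at most a + 1
        and b + 1 boxes. As m is at least the sum, both lose exactly that much, i.e. their largest
        rows.\<close>
      consider "i > Suc a" | "i = Suc a" | "i < Suc a" by linarith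
      then show "(\<Sum>s\<in>below r. P_weight (m - i) s (staircase (Suc b)) * comb_sum (comb_splittings R i) s r) =
        (if i = Suc a then (if m = Suc a + Suc b then of_bool (r = staircase_prod a b) else 0) else 0)"
      proof cases
        case 1
        have "comb_sum (comb_splittings R i) s r = 0" if "s \<in> below r" for s
        proof -
          have "comb_sum (comb_splittings R i) s r = comb_sum [] s r"
            by (rule comb_sum_ext) (use comb_splittings_staircase[OF 3(2), of i] 1 r that belowD in auto)
          then show ?thesis by simp
        qed
        then show ?thesis using 1 by simp
      next
        case 2
        have R': "represents (comb_splittings R (Suc a)) (staircase a)" using comb_splittings_staircase[OF 3(2), of "Suc a"] by (simp add: represents_def tail_staircase)
        have "P_weight (m - i) s (staircase (Suc b)) = of_bool (m = Suc a + Suc b \<and> s = staircase b)" if "s \<in> below r" for s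
          using P_weight_staircase_big[of "Suc b" "m - i" s] that belowD l(2) 2 i by (auto simp: tail_staircase m_def)
        then have "(\<Sum>s\<in>below r. P_weight (m - i) s (staircase (Suc b)) * comb_sum (comb_splittings R i) s r) =
           (if m = Suc a + Suc b then (\<Sum>s\<in>below r. of_bool (s = staircase b) * comb_sum (comb_splittings R i) s r) else 0)"
          by (auto intro!: sum.cong sum.neutral)
        moreover have "(\<Sum>s\<in>below r. of_bool (s = staircase b) * comb_sum (comb_splittings R i) s r) = (if staircase b \<le> r then comb_sum (comb_splittings R i) (staircase b) r else 0)"
          by (rule sum_of_bool_below) (use r in auto)
        ultimately show ?thesis using 2 3(1)[OF R' r(1)] comb_sum_zero[of "staircase b" r "comb_splittings R i"] by auto
      next
        case 3
        then have "P_weight (m - i) s (staircase (Suc b)) = 0" if "s \<in> below r" for s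
          using P_weight_staircase_big[of "Suc b" "m - i" s] that belowD l(2) i by (auto simp: m_def)
        then show ?thesis using 3 by simp
      qed
    qed
    also have "\<dots> = (if m = Suc a + Suc b then of_bool (r = staircase_prod a b) else 0)"
      using l(2) by (auto simp: m_def)
    finally show ?thesis by (simp add: m_def r_def)
  qed
  have bound: "width l \<le> Suc a + Suc b" if "height_fn l" "v l \<noteq> 0" for l
  proof (rule ccontr)
    assume big: "\<not> width l \<le> Suc a + Suc b"
    define S where "S = {l. height_fn l \<and> v l \<noteq> 0}"
    have "S \<subseteq> below (staircase K)" using vK by (auto simp: S_def)
    then have fin: "finite S" by (rule finite_subset) simp
    then have "Max (width ` S) \<in> width ` S" using that by (intro Max_in) (auto simp: S_def)
    then obtain l' where l': "l' \<in> S" "width l' = Max (width ` S)" by auto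
    have mx: "width l'' \<le> width l'" if "height_fn l''" "v l'' \<noteq> 0" for l''
      using that fin l' by (simp add: S_def)
    have "width l' > Suc a + Suc b" using mx[OF that] big by simp
    then show False using key[of l', OF _ _ mx] l'(1) by (auto simp: S_def split: if_splits)
  qed
  show ?case
  proof (cases "width l = Suc a + Suc b")
    case True
    then have "v l = of_bool (tail l = staircase_prod a b)" using key[of l] bound 3(3) by simp
    moreover have "tail l = staircase_prod a b \<longleftrightarrow> l = staircase_prod (Suc a) (Suc b)"
    proof
      assume t: "tail l = staircase_prod a b"
      show "l = staircase_prod (Suc a) (Suc b)"
      proof
        fix d show "l d = staircase_prod (Suc a) (Suc b) d"
          using fun_cong[OF t, of d] width_iff[OF 3(3), of d] True by (auto simp: tail_def)
      qed
    next
      assume l: "l = staircase_prod (Suc a) (Suc b)"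
      show "tail l = staircase_prod a b"
      proof
        fix d
        have "staircase_prod a b d = 0" if "\<not> d < Suc (Suc (a + b))" using staircase_prod_props[of a b] that by auto
        then show "tail l d = staircase_prod a b d" by (cases "d < Suc (Suc (a + b))") (simp_all only: l tail_def staircase_prod.simps, simp_all)
      qed
    qed
    ultimately show ?thesis by (simp add: v_def)
  next
    case False
    then have "v l = 0" using bound[OF 3(3)] small[OF 3(3)] by force
    moreover have "l \<noteq> staircase_prod (Suc a) (Suc b)" using False width_staircase_prod[of "Suc a" "Suc b"] by auto
    ultimately show ?thesis by (simp add: v_def)
  qed
qed

section \<open>Skew Q-functions obtained from products\<close>

lemma chain_sum_stair: "h \<in> below (staircase n) \<Longrightarrow> chain_sum cs h (staircase n) = chain_sum cs (staircase 0) (complement n h)"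
proof -
  assume h: "h \<in> below (staircase n)"
  have "complement n (staircase n) = staircase 0" by (auto simp: complement_def staircase_def)
  then show ?thesis using complement_chain_sum[OF h, of "staircase n" cs] by simp
qed

text \<open>By \<open>represents_complement\<close> the skew Q-function is governed by the product
  of the staircases a and b, which is the single shape \<open>staircase_prod a b\<close>.\<close>

lemma chain_sum_trapezoid:
  assumes "a + b \<le> n"
  shows "chain_sum cs (staircase a) (complement n (staircase b)) = chain_sum cs (staircase 0) (complement n (staircase_prod a b))"
proof -
  obtain R where R: "represents R (staircase a)" using represents_exists[OF height_fn_staircase] by blast
  have b: "staircase a \<in> below (staircase n)" "staircase b \<in> below (staircase n)" "staircase_prod a b \<in> below (staircase n)"
    using assms staircase_prod_props[of a b] width_staircase_prod[of a b] by (auto simp: below_staircase_iff)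
  have "chain_sum cs (staircase a) (complement n (staircase b)) = (\<Sum>s\<in>below (staircase n). of_bool (s = staircase_prod a b) * chain_sum cs (staircase 0) (complement n s))"
    unfolding represents_complement[OF R b(1,2)] using staircase_product[OF R] belowD by (intro sum.cong) auto
  also have "\<dots> = (if staircase_prod a b \<le> staircase n then chain_sum cs (staircase 0) (complement n (staircase_prod a b)) else 0)"
    by (rule sum_of_bool_below) (use staircase_prod_props in auto)
  finally show ?thesis using b(3) by (simp add: below_def)
qed

definition row :: "nat \<Rightarrow> nat \<Rightarrow> nat" where "row m d = of_bool (d < m)"

lemma height_fn_row[simp]: "height_fn (row m)" by (auto simp: height_fn_def row_def intro: exI[of _ m])

text \<open>A single strip on the empty shape is one run, so it yields 2 times the row; the factor
  1/2 compensates.\<close>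

lemma represents_row: assumes "m > 0" shows "represents [(1/2, [m])] (row m)"
  unfolding represents_def
proof (intro allI impI)
  fix l assume l: "height_fn l"
  have "strip_weight m (staircase 0) l = (if l = row m then 2 else 0)"
  proof (cases "strip (staircase 0) l \<and> card (added (staircase 0) l) = m")
    case True
    have d: "added (staircase 0) l = {..<width l}"
    proof (rule set_eqI)
      fix d show "d \<in> added (staircase 0) l \<longleftrightarrow> d \<in> {..<width l}"
        unfolding added_def mem_Collect_eq lessThan_iff stc0 using width_iff[OF l, of d] by linarith
    qed
    then have w: "width l = m" using True by simp
    have "l d = row m d" for d
      using True stripD[of "staircase 0" l d] width_iff[OF l, of d] w by (auto simp: row_def)
    then have "l = row m" by blast
    then show ?thesis using True d w assms by (simp add: strip_weight_def)
  next
    case False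
    have "added (staircase 0) (row m) = {..<m}" by (auto simp: added_def row_def)
    then have "card (added (staircase 0) (row m)) = m" by simp
    moreover have "strip (staircase 0) (row m)" by (auto simp: strip_def row_def)
    ultimately have "l \<noteq> row m" using False by blast
    then show ?thesis using False unfolding strip_weight_def by (simp only: if_False)
  qed
  then show "comb_sum [(1 / 2, [m])] (staircase 0) l = of_bool (l = row m)" by (simp add: chain_sum_single[OF l] del: chain_sum.simps)
qed

text \<open>Inside \<open>staircase (r + 2)\<close> the square of a row of length r + 1 retains only
  the shape (r + 2, r). Its strip has two runs, and 2^2 divided by the 2 of
  \<open>represents_row\<close> is the exceptional factor 2.\<close>

lemma chain_sum_box_staircase:
  assumes "r \<ge> 1"
  shows "chain_sum cs (row (Suc r)) (complement (r + 2) (row (Suc r))) =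
     2 * chain_sum cs (staircase 0) (complement (r + 2) (\<lambda>d. row (r + 2) d + row r d))"
proof -
  define n m t where "n = r + 2" and "m = Suc r" and "t = (\<lambda>d. row (r + 2) d + row r d)"
  have mb: "row m \<in> below (staircase n)" by (auto intro!: belowI simp: row_def staircase_def n_def m_def)
  have at: "height_fn t" unfolding height_fn_def t_def row_def by (intro conjI allI exI[of _ "r + 2"]) auto
  have tb: "t \<in> below (staircase n)" by (rule belowI[OF at]) (auto simp: t_def row_def staircase_def n_def)
  have key: "comb_sum [(1/2, [m])] (row m) s = of_bool (s = t) * 2" if s: "s \<in> below (staircase n)" for s
  proof -
    have as: "height_fn s" using s belowD by blast
    have "strip_weight m (row m) s = (if s = t then 4 else 0)"
    proof (cases "strip (row m) s \<and> card (added (row m) s) = m")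
      case True
      then have st: "row m d \<le> s d" "s d \<le> Suc (row m d)" for d using stripD by blast+
      have s0: "s d = 0" if "d \<ge> n" for d using staircaseD[OF s, of d] that by simp
      have s1: "s (Suc r) \<le> 1" using staircaseD[OF s, of "Suc r"] by (simp add: n_def)
      have D: "added (row m) s \<subseteq> {..Suc r}"
      proof
        fix d assume "d \<in> added (row m) s"
        then show "d \<in> {..Suc r}" using s0[of d] by (cases "d \<ge> n") (auto simp: added_def n_def)
      qed
      have le: "s (Suc d) \<le> s d" for d using height_fnD(1)[OF as] .
      \<comment> \<open>The strip misses exactly one of the diagonals 0, ..., r + 1, and this must
        be r: without a box on r + 1 it would also miss r, and with a box on r it would miss
        none.\<close>
      have r1: "s (Suc r) = 1"
      proof (rule ccontr)
        assume "s (Suc r) \<noteq> 1"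
        then have "s (Suc r) = 0" using s1 by simp
        then have sr: "s r \<le> 1" using height_fnD(2)[OF as, of r] by simp
        have "added (row m) s \<subseteq> {..<r}"
        proof
          fix d assume d: "d \<in> added (row m) s"
          then have "d \<le> Suc r" using D by auto
          moreover have "d \<noteq> Suc r" "d \<noteq> r" using d \<open>s (Suc r) = 0\<close> sr by (auto simp: added_def row_def m_def)
          ultimately show "d \<in> {..<r}" by simp
        qed
        then have "card (added (row m) s) \<le> r" using card_mono[of "{..<r}"] by fastforce
        then show False using True by (simp add: m_def)
      qed
      have sr: "s r = 1"
      proof (rule ccontr)
        assume "s r \<noteq> 1"
        then have "s r = 2" using st[of r] by (simp add: row_def m_def)
        then have s2: "s d \<ge> 2" if "d \<le> r" for d using height_fn_antimono[OF as that] by simp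
        have "d \<in> added (row m) s" if "d \<le> Suc r" for d
        proof (cases "d = Suc r")
          case True then show ?thesis using r1 by (simp add: added_def row_def m_def)
        next
          case False then show ?thesis using that s2[of d] by (simp add: added_def row_def m_def)
        qed
        then have "{..Suc r} \<subseteq> added (row m) s" by auto
        then have "card {..Suc r} \<le> card (added (row m) s)" by (rule card_mono[OF finite_added[OF as]])
        then show False using True by (simp add: m_def)
      qed
      have "r \<notin> added (row m) s" using sr by (simp add: added_def row_def m_def)
      then have Dr: "added (row m) s \<subseteq> {..Suc r} - {r}" using D by auto
      have De: "added (row m) s = {..Suc r} - {r}" by (rule card_subset_eq[OF _ Dr]) (use True in \<open>auto simp: m_def\<close>)
      have "s d = t d" for d
      proof -
        have "d \<in> added (row m) s \<longleftrightarrow> d \<le> Suc r \<and> d \<noteq> r" using De by auto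
        then show ?thesis using st[of d] sr by (auto simp: added_def t_def row_def m_def)
      qed
      then have "s = t" by blast
      have "{d \<in> {..Suc r} - {r}. Suc d \<notin> {..Suc r} - {r}} = {r - 1, Suc r}" using assms by auto
      then have "runs ({..Suc r} - {r}) = 2" using assms by (simp add: runs_def)
      then show ?thesis using True De \<open>s = t\<close> by (simp add: strip_weight_def)
    next
      case False
      have e: "added (row m) t = {..Suc r} - {r}" by (auto simp: added_def t_def row_def m_def)
      have "card ({..Suc r} - {r}) = m" by (simp add: m_def)
      then have "card (added (row m) t) = m" by (simp only: e)
      moreover have "strip (row m) t" by (auto simp: strip_def t_def row_def m_def)
      ultimately have "s \<noteq> t" using False by blast
      then show ?thesis using False unfolding strip_weight_def by (simp only: if_False)
    qed
    then show ?thesis by (simp add: chain_sum_single[OF as] del: chain_sum.simps)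
  qed
  have "chain_sum cs (row m) (complement n (row m)) = (\<Sum>s\<in>below (staircase n). comb_sum [(1/2, [m])] (row m) s * chain_sum cs (staircase 0) (complement n s))"
    by (rule represents_complement[OF represents_row mb mb]) (simp add: m_def)
  also have "\<dots> = (\<Sum>s\<in>below (staircase n). of_bool (s = t) * (2 * chain_sum cs (staircase 0) (complement n s)))"
    by (intro sum.cong refl) (simp only: key mult.assoc)
  also have "\<dots> = (if t \<le> staircase n then 2 * chain_sum cs (staircase 0) (complement n t) else 0)"
    by (rule sum_of_bool_below) (use at in auto)
  finally show ?thesis using tb by (simp add: below_def m_def n_def t_def)
qed

section \<open>Tableaux as chains of strips\<close>

definition diagram :: "(nat \<Rightarrow> nat) \<Rightarrow> (nat \<Rightarrow> nat) \<Rightarrow> (nat \<times> nat) set" where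
  "diagram h h' = {(i, j). i \<le> j \<and> h (j - i) < i \<and> i \<le> h' (j - i)}"

definition tableaux :: "(nat \<Rightarrow> nat) \<Rightarrow> (nat \<Rightarrow> nat) \<Rightarrow> (nat \<Rightarrow> nat) \<Rightarrow> (nat \<times> nat \<Rightarrow> nat) set" where
  "tableaux h h' c = {T. is_tableau (diagram h h') T \<and> content (diagram h h') T = c}"

lemma diagram_iff: "(i, j) \<in> diagram h h' \<longleftrightarrow> i \<le> j \<and> h (j - i) < i \<and> i \<le> h' (j - i)"
  by (simp add: diagram_def)

lemma diagram_diag: "(i, i + d) \<in> diagram h h' \<longleftrightarrow> h d < i \<and> i \<le> h' d"
  by (simp add: diagram_def)

lemma finite_diagram: assumes "height_fn h'" shows "finite (diagram h h')"
proof -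
  have "diagram h h' \<subseteq> (\<lambda>(i, d). (i, i + d)) ` ({..h' 0} \<times> {..<width h'})"
  proof
    fix x assume "x \<in> diagram h h'"
    then obtain i d where x: "x = (i, i + d)" "h d < i" "i \<le> h' d"
      by (cases x) (metis diagram_iff le_add_diff_inverse)
    then have "i \<le> h' 0" "d < width h'" using height_fn_antimono[OF assms, of 0 d] width_iff[OF assms, of d] by linarith+
    then show "x \<in> (\<lambda>(i, d). (i, i + d)) ` ({..h' 0} \<times> {..<width h'})" using x by auto
  qed
  then show ?thesis by (rule finite_subset) auto
qed

lemma letter_num_iff: "a \<ge> 1 \<Longrightarrow> letter_num a = Suc N \<longleftrightarrow> a = 2 * N + 1 \<or> a = 2 * N + 2"
  "letter_num a \<le> N \<longleftrightarrow> a \<le> 2 * N" "letter_num a = 0 \<longleftrightarrow> a = 0"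
  by (auto simp: letter_num_def)

section \<open>Removing the largest letter from a tableau\<close>

context
  fixes h h' :: "nat \<Rightarrow> nat" and N :: nat
  assumes h: "height_fn h" and h': "height_fn h'"
begin

text \<open>Between the two boxes lies one step right and one step down. Equality in a row needs an
  unmarked letter and equality in a column a marked one, so the two steps together leave the pair
  k', k.\<close>

lemma tableau_diag_strict:
  assumes T: "is_tableau (diagram h h') T" and "h d < i" "Suc i \<le> h' d"
  shows "letter_num (T (i, i + d)) < letter_num (T (Suc i, Suc i + d))"
proof -
  have s: "h (Suc d) \<le> h d" "h' d \<le> Suc (h' (Suc d))" using height_fnD h h' by auto
  have D: "(i, i + d) \<in> diagram h h'" "(i, Suc (i + d)) \<in> diagram h h'" "(Suc i, Suc (i + d)) \<in> diagram h h'"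
    using assms s by (auto simp: diagram_iff)
  let ?a = "T (i, i + d)" and ?b = "T (i, Suc (i + d))" and ?c = "T (Suc i, Suc (i + d))"
  have "?a \<le> ?b" "?b \<le> ?c" using T D unfolding is_tableau_def by (meson le_SucI le_refl)+
  moreover have "?a \<noteq> ?b" if "odd ?a" using T D that unfolding is_tableau_def is_marked_def by (metis n_not_Suc_n)
  moreover have "?b \<noteq> ?c" if "even ?b" using T D that unfolding is_tableau_def is_marked_def by (metis n_not_Suc_n)
  ultimately have "(even ?a \<longrightarrow> ?a + 1 \<le> ?c) \<and> (odd ?a \<longrightarrow> ?a + 2 \<le> ?c)" by presburger
  moreover have "(even a \<longrightarrow> a + 1 \<le> c) \<and> (odd a \<longrightarrow> a + 2 \<le> c) \<Longrightarrow> (a + 1) div 2 < (c + 1) div 2" for a c :: nat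
    by presburger
  ultimately show ?thesis unfolding letter_num_def by simp
qed

text \<open>The heights of the part filled with letters at most N. Dropping one box per diagonal is
  enough because letters increase strictly along diagonals.\<close>

definition last_rows :: "(nat \<times> nat \<Rightarrow> nat) \<Rightarrow> nat \<Rightarrow> nat" where
  "last_rows T d = (if h d < h' d \<and> letter_num (T (h' d, h' d + d)) = Suc N then h' d - 1 else h' d)"

lemma last_rows_props:
  assumes T: "is_tableau (diagram h h') T" and hh: "h \<le> h'" and le': "\<forall>x\<in>diagram h h'. letter_num (T x) \<le> Suc N"
  shows "\<And>d. h d \<le> last_rows T d \<and> last_rows T d \<le> h' d \<and> h' d \<le> Suc (last_rows T d)"
    and "\<And>i d. (i, i + d) \<in> diagram h h' \<Longrightarrow> i \<le> last_rows T d \<longleftrightarrow> letter_num (T (i, i + d)) \<le> N"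
    and "height_fn (last_rows T)"
proof -
  note le = bspec[OF le']
  show b: "h d \<le> last_rows T d \<and> last_rows T d \<le> h' d \<and> h' d \<le> Suc (last_rows T d)" for d
    using hh by (auto simp: last_rows_def le_fun_def)
  show c: "i \<le> last_rows T d \<longleftrightarrow> letter_num (T (i, i + d)) \<le> N" if x: "(i, i + d) \<in> diagram h h'" for i d
  proof (cases "i = h' d")
    case True
    then show ?thesis using x le[OF x] by (auto simp: last_rows_def diagram_diag)
  next
    case False
    then have i: "Suc i \<le> h' d" "h d < i" using x by (auto simp: diagram_diag)
    then have "(Suc i, Suc i + d) \<in> diagram h h'" by (simp add: diagram_iff)
    from le[OF this] tableau_diag_strict[OF T i(2,1)] have "letter_num (T (i, i + d)) \<le> N" by simp
    moreover have "i \<le> last_rows T d" using i b[of d] by linarith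
    ultimately show ?thesis by simp
  qed
  have row: "T (i, j) \<le> T (i, j')" if "(i, j) \<in> diagram h h'" "(i, j') \<in> diagram h h'" "j \<le> j'" for i j j'
    using T that unfolding is_tableau_def by blast
  have col: "T (i, j) \<le> T (i', j)" if "(i, j) \<in> diagram h h'" "(i', j) \<in> diagram h h'" "i \<le> i'" for i i' j
    using T that unfolding is_tableau_def by blast
  have mono: "letter_num a \<le> letter_num a'" if "a \<le> a'" for a a' using that unfolding letter_num_def by (intro div_le_mono) simp
  have s: "h (Suc d) \<le> h d" "h d \<le> Suc (h (Suc d))" "h' (Suc d) \<le> h' d" "h' d \<le> Suc (h' (Suc d))" for d
    using height_fnD h h' by auto
  have "last_rows T (Suc d) \<le> last_rows T d" for d
  proof (rule ccontr)
    assume n: "\<not> ?thesis"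
    define i where "i = h' d"
    have i: "h' (Suc d) = i" "last_rows T (Suc d) = i" "last_rows T d = i - 1" "i > 0"
      using n b[of d] b[of "Suc d"] s[of d] by (auto simp: i_def)
    have D: "(i, i + d) \<in> diagram h h'" "(i, i + Suc d) \<in> diagram h h'"
      using i b[of d] s[of d] unfolding diagram_diag by (auto simp: i_def)
    have "letter_num (T (i, i + Suc d)) \<le> N" "\<not> letter_num (T (i, i + d)) \<le> N"
      using c[OF D(1)] c[OF D(2)] i by auto
    then show False using mono[OF row[OF D]] by simp
  qed
  moreover have "last_rows T d \<le> Suc (last_rows T (Suc d))" for d
  proof (rule ccontr)
    assume n: "\<not> ?thesis"
    define i where "i = h' (Suc d)"
    have i: "h' d = Suc i" "last_rows T d = Suc i" "last_rows T (Suc d) = i - 1" "i > 0" "h (Suc d) < i"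
      using n b[of d] b[of "Suc d"] s[of d] by (auto simp: i_def)
    have D: "(i, i + Suc d) \<in> diagram h h'" "(Suc i, Suc i + d) \<in> diagram h h'"
      using i s[of d] unfolding diagram_diag by (auto simp: i_def)
    have "letter_num (T (Suc i, Suc i + d)) \<le> N" "\<not> letter_num (T (i, i + Suc d)) \<le> N"
      using c[OF D(1)] c[OF D(2)] i by auto
    then show False using mono[OF col[of i "i + Suc d" "Suc i"]] D by simp
  qed
  moreover have "\<exists>n. last_rows T n = 0" using h' b unfolding height_fn_def by (metis le_zero_eq)
  ultimately show "height_fn (last_rows T)" by (auto simp: height_fn_def)
qed

lemma is_tableau_restrict:
  assumes t: "is_tableau D T" and s: "E \<subseteq> D"
  shows "is_tableau E (\<lambda>x. if x \<in> E then T x else 0)"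
proof -
  note t' = t[unfolded is_tableau_def]
  show ?thesis unfolding is_tableau_def
  proof (intro conjI)
    show "\<forall>x\<in>E. 1 \<le> (if x \<in> E then T x else 0)" using t'[THEN conjunct1] s by auto
    show "\<forall>i j j'. (i, j) \<in> E \<and> (i, j') \<in> E \<and> j \<le> j' \<longrightarrow>
      (if (i, j) \<in> E then T (i, j) else 0) \<le> (if (i, j') \<in> E then T (i, j') else 0)"
      using t'[THEN conjunct2, THEN conjunct2, THEN conjunct1] s by auto
    show "\<forall>i i' j. (i, j) \<in> E \<and> (i', j) \<in> E \<and> i \<le> i' \<longrightarrow>
      (if (i, j) \<in> E then T (i, j) else 0) \<le> (if (i', j) \<in> E then T (i', j) else 0)"
      using t'[THEN conjunct2, THEN conjunct2, THEN conjunct2, THEN conjunct1] s by auto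
    show "\<forall>i i' j. (i, j) \<in> E \<and> (i', j) \<in> E \<and> i \<noteq> i' \<and> \<not> is_marked (if (i, j) \<in> E then T (i, j) else 0) \<longrightarrow>
      (if (i, j) \<in> E then T (i, j) else 0) \<noteq> (if (i', j) \<in> E then T (i', j) else 0)"
      using t'[THEN conjunct2, THEN conjunct2, THEN conjunct2, THEN conjunct2, THEN conjunct1] s by (simp add: subset_iff)
    show "\<forall>i j j'. (i, j) \<in> E \<and> (i, j') \<in> E \<and> j \<noteq> j' \<and> is_marked (if (i, j) \<in> E then T (i, j) else 0) \<longrightarrow>
      (if (i, j) \<in> E then T (i, j) else 0) \<noteq> (if (i, j') \<in> E then T (i, j') else 0)"
      using t'[THEN conjunct2, THEN conjunct2, THEN conjunct2, THEN conjunct2, THEN conjunct2] s by (simp add: subset_iff)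
  qed simp
qed

text \<open>The left ends of the runs of the top strip; only there can the mark be chosen
  freely.\<close>

definition ends :: "(nat \<Rightarrow> nat) \<Rightarrow> nat set" where
  "ends r = {d \<in> added r h'. d = 0 \<or> d - 1 \<notin> added r h'}"

definition fwd where
  "fwd T = (last_rows T, (\<lambda>x. if x \<in> diagram h (last_rows T) then T x else 0),
     {d \<in> ends (last_rows T). T (h' d, h' d + d) = 2 * N + 2})"

text \<open>If diagonal d - 1 also carries a new box, that box lies directly to the left (equal
  heights) and forces an unmarked letter, or directly below and forces a marked one. Otherwise the
  choice is stored in A.\<close>

definition lastval :: "(nat \<Rightarrow> nat) \<Rightarrow> nat set \<Rightarrow> nat \<Rightarrow> nat" where
  "lastval r A d = (if d \<noteq> 0 \<and> d - 1 \<in> added r h' then (if h' (d - 1) = h' d then 2 * N + 2 else 2 * N + 1)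
     else if d \<in> A then 2 * N + 2 else 2 * N + 1)"

definition bwd where
  "bwd = (\<lambda>(r, T, A) x. if x \<in> diagram h r then T x else if x \<in> diagram h h' then lastval r A (snd x - fst x) else 0)"

definition target where
  "target c = (SIGMA r:{r \<in> below h'. h \<le> r \<and> strip r h' \<and> card (added r h') = c (Suc N)}.
     tableaux h r (c(Suc N := 0)) \<times> Pow (ends r))"

lemma lastval_letter: "letter_num (lastval r A d) = Suc N" "lastval r A d \<ge> 1"
  by (auto simp: lastval_def letter_num_def)

lemma diagram_mono: "r \<le> h' \<Longrightarrow> diagram h r \<subseteq> diagram h h'"
  by (auto simp: diagram_def le_fun_def intro: order_trans)

lemma content_le:
  assumes "height_fn s" "content (diagram h s) T = c" "\<forall>i>n. c i = 0" "x \<in> diagram h s"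
  shows "letter_num (T x) \<le> n"
proof (rule ccontr)
  assume "\<not> ?thesis"
  then have "c (letter_num (T x)) = 0" using assms(3) by simp
  then have "card {y \<in> diagram h s. letter_num (T y) = letter_num (T x)} = 0"
    using assms(2) by (auto simp: content_def)
  moreover have "finite {y \<in> diagram h s. letter_num (T y) = letter_num (T x)}"
    using finite_diagram[OF assms(1), of h] by simp
  ultimately have "{y \<in> diagram h s. letter_num (T y) = letter_num (T x)} = {}"
    using card_0_eq by blast
  then show False using assms(4) by blast
qed

lemma new_box:
  assumes "strip r h'" "(i, j) \<in> diagram h h'" "(i, j) \<notin> diagram h r"
  shows "i \<le> j" "h' (j - i) = i" "r (j - i) = i - 1" "j - i \<in> added r h'" "i > 0"
  using assms stripD[OF assms(1), of "j - i"] by (auto simp: diagram_iff added_def)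

lemma new_box_card:
  assumes "strip r h'" "h \<le> r" "\<And>x. x \<in> diagram h h' \<Longrightarrow> letter_num (T x) = Suc N \<longleftrightarrow> x \<notin> diagram h r"
  shows "card {x \<in> diagram h h'. letter_num (T x) = Suc N} = card (added r h')"
proof -
  have "bij_betw (\<lambda>d. (h' d, h' d + d)) (added r h') {x \<in> diagram h h'. letter_num (T x) = Suc N}"
    unfolding bij_betw_def
  proof
    show "inj_on (\<lambda>d. (h' d, h' d + d)) (added r h')" by (auto simp: inj_on_def)
    show "(\<lambda>d. (h' d, h' d + d)) ` added r h' = {x \<in> diagram h h'. letter_num (T x) = Suc N}"
    proof (intro equalityI subsetI)
      fix x assume "x \<in> (\<lambda>d. (h' d, h' d + d)) ` added r h'"
      then obtain d where d: "x = (h' d, h' d + d)" "r d < h' d" by (auto simp: added_def)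
      moreover have "h d \<le> r d" using assms(2) by (simp add: le_fun_def)
      ultimately show "x \<in> {x \<in> diagram h h'. letter_num (T x) = Suc N}"
        using assms(3)[of x] by (simp add: diagram_diag)
    next
      fix x assume x: "x \<in> {x \<in> diagram h h'. letter_num (T x) = Suc N}"
      obtain i j where ij: "x = (i, j)" by (cases x)
      have "(i, j) \<in> diagram h h'" "(i, j) \<notin> diagram h r" using x assms(3)[of x] ij by auto
      from new_box[OF assms(1) this] show "x \<in> (\<lambda>d. (h' d, h' d + d)) ` added r h'"
        using ij by (intro image_eqI[of _ _ "j - i"]) auto
    qed
  qed
  from bij_betw_same_card[OF this] show ?thesis by simp
qed

lemma fwd_target:
  assumes hh: "h \<le> h'" and c: "\<forall>i>Suc N. c i = 0" and T: "T \<in> tableaux h h' c"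
  shows "fwd T \<in> target c"
proof -
  have tab: "is_tableau (diagram h h') T" and con: "content (diagram h h') T = c" using T by (auto simp: tableaux_def)
  have le': "\<forall>x\<in>diagram h h'. letter_num (T x) \<le> Suc N" using content_le[OF h' con c] by blast
  note le = bspec[OF le']
  note P = last_rows_props[OF tab hh le']
  define r where "r = last_rows T"
  define T0 where "T0 = (\<lambda>x. if x \<in> diagram h r then T x else 0)"
  have r: "r \<le> h'" "h \<le> r" "strip r h'" "height_fn r" using P by (auto simp: r_def le_fun_def strip_def)
  have sub: "diagram h r \<subseteq> diagram h h'" by (rule diagram_mono[OF r(1)])
  have old: "x \<in> diagram h r \<longleftrightarrow> letter_num (T x) \<le> N" if x: "x \<in> diagram h h'" for x
  proof -
    obtain i d where id: "x = (i, i + d)" using x by (cases x) (metis diagram_iff le_add_diff_inverse)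
    show ?thesis using P(2)[of i d] x by (simp add: id r_def diagram_diag)
  qed
  have "is_tableau (diagram h r) T0" unfolding T0_def by (rule is_tableau_restrict[OF tab sub])
  moreover have "content (diagram h r) T0 = c(Suc N := 0)"
  proof
    fix i
    have "{x \<in> diagram h r. letter_num (T0 x) = i} = (if i \<le> N then {x \<in> diagram h h'. letter_num (T x) = i} else {})"
      using old sub by (auto simp: T0_def)
    then show "content (diagram h r) T0 i = (c(Suc N := 0)) i"
      using con c by (auto simp: content_def fun_eq_iff)
  qed
  moreover have "card (added r h') = c (Suc N)"
    using new_box_card[OF r(3,2), of T] old le con by (force simp: content_def fun_eq_iff le_Suc_eq)
  ultimately show ?thesis using r
    by (auto simp: fwd_def target_def tableaux_def below_def r_def[symmetric] T0_def)
qed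

text \<open>Old boxes never lie to the right of or below new ones. Of two new boxes in a row the
  right one has a new left neighbour, of two in a column the upper one has a new lower neighbour, so
  the values forced by \<open>lastval\<close> satisfy the row and column rules.\<close>

lemma bwd_tableaux:
  assumes hh: "h \<le> h'" and c: "\<forall>i>Suc N. c i = 0" and X: "(r, T, A) \<in> target c"
  shows "bwd (r, T, A) \<in> tableaux h h' c" "last_rows (bwd (r, T, A)) = r"
proof -
  have r: "height_fn r" "r \<le> h'" "h \<le> r" "strip r h'" "card (added r h') = c (Suc N)" and T: "is_tableau (diagram h r) T"
    "content (diagram h r) T = c(Suc N := 0)" and A: "A \<subseteq> ends r"
    using X by (auto simp: target_def tableaux_def below_def)
  define U where "U = bwd (r, T, A)"
  have sub: "diagram h r \<subseteq> diagram h h'" by (rule diagram_mono[OF r(2)])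
  have Uo: "U x = T x" if "x \<in> diagram h r" for x using that by (simp add: U_def bwd_def)
  have Un: "U (i, j) = lastval r A (j - i)" if "(i, j) \<in> diagram h h'" "(i, j) \<notin> diagram h r" for i j using that by (simp add: U_def bwd_def)
  have Uz: "U x = 0" if "x \<notin> diagram h h'" for x using that sub by (auto simp: U_def bwd_def)
  have cN: "\<forall>i>N. (c(Suc N := 0)) i = 0" using c by auto
  have To: "letter_num (T x) \<le> N" if "x \<in> diagram h r" for x by (rule content_le[OF r(1) T(2) cN that])
  have To': "U x \<le> 2 * N" if "x \<in> diagram h r" for x using To[OF that] Uo[OF that] by (simp add: letter_num_iff)
  have lv: "2 * N + 1 \<le> lastval r A d" "lastval r A d \<le> 2 * N + 2" for d by (auto simp: lastval_def)
  have rowval: "lastval r A (j' - i) = 2 * N + 2"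
    if a: "(i, j) \<in> diagram h h'" "(i, j) \<notin> diagram h r" "(i, j') \<in> diagram h h'" "(i, j') \<notin> diagram h r" "j < j'" for i j j'
  proof -
    note 1 = new_box[OF r(4) a(1,2)] and 2 = new_box[OF r(4) a(3,4)]
    have d: "j - i \<le> j' - i - 1" "j' - i \<noteq> 0" using a(5) 1 by auto
    have "h' (j' - i - 1) = i"
      using height_fn_antimono[OF h' d(1)] height_fn_antimono[OF h', of "j' - i - 1" "j' - i"] 1 2 by simp
    moreover have "r (j' - i - 1) < i" using height_fn_antimono[OF r(1) d(1)] 1 by linarith
    ultimately show ?thesis using d(2) 1 2 by (simp add: lastval_def added_def)
  qed
  have colval: "lastval r A (j - i) = 2 * N + 1"
    if a: "(i, j) \<in> diagram h h'" "(i, j) \<notin> diagram h r" "(i', j) \<in> diagram h h'" "(i', j) \<notin> diagram h r" "i < i'" for i i' j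
  proof -
    note 1 = new_box[OF r(4) a(1,2)] and 2 = new_box[OF r(4) a(3,4)]
    define d where "d = j - i - 1"
    have d: "j - i = Suc d" "j - i' \<le> d" "i' - i - 1 = d - (j - i')" using a(5) 1 2 by (auto simp: d_def)
    have "h' (j - i') \<le> h' d + (d - (j - i'))" using height_fn_slope[OF h', of "j - i'" "d - (j - i')"] d(2) by simp
    moreover have "h' d \<le> Suc (h' (Suc d))" "r d \<le> Suc (r (Suc d))" using height_fnD h' r(1) by auto
    ultimately have "h' d = Suc i" "r d \<le> i" using 1 2 d a(5) by auto
    then show ?thesis using d 1 by (simp add: lastval_def added_def)
  qed
  have no_row: False if "(i, j) \<in> diagram h h'" "(i, j) \<notin> diagram h r" "(i, j') \<in> diagram h r" "j \<le> j'" for i j j'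
  proof -
    note 1 = new_box[OF r(4) that(1,2)]
    have "r (j' - i) \<le> r (j - i)" using height_fn_antimono[OF r(1)] that(4) by simp
    then show False using 1 that(3) by (auto simp: diagram_iff)
  qed
  have no_col: False if "(i, j) \<in> diagram h h'" "(i, j) \<notin> diagram h r" "(i', j) \<in> diagram h r" "i \<le> i'" for i i' j
  proof -
    note 1 = new_box[OF r(4) that(1,2)]
    have "i' \<le> j" "i' \<le> r (j - i')" using that(3) by (auto simp: diagram_iff)
    moreover have "r (j - i') \<le> r (j - i) + (i' - i)"
      using height_fn_slope[OF r(1), of "j - i'" "i' - i"] that(4) \<open>i' \<le> j\<close> by simp
    ultimately show False using 1 that(4) by simp
  qed
  have tab: "is_tableau (diagram h h') U"
    unfolding is_tableau_def
  proof (intro conjI allI impI ballI)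
    fix x assume x: "x \<in> diagram h h'"
    show "1 \<le> U x"
    proof (cases "x \<in> diagram h r")
      case True then show ?thesis using T(1) Uo by (auto simp: is_tableau_def)
    next
      case False then show ?thesis using x Un lastval_letter(2) by (cases x) auto
    qed
  next
    fix x assume "x \<notin> diagram h h'" then show "U x = 0" by (rule Uz)
  next
    fix i j j' assume a: "(i, j) \<in> diagram h h' \<and> (i, j') \<in> diagram h h' \<and> j \<le> j'"
    show "U (i, j) \<le> U (i, j')"
    proof (cases "(i, j) \<in> diagram h r")
      case o: True
      show ?thesis
      proof (cases "(i, j') \<in> diagram h r")
        case True then show ?thesis using o T(1) a Uo unfolding is_tableau_def by metis
      next
        case False then show ?thesis using To'[OF o] Un[of i j'] a lv[of "j' - i"] by linarith
      qed
    next
      case n: False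
      then have n': "(i, j') \<notin> diagram h r" using no_row a by blast
      show ?thesis
      proof (cases "j = j'")
        case False
        then show ?thesis using rowval[of i j j'] Un[of i j] Un[of i j'] n n' a lv[of "j - i"] by simp
      qed simp
    qed
  next
    fix i i' j assume a: "(i, j) \<in> diagram h h' \<and> (i', j) \<in> diagram h h' \<and> i \<le> i'"
    show "U (i, j) \<le> U (i', j)"
    proof (cases "(i, j) \<in> diagram h r")
      case o: True
      show ?thesis
      proof (cases "(i', j) \<in> diagram h r")
        case True then show ?thesis using o T(1) a Uo unfolding is_tableau_def by metis
      next
        case False then show ?thesis using To'[OF o] Un[of i' j] a lv[of "j - i'"] by linarith
      qed
    next
      case n: False
      then have n': "(i', j) \<notin> diagram h r" using no_col a by blast
      show ?thesis
      proof (cases "i = i'")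
        case False
        then show ?thesis using colval[of i j i'] Un[of i j] Un[of i' j] n n' a lv[of "j - i'"] by simp
      qed simp
    qed
  next
    fix i i' j assume a: "(i, j) \<in> diagram h h' \<and> (i', j) \<in> diagram h h' \<and> i \<noteq> i' \<and> \<not> is_marked (U (i, j))"
    consider "(i, j) \<in> diagram h r" "(i', j) \<in> diagram h r" | "(i, j) \<in> diagram h r" "(i', j) \<notin> diagram h r"
      | "(i, j) \<notin> diagram h r" "(i', j) \<in> diagram h r" | "(i, j) \<notin> diagram h r" "(i', j) \<notin> diagram h r" by blast
    then show "U (i, j) \<noteq> U (i', j)"
    proof cases
      case 1 then show ?thesis using T(1) a Uo unfolding is_tableau_def by metis
    next
      case 2 then show ?thesis using To'[of "(i, j)"] Un[of i' j] a lv[of "j - i'"] by linarith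
    next
      case 3 then show ?thesis using To'[of "(i', j)"] Un[of i j] a lv[of "j - i"] by linarith
    next
      case 4
      then show ?thesis using colval[of i j i'] colval[of i' j i] Un[of i j] Un[of i' j] a
        by (cases "i < i'") (auto simp: is_marked_def)
    qed
  next
    fix i j j' assume a: "(i, j) \<in> diagram h h' \<and> (i, j') \<in> diagram h h' \<and> j \<noteq> j' \<and> is_marked (U (i, j))"
    consider "(i, j) \<in> diagram h r" "(i, j') \<in> diagram h r" | "(i, j) \<in> diagram h r" "(i, j') \<notin> diagram h r"
      | "(i, j) \<notin> diagram h r" "(i, j') \<in> diagram h r" | "(i, j) \<notin> diagram h r" "(i, j') \<notin> diagram h r" by blast
    then show "U (i, j) \<noteq> U (i, j')"
    proof cases
      case 1 then show ?thesis using T(1) a Uo unfolding is_tableau_def by metis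
    next
      case 2 then show ?thesis using To'[of "(i, j)"] Un[of i j'] a lv[of "j' - i"] by linarith
    next
      case 3 then show ?thesis using To'[of "(i, j')"] Un[of i j] a lv[of "j - i"] by linarith
    next
      case 4
      then show ?thesis using rowval[of i j j'] rowval[of i j' j] Un[of i j] Un[of i j'] a
        by (cases "j < j'") (auto simp: is_marked_def)
    qed
  qed
  have letU: "letter_num (U x) = (if x \<in> diagram h r then letter_num (T x) else Suc N)" if "x \<in> diagram h h'" for x
    using that Uo Un lastval_letter(1) by (cases x) auto
  have "content (diagram h h') U = c"
  proof
    fix i
    consider "i \<le> N" | "i = Suc N" | "i > Suc N" by linarith
    then show "content (diagram h h') U i = c i"
    proof cases
      case 1
      have "x \<in> diagram h h' \<and> letter_num (U x) = i \<longleftrightarrow> x \<in> diagram h r \<and> letter_num (T x) = i" for x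
        using letU[of x] sub 1 by (cases "x \<in> diagram h h'") (auto split: if_splits)
      then have "{x \<in> diagram h h'. letter_num (U x) = i} = {x \<in> diagram h r. letter_num (T x) = i}" by blast
      then show ?thesis using fun_cong[OF T(2), of i] 1 by (simp add: content_def)
    next
      case 2
      have "letter_num (U x) = Suc N \<longleftrightarrow> x \<notin> diagram h r" if "x \<in> diagram h h'" for x
        using letU[OF that] To[of x] by auto
      from new_box_card[OF r(4,3) this] show ?thesis using 2 r(5) by (simp add: content_def)
    next
      case 3
      have "letter_num (U x) \<noteq> i" if "x \<in> diagram h h'" for x using letU[OF that] To[of x] 3 by auto
      then have e: "{x \<in> diagram h h'. letter_num (U x) = i} = {}" by blast
      have "content (diagram h h') U i = 0" unfolding content_def e by simp
      then show ?thesis using c 3 by simp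
    qed
  qed
  then show "bwd (r, T, A) \<in> tableaux h h' c" using tab by (simp add: tableaux_def U_def)
  show "last_rows (bwd (r, T, A)) = r"
  proof
    fix d
    have s: "h d \<le> r d" "r d \<le> h' d" "h' d \<le> Suc (r d)" using r(2,3) stripD[OF r(4)] by (auto simp: le_fun_def)
    show "last_rows (bwd (r, T, A)) d = r d"
    proof (cases "h d < h' d")
      case True
      then have "(h' d, h' d + d) \<in> diagram h h'" by (simp add: diagram_diag)
      from letU[OF this] To[of "(h' d, h' d + d)"] True s show ?thesis
        by (auto simp: last_rows_def diagram_diag U_def[symmetric])
    qed (use s in \<open>auto simp: last_rows_def\<close>)
  qed
qed

lemma tableau_bij:
  assumes hh: "h \<le> h'" and c: "\<forall>i>Suc N. c i = 0"
  shows "bij_betw fwd (tableaux h h' c) (target c)"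
proof (rule bij_betw_byWitness[where f' = bwd])
  show "fwd ` tableaux h h' c \<subseteq> target c" using fwd_target[OF hh c] by blast
  show "bwd ` target c \<subseteq> tableaux h h' c" using bwd_tableaux(1)[OF hh c] by auto
  show "\<forall>T\<in>tableaux h h' c. bwd (fwd T) = T"
  proof
    fix T assume T: "T \<in> tableaux h h' c"
    then have tab: "is_tableau (diagram h h') T" and con: "content (diagram h h') T = c" by (auto simp: tableaux_def)
    have le': "\<forall>x\<in>diagram h h'. letter_num (T x) \<le> Suc N" using content_le[OF h' con c] by blast
    note le = bspec[OF le']
    note P = last_rows_props[OF tab hh le']
    define r where "r = last_rows T"
    have r: "strip r h'" "r \<le> h'" using P(1) by (auto simp: r_def strip_def le_fun_def)
    define A where "A = {d \<in> ends r. T (h' d, h' d + d) = 2 * N + 2}"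
    have pos: "1 \<le> T x" if "x \<in> diagram h h'" for x using tab that unfolding is_tableau_def by blast
    have two: "T (h' d, h' d + d) = 2 * N + 1 \<or> T (h' d, h' d + d) = 2 * N + 2" "(h' d, h' d + d) \<in> diagram h h'"
      if "d \<in> added r h'" for d
    proof -
      show D: "(h' d, h' d + d) \<in> diagram h h'" using that P(1)[of d] by (auto simp: added_def r_def diagram_diag)
      have "letter_num (T (h' d, h' d + d)) = Suc N"
        using P(2)[OF D] le[OF D] that by (auto simp: added_def r_def)
      then show "T (h' d, h' d + d) = 2 * N + 1 \<or> T (h' d, h' d + d) = 2 * N + 2"
        using letter_num_iff(1)[OF pos[OF D], of N] by simp
    qed
    have val: "T (h' d, h' d + d) = lastval r A d" if d: "d \<in> added r h'" for d
    proof (cases "d \<noteq> 0 \<and> d - 1 \<in> added r h'")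
      case True
      then obtain e where e: "d = Suc e" "e \<in> added r h'" by (cases d) auto
      have "h' e = h' d \<or> h' e = Suc (h' d)" using height_fnD[OF h', of e] e by auto
      then show ?thesis
      proof
        assume q: "h' e = h' d"
        let ?a = "T (h' d, h' d + e)" and ?b = "T (h' d, h' d + d)"
        have D: "(h' d, h' d + e) \<in> diagram h h'" "(h' d, h' d + d) \<in> diagram h h'" using two(2)[OF e(2)] two(2)[OF d] q by auto
        have "?a \<le> ?b" using tab D e unfolding is_tableau_def by (meson le_SucI le_refl add_le_mono)
        moreover have "?a \<noteq> ?b" if "is_marked ?a" using tab D e that unfolding is_tableau_def by (metis add_left_cancel n_not_Suc_n)
        ultimately have "?b = 2 * N + 2" using two(1)[OF e(2)] two(1)[OF d] q by (auto simp: is_marked_def)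
        then show ?thesis using e q by (simp add: lastval_def)
      next
        assume q: "h' e = Suc (h' d)"
        let ?a = "T (h' d, h' d + d)" and ?b = "T (Suc (h' d), h' d + d)"
        have D: "(h' d, h' d + d) \<in> diagram h h'" "(Suc (h' d), h' d + d) \<in> diagram h h'" using two(2)[OF e(2)] two(2)[OF d] q e by auto
        have b: "?b = 2 * N + 1 \<or> ?b = 2 * N + 2" using two(1)[OF e(2)] q e by simp
        have "?a \<le> ?b" using tab D unfolding is_tableau_def by (meson le_SucI le_refl)
        moreover have "?a \<noteq> ?b" if "\<not> is_marked ?a" using tab D that unfolding is_tableau_def by (metis n_not_Suc_n)
        ultimately have "?a = 2 * N + 1" using b two(1)[OF d] by (auto simp: is_marked_def)
        then show ?thesis using e q by (simp add: lastval_def)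
      qed
    next
      case False
      then have "d \<in> ends r" using d by (auto simp: ends_def)
      then show ?thesis using False two(1)[OF d] by (auto simp: lastval_def A_def)
    qed
    have fT: "fwd T = (r, \<lambda>x. if x \<in> diagram h r then T x else 0, A)" by (simp only: fwd_def r_def A_def)
    show "bwd (fwd T) = T"
    proof
      fix x :: "nat \<times> nat"
      obtain i j where ij: "x = (i, j)" by (cases x)
      consider "x \<in> diagram h r" | "x \<notin> diagram h r" "x \<in> diagram h h'" | "x \<notin> diagram h h'" "x \<notin> diagram h r" by blast
      then show "bwd (fwd T) x = T x"
      proof cases
        case 2
        note b = new_box[OF r(1), of i j] 
        have "x = (h' (j - i), h' (j - i) + (j - i))" "j - i \<in> added r h'" using b 2 ij by auto
        then show ?thesis using val[of "j - i"] 2 ij by (simp add: bwd_def fT)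
      next
        case 3
        then have "T x = 0" using tab unfolding is_tableau_def by blast
        then show ?thesis using 3 by (simp add: bwd_def fT)
      qed (simp add: bwd_def fT)
    qed
  qed
  show "\<forall>X\<in>target c. fwd (bwd X) = X"
  proof
    fix X assume X: "X \<in> target c"
    obtain r T A where rta: "X = (r, T, A)" by (cases X)
    note B = bwd_tableaux[OF hh c X[unfolded rta]]
    have r: "height_fn r" "r \<le> h'" "h \<le> r" "strip r h'" and T: "is_tableau (diagram h r) T" and A: "A \<subseteq> ends r"
      using X by (auto simp: rta target_def tableaux_def below_def)
    have "(\<lambda>x. if x \<in> diagram h r then bwd (r, T, A) x else 0) = T"
      using T by (auto simp: bwd_def is_tableau_def)
    moreover have "{d \<in> ends r. bwd (r, T, A) (h' d, h' d + d) = 2 * N + 2} = A"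
    proof -
      have "bwd (r, T, A) (h' d, h' d + d) = 2 * N + 2 \<longleftrightarrow> d \<in> A" if "d \<in> ends r" for d
      proof -
        have "r d < h' d" "h d \<le> r d" using that r(3) by (auto simp: ends_def added_def le_fun_def)
        then have "bwd (r, T, A) (h' d, h' d + d) = lastval r A d" by (simp add: bwd_def diagram_diag)
        then show ?thesis using that by (auto simp: lastval_def ends_def)
      qed
      then show ?thesis using A by blast
    qed
    ultimately show "fwd (bwd X) = X" using B(2) by (simp add: fwd_def rta)
  qed
qed

end

text \<open>Peeling off the top letter contributes one \<open>strip_weight\<close>, since the free
  choices form the power set of \<open>ends\<close>, which has as many elements as the strip has
  runs.\<close>

lemma tableaux_card:
  assumes "height_fn h" "height_fn h'" "h \<le> h'" "\<forall>i>N. c i = 0" "c 0 = 0"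
  shows "finite (tableaux h h' c) \<and> real (card (tableaux h h' c)) = chain_sum (map c [1..<Suc N]) h h'"
  using assms(2-)
proof (induction N arbitrary: h' c)
  case 0
  then have c: "c = (\<lambda>_. 0)" by (metis gr0I)
  show ?case
  proof (cases "h = h'")
    case True
    then have "diagram h h' = {}" by (auto simp: diagram_def)
    then have "tableaux h h' c = {\<lambda>_. 0}" by (auto simp: tableaux_def is_tableau_def content_def c)
    then show ?thesis using True by simp
  next
    case False
    then obtain d where "h d < h' d" using 0(2) by (metis le_fun_def le_neq_implies_less ext)
    then have x: "(h' d, h' d + d) \<in> diagram h h'" by (simp add: diagram_diag)
    have "T \<notin> tableaux h h' c" for T
    proof
      assume "T \<in> tableaux h h' c"
      then have "content (diagram h h') T (letter_num (T (h' d, h' d + d))) = 0" by (simp add: tableaux_def c)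
      then show False using finite_diagram[OF 0(1), of h] x by (auto simp: content_def)
    qed
    then have "tableaux h h' c = {}" by blast
    then show ?thesis using False by simp
  qed
next
  case (Suc N)
  define Mid where "Mid = {r \<in> below h'. h \<le> r \<and> strip r h' \<and> card (added r h') = c (Suc N)}"
  define c0 where "c0 = c(Suc N := 0)"
  have c0: "\<forall>i>N. c0 i = 0" "c0 0 = 0" using Suc.prems by (auto simp: c0_def)
  note bij = tableau_bij[OF assms(1) Suc.prems(1,2,3)]
  have tg: "target h h' N c = (SIGMA r:Mid. tableaux h r c0 \<times> Pow (ends h' r))"
    by (simp add: target_def[OF assms(1) Suc.prems(1)] Mid_def c0_def)
  have fm: "finite Mid" using Suc.prems(1) by (simp add: Mid_def)
  have ih: "finite (tableaux h r c0)" "real (card (tableaux h r c0)) = chain_sum (map c0 [1..<Suc N]) h r" if "r \<in> Mid" for r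
    using Suc.IH[of r c0] that c0 by (auto simp: Mid_def belowD)
  have en: "finite (ends h' r)" "card (ends h' r) = runs (added r h')" for r
    using finite_added[OF Suc.prems(1), of r] runs_left[of "added r h'"] by (auto simp: ends_def[OF assms(1) Suc.prems(1)])
  have ft: "finite (target h h' N c)" unfolding tg using fm ih en by (intro finite_SigmaI) auto
  have "finite (tableaux h h' c)" using bij ft bij_betw_finite by blast
  moreover have "real (card (tableaux h h' c)) = chain_sum (map c [1..<Suc (Suc N)]) h h'"
  proof -
    have "card (tableaux h h' c) = card (target h h' N c)" using bij by (rule bij_betw_same_card)
    also have "\<dots> = (\<Sum>r\<in>Mid. card (tableaux h r c0 \<times> Pow (ends h' r)))"
      unfolding tg by (rule card_SigmaI) (use fm ih en in auto)
    finally have "real (card (tableaux h h' c)) = (\<Sum>r\<in>Mid. chain_sum (map c0 [1..<Suc N]) h r * 2 ^ runs (added r h'))"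
      using ih en by (simp add: card_cartesian_product card_Pow)
    also have "\<dots> = (\<Sum>r\<in>Mid. chain_sum (map c0 [1..<Suc N]) h r * strip_weight (c (Suc N)) r h')"
      by (rule sum.cong) (auto simp: Mid_def strip_weight_def)
    also have "\<dots> = (\<Sum>r\<in>below h'. chain_sum (map c0 [1..<Suc N]) h r * strip_weight (c (Suc N)) r h')"
      by (rule sum.mono_neutral_left) (use Suc.prems(1) chain_sum_zero in \<open>auto simp: Mid_def strip_weight_def\<close>)
    also have "map c0 [1..<Suc N] = map c [1..<Suc N]" by (auto simp: c0_def)
    also have "(\<Sum>r\<in>below h'. chain_sum (map c [1..<Suc N]) h r * strip_weight (c (Suc N)) r h') = chain_sum (map c [1..<Suc N] @ [c (Suc N)]) h h'"
      by (simp only: chain_sum_append[OF Suc.prems(1) assms(1)] chain_sum_single[OF Suc.prems(1)])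
    finally show ?thesis by simp
  qed
  ultimately show ?case by blast
qed

section \<open>Partitions with distinct parts as height functions\<close>

definition height :: "nat list \<Rightarrow> nat \<Rightarrow> nat" where "height lam d = card {x \<in> set lam. d < x}"

lemma DP_distinct: "is_DP lam \<Longrightarrow> distinct lam"
  by (induction lam) (auto simp: is_DP_def)

lemma DP_pos: "is_DP lam \<Longrightarrow> x \<in> set lam \<Longrightarrow> 0 < x" by (simp add: is_DP_def)

lemma DP_Cons: "is_DP (x # xs) \<longleftrightarrow> 0 < x \<and> (\<forall>y\<in>set xs. y < x) \<and> is_DP xs"
  by (auto simp: is_DP_def)

lemma height_Nil: "height [] = staircase 0" by (auto simp: height_def)

lemma height_Cons: "is_DP (x # xs) \<Longrightarrow> height (x # xs) d = (if d < x then Suc (height xs d) else 0)"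
proof -
  assume D: "is_DP (x # xs)"
  then have "x \<notin> set xs" by (auto simp: DP_Cons)
  show ?thesis
  proof (cases "d < x")
    case True
    have "{y \<in> set (x # xs). d < y} = insert x {y \<in> set xs. d < y}" using True by auto
    then show ?thesis using True \<open>x \<notin> set xs\<close> by (simp add: height_def)
  next
    case False
    then have e: "{y \<in> set (x # xs). d < y} = {}" using D by (fastforce simp: DP_Cons)
    show ?thesis using False unfolding height_def e by simp
  qed
qed

lemma height_step: "height lam d = height lam (Suc d) + of_bool (Suc d \<in> set lam)"
proof (cases "Suc d \<in> set lam")
  case True
  then have "{x \<in> set lam. d < x} = insert (Suc d) {x \<in> set lam. Suc d < x}" by auto
  then show ?thesis using True by (simp add: height_def)
next
  case False
  then have "d < x \<longleftrightarrow> Suc d < x" if "x \<in> set lam" for x using that by (cases "x = Suc d") auto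
  then have "{x \<in> set lam. d < x} = {x \<in> set lam. Suc d < x}" by blast
  then show ?thesis using False by (simp add: height_def)
qed

lemma height_zero: "\<exists>n. height lam n = 0"
proof -
  have "\<not> sum_list lam < x" if "x \<in> set lam" for x using member_le_sum_list[OF that] by simp
  then have e: "{x \<in> set lam. sum_list lam < x} = {}" by blast
  have "height lam (sum_list lam) = 0" unfolding height_def e by simp
  then show ?thesis by blast
qed

lemma height_fn_height[simp]: "height_fn (height lam)"
proof -
  have "height lam (Suc d) \<le> height lam d \<and> height lam d \<le> Suc (height lam (Suc d))" for d
    using height_step[of lam d] by (cases "Suc d \<in> set lam") simp_all
  then show ?thesis using height_zero[of lam] unfolding height_fn_def by blast
qed

text \<open>The sequences of parts and of heights are conjugate to each other.\<close>

lemma part_iff: "is_DP lam \<Longrightarrow> 1 \<le> i \<Longrightarrow> d < part lam i \<longleftrightarrow> i \<le> height lam d"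
proof (induction lam arbitrary: i)
  case Nil then show ?case by (simp add: part_def height_def)
next
  case (Cons x xs)
  then have D: "is_DP xs" "0 < x" "\<forall>y\<in>set xs. y < x" by (auto simp: DP_Cons)
  have z: "height xs d = 0" if "\<not> d < x"
  proof -
    have e: "{y \<in> set xs. d < y} = {}" using D(3) that by fastforce
    show ?thesis unfolding height_def e by simp
  qed
  show ?case
  proof (cases "i = 1")
    case True
    then show ?thesis using Cons.prems by (simp add: part_def height_Cons)
  next
    case False
    then obtain j where j: "i = Suc j" "1 \<le> j" using Cons.prems by (cases i) auto
    have "part (x # xs) i = part xs j" using j by (auto simp: part_def nth_Cons')
    then show ?thesis using Cons.IH[OF D(1) j(2)] height_Cons[OF Cons.prems(1)] j z by auto
  qed
qed

lemma shifted_diagram_diagram: assumes "is_DP lam" shows "shifted_diagram lam = diagram (staircase 0) (height lam)"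
proof -
  have "(i, j) \<in> shifted_diagram lam \<longleftrightarrow> (i, j) \<in> diagram (staircase 0) (height lam)" for i j
  proof (cases "1 \<le> i \<and> i \<le> j")
    case True
    have "j + 1 \<le> i + part lam i \<longleftrightarrow> j - i < part lam i" using True by linarith
    then show ?thesis using True part_iff[OF assms, of i "j - i"]
      by (auto simp: shifted_diagram_def diagram_iff part_def split: if_splits)
  qed (auto simp: shifted_diagram_def diagram_iff)
  then show ?thesis by auto
qed

lemma skew_diagram_diagram:
  assumes "is_DP lam" "is_DP mu" shows "skew_diagram lam mu = diagram (height mu) (height lam)"
  unfolding skew_diagram_def shifted_diagram_diagram[OF assms(1)] shifted_diagram_diagram[OF assms(2)]
  by (auto simp: diagram_def)

lemma set_height: assumes "is_DP lam" shows "x \<in> set lam \<longleftrightarrow> 1 \<le> x \<and> height lam (x - 1) = Suc (height lam x)"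
  using height_step[of lam "x - 1"] DP_pos[OF assms, of x] by (cases x) auto

lemma DP_set_eq: assumes "is_DP a" "is_DP b" "set a = set b" shows "a = b"
proof -
  have "sorted_wrt (<) (rev a)" "sorted_wrt (<) (rev b)" using assms by (simp_all add: is_DP_def sorted_wrt_rev)
  then have "rev a = rev b" using assms(3) by (intro strict_sorted_equal) auto
  then show ?thesis by simp
qed

lemma height_inj: assumes "is_DP a" "is_DP b" "height a = height b" shows "a = b"
  by (rule DP_set_eq) (use assms set_height[of a] set_height[of b] in auto)

lemma height_le_iff: assumes "is_DP lam" "is_DP mu"
  shows "shifted_diagram mu \<subseteq> shifted_diagram lam \<longleftrightarrow> height mu \<le> height lam"
proof
  assume s: "shifted_diagram mu \<subseteq> shifted_diagram lam"
  have "height mu d \<le> height lam d" for d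
  proof (cases "height mu d = 0")
    case False
    then have "(height mu d, height mu d + d) \<in> shifted_diagram mu" using assms by (simp add: shifted_diagram_diagram diagram_iff)
    then have "(height mu d, height mu d + d) \<in> diagram (staircase 0) (height lam)" using s assms shifted_diagram_diagram by auto
    then show ?thesis by (simp add: diagram_iff)
  qed simp
  then show "height mu \<le> height lam" by (simp add: le_fun_def)
next
  assume "height mu \<le> height lam"
  then show "shifted_diagram mu \<subseteq> shifted_diagram lam"
    using assms by (auto simp: shifted_diagram_diagram diagram_def le_fun_def intro: order_trans)
qed

lemma height_0: "is_DP lam \<Longrightarrow> height lam 0 = length lam"
  using DP_pos[of lam] distinct_card[OF DP_distinct, of lam]
  by (auto simp: height_def intro!: arg_cong[of _ _ card] cong: conj_cong)

text \<open>Contents with infinite support or with a nonzero entry at 0 belong to no tableau, so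
  finite words of letter multiplicities carry all information.\<close>

lemma Qcoeff_eq_iff:
  assumes h: "height_fn h" "height_fn h'" "h \<le> h'" and s: "height_fn s" "height_fn s'" "s \<le> s'"
  shows "Qcoeff (diagram h h') = (\<lambda>c. k * Qcoeff (diagram s s') c) \<longleftrightarrow> (\<forall>cs. chain_sum cs h h' = real k * chain_sum cs s s')"
proof -
  have Q: "Qcoeff (diagram h h') c = card (tableaux h h' c)" for h h' c by (simp add: Qcoeff_def tableaux_def)
  have none: "Qcoeff (diagram h h') c = 0" if "height_fn h'" "\<not> (c 0 = 0 \<and> (\<exists>N. \<forall>i>N. c i = 0))" for h h' c
  proof -
    have "T \<notin> tableaux h h' c" for T
    proof
      assume T: "T \<in> tableaux h h' c"
      then have pos: "1 \<le> T x" if "x \<in> diagram h h'" for x using that unfolding tableaux_def is_tableau_def by blast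
      have con: "content (diagram h h') T = c" using T by (simp add: tableaux_def)
      have "{x \<in> diagram h h'. letter_num (T x) = 0} = {}" using pos by (fastforce simp: letter_num_iff)
      then have "content (diagram h h') T 0 = 0" unfolding content_def by (simp only: card.empty)
      then have "c 0 = 0" using con by simp
      moreover have "c i = 0" if i: "i > Max (insert 0 ((\<lambda>x. letter_num (T x)) ` diagram h h'))" for i
      proof -
        have "letter_num (T x) < i" if "x \<in> diagram h h'" for x
          using i finite_diagram[OF \<open>height_fn h'\<close>, of h] that by simp
        then have "{x \<in> diagram h h'. letter_num (T x) = i} = {}" by fastforce
        then have "content (diagram h h') T i = 0" unfolding content_def by (simp only: card.empty)
        then show ?thesis using con by simp
      qed
      ultimately show False using that(2) by blast
    qed
    then have "tableaux h h' c = {}" by blast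
    then show ?thesis by (simp add: Q)
  qed
  show ?thesis
  proof
    assume e: "Qcoeff (diagram h h') = (\<lambda>c. k * Qcoeff (diagram s s') c)"
    show "\<forall>cs. chain_sum cs h h' = real k * chain_sum cs s s'"
    proof
      fix cs :: "nat list"
      define c where "c i = (if 1 \<le> i \<and> i \<le> length cs then cs ! (i - 1) else 0)" for i
      have m: "map c [1..<Suc (length cs)] = cs" by (rule nth_equalityI) (auto simp: c_def simp del: upt_Suc)
      have cz: "\<forall>i>length cs. c i = 0" "c 0 = 0" by (simp_all add: c_def)
      have "real (card (tableaux h h' c)) = chain_sum cs h h'" "real (card (tableaux s s' c)) = chain_sum cs s s'"
        using tableaux_card[OF h cz, unfolded m] tableaux_card[OF s cz, unfolded m] by blast+
      moreover have "card (tableaux h h' c) = k * card (tableaux s s' c)" using fun_cong[OF e, of c] by (simp add: Q)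
      ultimately show "chain_sum cs h h' = real k * chain_sum cs s s'" by (metis of_nat_mult)
    qed
  next
    assume m: "\<forall>cs. chain_sum cs h h' = real k * chain_sum cs s s'"
    show "Qcoeff (diagram h h') = (\<lambda>c. k * Qcoeff (diagram s s') c)"
    proof
      fix c
      show "Qcoeff (diagram h h') c = k * Qcoeff (diagram s s') c"
      proof (cases "c 0 = 0 \<and> (\<exists>N. \<forall>i>N. c i = 0)")
        case True
        then obtain N where "\<forall>i>N. c i = 0" by blast
        then have "real (card (tableaux h h' c)) = real k * real (card (tableaux s s' c))"
          using tableaux_card[OF h, of N c] tableaux_card[OF s, of N c] m True by simp
        then have "real (card (tableaux h h' c)) = real (k * card (tableaux s s' c))" by simp
        then show ?thesis unfolding Q of_nat_eq_iff .
      qed (simp add: none h s)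
    qed
  qed
qed

lemma height_complement:
  assumes "set lam' = {1..n} - set lam" "set lam \<subseteq> {1..n}"
  shows "height lam' = complement n (height lam)"
proof
  fix d
  have "{x \<in> set lam'. d < x} = {d<..n} - {x \<in> set lam. d < x}" using assms by auto
  moreover have "{x \<in> set lam. d < x} \<subseteq> {d<..n}" using assms by auto
  ultimately show "height lam' d = complement n (height lam) d"
    by (simp add: height_def complement_def card_Diff_subset)
qed

lemma set_stair: "set (stair r) = {1..r}" by (auto simp: stair_def)

lemma DP_stair: "is_DP (stair r)"
  by (auto simp: is_DP_def stair_def sorted_wrt_rev simp del: upt_Suc)

lemma DP_down: "1 \<le> a \<Longrightarrow> is_DP (down_from_to b a)"
  by (auto simp: is_DP_def down_from_to_def sorted_wrt_rev simp del: upt_Suc)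

lemma set_down: "set (down_from_to b a) = {a..b}" by (auto simp: down_from_to_def)

lemma height_stair: "height (stair r) = staircase r"
proof
  fix d
  have "{x \<in> set (stair r). d < x} = {d<..r}" by (auto simp: set_stair)
  then show "height (stair r) d = staircase r d" by (simp add: height_def staircase_def)
qed

section \<open>Levels of a skew shape and near-leading coefficients\<close>

lemma runs_insert:
  assumes "finite S" "d \<notin> S"
  shows "runs (insert d S) + of_bool (Suc d \<in> S) + of_bool (d \<noteq> 0 \<and> d - 1 \<in> S) = Suc (runs S)"
proof -
  define A where "A = {e \<in> S. Suc e \<notin> S}"
  have A: "finite A" "runs S = card A" "d \<notin> A" using assms by (auto simp: A_def runs_def)
  have e: "{e \<in> insert d S. Suc e \<notin> insert d S} =
    (if Suc d \<in> S then {} else {d}) \<union> (A - (if d \<noteq> 0 \<and> d - 1 \<in> S then {d - 1} else {}))"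
  proof (rule set_eqI)
    fix x show "x \<in> {e \<in> insert d S. Suc e \<notin> insert d S} \<longleftrightarrow>
      x \<in> (if Suc d \<in> S then {} else {d}) \<union> (A - (if d \<noteq> 0 \<and> d - 1 \<in> S then {d - 1} else {}))"
      using assms(2) by (cases d) (auto simp: A_def)
  qed
  have p: "d - 1 \<in> A" if "d \<noteq> 0 \<and> d - 1 \<in> S" using that assms(2) by (auto simp: A_def)
  have d: "card (A - {d - 1}) + 1 = card A" if "d \<noteq> 0 \<and> d - 1 \<in> S"
    using p[OF that] A(1) by (metis Suc_eq_plus1 card_Suc_Diff1)
  show ?thesis unfolding runs_def[of "insert d S"] e A(2) using d A
    by (auto simp: card_insert_if)
qed

lemma runs_delete:
  assumes "finite S" "d \<in> S"
  shows "runs (S - {d}) + 1 = runs S + of_bool (Suc d \<in> S) + of_bool (d \<noteq> 0 \<and> d - 1 \<in> S)"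
  using runs_insert[of "S - {d}" d] assms by (cases d) (auto simp: insert_absorb)

text \<open>\<open>raised t h h'\<close> is what remains to be started from after the leading content has been filled \<open>t\<close> times;
  \<open>hole t d h h'\<close> is the same shape lacking one box on diagonal \<open>d\<close>.\<close>

definition raised :: "nat \<Rightarrow> (nat \<Rightarrow> nat) \<Rightarrow> (nat \<Rightarrow> nat) \<Rightarrow> nat \<Rightarrow> nat" where
  "raised t h h' d = min (h d + t) (h' d)"

definition level :: "(nat \<Rightarrow> nat) \<Rightarrow> (nat \<Rightarrow> nat) \<Rightarrow> nat \<Rightarrow> nat set" where
  "level h h' t = {d. h d + t \<le> h' d}"

definition level_size :: "(nat \<Rightarrow> nat) \<Rightarrow> (nat \<Rightarrow> nat) \<Rightarrow> nat \<Rightarrow> nat" where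
  "level_size h h' t = card (level h h' t)"

definition hole :: "nat \<Rightarrow> nat \<Rightarrow> (nat \<Rightarrow> nat) \<Rightarrow> (nat \<Rightarrow> nat) \<Rightarrow> nat \<Rightarrow> nat" where
  "hole t d h h' x = (if x = d then raised t h h' x - 1 else raised t h h' x)"

text \<open>The diagonals that receive a box in step t while the hole moves from d to d': the old
  hole is filled and d' is left out instead.\<close>

definition moved_level :: "(nat \<Rightarrow> nat) \<Rightarrow> (nat \<Rightarrow> nat) \<Rightarrow> nat \<Rightarrow> nat \<Rightarrow> nat \<Rightarrow> nat set" where
  "moved_level h h' t d d' = (if d = d' then level h h' t else insert d (level h h' t) - {d'})"

section \<open>Greedy filling and the moves of a missing box\<close>

locale skew =
  fixes h h' :: "nat \<Rightarrow> nat"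
  assumes ah: "height_fn h" and ah': "height_fn h'" and hh: "h d \<le> h' d"
begin

lemma height_fn_raised: "height_fn (raised t h h')"
proof -
  obtain n where "h' n = 0" using ah' by (auto simp: height_fn_def)
  then have "raised t h h' n = 0" by (simp add: raised_def)
  moreover have "raised t h h' (Suc d) \<le> raised t h h' d \<and> raised t h h' d \<le> Suc (raised t h h' (Suc d))" for d
    using height_fnD[OF ah, of d] height_fnD[OF ah', of d] unfolding raised_def by linarith
  ultimately show ?thesis unfolding height_fn_def by blast
qed

lemma raised_below: "raised t h h' \<in> below h'" by (intro belowI height_fn_raised) (simp add: raised_def)

lemma raised_0: "raised 0 h h' = h" using hh by (auto simp: raised_def fun_eq_iff min_def)

lemma finite_level: "t > 0 \<Longrightarrow> finite (level h h' t)"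
proof -
  assume t: "t > 0"
  have "level h h' t \<subseteq> {..<width h'}"
  proof
    fix d assume "d \<in> level h h' t"
    then have "h' d \<noteq> 0" using t by (auto simp: level_def)
    then show "d \<in> {..<width h'}" using width_iff[OF ah', of d] by simp
  qed
  then show ?thesis by (rule finite_subset) simp
qed

lemma finite_Suc_level[simp]: "finite (level h h' (Suc t))" by (rule finite_level) simp

lemma raised_Suc: "raised (Suc t) h h' d = raised t h h' d + of_bool (d \<in> level h h' (Suc t))"
  using hh[of d] by (auto simp: raised_def level_def)

lemma raised_added: "added (raised t h h') (raised (Suc t) h h') = level h h' (Suc t)"
  by (auto simp: added_def raised_Suc)

lemma strip_raised_le: "strip r r' \<Longrightarrow> r' \<le> h' \<Longrightarrow> r d \<le> raised t h h' d \<Longrightarrow> r' d \<le> raised (Suc t) h h' d"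
  using stripD(2)[of r r' d] by (auto simp: raised_def le_fun_def)

lemma chain_sum_step_le:
  assumes "c > level_size h h' (Suc t)" shows "chain_sum (c # cs) (raised t h h') h' = 0"
proof -
  have "strip_weight c (raised t h h') r = 0" if "r \<in> below h'" for r
  proof (rule ccontr)
    assume "strip_weight c (raised t h h') r \<noteq> 0"
    then have r: "strip (raised t h h') r" "card (added (raised t h h') r) = c" by (auto simp: strip_weight_def split: if_splits)
    have "added (raised t h h') r \<subseteq> level h h' (Suc t)"
      using strip_raised_le[OF r(1), of _ t] that by (fastforce simp: added_def raised_Suc below_def of_bool_def split: if_splits)
    then have "c \<le> level_size h h' (Suc t)" using r(2) card_mono[of "level h h' (Suc t)"] by (auto simp: level_size_def)
    then show False using assms by simp
  qed
  then show ?thesis by (auto intro!: sum.neutral)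
qed

lemma chain_sum_single_term:
  assumes "r \<in> below h'" "\<And>r'. r' \<in> below h' \<Longrightarrow> strip_weight c k r' \<noteq> 0 \<Longrightarrow> r' = r"
  shows "chain_sum (c # cs) k h' = strip_weight c k r * chain_sum cs r h'"
proof -
  have "chain_sum (c # cs) k h' = (\<Sum>r'\<in>below h'. if r' = r then strip_weight c k r * chain_sum cs r h' else 0)"
    unfolding chain_sum.simps by (rule sum.cong[OF refl]) (use assms(2) in auto)
  then show ?thesis using assms(1) ah' by simp
qed

text \<open>A strip of the largest possible size must use every diagonal of the next level, so only
  one intermediate shape contributes.\<close>

lemma chain_sum_peel:
  "chain_sum (level_size h h' (Suc t) # cs) (raised t h h') h' = 2 ^ runs (level h h' (Suc t)) * chain_sum cs (raised (Suc t) h h') h'"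
proof -
  let ?c = "level_size h h' (Suc t)"
  have s: "strip (raised t h h') (raised (Suc t) h h')" by (auto simp: strip_def raised_Suc)
  have "r' = raised (Suc t) h h'" if r: "r' \<in> below h'" "strip_weight ?c (raised t h h') r' \<noteq> 0" for r'
  proof -
    have st: "strip (raised t h h') r'" "card (added (raised t h h') r') = ?c" using r by (auto simp: strip_weight_def split: if_splits)
    have le: "r' d \<le> raised (Suc t) h h' d" for d using strip_raised_le[OF st(1), of d t] r(1) by (simp add: below_def)
    have "added (raised t h h') r' \<subseteq> level h h' (Suc t)"
    proof
      fix d assume "d \<in> added (raised t h h') r'"
      then show "d \<in> level h h' (Suc t)" using le[of d] by (cases "d \<in> level h h' (Suc t)") (auto simp: added_def raised_Suc)
    qed
    then have e: "added (raised t h h') r' = level h h' (Suc t)" using st(2) by (intro card_subset_eq) (auto simp: level_size_def)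
    show "r' = raised (Suc t) h h'"
    proof
      fix d
      have "d \<in> added (raised t h h') r' \<longleftrightarrow> d \<in> level h h' (Suc t)" using e by simp
      then show "r' d = raised (Suc t) h h' d" using stripD[OF st(1), of d] by (auto simp: added_def raised_Suc)
    qed
  qed
  from chain_sum_single_term[OF raised_below this] show ?thesis using s by (simp add: strip_weight_def raised_added level_size_def)
qed

lemma raised_max: "\<exists>L. \<forall>l\<ge>L. raised l h h' = h'"
proof -
  have "h' d \<le> h' 0" for d by (rule height_fn_antimono[OF ah']) simp
  then have "raised l h h' = h'" if "l \<ge> h' 0" for l
    using that by (auto simp: raised_def fun_eq_iff intro!: min_absorb2) (meson le_trans trans_le_add2)
  then show ?thesis by blast
qed

definition top_word :: "nat \<Rightarrow> nat \<Rightarrow> nat list" where "top_word t L = map (level_size h h') [Suc t..<Suc L]"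

definition leading :: "nat \<Rightarrow> nat \<Rightarrow> real" where "leading t L = chain_sum (top_word t L) (raised t h h') h'"

lemma top_word_step: "t < L \<Longrightarrow> top_word t L = level_size h h' (Suc t) # top_word (Suc t) L"
  by (simp add: top_word_def upt_conv_Cons del: upt_Suc)

lemma leading_step: "t < L \<Longrightarrow> leading t L = 2 ^ runs (level h h' (Suc t)) * leading (Suc t) L"
  by (simp add: leading_def top_word_step chain_sum_peel del: chain_sum.simps)

lemma leading_pos: "raised L h h' = h' \<Longrightarrow> t \<le> L \<Longrightarrow> leading t L > 0"
proof (induction "L - t" arbitrary: t)
  case 0 then show ?case by (simp add: leading_def top_word_def)
next
  case (Suc n)
  then show ?case using leading_step[of t L] by simp
qed

lemma hole_height_fn:
  assumes "t > 0" "h d < h' d" "Suc (raised t h h' (Suc d)) = raised t h h' d" "d = 0 \<or> raised t h h' (d - 1) = raised t h h' d"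
  shows "height_fn (hole t d h h')"
proof -
  have "hole t d h h' (Suc x) \<le> hole t d h h' x \<and> hole t d h h' x \<le> Suc (hole t d h h' (Suc x))" for x
    using height_fnD[OF height_fn_raised, of t x] assms(3,4) unfolding hole_def by (cases "x = d"; cases "Suc x = d") auto
  moreover obtain n where "raised t h h' n = 0" using height_fn_raised[of t] by (auto simp: height_fn_def)
  then have "hole t d h h' n = 0" by (cases "n = d") (simp_all add: hole_def)
  ultimately show ?thesis unfolding height_fn_def by blast
qed

lemma hole_height_fnD:
  assumes "height_fn (hole t d h h')" "raised t h h' d > 0"
  shows "Suc (raised t h h' (Suc d)) = raised t h h' d" "d = 0 \<or> raised t h h' (d - 1) = raised t h h' d"
proof -
  show "Suc (raised t h h' (Suc d)) = raised t h h' d"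
    using height_fnD(1)[OF assms(1), of d] height_fnD(2)[OF height_fn_raised, of t d] assms(2) by (simp add: hole_def)
  show "d = 0 \<or> raised t h h' (d - 1) = raised t h h' d"
    using height_fnD(2)[OF assms(1), of "d - 1"] height_fnD(1)[OF height_fn_raised, of t "d - 1"] assms(2)
    by (cases d) (auto simp: hole_def)
qed

lemma hole_below: "height_fn (hole t d h h') \<Longrightarrow> hole t d h h' \<in> below h'"
  by (intro belowI) (auto simp: hole_def raised_def)

lemma hole_pos: "h d < h' d \<Longrightarrow> t > 0 \<Longrightarrow> raised t h h' d > 0" by (auto simp: raised_def)

lemma hole_inj: "raised t h h' d > 0 \<Longrightarrow> hole t d h h' = hole t e h h' \<Longrightarrow> d = e"
  by (rule ccontr) (auto simp: hole_def fun_eq_iff dest!: spec[of _ d])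

lemma strip_weight_hole:
  assumes "d \<in> level h h' 1" "t > 0" "d' = d \<or> (d \<notin> level h h' (Suc t) \<and> d' \<in> level h h' (Suc t))"
  shows "strip_weight (level_size h h' (Suc t)) (hole t d h h') (hole (Suc t) d' h h') = 2 ^ runs (moved_level h h' (Suc t) d d')"
proof -
  have p: "raised t h h' d > 0" using assms(1,2) by (intro hole_pos) (auto simp: level_def)
  have s: "strip (hole t d h h') (hole (Suc t) d' h h')"
    unfolding strip_def hole_def raised_Suc using assms(3) p by auto
  have e: "added (hole t d h h') (hole (Suc t) d' h h') = moved_level h h' (Suc t) d d'"
    unfolding added_def hole_def raised_Suc moved_level_def using assms(3) p by auto
  have "card (moved_level h h' (Suc t) d d') = level_size h h' (Suc t)"
    using assms(3) by (auto simp: moved_level_def level_size_def)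
  then show ?thesis using s e by (simp add: strip_weight_def)
qed

text \<open>Any family X of admissible moves gives a lower bound; exhibiting too many paths needs no
  more. The upper bound \<open>hole_step_le\<close> requires X to exhaust the moves.\<close>

lemma hole_step_ge:
  assumes "d \<in> level h h' 1" "t > 0" "finite X"
    and X: "\<And>d'. d' \<in> X \<Longrightarrow> height_fn (hole (Suc t) d' h h') \<and> (d' = d \<or> (d \<notin> level h h' (Suc t) \<and> d' \<in> level h h' (Suc t)))"
  shows "chain_sum (level_size h h' (Suc t) # cs) (hole t d h h') h' \<ge>
    (\<Sum>d'\<in>X. 2 ^ runs (moved_level h h' (Suc t) d d') * chain_sum cs (hole (Suc t) d' h h') h')"
proof -
  have "inj_on (\<lambda>d'. hole (Suc t) d' h h') X"
  proof (rule inj_onI)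
    fix x y assume "x \<in> X" "y \<in> X" "hole (Suc t) x h h' = hole (Suc t) y h h'"
    moreover have "raised (Suc t) h h' x > 0" using X[OF \<open>x \<in> X\<close>] assms(1) by (auto simp: level_def raised_def)
    ultimately show "x = y" using hole_inj by blast
  qed
  then have "(\<Sum>d'\<in>X. 2 ^ runs (moved_level h h' (Suc t) d d') * chain_sum cs (hole (Suc t) d' h h') h') =
    (\<Sum>r\<in>(\<lambda>d'. hole (Suc t) d' h h') ` X. strip_weight (level_size h h' (Suc t)) (hole t d h h') r * chain_sum cs r h')"
    using X strip_weight_hole[OF assms(1,2)] by (simp add: sum.reindex)
  also have "\<dots> \<le> chain_sum (level_size h h' (Suc t) # cs) (hole t d h h') h'"
    unfolding chain_sum.simps by (rule sum_mono2) (use X ah' hole_below in auto)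
  finally show ?thesis .
qed

lemma first_hole_ge:
  assumes "finite X" and X: "\<And>d. d \<in> X \<Longrightarrow> height_fn (hole 1 d h h') \<and> d \<in> level h h' 1"
  shows "chain_sum ((level_size h h' 1 - 1) # cs) h h' \<ge> (\<Sum>d\<in>X. 2 ^ runs (level h h' 1 - {d}) * chain_sum cs (hole 1 d h h') h')"
proof -
  have f1: "raised 1 h h' d = h d + of_bool (d \<in> level h h' 1)" for d using raised_Suc[of 0 d] raised_0 by simp
  have "inj_on (\<lambda>d'. hole 1 d' h h') X"
  proof (rule inj_onI)
    fix x y assume "x \<in> X" "y \<in> X" "hole 1 x h h' = hole 1 y h h'"
    moreover have "raised 1 h h' x > 0" using X[OF \<open>x \<in> X\<close>] f1 by auto
    ultimately show "x = y" using hole_inj by blast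
  qed
  moreover have "strip_weight (level_size h h' 1 - 1) h (hole 1 d h h') = 2 ^ runs (level h h' 1 - {d})" if "d \<in> X" for d
  proof -
    have s: "strip h (hole 1 d h h')" unfolding strip_def hole_def f1 using X[OF that] by auto
    have e: "added h (hole 1 d h h') = level h h' 1 - {d}" unfolding added_def hole_def f1 by auto
    show ?thesis using s e X[OF that] finite_level[of 1] by (simp add: strip_weight_def level_size_def)
  qed
  ultimately have "(\<Sum>d\<in>X. 2 ^ runs (level h h' 1 - {d}) * chain_sum cs (hole 1 d h h') h') =
    (\<Sum>r\<in>(\<lambda>d. hole 1 d h h') ` X. strip_weight (level_size h h' 1 - 1) h r * chain_sum cs r h')"
    by (simp add: sum.reindex)
  also have "\<dots> \<le> chain_sum ((level_size h h' 1 - 1) # cs) h h'"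
    unfolding chain_sum.simps by (rule sum_mono2) (use X ah' hole_below in auto)
  finally show ?thesis .
qed

text \<open>One box more than the level has diagonals is possible only if the hole is filled too; it
  is thereby closed in a unique way.\<close>

lemma last_hole:
  assumes "d \<in> level h h' 1" "t > 0" "d \<notin> level h h' (Suc t)"
  shows "chain_sum (Suc (level_size h h' (Suc t)) # cs) (hole t d h h') h' =
    2 ^ runs (insert d (level h h' (Suc t))) * chain_sum cs (raised (Suc t) h h') h'"
proof -
  have p: "raised t h h' d > 0" using assms(1,2) by (intro hole_pos) (auto simp: level_def)
  have s: "strip (hole t d h h') (raised (Suc t) h h')"
    unfolding strip_def hole_def raised_Suc using assms(3) by auto
  have e: "added (hole t d h h') (raised (Suc t) h h') = insert d (level h h' (Suc t))"
    unfolding added_def hole_def raised_Suc using p by auto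
  have "r = raised (Suc t) h h'" if r: "r \<in> below h'" "strip_weight (Suc (level_size h h' (Suc t))) (hole t d h h') r \<noteq> 0" for r
  proof -
    have st: "strip (hole t d h h') r" "card (added (hole t d h h') r) = Suc (level_size h h' (Suc t))"
      using r by (auto simp: strip_weight_def split: if_splits)
    have le: "r x \<le> raised (Suc t) h h' x" for x
      using strip_raised_le[OF st(1), of x t] r(1) by (simp add: below_def hole_def split: if_splits)
    have "added (hole t d h h') r \<subseteq> insert d (level h h' (Suc t))"
    proof
      fix x assume "x \<in> added (hole t d h h') r"
      then show "x \<in> insert d (level h h' (Suc t))" using le[of x]
        by (cases "x \<in> level h h' (Suc t)") (auto simp: added_def raised_Suc hole_def split: if_splits)
    qed
    then have e': "added (hole t d h h') r = insert d (level h h' (Suc t))"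
      using st(2) assms(3) by (intro card_subset_eq) (auto simp: level_size_def)
    show "r = raised (Suc t) h h'"
    proof
      fix x
      have "x \<in> added (hole t d h h') r \<longleftrightarrow> x = d \<or> x \<in> level h h' (Suc t)" using e' by simp
      then show "r x = raised (Suc t) h h' x" using stripD[OF st(1), of x] p assms(3)
        by (auto simp: added_def raised_Suc hole_def split: if_splits)
    qed
  qed
  from chain_sum_single_term[OF raised_below this] show ?thesis using s e assms(3) by (simp add: strip_weight_def level_size_def)
qed

text \<open>If the hole lies outside the next level, \<open>level_size + 1\<close> diagonals are
  available for \<open>level_size\<close> boxes; the one left out is the new hole.\<close>

lemma hole_step_le:
  assumes "d \<in> level h h' 1" "t > 0" "d \<notin> level h h' (Suc t)" "finite X"
    and X: "\<And>d'. d' = d \<or> d' \<in> level h h' (Suc t) \<Longrightarrow> height_fn (hole (Suc t) d' h h') \<Longrightarrow> d' \<in> X"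
    and X': "\<And>d'. d' \<in> X \<Longrightarrow> d' = d \<or> d' \<in> level h h' (Suc t)"
  shows "chain_sum (level_size h h' (Suc t) # cs) (hole t d h h') h' \<le>
    (\<Sum>d'\<in>X. 2 ^ runs (moved_level h h' (Suc t) d d') * chain_sum cs (hole (Suc t) d' h h') h')"
proof -
  have p: "raised t h h' d > 0" using assms(1,2) by (intro hole_pos) (auto simp: level_def)
  have inj: "inj_on (\<lambda>d'. hole (Suc t) d' h h') X"
  proof (rule inj_onI)
    fix x y assume "x \<in> X" "y \<in> X" "hole (Suc t) x h h' = hole (Suc t) y h h'"
    moreover have "raised (Suc t) h h' x > 0" using X'[OF \<open>x \<in> X\<close>] assms(1) by (auto simp: level_def raised_def)
    ultimately show "x = y" using hole_inj by blast
  qed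
  have out: "r \<in> (\<lambda>d'. hole (Suc t) d' h h') ` X"
    if r: "r \<in> below h'" "strip_weight (level_size h h' (Suc t)) (hole t d h h') r \<noteq> 0" for r
  proof -
    have st: "strip (hole t d h h') r" "card (added (hole t d h h') r) = level_size h h' (Suc t)"
      using r by (auto simp: strip_weight_def split: if_splits)
    have le: "r x \<le> raised (Suc t) h h' x" for x
      using strip_raised_le[OF st(1), of x t] r(1) by (simp add: below_def hole_def split: if_splits)
    have sub: "added (hole t d h h') r \<subseteq> insert d (level h h' (Suc t))"
    proof
      fix x assume "x \<in> added (hole t d h h') r"
      then show "x \<in> insert d (level h h' (Suc t))" using le[of x]
        by (cases "x \<in> level h h' (Suc t)") (auto simp: added_def raised_Suc hole_def split: if_splits)
    qed
    have "card (insert d (level h h' (Suc t)) - added (hole t d h h') r) = 1"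
      using sub st(2) assms(3) finite_subset[OF sub] by (simp add: card_Diff_subset level_size_def)
    then obtain d' where d': "insert d (level h h' (Suc t)) - added (hole t d h h') r = {d'}"
      by (auto simp: card_1_singleton_iff)
    have e: "r = hole (Suc t) d' h h'"
    proof
      fix x
      have "x \<in> added (hole t d h h') r \<longleftrightarrow> (x = d \<or> x \<in> level h h' (Suc t)) \<and> x \<noteq> d'" using d' sub by blast
      moreover have "d' = d \<or> d' \<in> level h h' (Suc t)" using d' by blast
      ultimately show "r x = hole (Suc t) d' h h' x" using stripD[OF st(1), of x] p assms(3)
        unfolding added_def mem_Collect_eq raised_Suc hole_def
        by (cases "x = d"; cases "x = d'"; cases "x \<in> level h h' (Suc t)") auto
    qed
    have "d' \<in> X" by (rule X) (use d' e belowD(1)[OF r(1)] in auto)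
    then show ?thesis using e by blast
  qed
  have "chain_sum (level_size h h' (Suc t) # cs) (hole t d h h') h' \<le>
     (\<Sum>r\<in>(\<lambda>d'. hole (Suc t) d' h h') ` X. strip_weight (level_size h h' (Suc t)) (hole t d h h') r * chain_sum cs r h')"
  proof -
    have "chain_sum (level_size h h' (Suc t) # cs) (hole t d h h') h' =
      (\<Sum>r\<in>below h' \<inter> (\<lambda>d'. hole (Suc t) d' h h') ` X. strip_weight (level_size h h' (Suc t)) (hole t d h h') r * chain_sum cs r h')"
      unfolding chain_sum.simps by (rule sum.mono_neutral_right) (use ah' out in auto)
    also have "\<dots> \<le> (\<Sum>r\<in>(\<lambda>d'. hole (Suc t) d' h h') ` X. strip_weight (level_size h h' (Suc t)) (hole t d h h') r * chain_sum cs r h')"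
      by (rule sum_mono2) (use assms(4) in auto)
    finally show ?thesis .
  qed
  also have "\<dots> = (\<Sum>d'\<in>X. 2 ^ runs (moved_level h h' (Suc t) d d') * chain_sum cs (hole (Suc t) d' h h') h')"
    using strip_weight_hole[OF assms(1,2)] X' assms(3) by (simp add: sum.reindex[OF inj])
  finally show ?thesis .
qed

lemma first_hole_le:
  assumes "finite X" "level h h' 1 \<noteq> {}" and X: "\<And>d. height_fn (hole 1 d h h') \<Longrightarrow> d \<in> level h h' 1 \<Longrightarrow> d \<in> X"
    and X': "X \<subseteq> level h h' 1"
  shows "chain_sum ((level_size h h' 1 - 1) # cs) h h' \<le> (\<Sum>d\<in>X. 2 ^ runs (level h h' 1 - {d}) * chain_sum cs (hole 1 d h h') h')"
proof -
  have f1: "raised 1 h h' d = h d + of_bool (d \<in> level h h' 1)" for d using raised_Suc[of 0 d] raised_0 by simp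
  have fin: "finite (level h h' 1)" by (rule finite_level) simp
  have inj: "inj_on (\<lambda>d'. hole 1 d' h h') X"
  proof (rule inj_onI)
    fix x y assume "x \<in> X" "y \<in> X" "hole 1 x h h' = hole 1 y h h'"
    moreover have "raised 1 h h' x > 0" using X' \<open>x \<in> X\<close> f1 by auto
    ultimately show "x = y" using hole_inj by blast
  qed
  have out: "r \<in> (\<lambda>d'. hole 1 d' h h') ` X" if r: "r \<in> below h'" "strip_weight (level_size h h' 1 - 1) h r \<noteq> 0" for r
  proof -
    have st: "strip h r" "card (added h r) = level_size h h' 1 - 1" using r by (auto simp: strip_weight_def split: if_splits)
    have sub: "added h r \<subseteq> level h h' 1"
      using belowD(2)[OF r(1)] by (auto simp: added_def level_def) (metis Suc_leI le_trans)
    have "level_size h h' 1 \<noteq> 0" using assms(2) fin by (simp add: level_size_def)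
    moreover have "card (level h h' 1 - added h r) = level_size h h' 1 - (level_size h h' 1 - 1)"
      using sub st(2) finite_subset[OF sub fin] by (simp add: card_Diff_subset level_size_def)
    ultimately have "card (level h h' 1 - added h r) = 1" by linarith
    then obtain d' where d': "level h h' 1 - added h r = {d'}" by (auto simp: card_1_singleton_iff)
    have e: "r = hole 1 d' h h'"
    proof
      fix x
      have "x \<in> added h r \<longleftrightarrow> x \<in> level h h' 1 \<and> x \<noteq> d'" using d' sub by blast
      moreover have "d' \<in> level h h' 1" using d' by blast
      ultimately show "r x = hole 1 d' h h' x" using stripD[OF st(1), of x]
        unfolding hole_def f1 added_def mem_Collect_eq by (cases "x = d'"; cases "x \<in> level h h' 1") auto
    qed
    have "d' \<in> X" by (rule X) (use d' e belowD(1)[OF r(1)] in auto)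
    then show ?thesis using e by blast
  qed
  have strip_weight: "strip_weight (level_size h h' 1 - 1) h (hole 1 d h h') = 2 ^ runs (level h h' 1 - {d})" if "d \<in> X" for d
  proof -
    have dl: "d \<in> level h h' 1" using X' that by blast
    have s: "strip h (hole 1 d h h')" unfolding strip_def hole_def f1 using dl by auto
    have e: "added h (hole 1 d h h') = level h h' 1 - {d}" unfolding added_def hole_def f1 by auto
    show ?thesis using s e dl fin by (simp add: strip_weight_def level_size_def)
  qed
  have "chain_sum ((level_size h h' 1 - 1) # cs) h h' =
      (\<Sum>r\<in>below h' \<inter> (\<lambda>d'. hole 1 d' h h') ` X. strip_weight (level_size h h' 1 - 1) h r * chain_sum cs r h')"
    unfolding chain_sum.simps by (rule sum.mono_neutral_right) (use ah' out in auto)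
  also have "\<dots> \<le> (\<Sum>r\<in>(\<lambda>d'. hole 1 d' h h') ` X. strip_weight (level_size h h' 1 - 1) h r * chain_sum cs r h')"
    by (rule sum_mono2) (use assms(1) in auto)
  also have "\<dots> = (\<Sum>d\<in>X. 2 ^ runs (level h h' 1 - {d}) * chain_sum cs (hole 1 d h h') h')"
    by (subst sum.reindex[OF inj]) (auto intro!: sum.cong simp: strip_weight[simplified])
  finally show ?thesis .
qed

lemma skew_raised: "skew (raised t h h') h'"
  by unfold_locales (auto simp: height_fn_raised ah' raised_def)

lemma level_raised: "s > 0 \<Longrightarrow> level (raised t h h') h' s = level h h' (t + s)"
  by (auto simp: level_def raised_def min_def split: if_splits)

lemma level_size_raised: "s > 0 \<Longrightarrow> level_size (raised t h h') h' s = level_size h h' (t + s)"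
  by (simp add: level_size_def level_raised)

end

section \<open>Shapes with proportional Q-functions\<close>

definition homog :: "real \<Rightarrow> (nat \<Rightarrow> nat) \<Rightarrow> (nat \<Rightarrow> nat) \<Rightarrow> (nat \<Rightarrow> nat) \<Rightarrow> (nat \<Rightarrow> nat) \<Rightarrow> bool" where
  "homog k h h' s s' \<longleftrightarrow> k > 0 \<and> (\<forall>cs. chain_sum cs h h' = k * chain_sum cs s s')"

text \<open>Each of the two leading contents has a nonzero coefficient on both sides, and no such
  content can begin with a letter larger than the first level.\<close>

lemma homog_level_size:
  assumes "skew h h'" "skew s s'" "homog k h h' s s'"
  shows "level_size h h' 1 = level_size s s' 1"
proof -
  interpret a: skew h h' by fact
  interpret b: skew s s' by fact
  obtain L1 where L1: "\<forall>l\<ge>L1. raised l h h' = h'" using a.raised_max by blast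
  obtain L2 where L2: "\<forall>l\<ge>L2. raised l s s' = s'" using b.raised_max by blast
  have "chain_sum (a.top_word 0 (Suc L1)) h h' > 0" using a.leading_pos[of "Suc L1" 0] L1 by (simp add: a.leading_def a.raised_0)
  then have "chain_sum (a.top_word 0 (Suc L1)) s s' \<noteq> 0" using assms(3) by (auto simp: homog_def)
  then have "chain_sum (level_size h h' (Suc 0) # a.top_word (Suc 0) (Suc L1)) s s' \<noteq> 0" by (simp add: a.top_word_step del: chain_sum.simps)
  then have "\<not> level_size h h' (Suc 0) > level_size s s' (Suc 0)" using b.chain_sum_step_le[of 0, unfolded b.raised_0] by metis
  moreover have "chain_sum (b.top_word 0 (Suc L2)) s s' > 0" using b.leading_pos[of "Suc L2" 0] L2 by (simp add: b.leading_def b.raised_0)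
  then have "chain_sum (b.top_word 0 (Suc L2)) h h' \<noteq> 0" using assms(3) by (auto simp: homog_def)
  then have "chain_sum (level_size s s' (Suc 0) # b.top_word (Suc 0) (Suc L2)) h h' \<noteq> 0" by (simp add: b.top_word_step del: chain_sum.simps)
  then have "\<not> level_size s s' (Suc 0) > level_size h h' (Suc 0)" using a.chain_sum_step_le[of 0, unfolded a.raised_0] by metis
  ultimately show ?thesis by simp
qed

text \<open>Splitting off the common leading letter only multiplies the two sides by powers of 2.
  They stay proportional with another factor, and the comparison can go on to the next
  level.\<close>

lemma homog_raised:
  assumes "skew h h'" "skew s s'" "homog k h h' s s'"
  shows "(\<exists>k. homog k (raised t h h') h' (raised t s s') s') \<and> level_size h h' (Suc t) = level_size s s' (Suc t)"
proof -
  interpret a: skew h h' by fact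
  interpret b: skew s s' by fact
  show ?thesis
  proof (induction t)
    case 0
    then show ?case using assms homog_level_size[OF assms] by (auto simp: a.raised_0 b.raised_0)
  next
    case (Suc t)
    then obtain k where k: "homog k (raised t h h') h' (raised t s s') s'" and n: "level_size h h' (Suc t) = level_size s s' (Suc t)" by blast
    define q where "q = k * 2 ^ runs (level s s' (Suc t)) / 2 ^ runs (level h h' (Suc t))"
    have "chain_sum cs (raised (Suc t) h h') h' = q * chain_sum cs (raised (Suc t) s s') s'" for cs
    proof -
      have "2 ^ runs (level h h' (Suc t)) * chain_sum cs (raised (Suc t) h h') h' = k * (2 ^ runs (level s s' (Suc t)) * chain_sum cs (raised (Suc t) s s') s')"
        unfolding a.chain_sum_peel[symmetric] b.chain_sum_peel[symmetric] using k n unfolding homog_def by metis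
      then show ?thesis by (simp add: q_def field_simps)
    qed
    moreover have "q > 0" using k by (simp add: q_def homog_def)
    ultimately have hq: "homog q (raised (Suc t) h h') h' (raised (Suc t) s s') s'" by (simp add: homog_def)
    from homog_level_size[OF a.skew_raised b.skew_raised hq] have "level_size h h' (Suc (Suc t)) = level_size s s' (Suc (Suc t))"
      by (simp add: a.level_size_raised b.level_size_raised)
    then show ?case using hq by blast
  qed
qed

lemma runs_two: "runs {..<m} \<le> 1" by simp

lemma runs_insert_le: "finite S \<Longrightarrow> runs (insert d S) \<le> Suc (runs S)"
  using runs_insert[of S d] by (cases "d \<in> S") (auto simp: insert_absorb)

lemma pow2_le: "a \<le> b \<Longrightarrow> (2::real) ^ a \<le> 2 ^ b" by (rule power_increasing) auto

context skew begin

text \<open>With the first entry \<open>n\<^sub>1 - 1\<close> put in front, \<open>near_word 1 j L\<close> is the content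
  \<open>(n\<^sub>1 - 1, n\<^sub>2, \<dots>, n\<^sub>j, n\<^sub>j\<^sub>+\<^sub>1 + 1, n\<^sub>j\<^sub>+\<^sub>2, \<dots>)\<close>: a hole is created in step 1, wanders, and is closed in step \<open>j + 1\<close>.\<close>

definition near_word :: "nat \<Rightarrow> nat \<Rightarrow> nat \<Rightarrow> nat list" where
  "near_word i j L = map (level_size h h') [Suc i..<Suc j] @ Suc (level_size h h' (Suc j)) # top_word (Suc j) L"

lemma near_word_step: "i < j \<Longrightarrow> near_word i j L = level_size h h' (Suc i) # near_word (Suc i) j L"
  by (simp add: near_word_def upt_conv_Cons del: upt_Suc)

lemma near_word_last: "near_word j j L = Suc (level_size h h' (Suc j)) # top_word (Suc j) L"
  by (simp add: near_word_def del: upt_Suc)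

definition hole_value :: "nat \<Rightarrow> nat \<Rightarrow> nat \<Rightarrow> nat \<Rightarrow> real" where
  "hole_value i d j L = chain_sum (near_word i j L) (hole i d h h') h' / leading i L"

text \<open>Dividing by the leading coefficient makes the value independent of the factor of
  proportionality.\<close>

definition near_value :: "nat \<Rightarrow> nat \<Rightarrow> real" where
  "near_value j L = chain_sum ((level_size h h' 1 - 1) # near_word 1 j L) h h' / leading 0 L"

context
  fixes L :: nat assumes L: "raised L h h' = h'"
begin

lemma lp: "t \<le> L \<Longrightarrow> leading t L > 0" by (rule leading_pos[OF L])

lemma hole_value_last:
  assumes "d \<in> level h h' 1" "j > 0" "d \<notin> level h h' (Suc j)" "j < L"
  shows "hole_value j d j L = 2 ^ runs (insert d (level h h' (Suc j))) / 2 ^ runs (level h h' (Suc j))"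
  unfolding hole_value_def near_word_last last_hole[OF assms(1-3)] leading_def[symmetric] leading_step[OF assms(4)]
  using lp[of "Suc j"] assms(4) by simp

lemma hole_value_ge:
  assumes "d \<in> level h h' 1" "i > 0" "finite X" "i < j" "j < L"
    and X: "\<And>d'. d' \<in> X \<Longrightarrow> height_fn (hole (Suc i) d' h h') \<and> (d' = d \<or> (d \<notin> level h h' (Suc i) \<and> d' \<in> level h h' (Suc i)))"
  shows "hole_value i d j L \<ge> (\<Sum>d'\<in>X. 2 ^ runs (moved_level h h' (Suc i) d d') / 2 ^ runs (level h h' (Suc i)) * hole_value (Suc i) d' j L)"
proof -
  have l: "leading i L = 2 ^ runs (level h h' (Suc i)) * leading (Suc i) L" "leading (Suc i) L > 0"
    using leading_step[of i L] lp[of "Suc i"] assms by auto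
  have "(\<Sum>d'\<in>X. 2 ^ runs (moved_level h h' (Suc i) d d') / 2 ^ runs (level h h' (Suc i)) * hole_value (Suc i) d' j L) =
    (\<Sum>d'\<in>X. 2 ^ runs (moved_level h h' (Suc i) d d') * chain_sum (near_word (Suc i) j L) (hole (Suc i) d' h h') h') / leading i L"
    unfolding l hole_value_def sum_divide_distrib by simp
  also have "\<dots> \<le> hole_value i d j L" unfolding hole_value_def near_word_step[OF assms(4)]
    by (rule divide_right_mono[OF hole_step_ge[OF assms(1-3) X]]) (use lp[of i] assms in auto)
  finally show ?thesis .
qed

lemma hole_value_le:
  assumes "d \<in> level h h' 1" "i > 0" "d \<notin> level h h' (Suc i)" "finite X" "i < j" "j < L"
    and X: "\<And>d'. d' = d \<or> d' \<in> level h h' (Suc i) \<Longrightarrow> height_fn (hole (Suc i) d' h h') \<Longrightarrow> d' \<in> X"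
    and X': "\<And>d'. d' \<in> X \<Longrightarrow> d' = d \<or> d' \<in> level h h' (Suc i)"
  shows "hole_value i d j L \<le> (\<Sum>d'\<in>X. 2 ^ runs (moved_level h h' (Suc i) d d') / 2 ^ runs (level h h' (Suc i)) * hole_value (Suc i) d' j L)"
proof -
  have l: "leading i L = 2 ^ runs (level h h' (Suc i)) * leading (Suc i) L" "leading (Suc i) L > 0"
    using leading_step[of i L] lp[of "Suc i"] assms by auto
  have "hole_value i d j L \<le> (\<Sum>d'\<in>X. 2 ^ runs (moved_level h h' (Suc i) d d') * chain_sum (near_word (Suc i) j L) (hole (Suc i) d' h h') h') / leading i L"
    unfolding hole_value_def near_word_step[OF assms(5)]
    by (rule divide_right_mono[OF hole_step_le[OF assms(1-4) X X']]) (use lp[of i] assms in auto)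
  also have "\<dots> = (\<Sum>d'\<in>X. 2 ^ runs (moved_level h h' (Suc i) d d') / 2 ^ runs (level h h' (Suc i)) * hole_value (Suc i) d' j L)"
    unfolding l hole_value_def sum_divide_distrib by simp
  finally show ?thesis .
qed

lemma hole_value_nonneg: "i \<le> L \<Longrightarrow> hole_value i d j L \<ge> 0"
  unfolding hole_value_def using lp[of i] by (intro divide_nonneg_pos) auto

lemma near_value_ge:
  assumes "finite X" "1 \<le> L" and X: "\<And>d. d \<in> X \<Longrightarrow> height_fn (hole 1 d h h') \<and> d \<in> level h h' 1"
  shows "near_value j L \<ge> (\<Sum>d\<in>X. 2 ^ runs (level h h' 1 - {d}) / 2 ^ runs (level h h' 1) * hole_value 1 d j L)"
proof -
  have l: "leading 0 L = 2 ^ runs (level h h' 1) * leading 1 L" "leading 1 L > 0"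
    using leading_step[of 0 L] lp[of 1] assms by auto
  have "(\<Sum>d\<in>X. 2 ^ runs (level h h' 1 - {d}) / 2 ^ runs (level h h' 1) * hole_value 1 d j L) =
    (\<Sum>d\<in>X. 2 ^ runs (level h h' 1 - {d}) * chain_sum (near_word 1 j L) (hole 1 d h h') h') / leading 0 L"
    unfolding l hole_value_def sum_divide_distrib by simp
  also have "\<dots> \<le> near_value j L" unfolding near_value_def
    by (rule divide_right_mono[OF first_hole_ge[OF assms(1) X]]) (use lp[of 0] in auto)
  finally show ?thesis .
qed

lemma near_value_le:
  assumes "finite X" "1 \<le> L" "level h h' 1 \<noteq> {}" and X: "\<And>d. height_fn (hole 1 d h h') \<Longrightarrow> d \<in> level h h' 1 \<Longrightarrow> d \<in> X"
    and X': "X \<subseteq> level h h' 1"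
  shows "near_value j L \<le> (\<Sum>d\<in>X. 2 ^ runs (level h h' 1 - {d}) / 2 ^ runs (level h h' 1) * hole_value 1 d j L)"
proof -
  have l: "leading 0 L = 2 ^ runs (level h h' 1) * leading 1 L" "leading 1 L > 0"
    using leading_step[of 0 L] lp[of 1] assms by auto
  have "near_value j L \<le> (\<Sum>d\<in>X. 2 ^ runs (level h h' 1 - {d}) * chain_sum (near_word 1 j L) (hole 1 d h h') h') / leading 0 L"
    unfolding near_value_def by (rule divide_right_mono[OF first_hole_le[OF assms(1,3) X X']]) (use lp[of 0] in auto)
  also have "\<dots> = (\<Sum>d\<in>X. 2 ^ runs (level h h' 1 - {d}) / 2 ^ runs (level h h' 1) * hole_value 1 d j L)"
    unfolding l hole_value_def sum_divide_distrib by simp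
  finally show ?thesis .
qed

end

end

section \<open>The upper bound for straight shapes\<close>

text \<open>This is what remains of a straight shape after t greedy steps: the t largest parts are
  filled, the others are still to come, and \<open>level_size i\<close> is the i-th of
  these.\<close>

locale rows = skew +
  fixes t :: nat
  assumes rowsh: "h d = min t (h' d)"
begin

lemma rows_raised: "raised i h h' d = min (t + i) (h' d)" using rowsh[of d] by (simp add: raised_def)

lemma rows_level: assumes "i > 0" shows "level h h' i = {..<level_size h h' i}" "d < level_size h h' i \<longleftrightarrow> t + i \<le> h' d"
proof -
  define m where "m = (LEAST d. h' d < t + i)"
  obtain z where "h' z = 0" using ah' by (auto simp: height_fn_def)
  then have ex: "h' z < t + i" using assms by simp
  have m: "h' m < t + i" unfolding m_def by (rule LeastI[of _ z]) (rule ex)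
  have iff: "t + i \<le> h' d \<longleftrightarrow> d < m" for d
  proof
    assume "t + i \<le> h' d"
    then show "d < m" using m height_fn_antimono[OF ah', of m d] by (cases "m \<le> d") auto
  next
    assume "d < m"
    then show "t + i \<le> h' d" using not_less_Least[of d "\<lambda>d. h' d < t + i"] by (simp add: m_def)
  qed
  have "level h h' i = {d. t + i \<le> h' d}" using assms rowsh by (auto simp: level_def min_def)
  then have e: "level h h' i = {..<m}" using iff by auto
  then have "level_size h h' i = m" by (simp add: level_size_def)
  then show "level h h' i = {..<level_size h h' i}" "d < level_size h h' i \<longleftrightarrow> t + i \<le> h' d" using e iff by auto
qed

lemma rows_decr: assumes "i > 0" "level_size h h' i > 0" shows "level_size h h' (Suc i) < level_size h h' i"
proof -
  let ?d = "level_size h h' i - 1"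
  have "\<not> t + i \<le> h' (level_size h h' i)" using rows_level(2)[OF assms(1), of "level_size h h' i"] by simp
  moreover have "h' ?d \<le> Suc (h' (level_size h h' i))" using height_fnD(2)[OF ah', of ?d] assms(2) by simp
  ultimately have "\<not> t + Suc i \<le> h' ?d" by linarith
  then show ?thesis using rows_level(2)[of "Suc i" ?d] assms(2) by simp
qed

lemma rows_corner:
  assumes "i > 0" "d \<in> level h h' 1" "height_fn (hole i d h h')"
  shows "\<exists>a. 1 \<le> a \<and> a \<le> i \<and> d = level_size h h' a - 1 \<and> level_size h h' a > 0 \<and> (a = i \<or> d = 0 \<or> level_size h h' (Suc a) < d)"
proof -
  have "raised i h h' d > 0" using assms(1,2) by (auto simp: raised_def level_def)
  note c = hole_height_fnD[OF assms(3) this, unfolded rows_raised]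
  have d1: "t + 1 \<le> h' d" using assms(2) rows_level[of 1] by auto
  have s: "h' d = Suc (h' (Suc d))" "h' d \<le> t + i" using c(1) height_fnD[OF ah', of d] by (auto simp: min_def split: if_splits)
  define a where "a = h' d - t"
  have a: "1 \<le> a" "a \<le> i" "h' d = t + a" using d1 s by (auto simp: a_def)
  have "d < level_size h h' a" "\<not> Suc d < level_size h h' a" using rows_level(2)[of a d] rows_level(2)[of a "Suc d"] a s by auto
  then have n: "level_size h h' a = Suc d" by simp
  have "a = i \<or> d = 0 \<or> level_size h h' (Suc a) < d"
  proof (rule ccontr)
    assume "\<not> ?thesis"
    then have q: "a < i" "d > 0" "\<not> level_size h h' (Suc a) < d" using a by auto
    then have "h' (d - 1) = h' d" using c(2) a by (auto simp: min_def split: if_splits)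
    then have "\<not> d - 1 < level_size h h' (Suc a)" using rows_level(2)[of "Suc a" "d - 1"] a by simp
    then have "level_size h h' (Suc a) < d" using q(2) by linarith
    then show False using q by simp
  qed
  then show ?thesis using a(1,2) n by (intro exI[of _ a]) simp
qed

text \<open>Rows 2, ..., j - 1 each end directly above a box of the next row, so in step i the hole
  sits at the end of row 1 or of row i.\<close>

lemma rows_bound:
  assumes L: "raised L h h' = h'" and j: "1 \<le> j" "j < L" and n: "level_size h h' j > 0"
    and e: "\<And>a. 1 < a \<Longrightarrow> a < j \<Longrightarrow> level_size h h' a = Suc (level_size h h' (Suc a))"
  shows "near_value j L \<le> 2 ^ (j + 1) - 2"
proof -
  let ?n = "level_size h h'"
  have anti: "?n b \<le> ?n a" if "1 \<le> a" "a \<le> b" for a b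
    using that(2,1)
  proof (induction b rule: dec_induct)
    case (step b)
    have "?n (Suc b) \<le> ?n b" unfolding level_size_def
    proof (rule card_mono)
      show "finite (level h h' b)" using step by (intro finite_level) simp
    qed (auto simp: level_def)
    then show ?case using step by simp
  qed simp
  have npos: "?n a > 0" if "1 \<le> a" "a \<le> j" for a using anti[OF that] n by simp
  have strict: "?n b < ?n a" if "1 \<le> a" "a < b" "a \<le> j" for a b
    using anti[of "Suc a" b] rows_decr[of a] npos[of a] that by auto
  \<comment> \<open>\<open>f i\<close> bounds the continuations of a hole waiting at the end of row
    1, \<open>g i\<close> those of a hole at the end of row i > 1, which must move to row i + 1.
    Hence \<open>f i = f (i + 1) + 2 * g (i + 1)\<close> and \<open>g i = 2 * g (i + 1)\<close>, and
    both are 2 for i = j.\<close>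
  define f where "f i = 2 ^ (j - i + 2) - (2::real)" for i
  define g where "g i = (2::real) ^ (j - i + 1)" for i
  have d1: "?n a - 1 \<in> level h h' 1" if "1 \<le> a" "a \<le> j" for a
    using anti[of 1 a] npos[OF that] that rows_level(1)[of 1] by auto
  have dn: "?n a - 1 \<notin> level h h' (Suc b)" if "1 \<le> a" "a \<le> b" "a \<le> j" for a b
    using strict[of a "Suc b"] that rows_level(1)[of "Suc b"] by auto
  have corner: "d = ?n 1 - 1 \<or> d = ?n i - 1" if c: "height_fn (hole i d h h')" "d \<in> level h h' 1" "1 \<le> i" "i \<le> j" for i d
  proof -
    obtain a where a: "1 \<le> a" "a \<le> i" "d = ?n a - 1" "?n a > 0" "a = i \<or> d = 0 \<or> ?n (Suc a) < d"
      using rows_corner[of i d] c by auto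
    show ?thesis
    proof (cases "a = i \<or> a = 1")
      case False
      then have "1 < a" "a < j" using a c by auto
      moreover from this have "?n (Suc a) > 0" using npos[of "Suc a"] by simp
      ultimately show ?thesis using e[of a] a False by simp
    qed (use a in auto)
  qed
  have rs: "runs (level h h' (Suc i)) = 1" if "Suc i \<le> j" for i using npos[of "Suc i"] that by (simp add: rows_level(1))
  have rd: "runs (moved_level h h' (Suc i) d (?n (Suc i) - 1)) \<le> 2" if "Suc i \<le> j" "d \<notin> level h h' (Suc i)" for i d
  proof -
    have p: "?n (Suc i) > 0" using npos[of "Suc i"] that(1) by simp
    then have "d \<noteq> ?n (Suc i) - 1" using that(2) rows_level(1)[of "Suc i"] by auto
    then have "moved_level h h' (Suc i) d (?n (Suc i) - 1) = insert d ({..<?n (Suc i)} - {?n (Suc i) - 1})"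
      by (auto simp: moved_level_def rows_level(1))
    also have "{..<?n (Suc i)} - {?n (Suc i) - 1} = {..<?n (Suc i) - 1}" using p by auto
    finally show ?thesis using runs_insert_le[of "{..<?n (Suc i) - 1}" d] runs_two[of "?n (Suc i) - 1"] by simp
  qed
  have last: "hole_value j d j L \<le> 2" if "d \<in> level h h' 1" "d \<notin> level h h' (Suc j)" for d
  proof -
    have "(2::real) ^ runs (insert d (level h h' (Suc j))) \<le> 2 ^ Suc (runs (level h h' (Suc j)))"
      by (rule pow2_le) (rule runs_insert_le, simp)
    then have "(2::real) ^ runs (insert d (level h h' (Suc j))) / 2 ^ runs (level h h' (Suc j)) \<le> 2"
      by (simp add: pos_divide_le_eq)
    then show ?thesis using hole_value_last[OF L that(1) _ that(2)] j by simp
  qed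
  have main: "i \<le> j \<Longrightarrow> 1 \<le> i \<Longrightarrow> hole_value i (?n 1 - 1) j L \<le> f i \<and> (1 < i \<longrightarrow> hole_value i (?n i - 1) j L \<le> g i)" for i
  proof (induction i rule: inc_induct)
    case base
    show ?case using last[OF d1[of 1] dn[of 1 j]] last[OF d1[of j] dn[of j j]] j by (auto simp: f_def g_def)
  next
    case (step i)
    have i: "1 \<le> i" "i < j" using step by auto
    let ?R = "2 ^ runs (level h h' (Suc i)) :: real"
    have R: "?R = 2" using rs[of i] i by simp
    have ih: "hole_value (Suc i) (?n 1 - 1) j L \<le> f (Suc i)" "hole_value (Suc i) (?n (Suc i) - 1) j L \<le> g (Suc i)" using step i by auto
    have j2: "j - i = Suc (j - Suc i)" using i by simp
    have sd: "2 ^ runs (moved_level h h' (Suc i) d (?n (Suc i) - 1)) / ?R * hole_value (Suc i) (?n (Suc i) - 1) j L \<le> 2 * g (Suc i)"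
      if "d \<notin> level h h' (Suc i)" for d
    proof -
      have "(2::real) ^ runs (moved_level h h' (Suc i) d (?n (Suc i) - 1)) \<le> 2 ^ 2" using pow2_le[OF rd[OF _ that]] i by simp
      then have "(2::real) ^ runs (moved_level h h' (Suc i) d (?n (Suc i) - 1)) / ?R \<le> 2" using R by simp
      moreover have "0 \<le> hole_value (Suc i) (?n (Suc i) - 1) j L" using hole_value_nonneg[OF L] i j by simp
      ultimately show ?thesis using ih(2) by (intro mult_mono) auto
    qed
    have in1: "?n (Suc i) - 1 \<in> level h h' (Suc i)" using npos[of "Suc i"] i rows_level(1)[of "Suc i"] by auto
    have ne: "?n 1 - 1 \<noteq> ?n (Suc i) - 1" using dn[of 1 i] in1 i by auto
    have lsub: "level h h' (Suc i) \<subseteq> level h h' 1" by (auto simp: level_def)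
    have A: "hole_value i (?n 1 - 1) j L \<le> f i"
    proof -
      have "hole_value i (?n 1 - 1) j L \<le> (\<Sum>d'\<in>{?n 1 - 1, ?n (Suc i) - 1}. 2 ^ runs (moved_level h h' (Suc i) (?n 1 - 1) d') / ?R * hole_value (Suc i) d' j L)"
        by (rule hole_value_le[OF L d1[of 1] _ dn[of 1 i]]) (use i j in1 d1[of 1] lsub corner[of "Suc i"] in auto)
      also have "\<dots> = hole_value (Suc i) (?n 1 - 1) j L + 2 ^ runs (moved_level h h' (Suc i) (?n 1 - 1) (?n (Suc i) - 1)) / ?R * hole_value (Suc i) (?n (Suc i) - 1) j L"
        using ne by (simp add: moved_level_def)
      also have "\<dots> \<le> f (Suc i) + 2 * g (Suc i)" using ih(1) sd[OF dn[of 1 i]] i j by simp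
      also have "\<dots> = f i" unfolding f_def g_def j2 by simp
      finally show ?thesis .
    qed
    have B: "hole_value i (?n i - 1) j L \<le> g i" if "1 < i"
    proof -
      have no: "\<not> height_fn (hole (Suc i) (?n i - 1) h h')"
      proof
        assume "height_fn (hole (Suc i) (?n i - 1) h h')"
        from corner[OF this d1] have "?n i - 1 = ?n 1 - 1 \<or> ?n i - 1 = ?n (Suc i) - 1" using i by simp
        then show False using strict[of 1 i] strict[of i "Suc i"] npos[of 1] npos[of i] npos[of "Suc i"] that i j by auto
      qed
      have "d' = ?n (Suc i) - 1" if d': "d' \<in> level h h' (Suc i)" "height_fn (hole (Suc i) d' h h')" for d'
        using corner[OF d'(2)] d' lsub i dn[of 1 i] j by auto
      then have "hole_value i (?n i - 1) j L \<le> (\<Sum>d'\<in>{?n (Suc i) - 1}. 2 ^ runs (moved_level h h' (Suc i) (?n i - 1) d') / ?R * hole_value (Suc i) d' j L)"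
        by (intro hole_value_le[OF L d1[of i] _ dn[of i i]]) (use i j in1 no in auto)
      also have "\<dots> \<le> 2 * g (Suc i)" using sd[OF dn[of i i]] i by simp
      also have "\<dots> = g i" unfolding g_def j2 by simp
      finally show ?thesis .
    qed
    show ?case using A B by blast
  qed
  have "near_value j L \<le> (\<Sum>d\<in>{?n 1 - 1}. 2 ^ runs (level h h' 1 - {d}) / 2 ^ runs (level h h' 1) * hole_value 1 d j L)"
    by (rule near_value_le[OF L]) (use j d1[of 1] corner[of 1] in auto)
  also have "\<dots> \<le> hole_value 1 (?n 1 - 1) j L"
  proof -
    have "{..<m} - {m - 1} = {..<m - 1}" for m :: nat by auto
    then have "level h h' 1 - {?n 1 - 1} = {..<?n 1 - 1}" by (simp only: rows_level(1)[OF zero_less_one])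
    then have "(2::real) ^ runs (level h h' 1 - {?n 1 - 1}) \<le> 2 ^ runs (level h h' 1)"
      using rs[of 0] j by (intro pow2_le) simp
    then have q: "(2::real) ^ runs (level h h' 1 - {?n 1 - 1}) / 2 ^ runs (level h h' 1) \<le> 1" by (simp add: pos_divide_le_eq)
    have "0 \<le> hole_value 1 (?n 1 - 1) j L" using hole_value_nonneg[OF L, of 1 "?n 1 - 1" j] j by simp
    from mult_right_mono[OF q this] show ?thesis by simp
  qed
  also have "\<dots> \<le> f 1" using main[of 1] j by simp
  also have "f 1 = 2 ^ (j + 1) - 2"
  proof -
    have "j - 1 + 2 = j + 1" using j by simp
    then show ?thesis unfolding f_def by (simp only:)
  qed
  finally show ?thesis .
qed

end

section \<open>Local patterns with too many hole paths\<close>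

context skew begin

context
  fixes L :: nat assumes L: "raised L h h' = h'"
begin

text \<open>Deleting d from level 1 gains a factor 2 for each neighbour in level 1, and adding d to
  level 2 loses one for each neighbour in level 2. What survives are the neighbours lying in level 1
  but not in level 2.\<close>

lemma near_corner_sum:
  assumes X: "finite X" "\<And>d. d \<in> X \<Longrightarrow> d \<in> level h h' 1 \<and> d \<notin> level h h' 2 \<and> height_fn (hole 1 d h h')" and L1: "1 < L"
  shows "near_value 1 L \<ge> (\<Sum>d\<in>X. 2 ^ (of_bool (Suc d \<in> level h h' 1 - level h h' 2) + of_bool (d \<noteq> 0 \<and> d - 1 \<in> level h h' 1 - level h h' 2)))"
proof -
  have fin: "finite (level h h' 1)" "finite (level h h' 2)" by (auto intro: finite_level)
  have sub: "level h h' 2 \<subseteq> level h h' 1" by (auto simp: level_def)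
  have "(\<Sum>d\<in>X. 2 ^ (of_bool (Suc d \<in> level h h' 1 - level h h' 2) + of_bool (d \<noteq> 0 \<and> d - 1 \<in> level h h' 1 - level h h' 2)))
     = (\<Sum>d\<in>X. 2 ^ runs (level h h' 1 - {d}) / 2 ^ runs (level h h' 1) * hole_value 1 d 1 L)"
  proof (rule sum.cong[OF refl])
    fix d assume d: "d \<in> X"
    let ?e = "of_bool (Suc d \<in> level h h' 1 - level h h' 2) + of_bool (d \<noteq> 0 \<and> d - 1 \<in> level h h' 1 - level h h' 2) :: nat"
    have "hole_value 1 d 1 L = 2 ^ runs (insert d (level h h' 2)) / 2 ^ runs (level h h' 2)"
      using hole_value_last[OF L, of d 1] X(2)[OF d] L1 by (simp add: numeral_2_eq_2)
    moreover have "runs (level h h' 1 - {d}) + runs (insert d (level h h' 2)) = runs (level h h' 1) + runs (level h h' 2) + ?e"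
      using runs_insert[OF fin(2), of d] runs_delete[OF fin(1), of d] X(2)[OF d] sub
      by (auto simp: of_bool_def split: if_splits)
    then have "(2::real) ^ runs (level h h' 1 - {d}) * 2 ^ runs (insert d (level h h' 2)) =
       2 ^ runs (level h h' 1) * 2 ^ runs (level h h' 2) * 2 ^ ?e" by (simp add: power_add[symmetric])
    moreover have "a * b = p * q * e \<Longrightarrow> p \<noteq> 0 \<Longrightarrow> q \<noteq> 0 \<Longrightarrow> e = a / p * (b / q)" for a b p q e :: real
      by (simp add: field_simps)
    ultimately show "2 ^ ?e = 2 ^ runs (level h h' 1 - {d}) / 2 ^ runs (level h h' 1) * hole_value 1 d 1 L"
      by (metis power_not_zero zero_neq_numeral)
  qed
  also have "\<dots> \<le> near_value 1 L" by (rule near_value_ge[OF L X(1)]) (use X(2) L1 in auto)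
  finally show ?thesis .
qed

end

end

text \<open>A descending staircase of L-steps from diagonal \<open>z\<close> down to \<open>z + j\<close>: the hole can climb it one level at a time.\<close>

locale stairs = skew +
  fixes z j L H :: nat
  assumes L: "raised L h h' = h'" and jL: "j < L" and j2: "j \<ge> 2" and z0: "z \<ge> 1"
    and conf: "\<And>s. 1 \<le> s \<Longrightarrow> s \<le> j \<Longrightarrow> h (z + j - s) = H \<and> h' (z + j - s) = H + s"
    and above: "h (z - 1) = H" "H + j \<le> h' (z - 1)"
    and beneath: "raised 1 h h' (z + j) = H" "z + j \<notin> level h h' 2"
begin

text \<open>The diagonal of the descent with gap i; the climbing hole is there in step i.\<close>

definition "st i = z + j - i"

lemma st_level: "1 \<le> i \<Longrightarrow> i \<le> j \<Longrightarrow> st i \<in> level h h' t \<longleftrightarrow> t \<le> i"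
  using conf[of i] by (simp add: level_def st_def)

lemma st_raised: "1 \<le> i \<Longrightarrow> i \<le> j \<Longrightarrow> raised t h h' (st i) = min (H + t) (H + i)"
  using conf[of i] by (simp add: raised_def st_def)

lemma st_pred: "1 \<le> i \<Longrightarrow> i < j \<Longrightarrow> st i - 1 = st (Suc i)" "st j - 1 = z - 1" "st j = z"
  by (auto simp: st_def)

lemma st_pos: "i \<le> j \<Longrightarrow> st i \<noteq> 0" using z0 by (auto simp: st_def)

lemma st_succ: "2 \<le> i \<Longrightarrow> i \<le> j \<Longrightarrow> Suc (st i) = st (i - 1)" "Suc (st 1) = z + j"
  using j2 z0 by (auto simp: st_def)

lemma st_pred_level: "1 \<le> i \<Longrightarrow> i \<le> j \<Longrightarrow> st i - 1 \<in> level h h' i"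
proof (cases "i = j")
  case True
  then show ?thesis using above by (simp add: st_pred level_def)
next
  case False
  assume "1 \<le> i" "i \<le> j"
  then show ?thesis using False st_level[of "Suc i" i] st_pred(1)[of i] by simp
qed

lemma st_succ_level: "1 \<le> i \<Longrightarrow> i \<le> j \<Longrightarrow> Suc (st i) \<notin> level h h' (Suc i)"
proof (cases "i = 1")
  case True
  then show ?thesis using beneath(2) st_succ(2) by (simp add: numeral_2_eq_2)
next
  case False
  assume "1 \<le> i" "i \<le> j"
  then show ?thesis using False st_level[of "i - 1" "Suc i"] st_succ(1)[of i] by auto
qed

lemma st_hole: "1 \<le> i \<Longrightarrow> i \<le> j \<Longrightarrow> height_fn (hole i (st i) h h')"
proof (rule hole_height_fn)
  assume i: "1 \<le> i" "i \<le> j"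
  show "h (st i) < h' (st i)" using conf[of i] i by (simp add: st_def)
  show "Suc (raised i h h' (Suc (st i))) = raised i h h' (st i)"
  proof (cases "i = 1")
    case True then show ?thesis using beneath(1) st_succ(2) st_raised[of 1 1] i by simp
  next
    case False then show ?thesis using st_succ(1)[of i] st_raised[of "i - 1" i] st_raised[of i i] i by simp
  qed
  have "raised i h h' (st i - 1) = H + i"
  proof (cases "i = j")
    case True then show ?thesis using above by (simp add: st_pred raised_def)
  next
    case False then show ?thesis using st_pred(1)[of i] st_raised[of "Suc i" i] i by simp
  qed
  then show "st i = 0 \<or> raised i h h' (st i - 1) = raised i h h' (st i)" using st_raised[of i i] i by simp
qed simp

lemma st_in1: "1 \<le> i \<Longrightarrow> i \<le> j \<Longrightarrow> st i \<in> level h h' 1" using st_level[of i 1] by simp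

text \<open>Filling \<open>st i\<close> only prolongs the run ending at \<open>st (Suc i)\<close>;
  opening \<open>st (Suc i)\<close> then cuts it off as a run of its own.\<close>

lemma st_runs:
  assumes "1 \<le> i" "i < j"
  shows "runs (moved_level h h' (Suc i) (st i) (st (Suc i))) = Suc (runs (level h h' (Suc i)))"
proof -
  let ?S = "level h h' (Suc i)"
  have n: "st i \<notin> ?S" "st (Suc i) \<in> ?S" "Suc (st i) \<notin> ?S" using st_level[of i "Suc i"] st_level[of "Suc i" "Suc i"] st_succ_level[of i] assms by auto
  have a: "runs (insert (st i) ?S) = runs ?S"
    using runs_insert[of ?S "st i"] n st_pred(1)[of i] st_pos[of i] assms by simp
  have s: "Suc (st (Suc i)) = st i" using st_succ(1)[of "Suc i"] assms by simp
  have "runs (insert (st i) ?S - {st (Suc i)}) + 1 = runs (insert (st i) ?S) + 2"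
    using runs_delete[of "insert (st i) ?S" "st (Suc i)"] n s st_pos[of "Suc i"] st_pred_level[of "Suc i"] assms by simp
  moreover have "st i \<noteq> st (Suc i)" using s by auto
  ultimately show ?thesis using a by (simp add: moved_level_def)
qed

text \<open>The factor for closing the hole on z: the box either joins the run ending at z - 1 or is
  a new run.\<close>

definition "fz = (if z - 1 \<in> level h h' (Suc j) then 1 else 2 :: real)"

lemma hole_value_z: "hole_value j z j L = fz"
proof -
  have z: "z \<notin> level h h' (Suc j)" "z \<in> level h h' 1" "Suc z \<notin> level h h' (Suc j)"
    using st_level[of j "Suc j"] st_in1[of j] st_succ_level[of j] j2 by (auto simp: st_pred)
  have "runs (insert z (level h h' (Suc j))) + of_bool (z - 1 \<in> level h h' (Suc j)) = Suc (runs (level h h' (Suc j)))"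
    using runs_insert[of "level h h' (Suc j)" z] z z0 by simp
  then have "(2::real) ^ runs (insert z (level h h' (Suc j))) = fz * 2 ^ runs (level h h' (Suc j))"
    by (auto simp: fz_def)
  then show ?thesis using hole_value_last[OF L z(2) _ z(1) jL] j2 by simp
qed

lemma stair_ratio: "1 \<le> i \<Longrightarrow> i < j \<Longrightarrow>
   (2::real) ^ runs (moved_level h h' (Suc i) (st i) (st (Suc i))) / 2 ^ runs (level h h' (Suc i)) = 2"
  by (simp add: st_runs)

lemma stair_path: "i \<le> j \<Longrightarrow> 1 \<le> i \<Longrightarrow> hole_value i (st i) j L \<ge> fz * 2 ^ (j - i)"
proof (induction i rule: inc_induct)
  case base then show ?case using hole_value_z by (simp add: st_pred)
next
  case (step i)
  have "hole_value i (st i) j L \<ge> (\<Sum>d'\<in>{st (Suc i)}. 2 ^ runs (moved_level h h' (Suc i) (st i) d') / 2 ^ runs (level h h' (Suc i)) * hole_value (Suc i) d' j L)"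
    by (rule hole_value_ge[OF L st_in1]) (use step jL st_hole[of "Suc i"] st_level[of i "Suc i"] st_level[of "Suc i" "Suc i"] in auto)
  then have "hole_value i (st i) j L \<ge> 2 * hole_value (Suc i) (st (Suc i)) j L" using stair_ratio[of i] step by simp
  moreover have "j - i = Suc (j - Suc i)" using step by simp
  ultimately show ?case using step by simp
qed

lemma lev1_delete_b:
  "runs (level h h' 1 - {st 1}) = runs (level h h' 1) + of_bool (z + j \<in> level h h' 1)"
  using runs_delete[of "level h h' 1" "st 1"] st_in1[of 1] st_succ(2) st_pos[of 1] j2 st_pred(1)[of 1] st_in1[of 2]
  by (auto simp: finite_level numeral_2_eq_2)

text \<open>Creating the hole beside z + j gives 2, the j - 1 climbing steps give 2^(j-1), and
  closing it as a new run gives 2: together 2^(j+1), two above the bound.\<close>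

lemma two_types:
  assumes "z + j \<in> level h h' 1" "z - 1 \<notin> level h h' (Suc j)"
  shows "near_value j L > 2 ^ (j + 1) - 2"
proof -
  have "near_value j L \<ge> (\<Sum>d\<in>{st 1}. 2 ^ runs (level h h' 1 - {d}) / 2 ^ runs (level h h' 1) * hole_value 1 d j L)"
    by (rule near_value_ge[OF L]) (use jL j2 st_hole[of 1] st_in1[of 1] in auto)
  then have "near_value j L \<ge> 2 * hole_value 1 (st 1) j L" using assms(1) by (simp add: lev1_delete_b[simplified])
  moreover have "hole_value 1 (st 1) j L \<ge> 2 * 2 ^ (j - 1)" using stair_path[of 1] j2 assms(2) by (simp add: fz_def)
  moreover have "(2::real) ^ (j + 1) = 2 * (2 * 2 ^ (j - 1))" using j2 by (cases j) auto
  ultimately show ?thesis by linarith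
qed

context
  assumes zero: "h' 0 = h 0 + j" "h 0 = Suc (h 1)" "h' 1 = h' 0" and fz1: "z - 1 \<in> level h h' (Suc j)"
begin

lemma zero_level: "0 \<in> level h h' t \<longleftrightarrow> t \<le> j" "1 \<in> level h h' t \<longleftrightarrow> t \<le> Suc j"
  using zero by (auto simp: level_def)

lemma zero_ne: "0 \<noteq> st i" if "i \<le> j" using st_pos[OF that] by simp

lemma zero_hole: "1 \<le> i \<Longrightarrow> i \<le> j \<Longrightarrow> height_fn (hole i 0 h h')"
  by (rule hole_height_fn) (use zero j2 in \<open>auto simp: raised_def\<close>)

text \<open>A second place to wait: the main diagonal has gap j, and a hole there can stay through
  all steps.\<close>

lemma zero_path: "i \<le> j \<Longrightarrow> 1 \<le> i \<Longrightarrow> hole_value i 0 j L \<ge> 1"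
proof (induction i rule: inc_induct)
  case base
  have "runs (insert 0 (level h h' (Suc j))) = runs (level h h' (Suc j))"
    using runs_insert[of "level h h' (Suc j)" 0] zero_level by simp
  then show ?case using hole_value_last[OF L, of 0 j] zero_level jL j2 by simp
next
  case (step i)
  have "hole_value i 0 j L \<ge> (\<Sum>d'\<in>{0}. 2 ^ runs (moved_level h h' (Suc i) 0 d') / 2 ^ runs (level h h' (Suc i)) * hole_value (Suc i) d' j L)"
    by (rule hole_value_ge[OF L]) (use step jL zero_hole[of "Suc i"] zero_level in auto)
  then show ?case using step by (simp add: moved_level_def)
qed

lemma delete_zero:
  assumes "d \<notin> level h h' (Suc i)" "1 \<le> i" "i < j" "d \<noteq> 0"
  shows "runs (moved_level h h' (Suc i) d 0) = runs (insert d (level h h' (Suc i)))"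
proof -
  have "runs (insert d (level h h' (Suc i)) - {0}) + 1 = runs (insert d (level h h' (Suc i))) + 1"
    using runs_delete[of "insert d (level h h' (Suc i))" 0] zero_level assms by simp
  then show ?thesis using assms by (simp add: moved_level_def)
qed

text \<open>From \<open>st i\<close> the hole climbs with factor 2 or jumps to diagonal 0 with
  factor 1, so the values satisfy a_i = 2 a_(i+1) + 1.\<close>

lemma stair_zero_path: "i \<le> j \<Longrightarrow> 1 \<le> i \<Longrightarrow> hole_value i (st i) j L \<ge> 2 ^ (j - i + 1) - 1"
proof (induction i rule: inc_induct)
  case base then show ?case using hole_value_z fz1 by (simp add: st_pred fz_def)
next
  case (step i)
  let ?S = "level h h' (Suc i)"
  have n: "st i \<notin> ?S" "Suc (st i) \<notin> ?S" "st (Suc i) \<in> ?S"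
    using st_level[of i "Suc i"] st_level[of "Suc i" "Suc i"] st_succ_level[of i] step by auto
  have ins: "runs (insert (st i) ?S) = runs ?S"
    using runs_insert[of ?S "st i"] n st_pred(1)[of i] st_pos[of i] step by simp
  have z: "st (Suc i) \<noteq> 0" "st i \<noteq> 0" using zero_ne[of "Suc i"] zero_ne[of i] step by auto
  have "hole_value i (st i) j L \<ge> (\<Sum>d'\<in>{st (Suc i), 0}. 2 ^ runs (moved_level h h' (Suc i) (st i) d') / 2 ^ runs ?S * hole_value (Suc i) d' j L)"
    by (rule hole_value_ge[OF L st_in1]) (use step jL st_hole[of "Suc i"] zero_hole[of "Suc i"] n zero_level in auto)
  also have "(\<Sum>d'\<in>{st (Suc i), 0}. 2 ^ runs (moved_level h h' (Suc i) (st i) d') / 2 ^ runs ?S * hole_value (Suc i) d' j L)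
     = 2 * hole_value (Suc i) (st (Suc i)) j L + hole_value (Suc i) 0 j L"
    using z st_runs[of i] step delete_zero[OF n(1)] ins by simp
  finally have le: "hole_value i (st i) j L \<ge> 2 * hole_value (Suc i) (st (Suc i)) j L + hole_value (Suc i) 0 j L" .
  have "hole_value i (st i) j L \<ge> 2 * (2 ^ (j - Suc i + 1) - 1) + 1"
    by (rule order.trans[OF add_mono[OF mult_left_mono] le]) (use step zero_path[of "Suc i"] in auto)
  moreover have "j - i = Suc (j - Suc i)" using step by simp
  ultimately show ?case by simp
qed

text \<open>Twice 2^j - 1 for a hole created on the descent and 1 for a hole created on the main
  diagonal exceed the bound by one.\<close>

lemma up_then_plateau:
  assumes "z + j \<in> level h h' 1"
  shows "near_value j L > 2 ^ (j + 1) - 2"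
proof -
  have d0: "runs (level h h' 1 - {0}) = runs (level h h' 1)"
    using runs_delete[of "level h h' 1" 0] zero_level j2 by (simp add: finite_level)
  have "near_value j L \<ge> (\<Sum>d\<in>{st 1, 0}. 2 ^ runs (level h h' 1 - {d}) / 2 ^ runs (level h h' 1) * hole_value 1 d j L)"
    by (rule near_value_ge[OF L]) (use jL j2 st_hole[of 1] st_in1[of 1] zero_hole[of 1] zero_level in auto)
  then have "near_value j L \<ge> 2 * hole_value 1 (st 1) j L + hole_value 1 0 j L"
    using assms zero_ne[of 1] j2 by (simp add: lev1_delete_b[simplified] d0[simplified])
  moreover have "hole_value 1 (st 1) j L \<ge> 2 ^ j - 1" using stair_zero_path[of 1] j2 by simp
  moreover have "hole_value 1 0 j L \<ge> 1" using zero_path[of 1] j2 by simp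
  moreover have "(2::real) ^ (j + 1) = 2 * 2 ^ j" by simp
  ultimately show ?thesis by linarith
qed

end

context
  assumes box: "h (z + j) = h' (z + j)" "h' (Suc (z + j)) = Suc (h (Suc (z + j)))" "h' (Suc (z + j)) = h' (z + j)"
     "h' (Suc (Suc (z + j))) = h (Suc (Suc (z + j)))" "h (Suc (Suc (z + j))) = h (Suc (z + j))"
begin

text \<open>The diagonal of an isolated box just beyond the descent, a run of level 1 by
  itself.\<close>

definition "y = Suc (z + j)"

lemma y_level: "y \<in> level h h' t \<longleftrightarrow> t \<le> 1" "Suc y \<in> level h h' t \<longleftrightarrow> t = 0" "y - 1 \<in> level h h' t \<longleftrightarrow> t = 0" "y \<noteq> 0"
  using box by (auto simp: level_def y_def)

lemma y_hole: "1 \<le> i \<Longrightarrow> height_fn (hole i y h h')"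
  by (rule hole_height_fn) (use box in \<open>auto simp: raised_def y_def\<close>)

lemma y_st: "1 \<le> i \<Longrightarrow> i \<le> j \<Longrightarrow> st i < y - 1" by (auto simp: st_def y_def)

lemma y_insert: "1 \<le> i \<Longrightarrow> runs (insert y (level h h' (Suc i))) = Suc (runs (level h h' (Suc i)))"
  using runs_insert[of "level h h' (Suc i)" y] y_level by simp

lemma y_last: "hole_value j y j L = 2"
  using hole_value_last[OF L, of y j] y_level jL j2 y_insert[of j] by simp

lemma y_runs: "1 \<le> i \<Longrightarrow> i < j \<Longrightarrow> runs (moved_level h h' (Suc i) y (st (Suc i))) = Suc (runs (level h h' (Suc i)))"
proof -
  assume i: "1 \<le> i" "i < j"
  let ?S = "level h h' (Suc i)"
  have s: "Suc (st (Suc i)) = st i" "st i \<notin> ?S" "st i \<noteq> y" "st (Suc i) \<in> ?S" "st (Suc i) \<noteq> y"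
    using st_succ(1)[of "Suc i"] st_level[of i "Suc i"] st_level[of "Suc i" "Suc i"] y_st[of i] y_st[of "Suc i"] i by auto
  have "runs (insert y ?S - {st (Suc i)}) + 1 = runs (insert y ?S) + 1"
    using runs_delete[of "insert y ?S" "st (Suc i)"] s st_pos[of "Suc i"] st_pred_level[of "Suc i"] i by simp
  then show ?thesis using y_insert[OF i(1)] s by (simp add: moved_level_def)
qed

lemma y_first: "runs (level h h' 1) = Suc (runs (level h h' 1 - {y}))"
  using runs_delete[of "level h h' 1" y] y_level by (simp add: finite_level)

lemma b_notin: "z + j \<notin> level h h' 1" using y_level(3)[of 1] by (simp add: y_def)

text \<open>The descent contributes 2^j and the isolated box half of 2^(j+1) - 2, half because
  postponing it costs a run. The sum is one above the bound.\<close>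

lemma plateau_and_box:
  assumes "z - 1 \<notin> level h h' (Suc j)"
  shows "near_value j L > 2 ^ (j + 1) - 2"
proof -
  have p: "hole_value i (st i) j L \<ge> 2 ^ (j - i + 1)" if "1 \<le> i" "i \<le> j" for i
    using stair_path[OF that(2,1)] assms by (simp add: fz_def)
  have q: "i \<le> j \<Longrightarrow> 1 \<le> i \<Longrightarrow> hole_value i y j L \<ge> 2 ^ (j - i + 2) - 2" for i
  proof (induction i rule: inc_induct)
    case base show ?case using y_last by simp
  next
    case (step i)
    have "y \<noteq> st (Suc i)" using y_st[of "Suc i"] step by auto
    have "hole_value i y j L \<ge> (\<Sum>d'\<in>{y, st (Suc i)}. 2 ^ runs (moved_level h h' (Suc i) y d') / 2 ^ runs (level h h' (Suc i)) * hole_value (Suc i) d' j L)"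
      by (rule hole_value_ge[OF L]) (use step jL y_hole[of "Suc i"] y_level st_hole[of "Suc i"] st_level[of "Suc i" "Suc i"] in auto)
    also have "(\<Sum>d'\<in>{y, st (Suc i)}. 2 ^ runs (moved_level h h' (Suc i) y d') / 2 ^ runs (level h h' (Suc i)) * hole_value (Suc i) d' j L)
      = hole_value (Suc i) y j L + 2 * hole_value (Suc i) (st (Suc i)) j L"
      using \<open>y \<noteq> st (Suc i)\<close> y_runs[of i] step by (simp add: moved_level_def[of h h' "Suc i" y y])
    finally have "hole_value i y j L \<ge> (2 ^ (j - Suc i + 2) - 2) + 2 * 2 ^ (j - Suc i + 1)"
      using step p[of "Suc i"] by linarith
    moreover have "j - i = Suc (j - Suc i)" using step by simp
    ultimately show ?case by simp
  qed
  have "y \<noteq> st 1" using y_st[of 1] j2 by auto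
  have "near_value j L \<ge> (\<Sum>d\<in>{st 1, y}. 2 ^ runs (level h h' 1 - {d}) / 2 ^ runs (level h h' 1) * hole_value 1 d j L)"
    by (rule near_value_ge[OF L]) (use jL j2 st_hole[of 1] st_in1[of 1] y_hole[of 1] y_level in auto)
  then have "near_value j L \<ge> hole_value 1 (st 1) j L + 1 / 2 * hole_value 1 y j L"
    using \<open>y \<noteq> st 1\<close> b_notin y_first[simplified] by (simp add: lev1_delete_b[simplified])
  moreover have "hole_value 1 (st 1) j L \<ge> 2 ^ j" using p[of 1] j2 by simp
  moreover have "hole_value 1 y j L \<ge> 2 * 2 ^ j - 2" using q[of 1] j2 by (cases j) auto
  moreover have "(2::real) ^ (j + 1) = 2 * 2 ^ j" by simp
  ultimately show ?thesis by linarith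
qed

text \<open>Here descent and isolated box contribute 2^j - 1 each and the main diagonal 1, again one
  above the bound.\<close>

lemma up_and_box:
  assumes zero: "h' 0 = h 0 + j" "h 0 = Suc (h 1)" "h' 1 = h' 0" and fz1: "z - 1 \<in> level h h' (Suc j)"
  shows "near_value j L > 2 ^ (j + 1) - 2"
proof -
  note za = assms
  have p: "hole_value i (st i) j L \<ge> 2 ^ (j - i + 1) - 1" if "1 \<le> i" "i \<le> j" for i
    by (rule stair_zero_path[OF za that(2,1)])
  have q: "i \<le> j \<Longrightarrow> 1 \<le> i \<Longrightarrow> hole_value i y j L \<ge> 2 ^ (j - i + 2) - 2" for i
  proof (induction i rule: inc_induct)
    case base show ?case using y_last by simp
  next
    case (step i)
    have ne: "y \<noteq> st (Suc i)" "st (Suc i) \<noteq> 0" "y \<noteq> 0" using y_st[of "Suc i"] step st_pos[of "Suc i"] y_level(4) by auto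
    have r0: "runs (moved_level h h' (Suc i) y 0) = Suc (runs (level h h' (Suc i)))"
      using delete_zero[OF za, of y i] y_insert[of i] y_level step by simp
    have "hole_value i y j L \<ge> (\<Sum>d'\<in>{y, st (Suc i), 0}. 2 ^ runs (moved_level h h' (Suc i) y d') / 2 ^ runs (level h h' (Suc i)) * hole_value (Suc i) d' j L)"
      by (rule hole_value_ge[OF L]) (use step jL y_hole[of "Suc i"] y_level st_hole[of "Suc i"] st_level[of "Suc i" "Suc i"]
         zero_hole[OF za, of "Suc i"] zero_level[OF za] in auto)
    also have "(\<Sum>d'\<in>{y, st (Suc i), 0}. 2 ^ runs (moved_level h h' (Suc i) y d') / 2 ^ runs (level h h' (Suc i)) * hole_value (Suc i) d' j L)
      = hole_value (Suc i) y j L + (2 * hole_value (Suc i) (st (Suc i)) j L + 2 * hole_value (Suc i) 0 j L)"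
      using ne y_runs[of i] step r0 by (simp add: moved_level_def[of h h' "Suc i" y y])
    finally have le: "hole_value i y j L \<ge> hole_value (Suc i) y j L + (2 * hole_value (Suc i) (st (Suc i)) j L + 2 * hole_value (Suc i) 0 j L)" .
    have "hole_value (Suc i) 0 j L \<ge> 1" by (rule zero_path[OF za]) (use step in auto)
    moreover have "hole_value (Suc i) (st (Suc i)) j L \<ge> 2 ^ (j - Suc i + 1) - 1" by (rule p) (use step in auto)
    moreover have "hole_value (Suc i) y j L \<ge> 2 ^ (j - Suc i + 2) - 2" using step by simp
    ultimately have "hole_value i y j L \<ge> (2 ^ (j - Suc i + 2) - 2) + (2 * (2 ^ (j - Suc i + 1) - 1) + 2 * 1)"
      by (intro order.trans[OF add_mono[OF _ add_mono[OF mult_left_mono mult_left_mono]] le]) auto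
    moreover have "j - i = Suc (j - Suc i)" using step by simp
    ultimately show ?case by simp
  qed
  have ne: "y \<noteq> st 1" "st 1 \<noteq> 0" "y \<noteq> 0" using y_st[of 1] j2 st_pos[of 1] y_level(4) by auto
  have d0: "runs (level h h' 1 - {0}) = runs (level h h' 1)"
    using runs_delete[of "level h h' 1" 0] zero_level[OF za] j2 by (simp add: finite_level)
  have "near_value j L \<ge> (\<Sum>d\<in>{st 1, y, 0}. 2 ^ runs (level h h' 1 - {d}) / 2 ^ runs (level h h' 1) * hole_value 1 d j L)"
    by (rule near_value_ge[OF L]) (use jL j2 st_hole[of 1] st_in1[of 1] y_hole[of 1] y_level zero_hole[OF za, of 1] zero_level[OF za] in auto)
  then have "near_value j L \<ge> hole_value 1 (st 1) j L + (1 / 2 * hole_value 1 y j L + hole_value 1 0 j L)"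
    using ne b_notin y_first[simplified] by (simp add: lev1_delete_b[simplified] d0[simplified])
  moreover have "hole_value 1 (st 1) j L \<ge> 2 ^ j - 1" using p[of 1] j2 by simp
  moreover have "hole_value 1 y j L \<ge> 2 * 2 ^ j - 2" using q[of 1] j2 by (cases j) auto
  moreover have "hole_value 1 0 j L \<ge> 1" using zero_path[OF za, of 1] j2 by simp
  moreover have "(2::real) ^ (j + 1) = 2 * 2 ^ j" by simp
  ultimately show ?thesis by linarith
qed

end

end

lemma runs_ratio: "runs A + a = runs B + b \<Longrightarrow> (2::real) ^ runs A / 2 ^ runs B = 2 ^ b / 2 ^ a"
  by (simp add: field_simps flip: power_add)

context skew begin

context
  fixes L :: nat assumes L: "raised L h h' = h'"
begin

text \<open>The gaps from u - 1 to u + 3 are 2, 1, 2, 1, 0. A hole created on u has factor 2 and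
  value at least 2, one created on u + 2 has factor 1 and value at least 3: together 7, while the
  bound for j = 2 is 6.\<close>

lemma valley_above_box:
  assumes L2: "2 < L" and u0: "u \<ge> 1"
    and c: "h (u - 1) = Suc H" "h' (u - 1) = H + 3" "h u = Suc H" "h' u = H + 2" "h (u + 1) = H" "h' (u + 1) = H + 2"
      "h (u + 2) = H" "h' (u + 2) = H + 1" "h (u + 3) = H" "h' (u + 3) = H"
    and start: "u = 1 \<or> h (u - 2) = Suc H \<and> h' (u - 2) = H + 4"
  shows "near_value 2 L \<ge> 7"
proof -
  let ?S = "level h h'"
  have m: "u - 1 \<in> ?S t \<longleftrightarrow> t \<le> 2" "u \<in> ?S t \<longleftrightarrow> t \<le> 1" "u + 1 \<in> ?S t \<longleftrightarrow> t \<le> 2" "u + 2 \<in> ?S t \<longleftrightarrow> t \<le> 1" "u + 3 \<in> ?S t \<longleftrightarrow> t = 0" for t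
    using c by (auto simp: level_def)
  have ex: "\<exists>w. u = Suc w" using u0 by (cases u) auto
  then obtain w where w: "u = Suc w" ..
  \<comment> \<open>\<open>e\<close> records whether diagonal u - 1 has a left neighbour. The factor
    2^e gained when the hole arrives there is lost again when it is closed.\<close>
  define e :: nat where "e = of_bool (w \<noteq> 0)"
  have pw: "w \<noteq> 0 \<and> w - 1 \<in> ?S t \<longleftrightarrow> e = 1" if "t \<le> 3" for t
    using start that w by (auto simp: level_def e_def numeral_2_eq_2)
  have m: "w \<in> ?S t \<longleftrightarrow> t \<le> 2" "Suc w \<in> ?S t \<longleftrightarrow> t \<le> 1" "Suc (Suc w) \<in> ?S t \<longleftrightarrow> t \<le> 2" "Suc (Suc (Suc w)) \<in> ?S t \<longleftrightarrow> t \<le> 1" 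
      "Suc (Suc (Suc (Suc w))) \<in> ?S t \<longleftrightarrow> t = 0" for t
    using m[of t] w by (simp_all add: numeral_2_eq_2 numeral_3_eq_3)
  have fin: "finite (?S 1)" "finite (?S 2)" "finite (?S 3)" by (auto intro: finite_level)
  let ?a = "w" and ?b = "Suc w" and ?c = "Suc (Suc w)" and ?d = "Suc (Suc (Suc w))"
  have e01: "e = 0 \<or> e = 1" by (auto simp: e_def)
  have f: "(2::real) ^ runs (?S 1 - {?b}) / 2 ^ runs (?S 1) = 2" "(2::real) ^ runs (?S 1 - {?d}) / 2 ^ runs (?S 1) = 1"
    using runs_ratio[of "?S 1 - {?b}" 1 "?S 1" 2] runs_ratio[of "?S 1 - {?d}" 1 "?S 1" 1]
      runs_delete[OF fin(1), of ?b] runs_delete[OF fin(1), of ?d] m by simp_all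
  have ib: "runs (insert ?b (?S 2)) + 1 = runs (?S 2)" and id: "runs (insert ?d (?S 2)) = runs (?S 2)"
    using runs_insert[OF fin(2), of ?b] runs_insert[OF fin(2), of ?d] m by simp_all
  have finI: "finite (insert ?b (?S 2))" "finite (insert ?d (?S 2))" using fin by auto
  have pe: "of_bool (0 < w \<and> (w - Suc 0 = x \<or> w - Suc 0 \<in> ?S 2)) = e" if "w < x" for x
    using pw[of 2] e01 that by (auto simp: of_bool_def)
  have k: "runs (insert ?b (?S 2) - {?a}) + 1 = runs (?S 2) + e" "runs (insert ?b (?S 2) - {?c}) + 1 = runs (?S 2)"
    "runs (insert ?d (?S 2) - {?a}) + 1 = runs (?S 2) + e" "runs (insert ?d (?S 2) - {?c}) = runs (?S 2)"
    using runs_delete[OF finI(1), of ?a] runs_delete[OF finI(1), of ?c] runs_delete[OF finI(2), of ?a] runs_delete[OF finI(2), of ?c]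
      m pe[of ?b] pe[of ?d] ib id by simp_all
  have g: "(2::real) ^ runs (moved_level h h' 2 ?b ?a) / 2 ^ runs (?S 2) = 2 ^ e / 2"
    "(2::real) ^ runs (moved_level h h' 2 ?b ?c) / 2 ^ runs (?S 2) = 1 / 2"
    "(2::real) ^ runs (moved_level h h' 2 ?d ?a) / 2 ^ runs (?S 2) = 2 ^ e / 2"
    "(2::real) ^ runs (moved_level h h' 2 ?d ?c) / 2 ^ runs (?S 2) = 1"
    using runs_ratio[of "moved_level h h' 2 ?b ?a" 1 "?S 2" e] runs_ratio[of "moved_level h h' 2 ?b ?c" 1 "?S 2" 0]
      runs_ratio[of "moved_level h h' 2 ?d ?a" 1 "?S 2" e] runs_ratio[of "moved_level h h' 2 ?d ?c" 0 "?S 2" 0] k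
    by (simp_all add: moved_level_def)
  have l: "hole_value 2 ?a 2 L = 2 / 2 ^ e" "hole_value 2 ?c 2 L = 2"
    using runs_ratio[of "insert ?a (?S 3)" e "?S 3" 1] runs_ratio[of "insert ?c (?S 3)" 0 "?S 3" 1]
      runs_insert[OF fin(3), of ?a] runs_insert[OF fin(3), of ?c] m pw[of 3] e01
      hole_value_last[OF L, of ?a 2] hole_value_last[OF L, of ?c 2] L2
    by (auto simp: eval_nat_numeral)
  have c': "h w = Suc H" "h' w = H + 3" "h ?b = Suc H" "h' ?b = H + 2" "h ?c = H" "h' ?c = H + 2" "h ?d = H" "h' ?d = H + 1"
    "h (Suc ?d) = H" "h' (Suc ?d) = H" "w = 0 \<or> h (w - 1) = Suc H \<and> h' (w - 1) = H + 4"
    using c start w by (auto simp: eval_nat_numeral)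
  have hol: "height_fn (hole 1 ?b h h')" "height_fn (hole 1 ?d h h')" "height_fn (hole 2 ?a h h')" "height_fn (hole 2 ?c h h')"
    by (rule hole_height_fn; use c' in \<open>force simp: raised_def\<close>)+
  have p: "hole_value 1 d 2 L \<ge> (\<Sum>d'\<in>{?a, ?c}. 2 ^ runs (moved_level h h' 2 d d') / 2 ^ runs (?S 2) * hole_value 2 d' 2 L)" if "d = ?b \<or> d = ?d" for d
    by (rule hole_value_ge[OF L, of d 1 "{?a, ?c}" 2, unfolded Suc_1])
      (use that hol m L2 in auto)
  have s: "(\<Sum>d'\<in>{?a, ?c}. F d') = F ?a + F ?c" for F :: "nat \<Rightarrow> real" by simp
  have pb: "hole_value 1 ?b 2 L \<ge> 2 ^ e / 2 * (2 / 2 ^ e) + 1 / 2 * 2" using p[OF disjI1[OF refl], unfolded s g l] .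
  have pd: "hole_value 1 ?d 2 L \<ge> 2 ^ e / 2 * (2 / 2 ^ e) + 1 * 2" using p[OF disjI2[OF refl], unfolded s g l] .
  have s: "(\<Sum>d\<in>{?b, ?d}. F d) = F ?b + F ?d" for F :: "nat \<Rightarrow> real" by simp
  have "near_value 2 L \<ge> (\<Sum>d\<in>{?b, ?d}. 2 ^ runs (?S 1 - {d}) / 2 ^ runs (?S 1) * hole_value 1 d 2 L)"
    by (rule near_value_ge[OF L]) (use L2 hol m in auto)
  note this[unfolded s f]
  then show ?thesis using pb pd by simp
qed

end

end

section \<open>Consequences of proportionality to a straight shape\<close>

text \<open>Straight shapes alone would not be stable under \<open>raised\<close>; remainders of
  straight shapes with an unspecified factor are.\<close>

definition Q_like :: "(nat \<Rightarrow> nat) \<Rightarrow> (nat \<Rightarrow> nat) \<Rightarrow> bool" where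
  "Q_like h h' \<longleftrightarrow> skew h h' \<and> (\<exists>k s s' t. rows s s' t \<and> homog k h h' s s')"

lemma Q_like_skew: "Q_like h h' \<Longrightarrow> skew h h'" by (simp add: Q_like_def)

lemma Q_like_raised: assumes "Q_like h h'" shows "Q_like (raised u h h') h'"
proof -
  obtain k s s' t where *: "skew h h'" "rows s s' t" "homog k h h' s s'" using assms by (auto simp: Q_like_def)
  interpret r: rows s s' t by fact
  have "rows (raised u s s') s' (t + u)" 
    by (intro rows.intro r.skew_raised rows_axioms.intro) (rule r.rows_raised)
  then show ?thesis using homog_raised[OF *(1) r.skew_axioms *(3), of u] skew.skew_raised[OF *(1), of u] unfolding Q_like_def by blast
qed

lemma complement_id: "h \<in> below (staircase n) \<Longrightarrow> complement n h d + h d = n - d"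
  using belowD(2)[of h "staircase n" d] by (simp add: complement_def staircase_def)

lemma Q_like_complement: assumes "Q_like h h'" "h \<in> below (staircase n)" "h' \<in> below (staircase n)" shows "Q_like (complement n h') (complement n h)"
proof -
  obtain k s s' t where *: "skew h h'" "rows s s' t" "homog k h h' s s'" using assms by (auto simp: Q_like_def)
  interpret skew h h' by fact
  have "skew (complement n h') (complement n h)"
  proof
    fix d show "complement n h' d \<le> complement n h d" using complement_id[OF assms(2), of d] complement_id[OF assms(3), of d] hh[of d] by linarith
  qed (use assms height_fn_complement complement_below in \<open>auto dest: belowD(1)\<close>)
  moreover have "homog k (complement n h') (complement n h) s s'" using *(3) complement_chain_sum[OF assms(2,3)] by (simp add: homog_def)
  ultimately show ?thesis using *(2) unfolding Q_like_def by blast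
qed

lemma homog_level_size_all: "skew h h' \<Longrightarrow> skew s s' \<Longrightarrow> homog k h h' s s' \<Longrightarrow> level_size h h' (Suc t) = level_size s s' (Suc t)"
  using homog_raised by blast

text \<open>Equal level sizes give both shapes the same contents, so \<open>near_value\<close>
  agrees on both sides and the straight-shape bound transfers. L is chosen large enough for
  both.\<close>

lemma Q_like_bound:
  assumes Q: "Q_like h h'" and j: "1 \<le> j" "level_size h h' j > 0"
    and e: "\<And>a. 1 < a \<Longrightarrow> a < j \<Longrightarrow> level_size h h' a = Suc (level_size h h' (Suc a))"
  obtains L where "j < L" "raised L h h' = h'" "skew.near_value h h' j L \<le> 2 ^ (j + 1) - 2"
proof -
  obtain k s s' t where *: "skew h h'" "rows s s' t" "homog k h h' s s'" using assms by (auto simp: Q_like_def)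
  interpret a: skew h h' by fact
  interpret r: rows s s' t by fact
  obtain L1 L2 where L: "\<forall>l\<ge>L1. raised l h h' = h'" "\<forall>l\<ge>L2. raised l s s' = s'" using a.raised_max r.raised_max by blast
  define L where "L = Suc (j + L1 + L2)"
  have level_size: "level_size h h' a = level_size s s' a" if "a > 0" for a
    using homog_level_size_all[OF *(1) r.skew_axioms *(3), of "a - 1"] that by simp
  have top_word: "a.top_word i L = r.top_word i L" for i by (auto simp: a.top_word_def r.top_word_def level_size simp del: upt_Suc)
  have near_word: "a.near_word i j L = r.near_word i j L" for i by (auto simp: a.near_word_def r.near_word_def level_size top_word simp del: upt_Suc)
  have k: "k > 0" "chain_sum cs h h' = k * chain_sum cs s s'" for cs using *(3) by (auto simp: homog_def)
  have "a.near_value j L = r.near_value j L"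
    unfolding a.near_value_def r.near_value_def a.leading_def r.leading_def near_word top_word a.raised_0 r.raised_0 level_size[of 1, simplified]
    using k by (simp add: level_size)
  moreover have "r.near_value j L \<le> 2 ^ (j + 1) - 2"
    by (rule r.rows_bound) (use L j e in \<open>auto simp: L_def level_size\<close>)
  ultimately show ?thesis using that[of L] L by (auto simp: L_def)
qed

lemma level_size_pos: "skew h h' \<Longrightarrow> d \<in> level h h' (Suc t) \<Longrightarrow> level_size h h' (Suc t) > 0"
  by (auto simp: level_size_def card_gt_0_iff skew.finite_Suc_level)

text \<open>The letter of the boundary word at \<open>d + 1\<close> tells whether this part occurs in neither shape (N), in both (B),
  only in the larger (L) or only in the smaller (M) one.\<close>

definition N_step :: "(nat \<Rightarrow> nat) \<Rightarrow> (nat \<Rightarrow> nat) \<Rightarrow> nat \<Rightarrow> bool" where "N_step h h' d \<longleftrightarrow> h (Suc d) = h d \<and> h' (Suc d) = h' d"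
definition B_step :: "(nat \<Rightarrow> nat) \<Rightarrow> (nat \<Rightarrow> nat) \<Rightarrow> nat \<Rightarrow> bool" where "B_step h h' d \<longleftrightarrow> Suc (h (Suc d)) = h d \<and> Suc (h' (Suc d)) = h' d"
definition L_step :: "(nat \<Rightarrow> nat) \<Rightarrow> (nat \<Rightarrow> nat) \<Rightarrow> nat \<Rightarrow> bool" where "L_step h h' d \<longleftrightarrow> h (Suc d) = h d \<and> Suc (h' (Suc d)) = h' d"
definition M_step :: "(nat \<Rightarrow> nat) \<Rightarrow> (nat \<Rightarrow> nat) \<Rightarrow> nat \<Rightarrow> bool" where "M_step h h' d \<longleftrightarrow> Suc (h (Suc d)) = h d \<and> h' (Suc d) = h' d"
definition gap :: "(nat \<Rightarrow> nat) \<Rightarrow> (nat \<Rightarrow> nat) \<Rightarrow> nat \<Rightarrow> nat" where "gap h h' d = h' d - h d"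

context skew begin

lemma h'_gap: "h' d = h d + gap h h' d" using hh[of d] by (simp add: gap_def)

lemma step_cases: "N_step h h' d \<or> B_step h h' d \<or> L_step h h' d \<or> M_step h h' d"
  using height_fnD[OF ah, of d] height_fnD[OF ah', of d] by (auto simp: N_step_def B_step_def L_step_def M_step_def)

lemma gap_step: "N_step h h' d \<or> B_step h h' d \<longleftrightarrow> gap h h' (Suc d) = gap h h' d"
  "M_step h h' d \<longleftrightarrow> gap h h' (Suc d) = Suc (gap h h' d)"
  "L_step h h' d \<longleftrightarrow> gap h h' d = Suc (gap h h' (Suc d))"
  using step_cases[of d] h'_gap[of d] h'_gap[of "Suc d"] by (auto simp: N_step_def B_step_def L_step_def M_step_def)

lemma level_gap_iff: "d \<in> level h h' t \<longleftrightarrow> t \<le> gap h h' d" using h'_gap[of d] by (simp add: level_def)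

lemma gap_raised: "gap (raised t h h') h' d = gap h h' d - t" using h'_gap[of d] by (simp add: raised_def gap_def)

lemma raised_gap: "t \<le> gap h h' d \<Longrightarrow> raised t h h' d = h d + t" using h'_gap[of d] by (simp add: raised_def)

lemma steps_raised:
  assumes "t \<le> gap h h' d" "t \<le> gap h h' (Suc d)"
  shows "N_step (raised t h h') h' d = N_step h h' d" "B_step (raised t h h') h' d = B_step h h' d" 
    "L_step (raised t h h') h' d = L_step h h' d" "M_step (raised t h h') h' d = M_step h h' d"
  using assms by (auto simp: N_step_def B_step_def L_step_def M_step_def raised_gap)

section \<open>Corners and repeated gap values\<close>

text \<open>The places where the last box of a diagonal of gap one can be postponed, see
  \<open>corner_hole\<close>.\<close>

definition "corner d \<longleftrightarrow> gap h h' d = 1 \<and> \<not> N_step h h' d \<and> (d = 0 \<or> \<not> B_step h h' (d - 1))"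

lemma corner_hole: assumes "corner d" shows "height_fn (hole 1 d h h')"
proof (rule hole_height_fn)
  have d: "gap h h' d = 1" using assms by (simp add: corner_def)
  show "h d < h' d" using d h'_gap[of d] by simp
  show "Suc (raised 1 h h' (Suc d)) = raised 1 h h' d"
    using step_cases[of d] assms d h'_gap[of d] h'_gap[of "Suc d"] by (auto simp: corner_def raised_def N_step_def B_step_def L_step_def M_step_def)
  show "d = 0 \<or> raised 1 h h' (d - 1) = raised 1 h h' d"
    using step_cases[of "d - 1"] assms d h'_gap[of d] h'_gap[of "d - 1"] 
    by (cases d) (auto simp: corner_def raised_def N_step_def B_step_def L_step_def M_step_def)
qed simp

lemma gap_end: "gap h h' d > 0 \<Longrightarrow> d < width h'" using width_iff[OF ah', of d] by (cases "d < width h'") (auto simp: gap_def)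

lemma corner_right:
  assumes "gap h h' x = 1" "x = 0 \<or> \<not> B_step h h' (x - 1)"
  shows "\<exists>c\<ge>x. corner c \<and> (\<forall>y. x \<le> y \<and> y < c \<longrightarrow> gap h h' y = 1 \<and> N_step h h' y)"
  using assms
proof (induction "width h' - x" arbitrary: x rule: less_induct)
  case less
  show ?case
  proof (cases "N_step h h' x")
    case True
    then have s: "gap h h' (Suc x) = 1" using gap_step(1)[of x] less by simp
    have "width h' - Suc x < width h' - x" using gap_end[of x] less by simp
    moreover have "\<not> B_step h h' x" using True by (auto simp: N_step_def B_step_def)
    ultimately obtain c where c: "c \<ge> Suc x" "corner c" "\<forall>y. Suc x \<le> y \<and> y < c \<longrightarrow> gap h h' y = 1 \<and> N_step h h' y"
      using less.hyps[of "Suc x"] s by auto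
    then show ?thesis using True less by (intro exI[of _ c]) (metis Suc_leD le_antisym not_less_eq_eq)
  next
    case False
    then show ?thesis using less by (intro exI[of _ x]) (auto simp: corner_def)
  qed
qed

text \<open>Walking right along N-steps or left along B-steps keeps the gap one and stops at a
  corner.\<close>

lemma corner_near:
  assumes "gap h h' x = 1"
  shows "\<exists>c. corner c \<and> (x \<le> c \<and> (\<forall>y. x \<le> y \<and> y < c \<longrightarrow> gap h h' y = 1 \<and> N_step h h' y) \<or>
     c \<le> x \<and> (\<forall>y. c \<le> y \<and> y < x \<longrightarrow> gap h h' y = 1 \<and> B_step h h' y))"
  using assms
proof (induction x)
  case 0 then show ?case using corner_right[of 0] by auto
next
  case (Suc x)
  show ?case
  proof (cases "B_step h h' x")
    case True
    then have g: "gap h h' x = 1" using gap_step(1)[of x] Suc by simp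
    then obtain c where c: "corner c" "x \<le> c \<and> (\<forall>y. x \<le> y \<and> y < c \<longrightarrow> gap h h' y = 1 \<and> N_step h h' y) \<or>
     c \<le> x \<and> (\<forall>y. c \<le> y \<and> y < x \<longrightarrow> gap h h' y = 1 \<and> B_step h h' y)" using Suc by blast
    have "\<not> N_step h h' x" using True by (auto simp: N_step_def B_step_def)
    then have "c \<le> x" using c(2) by (cases "c \<le> x") auto
    moreover have "gap h h' y = 1 \<and> B_step h h' y" if "c \<le> y" "y < x" for y
      using c(2) \<open>c \<le> x\<close> that by (cases "c = x") auto
    ultimately have "c \<le> Suc x \<and> (\<forall>y. c \<le> y \<and> y < Suc x \<longrightarrow> gap h h' y = 1 \<and> B_step h h' y)"
      using True g by (auto simp: less_Suc_eq)
    then show ?thesis using c(1) by blast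
  next
    case False then show ?thesis using corner_right[of "Suc x"] Suc by auto
  qed
qed

text \<open>This is the case j = 1, where the bound is 2^2 - 2 = 2.\<close>

lemma corner_sum:
  assumes "Q_like h h'" "finite X" "X \<noteq> {}" "\<And>d. d \<in> X \<Longrightarrow> corner d"
  shows "(\<Sum>d\<in>X. (2::real) ^ (of_bool (gap h h' (Suc d) = 1) + of_bool (d \<noteq> 0 \<and> gap h h' (d - 1) = 1))) \<le> 2"
proof -
  obtain d where d: "d \<in> X" using assms by auto
  then have "d \<in> level h h' (Suc 0)" using assms(4)[of d] by (simp add: level_gap_iff corner_def)
  then have "level_size h h' 1 > 0" using level_size_pos[OF skew_axioms] by simp
  then obtain L where L: "1 < L" "raised L h h' = h'" "near_value 1 L \<le> 2"
    using Q_like_bound[OF assms(1), of 1] by auto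
  have e: "d \<in> level h h' 1 - level h h' 2 \<longleftrightarrow> gap h h' d = 1" for d by (auto simp: level_gap_iff)
  have "(\<Sum>d\<in>X. (2::real) ^ (of_bool (gap h h' (Suc d) = 1) + of_bool (d \<noteq> 0 \<and> gap h h' (d - 1) = 1))) \<le> near_value 1 L"
    unfolding e[symmetric]
    by (rule near_corner_sum[OF L(2) assms(2) _ L(1)]) (use assms(4) corner_hole in \<open>auto simp: corner_def level_gap_iff\<close>)
  then show ?thesis using L by simp
qed

end

text \<open>The corner at the right end of an N-plateau has a left neighbour of gap one and so uses
  up the whole bound 2. It is the only corner, and every diagonal of gap one must lead to
  it.\<close>

lemma plateau_N:
  assumes Q: "Q_like h h'" and y: "gap h h' y = 1" "gap h h' (Suc y) = 1" "N_step h h' y"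
  shows "\<exists>e. \<forall>x. gap h h' x = 1 \<longrightarrow> x \<le> e \<and> (\<forall>y. x \<le> y \<and> y < e \<longrightarrow> gap h h' y = 1 \<and> N_step h h' y)"
proof -
  interpret skew h h' using Q by (rule Q_like_skew)
  have "\<not> B_step h h' y" using y by (auto simp: N_step_def B_step_def)
  then obtain e where e: "e \<ge> Suc y" "corner e" "\<forall>x. Suc y \<le> x \<and> x < e \<longrightarrow> gap h h' x = 1 \<and> N_step h h' x"
    using corner_right[of "Suc y"] y by auto
  have pe: "e \<noteq> 0 \<and> gap h h' (e - 1) = 1" using e y by (cases "e = Suc y") auto
  have u: "c = e" if "corner c" for c
  proof (rule ccontr)
    assume "c \<noteq> e"
    then have "(\<Sum>d\<in>{e, c}. (2::real) ^ (of_bool (gap h h' (Suc d) = 1) + of_bool (d \<noteq> 0 \<and> gap h h' (d - 1) = 1))) =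
      2 ^ (of_bool (gap h h' (Suc e) = 1) + 1) + 2 ^ (of_bool (gap h h' (Suc c) = 1) + of_bool (c \<noteq> 0 \<and> gap h h' (c - 1) = 1))"
      using pe by simp
    moreover have "(2::real) ^ (of_bool (gap h h' (Suc e) = 1) + 1) \<ge> 2" "(2::real) ^ k \<ge> 1" for k
      by (auto simp: power_increasing[of 1 _ "2::real", simplified])
    ultimately show False using corner_sum[OF Q, of "{e, c}"] e that
      by (smt (verit) empty_iff finite.emptyI finite_insert insert_iff)
  qed
  have "gap h h' (Suc e) \<noteq> 1"
  proof
    assume "gap h h' (Suc e) = 1"
    then show False using corner_sum[OF Q, of "{e}"] e pe by simp
  qed
  then have nb: "\<not> B_step h h' e" using gap_step(1)[of e] e by (auto simp: corner_def)
  have "x \<le> e \<and> (\<forall>y. x \<le> y \<and> y < e \<longrightarrow> gap h h' y = 1 \<and> N_step h h' y)" if gx: "gap h h' x = 1" for x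
  proof -
    obtain c where "corner c" "x \<le> c \<and> (\<forall>y. x \<le> y \<and> y < c \<longrightarrow> gap h h' y = 1 \<and> N_step h h' y) \<or>
      c \<le> x \<and> (\<forall>y. c \<le> y \<and> y < x \<longrightarrow> gap h h' y = 1 \<and> B_step h h' y)" using corner_near[OF gx] by blast
    then have "x \<le> e \<and> (\<forall>y. x \<le> y \<and> y < e \<longrightarrow> gap h h' y = 1 \<and> N_step h h' y) \<or>
      e \<le> x \<and> (\<forall>y. e \<le> y \<and> y < x \<longrightarrow> gap h h' y = 1 \<and> B_step h h' y)" using u by blast
    then show ?thesis using nb by (cases "e < x") auto
  qed
  then show ?thesis by blast
qed

lemma plateau_B:
  assumes Q: "Q_like h h'" and y: "gap h h' y = 1" "gap h h' (Suc y) = 1" "B_step h h' y"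
  shows "\<exists>e. \<forall>x. gap h h' x = 1 \<longrightarrow> e \<le> x \<and> (\<forall>y. e \<le> y \<and> y < x \<longrightarrow> gap h h' y = 1 \<and> B_step h h' y)"
proof -
  interpret skew h h' using Q by (rule Q_like_skew)
  have "\<not> N_step h h' y" using y by (auto simp: N_step_def B_step_def)
  then obtain e where e: "e \<le> y" "corner e" "\<forall>x. e \<le> x \<and> x < y \<longrightarrow> gap h h' x = 1 \<and> B_step h h' x"
  proof -
    obtain c where c: "corner c" "y \<le> c \<and> (\<forall>z. y \<le> z \<and> z < c \<longrightarrow> gap h h' z = 1 \<and> N_step h h' z) \<or>
      c \<le> y \<and> (\<forall>z. c \<le> z \<and> z < y \<longrightarrow> gap h h' z = 1 \<and> B_step h h' z)" using corner_near[OF y(1)] by blast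
    show ?thesis
    proof (cases "y < c")
      case True
      then show ?thesis using c(2) \<open>\<not> N_step h h' y\<close> by auto
    next
      case False
      then have "c \<le> y \<and> (\<forall>z. c \<le> z \<and> z < y \<longrightarrow> gap h h' z = 1 \<and> B_step h h' z)" using c(2) by (cases "c = y") auto
      then show ?thesis using that[of c] c(1) by blast
    qed
  qed
  have pe: "gap h h' (Suc e) = 1" using e y gap_step(1)[of e] by (cases "e = y") auto
  have u: "c = e" if "corner c" for c
  proof (rule ccontr)
    assume "c \<noteq> e"
    then have "(\<Sum>d\<in>{e, c}. (2::real) ^ (of_bool (gap h h' (Suc d) = 1) + of_bool (d \<noteq> 0 \<and> gap h h' (d - 1) = 1))) =
      2 ^ (1 + of_bool (e \<noteq> 0 \<and> gap h h' (e - 1) = 1)) + 2 ^ (of_bool (gap h h' (Suc c) = 1) + of_bool (c \<noteq> 0 \<and> gap h h' (c - 1) = 1))"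
      using pe by simp
    moreover have "(2::real) ^ (1 + of_bool (e \<noteq> 0 \<and> gap h h' (e - 1) = 1)) \<ge> 2" "(2::real) ^ k \<ge> 1" for k
      by (auto simp: power_increasing[of 1 _ "2::real", simplified])
    ultimately show False using corner_sum[OF Q, of "{e, c}"] e that
      by (smt (verit) empty_iff finite.emptyI finite_insert insert_iff)
  qed
  have "e \<noteq> 0 \<longrightarrow> gap h h' (e - 1) \<noteq> 1"
  proof (intro impI notI)
    assume "e \<noteq> 0" "gap h h' (e - 1) = 1"
    then show False using corner_sum[OF Q, of "{e}"] e pe by simp
  qed
  then have nb: "e \<noteq> 0 \<longrightarrow> \<not> N_step h h' (e - 1)" using gap_step(1)[of "e - 1"] e by (auto simp: corner_def)
  have "e \<le> x \<and> (\<forall>y. e \<le> y \<and> y < x \<longrightarrow> gap h h' y = 1 \<and> B_step h h' y)" if x: "gap h h' x = 1" for x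
  proof -
    obtain c where "corner c" "x \<le> c \<and> (\<forall>y. x \<le> y \<and> y < c \<longrightarrow> gap h h' y = 1 \<and> N_step h h' y) \<or>
     c \<le> x \<and> (\<forall>y. c \<le> y \<and> y < x \<longrightarrow> gap h h' y = 1 \<and> B_step h h' y)" using corner_near[OF x] by blast
    then have "x \<le> e \<and> (\<forall>y. x \<le> y \<and> y < e \<longrightarrow> gap h h' y = 1 \<and> N_step h h' y) \<or>
     e \<le> x \<and> (\<forall>y. e \<le> y \<and> y < x \<longrightarrow> gap h h' y = 1 \<and> B_step h h' y)" using u by blast
    moreover have "x \<ge> e" if "x \<le> e \<and> (\<forall>y. x \<le> y \<and> y < e \<longrightarrow> gap h h' y = 1 \<and> N_step h h' y)"
    proof (rule ccontr)
      assume "\<not> x \<ge> e"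
      then have "x \<le> e - 1 \<and> e - 1 < e" "e \<noteq> 0" by auto
      then show False using that nb by blast
    qed
    ultimately show ?thesis by fastforce
  qed
  then show ?thesis by blast
qed

text \<open>Two separated occurrences exclude plateaus of gap one, so each diagonal of gap one is a
  corner of weight at least 1, and only two fit under the bound.\<close>

lemma gap_one_split:
  assumes Q: "Q_like h h'" and xy: "gap h h' x = 1" "gap h h' y = 1" "x < w" "w < y" "gap h h' w \<noteq> 1" and v: "gap h h' v = 1"
  shows "v = x \<or> v = y"
proof (rule ccontr)
  interpret skew h h' using Q by (rule Q_like_skew)
  assume vxy: "\<not> (v = x \<or> v = y)"
  have na: "gap h h' (Suc d) \<noteq> 1" if d: "gap h h' d = 1" for d
  proof
    assume s: "gap h h' (Suc d) = 1"
    then consider "N_step h h' d" | "B_step h h' d" using gap_step(1)[of d] d by auto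
    then show False
    proof cases
      case 1
      obtain e where e: "gap h h' x = 1 \<longrightarrow> x \<le> e \<and> (\<forall>y. x \<le> y \<and> y < e \<longrightarrow> gap h h' y = 1 \<and> N_step h h' y)" for x
        using plateau_N[OF Q d s 1] by blast
      have "y \<le> e" using e[of y] xy by blast
      then show False using e[of x] xy by auto
    next
      case 2
      obtain e where e: "gap h h' x = 1 \<longrightarrow> e \<le> x \<and> (\<forall>y. e \<le> y \<and> y < x \<longrightarrow> gap h h' y = 1 \<and> B_step h h' y)" for x
        using plateau_B[OF Q d s 2] by blast
      have "e \<le> x" using e[of x] xy by blast
      then show False using e[of y] xy by auto
    qed
  qed
  have c: "corner d" if "gap h h' d = 1" for d
    using gap_step(1)[of d] gap_step(1)[of "d - 1"] na[of d] na[of "d - 1"] that by (cases d) (auto simp: corner_def)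
  have "(2::real) ^ k \<ge> 1" for k by simp
  then have "(\<Sum>d\<in>{x, y, v}. (1::real)) \<le> (\<Sum>d\<in>{x, y, v}. 2 ^ (of_bool (gap h h' (Suc d) = 1) + of_bool (d \<noteq> 0 \<and> gap h h' (d - 1) = 1)))"
    by (intro sum_mono) auto
  also have "\<dots> \<le> 2" by (rule corner_sum[OF Q]) (use c xy v in auto)
  finally show False using vxy xy by simp
qed

text \<open>Raising lowers the common gap to one; then all diagonals of that gap lie on a single
  N-plateau, which has no room for a B-step.\<close>

lemma plateau_type:
  assumes Q: "Q_like h h'" and s: "gap h h' x \<ge> 1" and y: "gap h h' y = gap h h' x" and st: "N_step h h' x" "B_step h h' y"
  shows False
proof -
  interpret skew h h' using Q by (rule Q_like_skew)
  define H where "H = raised (gap h h' x - 1) h h'"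
  have QH: "Q_like H h'" unfolding H_def by (rule Q_like_raised[OF Q])
  have s': "gap h h' (Suc x) = gap h h' x" "gap h h' (Suc y) = gap h h' x" using gap_step(1)[of x] gap_step(1)[of y] st y by auto
  have g: "gap H h' d = 1 \<longleftrightarrow> gap h h' d = gap h h' x" for d using s by (auto simp: H_def gap_raised)
  have st': "N_step H h' x" "B_step H h' y" using steps_raised[of "gap h h' x - 1" x] steps_raised[of "gap h h' x - 1" y] s' y st by (auto simp: H_def)
  have g4: "gap H h' x = 1" "gap H h' (Suc x) = 1" "gap H h' y = 1" "gap H h' (Suc y) = 1" using g s' y by auto
  obtain e where e: "gap H h' v = 1 \<longrightarrow> v \<le> e \<and> (\<forall>y. v \<le> y \<and> y < e \<longrightarrow> gap H h' y = 1 \<and> N_step H h' y)" for v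
    using plateau_N[OF QH g4(1,2) st'(1)] by blast
  have "Suc y \<le> e" using e[of "Suc y"] g4 by blast
  then have "N_step H h' y" using e[of y] g4 by auto
  then show False using st'(2) by (auto simp: N_step_def B_step_def)
qed

lemma gap_split:
  assumes Q: "Q_like h h'" and s: "s \<ge> 1" and xy: "gap h h' x = s" "gap h h' y = s" "x < w" "w < y" "gap h h' w \<noteq> s" and v: "gap h h' v = s"
  shows "v = x \<or> v = y"
proof -
  interpret skew h h' using Q by (rule Q_like_skew)
  have g: "gap (raised (s - 1) h h') h' d = 1 \<longleftrightarrow> gap h h' d = s" for d using s by (auto simp: gap_raised)
  show ?thesis by (rule gap_one_split[OF Q_like_raised[OF Q, of "s - 1"], of x y w v]) (use xy v g in auto)
qed

section \<open>Patterns excluded around a descent\<close>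

text \<open>The gap falls from j at z to 1 at z + j - 1 while h stays constant. That the
  intermediate gaps occur nowhere else makes consecutive level sizes differ by one, the hypothesis
  of \<open>Q_like_bound\<close>.\<close>

definition descends :: "(nat \<Rightarrow> nat) \<Rightarrow> (nat \<Rightarrow> nat) \<Rightarrow> nat \<Rightarrow> nat \<Rightarrow> bool" where
  "descends h h' z j \<longleftrightarrow> 2 \<le> j \<and> 1 \<le> z \<and> (\<forall>i<j. h (z + i) = h z \<and> gap h h' (z + i) + i = j) \<and>
     (\<forall>a d. 1 < a \<and> a < j \<and> gap h h' d = a \<longrightarrow> d = z + (j - a))"

lemma complement_steps:
  assumes "skew h h'" "h \<in> below (staircase n)" "h' \<in> below (staircase n)"
  shows "gap (complement n h') (complement n h) d = gap h h' d"
    "d < n \<Longrightarrow> N_step (complement n h') (complement n h) d = B_step h h' d" "d < n \<Longrightarrow> B_step (complement n h') (complement n h) d = N_step h h' d"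
    "d < n \<Longrightarrow> L_step (complement n h') (complement n h) d = L_step h h' d" "d < n \<Longrightarrow> M_step (complement n h') (complement n h) d = M_step h h' d"
proof -
  note c = complement_id[OF assms(2), of d] complement_id[OF assms(3), of d] complement_id[OF assms(2), of "Suc d"] complement_id[OF assms(3), of "Suc d"]
    skew.hh[OF assms(1), of d]
  show "gap (complement n h') (complement n h) d = gap h h' d" using c unfolding gap_def by linarith
  assume "d < n"
  then have n: "n - d = Suc (n - Suc d)" by simp
  note c' = c[unfolded n] skew.step_cases[OF assms(1), of d, unfolded N_step_def B_step_def L_step_def M_step_def]
  show "N_step (complement n h') (complement n h) d = B_step h h' d" using c' unfolding N_step_def B_step_def by auto
  show "B_step (complement n h') (complement n h) d = N_step h h' d" using c' unfolding N_step_def B_step_def by auto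
  show "L_step (complement n h') (complement n h) d = L_step h h' d" using c' unfolding L_step_def by auto
  show "M_step (complement n h') (complement n h) d = M_step h h' d" using c' unfolding M_step_def by auto
qed

lemma desc_complement:
  assumes s: "skew h h'" "h \<in> below (staircase n)" "h' \<in> below (staircase n)" and d: "descends h h' z j" and n: "z + j \<le> n"
  shows "descends (complement n h') (complement n h) z j"
proof -
  have "complement n h' (z + i) = complement n h' z" if "i < j" for i
  proof -
    have "h (z + i) = h z" "gap h h' (z + i) + i = j" "gap h h' (z + 0) + 0 = j" using d that unfolding descends_def by (blast, blast, force)
    then have "h' (z + i) + i = h' z" using skew.h'_gap[OF s(1), of "z + i"] skew.h'_gap[OF s(1), of z] by simp
    then show ?thesis using complement_id[OF s(3), of "z + i"] complement_id[OF s(3), of z] n that by linarith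
  qed
  then show ?thesis using d by (simp add: descends_def complement_steps(1)[OF s])
qed

lemma desc_stairs:
  assumes Q: "Q_like h h'" and d: "descends h h' z j"
    and a: "h (z - 1) = h z" "h z + j \<le> h' (z - 1)" and b: "raised 1 h h' (z + j) = h z" "z + j \<notin> level h h' 2"
  obtains L where "stairs h h' z j L (h z)" "skew.near_value h h' j L \<le> 2 ^ (j + 1) - 2"
proof -
  interpret skew h h' using Q by (rule Q_like_skew)
  have c: "h (z + i) = h z" "gap h h' (z + i) = j - i" if "i < j" for i
    using d that unfolding descends_def by (blast, fastforce)
  have j: "2 \<le> j" "1 \<le> z" using d unfolding descends_def by auto
  have n: "level_size h h' e = Suc (level_size h h' (Suc e))" if e: "1 < e" "e < j" for e
  proof -
    have "gap h h' (z + (j - e)) = e" using c(2)[of "j - e"] e by simp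
    moreover have "\<forall>d. gap h h' d = e \<longrightarrow> d = z + (j - e)" using d e unfolding descends_def by blast
    ultimately have u: "gap h h' d = e \<longleftrightarrow> d = z + (j - e)" for d by metis
    have "d \<in> level h h' e \<longleftrightarrow> d = z + (j - e) \<or> d \<in> level h h' (Suc e)" for d
      unfolding level_gap_iff u[symmetric] by linarith
    then have "level h h' e = insert (z + (j - e)) (level h h' (Suc e))" by (simp add: set_eq_iff)
    moreover have "z + (j - e) \<notin> level h h' (Suc e)" using u[of "z + (j - e)"] by (simp add: level_gap_iff)
    ultimately have "level h h' e = insert (z + (j - e)) (level h h' (Suc e))" "z + (j - e) \<notin> level h h' (Suc e)" .
    then show ?thesis by (simp add: level_size_def)
  qed
  have "z \<in> level h h' (Suc (j - 1))" using c(2)[of 0] j by (simp add: level_gap_iff)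
  from level_size_pos[OF skew_axioms this] have np: "level_size h h' j > 0" using j by simp
  obtain L where L: "j < L" "raised L h h' = h'" "near_value j L \<le> 2 ^ (j + 1) - 2"
    by (rule Q_like_bound[OF Q _ np n]) (use j in auto)
  have "stairs h h' z j L (h z)"
  proof
    fix s assume s: "1 \<le> s" "s \<le> j"
    then have "z + j - s = z + (j - s)" "j - s < j" by auto
    then show "h (z + j - s) = h z \<and> h' (z + j - s) = h z + s"
      using c[of "j - s"] h'_gap[of "z + (j - s)"] s by simp
  qed (use L j a b in auto)
  then show ?thesis using that L by blast
qed

lemma descE:
  assumes "skew h h'" "descends h h' z j"
  shows "h (z + j - 1) = h z" "h' (z + j - 1) = Suc (h z)" "h' z = h z + j" "Suc (z + j - 1) = z + j" "Suc (z - 1) = z" "j \<ge> 2" "z \<ge> 1"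
proof -
  have j: "2 \<le> j" "1 \<le> z" and c: "\<forall>i<j. h (z + i) = h z \<and> gap h h' (z + i) + i = j" using assms unfolding descends_def by auto
  have e: "z + j - 1 = z + (j - 1)" using j by auto
  have "h (z + (j - 1)) = h z \<and> gap h h' (z + (j - 1)) + (j - 1) = j" "gap h h' (z + 0) + 0 = j"
    by (rule c[rule_format], use j in simp, rule c[rule_format, THEN conjunct2], use j in simp)
  then show "h (z + j - 1) = h z" "h' (z + j - 1) = Suc (h z)" "h' z = h z + j" "Suc (z + j - 1) = z + j" "Suc (z - 1) = z" "j \<ge> 2" "z \<ge> 1"
    unfolding e using skew.h'_gap[OF assms(1), of z] skew.h'_gap[OF assms(1), of "z + (j - 1)"] j by auto
qed

text \<open>Applied where the gap at b is zero: the gap then rises to one on b + 1 alone, an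
  isolated box.\<close>

definition box :: "(nat \<Rightarrow> nat) \<Rightarrow> (nat \<Rightarrow> nat) \<Rightarrow> nat \<Rightarrow> bool" where
  "box h h' b \<longleftrightarrow> L_step h h' (b - 1) \<and> M_step h h' b \<and> L_step h h' (Suc b)"

text \<open>The gap starts with j, rises, and comes back down to j at z, so that a hole can wait on
  the main diagonal.\<close>

definition climb :: "(nat \<Rightarrow> nat) \<Rightarrow> (nat \<Rightarrow> nat) \<Rightarrow> nat \<Rightarrow> nat \<Rightarrow> bool" where
  "climb h h' z j \<longleftrightarrow> gap h h' 0 = j \<and> M_step h h' 0 \<and> L_step h h' (z - 1)"

text \<open>The N-step keeps z - 1 at gap j, so closing the hole starts a new run; the B-step puts z
  + j into level 1. This is the situation of \<open>two_types\<close>.\<close>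

lemma no_N_B: assumes Q: "Q_like h h'" and d: "descends h h' z j" and s: "N_step h h' (z - 1)" "B_step h h' (z + j - 1)" shows False
proof -
  interpret skew h h' using Q by (rule Q_like_skew)
  note e = descE[OF skew_axioms d]
  obtain L where L: "stairs h h' z j L (h z)" "near_value j L \<le> 2 ^ (j + 1) - 2"
    by (rule desc_stairs[OF Q d]) (use e s in \<open>auto simp: N_step_def B_step_def raised_def level_def\<close>)
  show False using stairs.two_types[OF L(1)] L(2) e s by (auto simp: N_step_def B_step_def level_def)
qed

lemma no_climb_B: assumes Q: "Q_like h h'" and d: "descends h h' z j" and s: "climb h h' z j" "B_step h h' (z + j - 1)" shows False
proof -
  interpret skew h h' using Q by (rule Q_like_skew)
  note e = descE[OF skew_axioms d]
  obtain L where L: "stairs h h' z j L (h z)" "near_value j L \<le> 2 ^ (j + 1) - 2"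
    by (rule desc_stairs[OF Q d]) (use e s in \<open>auto simp: climb_def L_step_def B_step_def raised_def level_def\<close>)
  show False using stairs.up_then_plateau[OF L(1)] L(2) e s h'_gap[of 0] by (auto simp: climb_def L_step_def M_step_def B_step_def level_def)
qed

lemma no_N_box: assumes Q: "Q_like h h'" and d: "descends h h' z j" and s: "N_step h h' (z - 1)" "box h h' (z + j)" shows False
proof -
  interpret skew h h' using Q by (rule Q_like_skew)
  note e = descE[OF skew_axioms d]
  obtain L where L: "stairs h h' z j L (h z)" "near_value j L \<le> 2 ^ (j + 1) - 2"
    by (rule desc_stairs[OF Q d]) (use e s in \<open>auto simp: N_step_def L_step_def M_step_def box_def raised_def level_def\<close>)
  show False using stairs.plateau_and_box[OF L(1)] L(2) e s by (auto simp: N_step_def L_step_def M_step_def box_def level_def)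
qed

lemma no_climb_box: assumes Q: "Q_like h h'" and d: "descends h h' z j" and s: "climb h h' z j" "box h h' (z + j)" shows False
proof -
  interpret skew h h' using Q by (rule Q_like_skew)
  note e = descE[OF skew_axioms d]
  obtain L where L: "stairs h h' z j L (h z)" "near_value j L \<le> 2 ^ (j + 1) - 2"
    by (rule desc_stairs[OF Q d]) (use e s in \<open>auto simp: climb_def box_def L_step_def M_step_def raised_def level_def\<close>)
  show False using stairs.up_and_box[OF L(1)] L(2) e s h'_gap[of 0] by (auto simp: climb_def box_def L_step_def M_step_def level_def)
qed

lemma ex_below: assumes "skew h h'"
  obtains n where "h \<in> below (staircase n)" "h' \<in> below (staircase n)" "n > m"
proof -
  interpret skew h h' by fact
  have 1: "h' \<in> below (staircase (width h' + Suc m))" using below_staircase_iff[of h' "width h' + Suc m"] ah' by simp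
  then have "h \<in> below (staircase (width h' + Suc m))" using hh belowD(2)[OF 1] by (intro belowI ah) (meson le_trans)
  then show ?thesis using 1 that[of "width h' + Suc m"] by simp
qed

text \<open>The complement exchanges N and B and keeps gaps and descent, so this is the mirror image
  of \<open>no_N_B\<close>.\<close>

lemma no_B_N: assumes Q: "Q_like h h'" and d: "descends h h' z j" and s: "B_step h h' (z - 1)" "N_step h h' (z + j - 1)" shows False
proof -
  note sk = Q_like_skew[OF Q]
  obtain n where n: "h \<in> below (staircase n)" "h' \<in> below (staircase n)" "n > z + j" using ex_below[OF sk] .
  show False by (rule no_N_B[OF Q_like_complement[OF Q n(1,2)] desc_complement[OF sk n(1,2) d]])
    (use s n complement_steps[OF sk n(1,2)] in auto)
qed

lemma no_climb_N: assumes Q: "Q_like h h'" and d: "descends h h' z j" and s: "climb h h' z j" "N_step h h' (z + j - 1)" shows False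
proof -
  note sk = Q_like_skew[OF Q]
  obtain n where n: "h \<in> below (staircase n)" "h' \<in> below (staircase n)" "n > z + j" using ex_below[OF sk] .
  show False by (rule no_climb_B[OF Q_like_complement[OF Q n(1,2)] desc_complement[OF sk n(1,2) d]])
    (use s n complement_steps[OF sk n(1,2)] in \<open>auto simp: climb_def\<close>)
qed

lemma no_B_box: assumes Q: "Q_like h h'" and d: "descends h h' z j" and s: "B_step h h' (z - 1)" "box h h' (z + j)" shows False
proof -
  note sk = Q_like_skew[OF Q]
  obtain n where n: "h \<in> below (staircase n)" "h' \<in> below (staircase n)" "n > Suc (z + j)" using ex_below[OF sk] .
  show False by (rule no_N_box[OF Q_like_complement[OF Q n(1,2)] desc_complement[OF sk n(1,2) d]])
    (use s n complement_steps[OF sk n(1,2)] in \<open>auto simp: box_def\<close>)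
qed

context skew begin

lemma gap_step_le: "gap h h' (Suc d) \<le> Suc (gap h h' d)" "gap h h' d \<le> Suc (gap h h' (Suc d))"
  using height_fnD[OF ah, of d] height_fnD[OF ah', of d] h'_gap[of d] h'_gap[of "Suc d"] by linarith+

text \<open>The gap changes by at most one per step and is eventually zero.\<close>

lemma gap_ivt: "s \<le> gap h h' x \<Longrightarrow> s \<ge> 1 \<Longrightarrow> \<exists>y\<ge>x. gap h h' y = s"
proof (induction "width h' - x" arbitrary: x rule: less_induct)
  case less
  show ?case
  proof (cases "gap h h' x = s")
    case False
    then have "s \<le> gap h h' (Suc x)" using less.prems gap_step_le(2)[of x] by linarith
    moreover have "width h' - Suc x < width h' - x" using gap_end[of x] less.prems by simp
    ultimately obtain y where "y \<ge> Suc x" "gap h h' y = s" using less.hyps[of "Suc x"] less.prems by auto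
    then show ?thesis by (intro exI[of _ y]) auto
  qed auto
qed

end

text \<open>Since a separated gap value occurs only twice, everything around the valley is forced:
  after u + 1 the gap must fall twice, and before u - 1 it falls as well unless u = 1.\<close>

lemma no_valley:
  assumes Q: "Q_like h h'" and u: "u \<ge> 1" "gap h h' u = s" "s \<ge> 1" and st: "L_step h h' (u - 1)" "M_step h h' u"
  shows False
proof -
  interpret skew h h' using Q by (rule Q_like_skew)
  have g: "gap h h' (u - 1) = Suc s" "gap h h' (Suc u) = Suc s"
    using gap_step(3)[of "u - 1"] gap_step(2)[of u] st u by auto
  have sep: "v = u - 1 \<or> v = Suc u" if "gap h h' v = Suc s" for v
    by (rule gap_split[OF Q, of "Suc s" "u - 1" "Suc u" u]) (use u g that in auto)
  have n: "gap h h' (Suc (Suc u)) \<noteq> Suc s" using sep[of "Suc (Suc u)"] u by auto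
  have L1: "L_step h h' (Suc u)"
  proof (rule ccontr)
    assume "\<not> L_step h h' (Suc u)"
    then have m: "gap h h' (Suc (Suc u)) = Suc (Suc s)" using step_cases[of "Suc u"] gap_step(1)[of "Suc u"] gap_step(2)[of "Suc u"] g n by auto
    obtain x where "Suc (Suc u) \<le> x" "gap h h' x = Suc s"
      using gap_ivt[of "Suc s" "Suc (Suc u)"] m by auto
    then show False using sep[of x] u by auto
  qed
  have g2: "gap h h' (Suc (Suc u)) = s" using gap_step(3)[of "Suc u"] L1 g by simp
  have sep': "v = u \<or> v = Suc (Suc u)" if "gap h h' v = s" for v
    by (rule gap_split[OF Q, of s u "Suc (Suc u)" "Suc u"]) (use u g g2 that in auto)
  have L2: "L_step h h' (Suc (Suc u))"
    using step_cases[of "Suc (Suc u)"] gap_step(1)[of "Suc (Suc u)"] gap_step(2)[of "Suc (Suc u)"] g2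
      sep[of "Suc (Suc (Suc u))"] sep'[of "Suc (Suc (Suc u))"] u by auto
  have g3: "gap h h' (Suc (Suc (Suc u))) = s - 1" using gap_step(3)[of "Suc (Suc u)"] L2 g2 by simp
  have L0: "L_step h h' (u - 2)" "gap h h' (u - 2) = Suc (Suc s)" if "u \<noteq> 1"
  proof -
    define w where "w = u - 2"
    have w: "u = Suc (Suc w)" using that u(1) unfolding w_def by linarith
    have gw: "gap h h' (Suc w) = Suc s" using g(1) w by simp
    have "gap h h' w \<noteq> Suc s" "gap h h' w \<noteq> s" using sep[of w] sep'[of w] w by auto
    then have *: "gap h h' w = Suc (gap h h' (Suc w))" using gap_step_le[of w] gw by linarith
    show "L_step h h' (u - 2)" "gap h h' (u - 2) = Suc (Suc s)" using * gw w gap_step(3)[of w] by simp_all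
  qed
  \<comment> \<open>Filling s - 1 times lowers the gaps on u - 1, ..., u + 3 to 2, 1, 2, 1,
    0.\<close>
  define H where "H = raised (s - 1) h h'"
  have QH: "Q_like H h'" unfolding H_def by (rule Q_like_raised[OF Q])
  interpret H: skew H h' using QH by (rule Q_like_skew)
  have fH: "H d = h d + (s - 1)" if "s - 1 \<le> gap h h' d" for d using raised_gap[OF that] by (simp add: H_def)
  have "u - 1 \<in> level H h' (Suc 1)" unfolding H.level_gap_iff using g u by (simp add: H_def gap_raised)
  from level_size_pos[OF H.skew_axioms this] have "level_size H h' 2 > 0" by (simp add: numeral_2_eq_2)
  then obtain L where L: "2 < L" "raised L H h' = h'" "H.near_value 2 L \<le> 2 ^ (2 + 1) - 2"
    using Q_like_bound[OF QH, of 2] by auto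
  have u1: "Suc (u - 1) = u" using u by simp
  define K where "K = h (Suc u) + (s - 1)"
  have "H.near_value 2 L \<ge> 7"
  proof (rule H.valley_above_box[OF L(2,1) u(1), of K])
    have "h (Suc u) = h (Suc (Suc u))" "h (Suc u) = h (Suc (Suc (Suc u)))" "h u = Suc (h (Suc u))" "h (u - 1) = h u"
      using L1 L2 st u1 by (auto simp: L_step_def M_step_def)
    note hs = this
    have "h' (u - 1) = h (u - 1) + Suc s" "h' u = h u + s" "h' (Suc u) = h (Suc u) + Suc s" "h' (Suc (Suc u)) = h (Suc (Suc u)) + s"
      "h' (Suc (Suc (Suc u))) = h (Suc (Suc (Suc u))) + (s - 1)"
      using h'_gap g g2 g3 u by auto
    note hs' = this
    have "H (u - 1) = h (u - 1) + (s - 1)" "H u = h u + (s - 1)" "H (Suc u) = h (Suc u) + (s - 1)" "H (Suc (Suc u)) = h (Suc (Suc u)) + (s - 1)"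
      "H (Suc (Suc (Suc u))) = h (Suc (Suc (Suc u))) + (s - 1)"
      by (rule fH, use g g2 g3 u in linarith)+
    note Hs = this
    have u2: "u + 1 = Suc u" "u + 2 = Suc (Suc u)" "u + 3 = Suc (Suc (Suc u))" by auto
    show "H (u - 1) = Suc K" "h' (u - 1) = K + 3" "H u = Suc K" "h' u = K + 2" "H (u + 1) = K" "h' (u + 1) = K + 2"
      "H (u + 2) = K" "h' (u + 2) = K + 1" "H (u + 3) = K" "h' (u + 3) = K"
      unfolding u2 K_def using hs hs' Hs u(3) by linarith+
    show "u = 1 \<or> H (u - 2) = Suc K \<and> h' (u - 2) = K + 4"
    proof (cases "u = 1")
      case False
      then have "Suc (u - 2) = u - 1" using u by auto
      then have "h (u - 2) = h (u - 1)" "h' (u - 2) = h (u - 2) + Suc (Suc s)" "H (u - 2) = h (u - 2) + (s - 1)"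
        using L0[OF False] h'_gap[of "u - 2"] fH[of "u - 2"] by (auto simp: L_step_def)
      then show ?thesis using hs u(3) by (simp add: K_def)
    qed simp
  qed
  then show False using L(3) by simp
qed

section \<open>Classification of the height functions\<close>

text \<open>\<open>zeros\<close> is basicness in terms of heights: where the gap vanishes inside the
  shape, the next part belongs to the smaller partition only.\<close>

locale basic_Q = skew +
  assumes Q: "Q_like h h'" and start: "h 0 < h' 0"
    and zeros: "\<And>z. h z = h' z \<Longrightarrow> h' z > 0 \<Longrightarrow> M_step h h' z"
begin

abbreviation "g \<equiv> gap h h'"
definition "zero_from = width h'"

lemma zero_from_iff: "h' d = 0 \<longleftrightarrow> zero_from \<le> d" using width_iff[OF ah'] by (simp add: zero_from_def)

lemma g_end: "zero_from \<le> d \<Longrightarrow> g d = 0" using zero_from_iff[of d] by (simp add: gap_def)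

lemma g_zero: "g z = 0 \<Longrightarrow> z < zero_from \<Longrightarrow> M_step h h' z"
  using zeros[of z] zero_from_iff[of z] h'_gap[of z] by simp

lemma g0: "g 0 \<ge> 1" using start by (simp add: gap_def)

lemmas step_le = gap_step_le

text \<open>At such a zero the gap returns to one at once, so z - 1 and z + 1 are the only diagonals
  of gap one. Hence it is zero again at z + 2, where another zero inside the shape would start a
  third one.\<close>

lemma zero_valley:
  assumes "g z = 0" "z < zero_from"
  shows "zero_from = Suc (Suc z)" "z \<ge> 1" "g (z - 1) = 1" "g (Suc z) = 1" "\<And>v. g v = 1 \<Longrightarrow> v = z - 1 \<or> v = Suc z"
proof -
  show z1: "z \<ge> 1" using assms g0 by (cases z) auto
  then have s: "Suc (z - 1) = z" by simp
  show gs: "g (Suc z) = 1" using g_zero[OF assms] gap_step(2)[of z] assms by simp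
  have "g (z - 1) \<noteq> 0"
  proof
    assume "g (z - 1) = 0"
    then have "M_step h h' (z - 1)" using g_zero[of "z - 1"] assms by simp
    then show False using gap_step(2)[of "z - 1"] s assms by simp
  qed
  then show gp: "g (z - 1) = 1" using step_le[of "z - 1"] s assms by simp
  show sep: "v = z - 1 \<or> v = Suc z" if "g v = 1" for v
    by (rule gap_split[OF Q, of 1 "z - 1" "Suc z" z]) (use assms z1 gp gs that in auto)
  have "g (Suc (Suc z)) \<noteq> 1" using sep[of "Suc (Suc z)"] by auto
  moreover have "g (Suc (Suc z)) \<le> 1"
  proof (rule ccontr)
    assume "\<not> g (Suc (Suc z)) \<le> 1"
    then obtain y where "y \<ge> Suc (Suc z)" "g y = 1" using gap_ivt[of 1 "Suc (Suc z)"] by auto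
    then show False using sep[of y] by auto
  qed
  ultimately have z2: "g (Suc (Suc z)) = 0" by simp
  have "\<not> Suc (Suc z) < zero_from"
  proof
    assume "Suc (Suc z) < zero_from"
    then have "g (Suc (Suc (Suc z))) = 1" using g_zero[OF z2] gap_step(2)[of "Suc (Suc z)"] z2 by simp
    then show False using sep[of "Suc (Suc (Suc z))"] by auto
  qed
  moreover have "Suc z < zero_from" using gs g_end[of "Suc z"] by (cases "Suc z < zero_from") auto
  ultimately show "zero_from = Suc (Suc z)" by simp
qed

lemma up_split:
  assumes "g (Suc d) = Suc (g d)" "g d \<ge> 1"
  obtains e where "e > Suc d" "g e = g d" "\<And>v. g v = g d \<Longrightarrow> v = d \<or> v = e"
proof -
  obtain e where e: "e \<ge> Suc d" "g e = g d" using gap_ivt[of "g d" "Suc d"] assms by auto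
  have "e \<noteq> Suc d" using e assms by auto
  then have "e > Suc d" using e by simp
  moreover have "v = d \<or> v = e" if "g v = g d" for v
    by (rule gap_split[OF Q, of "g d" d e "Suc d"]) (use assms e that \<open>e > Suc d\<close> in auto)
  ultimately show ?thesis using that e by blast
qed

text \<open>Just before an increase the gap cannot have been equal (its value would occur three
  times), nor larger (a valley), nor zero (the shape would already end). So it was increasing all
  the way from diagonal 0.\<close>

lemma up_initial: "g (Suc d) = Suc (g d) \<Longrightarrow> g d \<ge> 1 \<Longrightarrow> x \<le> Suc d \<Longrightarrow> g x = g 0 + x"
proof (induction d arbitrary: x)
  case 0 then show ?case by (cases x) auto
next
  case (Suc c)
  obtain e where e: "e > Suc (Suc c)" "\<And>v. g v = g (Suc c) \<Longrightarrow> v = Suc c \<or> v = e" using up_split[OF Suc.prems(1,2)] by metis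
  have "g c \<noteq> g (Suc c)" using e(2)[of c] e(1) by auto
  moreover have "g c \<noteq> Suc (g (Suc c))"
  proof
    assume "g c = Suc (g (Suc c))"
    then have "L_step h h' c" "M_step h h' (Suc c)" using gap_step(3)[of c] gap_step(2)[of "Suc c"] Suc.prems(1) by blast+
    then show False using no_valley[OF Q, of "Suc c" "g (Suc c)"] Suc.prems(2) by simp
  qed
  ultimately have up: "g (Suc c) = Suc (g c)" using step_le[of c] by linarith
  have "g c \<noteq> 0"
  proof
    assume c: "g c = 0"
    have "c < zero_from" using up g_end[of c] g_end[of "Suc c"] by (cases "c < zero_from") auto
    then have "zero_from = Suc (Suc c)" using zero_valley(1)[OF c] by simp
    then show False using g_end[of "Suc (Suc c)"] Suc.prems by simp
  qed
  then have "g c \<ge> 1" by simp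
  note IH = Suc.IH[OF up this]
  have "g (Suc c) = g 0 + Suc c" by (rule IH) simp
  then have "g (Suc (Suc c)) = g 0 + Suc (Suc c)" using Suc.prems(1) by simp
  then show ?case using IH[of x] Suc.prems(3) by (cases "x = Suc (Suc c)") (simp, linarith)
qed

definition "rise = (LEAST d. g (Suc d) \<noteq> Suc (g d))"

lemma rise_neq: "g (Suc rise) \<noteq> Suc (g rise)"
proof -
  have "g (Suc zero_from) \<noteq> Suc (g zero_from)" using g_end by simp
  then show ?thesis unfolding rise_def by (rule LeastI)
qed

lemma rise_up: "x \<le> rise \<Longrightarrow> g x = g 0 + x"
proof (induction x)
  case (Suc x)
  then have "g (Suc x) = Suc (g x)" using not_less_Least[of x "\<lambda>d. g (Suc d) \<noteq> Suc (g d)"] by (auto simp: rise_def)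
  then show ?case using Suc by simp
qed simp

lemma rise_step: assumes "x < rise" shows "M_step h h' x"
proof -
  have "g (Suc x) = Suc (g x)" using rise_up[of x] rise_up[of "Suc x"] assms by linarith
  then show ?thesis using gap_step(2) by blast
qed

lemma not_up: "rise \<le> d \<Longrightarrow> g d \<ge> 1 \<Longrightarrow> g (Suc d) \<le> g d"
proof (rule ccontr)
  assume d: "rise \<le> d" "g d \<ge> 1" "\<not> g (Suc d) \<le> g d"
  then have up: "g (Suc d) = Suc (g d)" using step_le[of d] by linarith
  have "g (Suc rise) = g 0 + Suc rise" "g rise = g 0 + rise" by (rule up_initial[OF up d(2)], use d(1) in simp)+
  then show False using rise_neq by linarith
qed

text \<open>The first zero of the gap. By \<open>P_cases\<close> it is the end of the shape or lies
  two diagonals before it.\<close>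

definition "P = (LEAST d. g d = 0)"

lemma P_zero: "g P = 0" unfolding P_def by (rule LeastI[of _ zero_from]) (simp add: g_end)
lemma P_pos: "d < P \<Longrightarrow> g d \<ge> 1" unfolding P_def using not_less_Least by fastforce
lemma rise_P: "rise < P"
proof (rule ccontr)
  assume "\<not> rise < P" then show False using rise_up[of P] P_zero g0 by linarith
qed
lemma P_le: "P \<le> zero_from" unfolding P_def by (rule Least_le) (simp add: g_end)

lemma P_cases: "P < zero_from \<Longrightarrow> zero_from = Suc (Suc P)" using zero_valley(1)[OF P_zero] .

lemma g_anti: assumes "rise \<le> x" "x \<le> y" "y \<le> P" shows "g y \<le> g x"
  using assms(2,1,3)
proof (induction y rule: dec_induct)
  case (step y) then show ?case using not_up[of y] P_pos[of y] by fastforce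
qed simp

definition "flat d \<longleftrightarrow> rise \<le> d \<and> d < P \<and> g (Suc d) = g d"

lemma drop: "rise \<le> d \<Longrightarrow> d < P \<Longrightarrow> \<not> flat d \<Longrightarrow> L_step h h' d"
  using not_up[of d] P_pos[of d] step_le[of d] gap_step(3)[of d] by (auto simp: flat_def)

lemma flat_type: "flat d \<Longrightarrow> N_step h h' d \<or> B_step h h' d" using gap_step(1)[of d] by (simp add: flat_def)

lemma drops: "rise \<le> z \<Longrightarrow> z + i \<le> P \<Longrightarrow> (\<And>d. z \<le> d \<Longrightarrow> d < z + i \<Longrightarrow> \<not> flat d) \<Longrightarrow> h (z + i) = h z \<and> g (z + i) + i = g z"
proof (induction i)
  case (Suc i)
  have "L_step h h' (z + i)" by (rule drop) (use Suc.prems in auto)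
  then show ?case using Suc.IH Suc.prems gap_step(3)[of "z + i"] by (auto simp: L_step_def)
qed simp

text \<open>The gap decreases strictly on both sides of x within a weakly decreasing stretch. The
  last two hypotheses keep the value from reappearing on the initial climb or in the box beyond
  P.\<close>

lemma unique_site:
  assumes x: "rise < x" "x < P" and st: "\<not> flat (x - 1)" "\<not> flat x" and d: "g d = g x"
    and r: "rise = 0 \<or> g x < g 0" and v: "P = zero_from \<or> g x \<ge> 2"
  shows "d = x"
proof -
  have lx: "g (x - 1) = Suc (g x)" "g x = Suc (g (Suc x))"
    using drop[of "x - 1"] drop[of x] x st gap_step(3)[of "x - 1"] gap_step(3)[of x] by auto
  have "rise \<le> d" using r d rise_up[of d] by linarith
  moreover have "d < P"
  proof (rule ccontr)
    assume "\<not> d < P"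
    have pos: "g x \<ge> 1" using P_pos x by simp
    then have "d < zero_from" using d g_end[of d] by (cases "d < zero_from") auto
    then have "P \<noteq> zero_from" using \<open>\<not> d < P\<close> by auto
    then have PW: "P < zero_from" "g x \<ge> 2" using P_le v by auto
    then have "d = P \<or> d = Suc P" using P_cases \<open>d < zero_from\<close> \<open>\<not> d < P\<close> by auto
    then show False using P_zero zero_valley(4)[OF P_zero PW(1)] PW d by auto
  qed
  ultimately show "d = x" using g_anti[of "Suc x" d] g_anti[of d "x - 1"] lx d x by (cases d x rule: linorder_cases) linarith+
qed

text \<open>A stretch without plateaus becomes a descent to gap one after raising by t; the
  uniqueness it requires is \<open>unique_site\<close>.\<close>

lemma descent:
  assumes z: "rise < z" "z + (j - 1) < P" and st: "\<And>d. z \<le> d \<Longrightarrow> d < z + (j - 1) \<Longrightarrow> \<not> flat d" and gz: "g z = t + j" and j: "2 \<le> j"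
    and r: "rise = 0 \<or> t + j \<le> g 0" and v: "P = zero_from \<or> t = 0"
  shows "descends (raised t h h') h' z j"
proof -
  have c: "h (z + i) = h z \<and> g (z + i) + i = g z" if "i < j" for i by (rule drops) (use z that st in auto)
  have f: "raised t h h' (z + i) = h z + t" if "i < j" for i using c[OF that] raised_gap[of t "z + i"] gz that by simp
  have "d = z + (j - a)" if a: "1 < a" "a < j" "gap (raised t h h') h' d = a" for a d
  proof (rule unique_site)
    have "g (z + (j - a)) = t + a" using c[of "j - a"] a gz by auto
    then show "g d = g (z + (j - a))" "P = zero_from \<or> 2 \<le> g (z + (j - a))" "rise = 0 \<or> g (z + (j - a)) < g 0"
      using a r v by (auto simp: gap_raised)
    have "z + (j - a) - 1 = z + (j - a - 1)" using a by auto
    then show "\<not> flat (z + (j - a) - 1)" using a z by (intro st) auto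
  qed (use z a st in auto)
  moreover have "gap (raised t h h') h' (z + i) + i = j" if "i < j" for i
    using c[OF that] gz that unfolding gap_raised by linarith
  moreover have "raised t h h' z = h z + t" using f[of 0] j by simp
  ultimately show ?thesis unfolding descends_def using f z(1) j by auto
qed

end

context basic_Q begin

lemma flat_gap: "flat d \<Longrightarrow> g (Suc d) = g d" "flat d \<Longrightarrow> g d \<ge> 1" "flat d \<Longrightarrow> Suc d < P"
proof -
  assume f: "flat d"
  show "g (Suc d) = g d" and p: "g d \<ge> 1" using f P_pos[of d] by (auto simp: flat_def)
  then have "Suc d \<noteq> P" using P_zero by auto
  then show "Suc d < P" using f by (simp add: flat_def)
qed

lemma N_B: "\<not> (N_step h h' d \<and> B_step h h' d)" by (auto simp: N_step_def B_step_def)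

text \<open>For a closest pair of plateau steps of different type, either both have the same gap, or
  the stretch between them is, after raising, a descent from an N to a B or from a B to an
  N.\<close>

lemma no_mixed_flat:
  assumes "rise = 0" "P = zero_from"
  shows "flat x \<Longrightarrow> flat y \<Longrightarrow> x < y \<Longrightarrow> N_step h h' x \<noteq> N_step h h' y \<Longrightarrow> False"
proof (induction "y - x" arbitrary: x y rule: less_induct)
  case less
  note fx = flat_gap[OF less.prems(1)] and fy = flat_gap[OF less.prems(2)]
  show False
  proof (cases "\<exists>w. x < w \<and> w < y \<and> flat w")
    case True
    then obtain w where w: "x < w" "w < y" "flat w" by blast
    have "y - w < y - x" "w - x < y - x" using w by auto
    then show False using less.hyps[of w x] less.hyps[of y w] w less.prems by blast
  next
    case False
    have nf: "\<not> flat d" if "Suc x \<le> d" "d < y" for d using False that by auto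
    have "g (Suc x + (y - Suc x)) + (y - Suc x) = g (Suc x)"
      using drops[of "Suc x" "y - Suc x"] nf less.prems assms by (auto simp: flat_def)
    then have gy: "g y + (y - Suc x) = g (Suc x)" using less.prems by simp
    have ty: "N_step h h' x \<and> B_step h h' y \<or> B_step h h' x \<and> N_step h h' y" using flat_type[OF less.prems(1)] flat_type[OF less.prems(2)] N_B less.prems by blast
    show False
    proof (cases "y = Suc x")
      case True
      then have "g y = g x" using fx(1) by simp
      then show False using ty plateau_type[OF Q fx(2)] plateau_type[OF Q fy(2)] by metis
    next
      case False
      define t j where "t = g y - 1" and "j = Suc (y - Suc x)"
      have tj: "g y = Suc t" "g (Suc x) = t + j" "Suc x + (j - 1) = y" "2 \<le> j" "Suc x + j - 1 = y"
        using fy gy less.prems False unfolding t_def j_def by linarith+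
      have d: "descends (raised t h h') h' (Suc x) j"
        by (rule descent) (use tj less.prems nf assms in \<open>auto simp: flat_def\<close>)
      have "t \<le> g x" "t \<le> g (Suc x)" "t \<le> g y" "t \<le> g (Suc y)" using tj fx fy by auto
      note st = steps_raised[OF this(1,2)] steps_raised[OF this(3,4)]
      show False using ty no_N_B[OF Q_like_raised[OF Q] d] no_B_N[OF Q_like_raised[OF Q] d] st tj(5) by auto
    qed
  qed
qed

lemma rise_zero: assumes "rise \<ge> 1" shows "M_step h h' 0" "g (Suc 0) = Suc (g 0)"
proof -
  show "M_step h h' 0" by (rule rise_step) (use assms in simp)
  then show "g (Suc 0) = Suc (g 0)" using gap_step(2) by blast
qed

text \<open>The initial gap is taken again exactly once after the climb; this is where a descent
  below it begins.\<close>

lemma climb_site: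
  assumes "rise \<ge> 1"
  obtains z where "rise < z" "z < P" "g z = g 0" "L_step h h' (z - 1)" "\<And>v. g v = g 0 \<Longrightarrow> v = 0 \<or> v = z"
proof -
  obtain e where e: "e > Suc 0" "g e = g 0" "\<And>v. g v = g 0 \<Longrightarrow> v = 0 \<or> v = e"
    using up_split[OF rise_zero(2)[OF assms] g0] by metis
  have re: "rise < e" using rise_up[of e] e by (cases "rise < e") linarith+
  have eP: "e < P"
  proof (rule ccontr)
    assume "\<not> e < P"
    moreover have ew: "e < zero_from" using e g0 g_end[of e] by (cases "e < zero_from") auto
    ultimately have "P < zero_from" by simp
    then have "e = P \<or> e = Suc P" using P_cases ew \<open>\<not> e < P\<close> by linarith
    then have "g 0 = 1" using e g0 P_zero zero_valley(4)[OF P_zero \<open>P < zero_from\<close>] by auto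
    then have "0 = P - 1" using zero_valley(5)[OF P_zero \<open>P < zero_from\<close>, of 0] by simp
    then show False using rise_P assms by linarith
  qed
  have "\<not> flat (e - 1)"
  proof
    assume "flat (e - 1)"
    then have "g (e - 1) = g 0" using flat_gap(1)[of "e - 1"] e by simp
    then show False using e(3)[of "e - 1"] e(1) by auto
  qed
  then have "L_step h h' (e - 1)" using drop[of "e - 1"] re eP by simp
  then show ?thesis using that[of e] re eP e by blast
qed

lemma no_flat_after:
  assumes z: "rise < z" "z < P" "g z = g 0" "\<And>v. g v = g 0 \<Longrightarrow> v = 0 \<or> v = z"
    and low: "\<And>w. flat w \<Longrightarrow> g w < g 0 \<Longrightarrow> w < y \<Longrightarrow> False" and d: "z \<le> d" "d < y"
  shows "\<not> flat d"
proof
  assume f: "flat d"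
  then have "g d \<le> g z" using g_anti[of z d] z d by (auto simp: flat_def)
  moreover have "g d \<noteq> g z"
  proof
    assume "g d = g z"
    then have "d = 0 \<or> d = z" "Suc d = 0 \<or> Suc d = z" using z(3,4) flat_gap(1)[OF f] by metis+
    then show False using z(1) d by auto
  qed
  ultimately show False using low[OF f] d z by simp
qed

text \<open>The first plateau step below the initial gap would end a descent that starts where the
  climb has returned to that gap, and neither type of plateau is allowed there.\<close>

lemma no_low_flat:
  assumes "rise \<ge> 1" "P = zero_from"
  shows "flat y \<Longrightarrow> g y < g 0 \<Longrightarrow> False"
proof (induction y rule: less_induct)
  case (less y)
  note fy = flat_gap[OF less.prems(1)]
  obtain z where z: "rise < z" "z < P" "g z = g 0" "L_step h h' (z - 1)" "\<And>v. g v = g 0 \<Longrightarrow> v = 0 \<or> v = z"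
    using climb_site[OF assms(1)] by blast
  have zy: "z < y"
  proof (rule ccontr)
    assume "\<not> z < y"
    then have "g z \<le> g y" using less.prems(1) z by (intro g_anti) (auto simp: flat_def)
    then show False using less.prems z by simp
  qed
  have nf: "\<not> flat d" if "z \<le> d" "d < y" for d
    by (rule no_flat_after[OF z(1,2,3,5), where y = y]) (use less.IH that in auto)
  have "g (z + (y - z)) + (y - z) = g z"
    using drops[of z "y - z"] nf less.prems z zy by (auto simp: flat_def)
  then have gy: "g y + (y - z) = g z" using zy by simp
  define t j where "t = g y - 1" and "j = Suc (y - z)"
  have tj: "g y = Suc t" "g z = t + j" "z + (j - 1) = y" "2 \<le> j" "z + j - 1 = y"
    using fy gy zy unfolding t_def j_def by linarith+
  have d: "descends (raised t h h') h' z j"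
    by (rule descent) (use tj less.prems nf assms z in \<open>auto simp: flat_def\<close>)
  have sz: "Suc (z - 1) = z" "g (z - 1) = Suc (g z)" using z gap_step(3)[of "z - 1"] by auto
  have "t \<le> g 0" "t \<le> g (Suc 0)" "t \<le> g (z - 1)" "t \<le> g (Suc (z - 1))" "t \<le> g y" "t \<le> g (Suc y)"
    unfolding sz rise_zero(2)[OF assms(1)] fy(1) using tj z(3) by linarith+
  note st = steps_raised[OF this(1,2)] steps_raised[OF this(3,4)] steps_raised[OF this(5,6)]
  have "g 0 - t = j" using z(3) tj(2) by simp
  then have "climb (raised t h h') h' z j"
    unfolding climb_def gap_raised st(3,4,7,8) using st(3,4,7,8) rise_zero(1)[OF assms(1)] z(4) by blast
  moreover have "N_step (raised t h h') h' (z + j - 1) \<or> B_step (raised t h h') h' (z + j - 1)"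
    unfolding tj(5) st using flat_type[OF less.prems(1)] .
  ultimately show False using no_climb_B[OF Q_like_raised[OF Q] d] no_climb_N[OF Q_like_raised[OF Q] d] by blast
qed

section \<open>Shapes with a box beyond the first zero of the gap\<close>

context
  assumes PW: "P < zero_from"
begin

lemma zero_box: "box h h' P"
proof -
  have P1: "Suc (P - 1) = P" "P - 1 < P" "rise \<le> P - 1" using rise_P by auto
  have "\<not> flat (P - 1)" using flat_gap(3)[of "P - 1"] P1 by auto
  then have "L_step h h' (P - 1)" using drop[OF P1(3,2)] by simp
  moreover have "M_step h h' P" by (rule g_zero[OF P_zero PW])
  moreover have "g (Suc P) = Suc (g (Suc (Suc P)))"
    using zero_valley(4)[OF P_zero PW] g_end[of "Suc (Suc P)"] P_cases[OF PW] by simp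
  then have "L_step h h' (Suc P)" using gap_step(3) by blast
  ultimately show ?thesis by (simp add: box_def)
qed

lemma drops_P:
  assumes "rise \<le> z" "z \<le> P" "\<And>d. z \<le> d \<Longrightarrow> d < P \<Longrightarrow> \<not> flat d"
  shows "g z = P - z"
  using drops[of z "P - z"] assms P_zero by auto

text \<open>After the last such plateau the gap falls straight to zero at P, so a descent would
  connect a plateau with the isolated box.\<close>

lemma no_flat_box: "flat d \<Longrightarrow> rise = 0 \<or> g d < g 0 \<Longrightarrow> False"
proof (induction "P - d" arbitrary: d rule: less_induct)
  case less
  note fd = flat_gap[OF less.prems(1)]
  have nf: "\<not> flat w" if "Suc d \<le> w" "w < P" for w
  proof
    assume "flat w"
    moreover have "g w \<le> g d" using less.prems(1) that by (intro g_anti) (auto simp: flat_def)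
    ultimately show False using less.hyps[of w] less.prems that by fastforce
  qed
  have gz: "g (Suc d) = P - Suc d"
    by (rule drops_P) (use less.prems nf fd in \<open>auto simp: flat_def\<close>)
  have "g d \<noteq> 1"
  proof
    assume "g d = 1"
    then have "d = P - 1 \<or> d = Suc P" using zero_valley(5)[OF P_zero PW] by blast
    then show False using fd(3) by linarith
  qed
  then have j: "2 \<le> P - Suc d" using fd gz by linarith
  have d: "descends (raised 0 h h') h' (Suc d) (P - Suc d)"
    by (rule descent) (use less.prems nf gz j fd in \<open>auto simp: flat_def\<close>)
  have "box h h' (Suc d + (P - Suc d))" using zero_box fd(3) by simp
  then show False using no_N_box[OF Q d[unfolded raised_0]] no_B_box[OF Q d[unfolded raised_0]] flat_type[OF less.prems(1)] by auto
qed

lemma no_rise_box: "rise = 0"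
proof (rule ccontr)
  assume "rise \<noteq> 0"
  then have r: "rise \<ge> 1" by simp
  obtain z where z: "rise < z" "z < P" "g z = g 0" "L_step h h' (z - 1)" "\<And>v. g v = g 0 \<Longrightarrow> v = 0 \<or> v = z"
    using climb_site[OF r] by blast
  have nf: "\<not> flat d" if "z \<le> d" "d < P" for d
    by (rule no_flat_after[OF z(1,2,3,5), where y = P]) (use no_flat_box that in auto)
  have gz: "g z = P - z" by (rule drops_P) (use z nf in auto)
  have "g 0 \<noteq> 1"
  proof
    assume "g 0 = 1"
    then have "0 = P - 1" using zero_valley(5)[OF P_zero PW, of 0] by simp
    then show False using rise_P r by linarith
  qed
  then have j: "2 \<le> P - z" using g0 gz z by linarith
  have d: "descends (raised 0 h h') h' z (P - z)"
    by (rule descent) (use nf gz j z in auto)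
  have "climb h h' z (P - z)" using z gz rise_zero(1)[OF r] by (simp add: climb_def)
  moreover have "box h h' (z + (P - z))" using zero_box z(2) by simp
  ultimately show False by (rule no_climb_box[OF Q d[unfolded raised_0]])
qed

text \<open>Without plateaus and climb the gap is P, P - 1, ..., 1, 0 and then 1 on a single further
  diagonal, while h is 1 up to diagonal P.\<close>

lemma box_shape: "P \<ge> 1 \<and> h = row (Suc P) \<and> h' = complement (P + 2) (row (Suc P))"
proof -
  have nf: "\<not> flat d" for d using no_flat_box no_rise_box by blast
  have c: "h d = h 0" "g d + d = g 0" if "d \<le> P" for d
    using drops[of 0 d] that nf no_rise_box by auto
  have z: "h' (Suc (Suc P)) = 0" "h' (Suc (Suc P) + d) = 0" for d using zero_from_iff P_cases[OF PW] by auto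
  then have "h (Suc (Suc P)) = 0" "h (Suc (Suc P) + d) = 0" for d using hh[of "Suc (Suc P)"] hh[of "Suc (Suc P) + d"] by auto
  note z' = this
  have b: "h (Suc P) = 0" "h P = 1" "g P = 0" "g (Suc P) = 1" 
    using zero_box z' P_zero zero_valley(4)[OF P_zero PW] by (auto simp: box_def L_step_def M_step_def)
  have h: "h d = of_bool (d < Suc P) \<and> h' d = (P + 2 - d) - of_bool (d < Suc P)" for d
  proof -
    consider "d \<le> P" | "d = Suc P" | "d \<ge> Suc (Suc P)" by linarith
    then show ?thesis
    proof cases
      case 1
      then have "h d = 1" "g d + d = P" using c(1)[OF 1] c(1)[of P] c(2)[OF 1] c(2)[of P] b by linarith+
      then show ?thesis using 1 h'_gap[of d] by simp
    next
      case 2 then show ?thesis using b h'_gap[of d] by simp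
    next
      case 3
      then obtain i where "d = Suc (Suc P) + i" using le_Suc_ex by blast
      then show ?thesis using z'(2)[of i] z(2)[of i] by simp
    qed
  qed
  then show ?thesis using rise_P by (auto simp: row_def complement_def fun_eq_iff)
qed

end

section \<open>Shapes whose gap vanishes only at the end\<close>

text \<open>If all plateau steps are N-steps, h never drops and is therefore zero; if all are
  B-steps, the larger shape drops at every step and is a staircase.\<close>

lemma monotone_shape:
  assumes "rise = 0" "P = zero_from"
  shows "h = staircase 0 \<or> h' = staircase P"
proof -
  have zP: "h' d = 0" "h d = 0" if "P \<le> d" for d using zero_from_iff[of d] hh[of d] that assms by auto
  consider "\<forall>d. flat d \<longrightarrow> N_step h h' d" | "\<forall>d. flat d \<longrightarrow> B_step h h' d"
    using no_mixed_flat[OF assms] flat_type N_B by (metis linorder_neqE_nat)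
  then show ?thesis
  proof cases
    case 1
    have "h (Suc d) = h d" if "d < P" for d using 1 drop[of d] that assms by (auto simp: L_step_def N_step_def)
    note hS = this
    have hc: "d \<le> P \<Longrightarrow> h d = h 0" for d
    proof (induction d)
      case (Suc d) then show ?case using hS[of d] by simp
    qed simp
    have "h 0 = 0" using hc[of P] zP(2)[of P] by simp
    then have "h d = 0" for d using height_fn_antimono[OF ah, of 0 d] by simp
    then show ?thesis by (auto simp: staircase_def fun_eq_iff)
  next
    case 2
    have "Suc (h' (Suc d)) = h' d" if "d < P" for d using 2 drop[of d] that assms by (auto simp: L_step_def B_step_def)
    note hS = this
    have hc: "d \<le> P \<Longrightarrow> h' d + d = h' 0" for d
    proof (induction d)
      case (Suc d) then show ?case using hS[of d] by simp
    qed simp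
    have "h' 0 = P" using hc[of P] zP(1)[of P] by simp
    then have "h' d = P - d" for d using hc[of d] zP(1)[of d] by (cases "d \<le> P") (linarith, simp)
    then show ?thesis by (auto simp: staircase_def fun_eq_iff)
  qed
qed

text \<open>The gap rises, stays on one plateau of constant type and falls to zero. Type N makes h
  the staircase of the climb, type B exchanges the two staircases.\<close>

lemma rise_shape:
  assumes r: "rise \<ge> 1" and PW: "P = zero_from"
  shows "\<exists>q b. 1 \<le> q \<and> 1 \<le> b \<and> q + b < P \<and> h = staircase q \<and> h' = complement P (staircase b)"
proof -
  let ?m = "g 0"
  have zP: "h' d = 0" "h d = 0" "g d = 0" if "P \<le> d" for d using zero_from_iff[of d] hh[of d] h'_gap[of d] that PW by auto
  \<comment> \<open>Each value from the initial gap up to below the maximum occurs on the climb and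
    just once more, so a plateau at that level is impossible; lower ones are excluded by
    \<open>no_low_flat\<close>.\<close>
  have top: "g d = ?m + rise" if f: "flat d" for d
  proof (rule ccontr)
    assume ne: "g d \<noteq> ?m + rise"
    have "g d \<le> g rise" using f by (intro g_anti) (auto simp: flat_def)
    then have "g d < ?m + rise" using rise_up[of rise] ne by linarith
    moreover have "\<not> g d < ?m" using no_low_flat[OF assms f] by blast
    ultimately have "g d - ?m < rise" "g d = ?m + (g d - ?m)" by linarith+
    then obtain x where x: "x < rise" "g d = ?m + x" by blast
    have "g x = ?m + x" "g (Suc x) = Suc (g x)" using rise_up[of x] rise_up[of "Suc x"] x by linarith+
    moreover have "g x \<ge> 1" using calculation(1) g0 by linarith
    ultimately obtain e where sp: "\<And>v. g v = g x \<Longrightarrow> v = x \<or> v = e" using up_split[of x] by blast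
    have "g d = g x" using x \<open>g x = ?m + x\<close> by simp
    then have "d = x \<or> d = e" "Suc d = x \<or> Suc d = e" using sp[of d] sp[of "Suc d"] flat_gap(1)[OF f] by simp_all
    then show False using f x by (auto simp: flat_def)
  qed
  define e where "e = (LEAST d. rise \<le> d \<and> \<not> flat d)"
  have "rise \<le> P \<and> \<not> flat P" using rise_P by (auto simp: flat_def)
  then have e: "rise \<le> e" "\<not> flat e" "e \<le> P" 
    using LeastI[of "\<lambda>d. rise \<le> d \<and> \<not> flat d" P] Least_le[of "\<lambda>d. rise \<le> d \<and> \<not> flat d" P] unfolding e_def by blast+
  have fl: "flat d" if "rise \<le> d" "d < e" for d using not_less_Least[of d "\<lambda>d. rise \<le> d \<and> \<not> flat d"] that unfolding e_def by blast
  have ge: "g d = ?m + rise" if "rise \<le> d" "d \<le> e" for d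
    using that
  proof (induction d rule: dec_induct)
    case base show ?case by (rule rise_up) simp
  next
    case (step d) then show ?case using flat_gap(1)[OF fl[of d]] by simp
  qed
  have eP: "e < P" using ge[of e] e P_zero g0 by (cases "e = P") auto
  have de: "g e = Suc (g (Suc e))" using drop[of e] e eP gap_step(3) by blast
  have nf: "\<not> flat d" if "e \<le> d" "d < P" for d
  proof
    assume f: "flat d"
    then have "d \<noteq> e" using e by auto
    then have "g d \<le> g (Suc e)" using that e by (intro g_anti) auto
    then show False using top[OF f] ge[of e] e de by linarith
  qed
  have ce: "h (e + i) = h e" "g (e + i) + i = ?m + rise" if "e + i \<le> P" for i
    using drops[of e i] nf that e ge[of e] by auto
  have P: "P = e + ?m + rise" using ce(2)[of "P - e"] eP P_zero by simp
  have he: "h e = 0" using ce(1)[of "P - e"] eP zP by simp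
  have h0: "h x + x = h 0" if "x \<le> rise" for x
    using that
  proof (induction x)
    case (Suc x) then show ?case using rise_step[of x] by (simp add: M_step_def)
  qed simp
  have G: "g x = P - x" if "e < x" for x
  proof -
    define i where "i = x - e"
    have i: "x = e + i" using that by (simp add: i_def)
    show ?thesis unfolding i using ce(2)[of i] zP(3)[of "e + i"] P by (cases "e + i \<le> P") linarith+
  qed
  have G: "x \<le> rise \<and> g x = ?m + x \<or> rise < x \<and> x \<le> e \<and> g x = ?m + rise \<or> e < x \<and> g x = P - x" for x
    using rise_up[of x] ge[of x] G[of x] by linarith
  have uni: "(\<forall>d. flat d \<longrightarrow> N_step h h' d) \<or> (\<forall>d. flat d \<longrightarrow> B_step h h' d)"
    using flat_type top plateau_type[OF Q] flat_gap(2) by metis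
  then show ?thesis
  proof
    assume N: "\<forall>d. flat d \<longrightarrow> N_step h h' d"
    have "rise \<le> d \<Longrightarrow> d \<le> e \<Longrightarrow> h d = h rise" for d
    proof (induction d rule: dec_induct)
      case (step d) then show ?case using N fl[of d] by (simp add: N_step_def)
    qed simp
    from this[of e] have hr: "h rise = 0" using he e(1) by simp
    have H: "h x = rise - x" for x using h0[of x] h0[of rise] height_fn_antimono[OF ah, of rise x] hr by linarith
    have "h' x = (P - x) - (e - x)" for x using h'_gap[of x] G[of x] H[of x] P e by linarith
    then have "h = staircase rise" "h' = complement P (staircase e)" using H by (auto simp: staircase_def complement_def fun_eq_iff)
    then show ?thesis using r e P g0 by (intro exI[of _ rise] exI[of _ e]) auto
  next
    assume B: "\<forall>d. flat d \<longrightarrow> B_step h h' d"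
    have hB: "rise \<le> d \<Longrightarrow> d \<le> e \<Longrightarrow> h d + d = h 0" for d
    proof (induction d rule: dec_induct)
      case base show ?case by (rule h0) simp
    next
      case (step d)
      then have "Suc (h (Suc d)) = h d" "h d + d = h 0" using B fl[of d] by (simp_all add: B_step_def)
      then show ?case by linarith
    qed
    have H: "h x = e - x" for x
      using hB[of x] hB[of e] h0[of x] he e height_fn_antimono[OF ah, of e x] by linarith
    have "h' x = (P - x) - (rise - x)" for x using h'_gap[of x] G[of x] H[of x] P e by linarith
    then have "h = staircase e" "h' = complement P (staircase rise)" using H by (auto simp: staircase_def complement_def fun_eq_iff)
    then show ?thesis using r e P g0 by (intro exI[of _ e] exI[of _ rise]) auto
  qed
qed

theorem classification:
  "h = staircase 0 \<or> h' = staircase P \<or> (\<exists>q b. 1 \<le> q \<and> 1 \<le> b \<and> q + b < P \<and> h = staircase q \<and> h' = complement P (staircase b))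
   \<or> P \<ge> 1 \<and> h = row (Suc P) \<and> h' = complement (P + 2) (row (Suc P))"
  using box_shape monotone_shape rise_shape P_le by (metis One_nat_def Suc_leI le_neq_implies_less neq0_conv)

end

section \<open>Translation to lists and the main theorem\<close>

lemma height_eq_complement:
  assumes "height_fn l" "l \<in> below (staircase n)" "\<And>x. x \<in> set lam \<longleftrightarrow> 1 \<le> x \<and> x \<le> n \<and> l (x - 1) = l x"
  shows "height lam = complement n l"
proof -
  have "height lam (n - i) = complement n l (n - i)" if "i \<le> n" for i
    using that
  proof (induction i)
    case 0
    have e: "{x \<in> set lam. n < x} = {}" using assms(3) by auto
    then show ?case by (simp add: height_def complement_def e del: Collect_empty_eq)
  next
    case (Suc i)
    let ?d = "n - Suc i"
    have s: "Suc ?d = n - i" using Suc.prems by simp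
    have a: "l (Suc ?d) \<le> l ?d" "l ?d \<le> Suc (l (Suc ?d))" using height_fnD[OF assms(1), of ?d] by auto
    have "Suc ?d \<in> set lam \<longleftrightarrow> l ?d = l (Suc ?d)" using assms(3)[of "Suc ?d"] s by auto
    then have "height lam ?d = complement n l (Suc ?d) + of_bool (l ?d = l (Suc ?d))" using height_step[of lam ?d] Suc s by simp
    then show ?case using complement_id[OF assms(2), of ?d] complement_id[OF assms(2), of "Suc ?d"] a s Suc.prems by (cases "l ?d = l (Suc ?d)") auto
  qed
  then have 1: "height lam d = complement n l d" if "d \<le> n" for d using that by (metis diff_diff_cancel diff_le_self)
  have 2: "height lam d = 0" if "d > n" for d
  proof -
    have e: "{x \<in> set lam. d < x} = {}" using assms(3) that by auto
    show ?thesis unfolding height_def e by simp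
  qed
  show ?thesis
  proof
    fix d show "height lam d = complement n l d" using 1[of d] 2[of d] by (cases "d \<le> n") (auto simp: complement_def)
  qed
qed

text \<open>Equal neighbouring heights mean that x is not a part. The non-parts are listed, as these
  become the parts after complementation; the difference of maximum and minimum is the absolute
  difference.\<close>

lemma staircase_prod_parts:
  "1 \<le> x \<Longrightarrow> staircase_prod a b (x - 1) = staircase_prod a b x \<longleftrightarrow> a + b < x \<or> max a b - min a b < x \<and> odd (a + b + x)"
proof (induction a b rule: staircase_prod.induct)
  case (3 a b)
  consider "x = a + b + 2" | "x < a + b + 2" | "a + b + 2 < x" by linarith
  then show ?case
  proof cases
    case 1
    then have "staircase_prod a b (x - 1) = 0" "staircase_prod a b x = 0" using staircase_prod_props[of a b] by auto
    then show ?thesis using 1 by simp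
  next
    case 2
    have e: "max (Suc a) (Suc b) - min (Suc a) (Suc b) = max a b - min a b" by auto
    have "staircase_prod (Suc a) (Suc b) (x - 1) = staircase_prod (Suc a) (Suc b) x \<longleftrightarrow> staircase_prod a b (x - 1) = staircase_prod a b x" using 2 by auto
    moreover have "a + b < x \<longleftrightarrow> x = a + b + 1" using 2 by auto
    moreover have "max a b - min a b \<le> a + b" by auto
    ultimately show ?thesis using 3 2 e by auto
  next
    case 3
    then have "staircase_prod a b (x - 1) = 0" "staircase_prod a b x = 0" using staircase_prod_props[of a b] by auto
    then show ?thesis using 3 by simp
  qed
qed (auto simp: staircase_def)

lemma steps2_set:
  assumes "b \<le> a" "even (a + b)"
  shows "set (steps2 a b) = {x. b \<le> x \<and> x \<le> a \<and> even (a + x)}"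
proof -
  have "x \<in> set (steps2 a b) \<longleftrightarrow> b \<le> x \<and> x \<le> a \<and> even (a + x)" for x
  proof
    assume "x \<in> set (steps2 a b)"
    then obtain t where "t < (a - b) div 2 + 1" "x = a - 2 * t" by (auto simp: steps2_def simp del: upt_Suc)
    moreover have "2 * ((a - b) div 2) = a - b" using assms by (simp add: even_diff_nat)
    ultimately have "2 * t \<le> a - b" "x + 2 * t = a" "x = a - 2 * t" using assms(1) by linarith+
    then show "b \<le> x \<and> x \<le> a \<and> even (a + x)" using assms(1) by presburger
  next
    assume x: "b \<le> x \<and> x \<le> a \<and> even (a + x)"
    define t where "t = (a - x) div 2"
    have "2 * t = a - x" using x by (simp add: t_def even_diff_nat)
    moreover have "t \<le> (a - b) div 2" unfolding t_def using x by (intro div_le_mono) auto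
    ultimately have "t < (a - b) div 2 + 1" "x = a - 2 * t" using x by linarith+
    then show "x \<in> set (steps2 a b)" by (auto simp: steps2_def simp del: upt_Suc)
  qed
  then show ?thesis by blast
qed

lemma steps2_DP:
  assumes "b \<le> a" "1 \<le> b"
  shows "is_DP (steps2 a b)"
proof -
  have "t \<le> (a - b) div 2 \<Longrightarrow> 2 * t + 1 \<le> a" for t using assms by linarith
  then have "sorted_wrt (>) (map (\<lambda>t. a - 2 * t) [0..<(a - b) div 2 + 1])"
    unfolding sorted_wrt_map by (intro sorted_wrt_mono_rel[OF _ sorted_wrt_upt]) fastforce
  then show ?thesis using \<open>\<And>t. t \<le> (a - b) div 2 \<Longrightarrow> 2 * t + 1 \<le> a\<close>
    by (fastforce simp: is_DP_def steps2_def simp del: upt_Suc)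
qed

lemma DP_append: "is_DP xs \<Longrightarrow> is_DP ys \<Longrightarrow> (\<And>x y. x \<in> set xs \<Longrightarrow> y \<in> set ys \<Longrightarrow> y < x) \<Longrightarrow> is_DP (xs @ ys)"
  by (auto simp: is_DP_def sorted_wrt_append)

text \<open>For r = 0 the first list is empty, so the third and the fourth family are treated as
  one.\<close>

definition trapezoid_nu :: "nat \<Rightarrow> nat \<Rightarrow> nat \<Rightarrow> nat list" where
  "trapezoid_nu p q r = down_from_to (p + q + r) (p + q + 1) @ steps2 (p + q) (nat (max (int p - int q) (int q + 2 - int p)))"

context
  fixes p q r :: nat assumes p: "1 \<le> p" and q: "1 \<le> q"
begin

text \<open>The last part is the least number of the parity of p + q above the absolute difference
  of q and p - 1, the orders of the two staircases.\<close>

lemma last_step: "1 \<le> nat (max (int p - int q) (int q + 2 - int p))" "nat (max (int p - int q) (int q + 2 - int p)) \<le> p + q"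
  "even (p + q + nat (max (int p - int q) (int q + 2 - int p)))"
  "x > max q (p - 1) - min q (p - 1) \<and> even (p + q + x) \<longleftrightarrow> x \<ge> nat (max (int p - int q) (int q + 2 - int p)) \<and> even (p + q + x)"
proof -
  have e: "nat (max (int p - int q) (int q + 2 - int p)) = (if q < p then p - q else q + 2 - p)"
    "max q (p - 1) - min q (p - 1) = (if q < p then p - q - 1 else q + 1 - p)" using p q by auto
  show "1 \<le> nat (max (int p - int q) (int q + 2 - int p))" "nat (max (int p - int q) (int q + 2 - int p)) \<le> p + q"
    unfolding e using p q by auto
  show "even (p + q + nat (max (int p - int q) (int q + 2 - int p)))" unfolding e by (cases "q < p"; simp only: if_True if_False; presburger)
  show "x > max q (p - 1) - min q (p - 1) \<and> even (p + q + x) \<longleftrightarrow>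
      x \<ge> nat (max (int p - int q) (int q + 2 - int p)) \<and> even (p + q + x)"
    unfolding e by (cases "q < p"; simp only: if_True if_False; presburger)
qed

lemma set_trapezoid_nu: "x \<in> set (trapezoid_nu p q r) \<longleftrightarrow> 1 \<le> x \<and> x \<le> p + q + r \<and> staircase_prod q (p - 1) (x - 1) = staircase_prod q (p - 1) x"
proof -
  have "x \<in> set (trapezoid_nu p q r) \<longleftrightarrow> p + q + 1 \<le> x \<and> x \<le> p + q + r \<or>
      max q (p - 1) - min q (p - 1) < x \<and> x \<le> p + q \<and> even (p + q + x)"
    unfolding trapezoid_nu_def set_append set_down steps2_set[OF last_step(2,3)] using last_step(4)[of x] by auto
  also have "\<dots> \<longleftrightarrow> 1 \<le> x \<and> x \<le> p + q + r \<and> (p + q \<le> x \<or> max q (p - 1) - min q (p - 1) < x \<and> even (p + q + x))"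
  proof -
    have c: "(s + 1 \<le> x \<and> x \<le> s + r \<or> A < x \<and> x \<le> s \<and> E) \<longleftrightarrow> 1 \<le> x \<and> x \<le> s + r \<and> (s \<le> x \<or> A < x \<and> E)"
      if "A < s" "x = s \<Longrightarrow> E" for A s E
      using that by (cases E) (simp, presburger)+
    have "max q (p - 1) - min q (p - 1) < p + q" using p q by linarith
    then show ?thesis by (rule c) simp
  qed
  also have "\<dots> \<longleftrightarrow> 1 \<le> x \<and> x \<le> p + q + r \<and> staircase_prod q (p - 1) (x - 1) = staircase_prod q (p - 1) x"
  proof -
    have "odd (q + (p - 1) + x) \<longleftrightarrow> even (p + q + x)" "q + (p - 1) < x \<longleftrightarrow> p + q \<le> x" using p by presburger+
    then show ?thesis using staircase_prod_parts[of x q "p - 1"] by blast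
  qed
  finally show ?thesis .
qed

lemma DP_trapezoid_nu: "is_DP (trapezoid_nu p q r)"
  unfolding trapezoid_nu_def
  by (intro DP_append DP_down steps2_DP last_step) (auto simp: set_down steps2_set[OF last_step(2,3)])

lemma height_down: "height (down_from_to (p + q + r) p) = complement (p + q + r) (staircase (p - 1))"
  unfolding height_stair[symmetric] by (rule height_complement) (use p in \<open>auto simp: set_down set_stair\<close>)

text \<open>The parts missing from p, ..., p + q + r are those of \<open>stair (p - 1)\<close>, so
  the product of the staircases q and p - 1 is what matters.\<close>

lemma trapezoid_identity:
  "chain_sum cs (height (stair q)) (height (down_from_to (p + q + r) p)) = chain_sum cs (staircase 0) (height (trapezoid_nu p q r))"
proof -
  have "height (trapezoid_nu p q r) = complement (p + q + r) (staircase_prod q (p - 1))"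
  proof (rule height_eq_complement[OF _ _ set_trapezoid_nu])
    show "height_fn (staircase_prod q (p - 1))" using staircase_prod_props by blast
    from below_staircase_iff[OF this] show "staircase_prod q (p - 1) \<in> below (staircase (p + q + r))" using width_staircase_prod p by simp
  qed
  then show ?thesis using chain_sum_trapezoid[of q "p - 1" "p + q + r" cs] p by (simp add: height_down height_stair)
qed

end

lemma height_box: assumes "1 \<le> r"
  shows "height ((r + 2) # stair r) = complement (r + 2) (row (r + 1))" "height [r + 1] = row (r + 1)"
    "height ((r + 1) # stair (r - 1)) = complement (r + 2) (\<lambda>d. row (r + 2) d + row r d)"
proof -
  have 1: "height [m] = row m" if "1 \<le> m" for m using that by (auto simp: height_def row_def fun_eq_iff cong: conj_cong)
  show "height [r + 1] = row (r + 1)" by (rule 1) simp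
  show "height ((r + 2) # stair r) = complement (r + 2) (row (r + 1))"
    unfolding 1[symmetric, OF le_add2] by (rule height_complement) (auto simp: set_stair)
  have "is_DP [r + 2, r]" using assms by (simp add: is_DP_def)
  then have "height [r + 2, r] = (\<lambda>d. row (r + 2) d + row r d)" using height_Cons[of "r + 2" "[r]"] 1[OF assms] by (auto simp: row_def fun_eq_iff)
  moreover have "height ((r + 1) # stair (r - 1)) = complement (r + 2) (height [r + 2, r])"
    by (rule height_complement) (use assms in \<open>auto simp: set_stair\<close>)
  ultimately show "height ((r + 1) # stair (r - 1)) = complement (r + 2) (\<lambda>d. row (r + 2) d + row r d)" by simp
qed

section \<open>Basic shapes, uniqueness and the equivalence\<close>

lemma basic_height:
  assumes "is_DP lam" "is_DP mu" "basic lam mu"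
  shows "height mu \<le> height lam" "height mu 0 < height lam 0"
    "height mu z = height lam z \<Longrightarrow> height lam z > 0 \<Longrightarrow> M_step (height mu) (height lam) z"
proof -
  show "height mu \<le> height lam" using height_le_iff[OF assms(1,2)] assms(3) by (simp add: basic_def)
  show "height mu 0 < height lam 0" using assms by (simp add: basic_def height_0)
  assume z: "height mu z = height lam z" "height lam z > 0"
  define i where "i = height lam z"
  have i: "1 \<le> i" "i \<le> length mu" using z height_fn_antimono[OF height_fn_height[of mu], of 0 z] height_0[OF assms(2)] by (auto simp: i_def)
  have b: "part lam i > part mu i" "part mu i \<le> Suc (part lam (i + 1))" using assms(3) i unfolding basic_def by fastforce+
  have "z < part mu i" using part_iff[OF assms(2) i(1), of z] z by (simp add: i_def)
  moreover have "\<not> z < part lam (i + 1)" using part_iff[OF assms(1), of "i + 1" z] by (simp add: i_def)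
  \<comment> \<open>Basicness squeezes \<open>part mu i\<close>: it exceeds z but is at most one
    more than \<open>part lam (i + 1)\<close>, which does not exceed z.\<close>
  ultimately have m: "part mu i = Suc z" using b(2) by linarith
  then have "\<not> i \<le> height mu (Suc z)" using part_iff[OF assms(2) i(1), of "Suc z"] by simp
  moreover have "i \<le> height lam (Suc z)" using part_iff[OF assms(1) i(1), of "Suc z"] m b(1) by simp
  ultimately show "M_step (height mu) (height lam) z"
    using height_fnD[OF height_fn_height, of mu z] height_fnD[OF height_fn_height, of lam z] z unfolding M_step_def i_def by linarith
qed

lemma staircase_zero: "staircase 0 \<le> h" by (simp add: staircase_def le_fun_def)

lemma skew_zero: "height_fn s \<Longrightarrow> skew (staircase 0) s"
  using height_fn_height[of "[]"] unfolding height_Nil by unfold_locales (auto simp: staircase_def)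

lemma rows_zero: "height_fn s \<Longrightarrow> rows (staircase 0) s 0"
  by (intro rows.intro skew_zero rows_axioms.intro) (auto simp: staircase_def)

lemma chain_sum_nonzero: assumes "skew h h'" shows "\<exists>cs. chain_sum cs h h' > 0"
proof -
  interpret skew h h' by fact
  obtain L where "raised L h h' = h'" using raised_max by blast
  from leading_pos[OF this, of 0] show ?thesis unfolding leading_def raised_0 by auto
qed

text \<open>The level sizes of a straight shape are its parts, and proportional Q-functions have
  equal level sizes; one nonzero coefficient then fixes the factor.\<close>

lemma straight_unique:
  assumes s: "height_fn s" "height_fn s'" and k: "k > 0" "k' > 0" and e: "\<And>cs. k * chain_sum cs (staircase 0) s = k' * chain_sum cs (staircase 0) s'"
  shows "s = s' \<and> k = k'"
proof -
  interpret a: rows "staircase 0" s 0 by (rule rows_zero[OF s(1)])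
  interpret b: rows "staircase 0" s' 0 by (rule rows_zero[OF s(2)])
  have "chain_sum cs (staircase 0) s = k' / k * chain_sum cs (staircase 0) s'" for cs using e[of cs] k by (simp add: field_simps)
  then have h: "homog (k' / k) (staircase 0) s (staircase 0) s'" using k by (simp add: homog_def)
  have "Suc i \<le> s d \<longleftrightarrow> Suc i \<le> s' d" for i d
    using homog_level_size_all[OF a.skew_axioms b.skew_axioms h, of i] a.rows_level(2)[of "Suc i" d] b.rows_level(2)[of "Suc i" d] by simp
  note eq = this
  have s: "s = s'"
  proof
    fix d show "s d = s' d" using eq[of "s d" d] eq[of "s' d" d] by linarith
  qed
  obtain cs where "chain_sum cs (staircase 0) s' > 0" using chain_sum_nonzero[OF b.skew_axioms] by blast
  then show ?thesis using e[of cs] s by simp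
qed

lemma DP_remove: "is_DP lam \<Longrightarrow> is_DP (remove_parts lam mu)"
  by (auto simp: is_DP_def remove_parts_def sorted_wrt_filter)

lemma remove_identity:
  assumes "is_DP mu" "height mu \<le> staircase r"
  shows "chain_sum cs (height mu) (staircase r) = chain_sum cs (staircase 0) (height (remove_parts (stair r) mu))"
proof -
  have "set mu \<subseteq> {1..r}"
  proof
    fix x assume "x \<in> set mu"
    then have "1 \<le> x" "height mu (x - 1) > 0" using set_height[OF assms(1), of x] by auto
    moreover have "height mu (x - 1) \<le> staircase r (x - 1)" using assms(2) by (simp add: le_fun_def)
    ultimately show "x \<in> {1..r}" by (simp add: staircase_def)
  qed
  then have "height (remove_parts (stair r) mu) = complement r (height mu)"
    by (intro height_complement) (auto simp: remove_parts_def set_stair)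
  moreover have "height mu \<in> below (staircase r)" using assms(2) by (intro belowI height_fn_height) (simp add: le_fun_def)
  ultimately show ?thesis using chain_sum_stair by simp
qed

theorem theorem4p23:
  fixes lam mu nu :: "nat list" and k :: nat
  assumes "is_DP lam" and "is_DP mu" and "basic lam mu" and "is_DP nu"
  shows "(Qcoeff (skew_diagram lam mu) = (\<lambda>c. k * Qcoeff (shifted_diagram nu) c)) \<longleftrightarrow>
    ((mu = [] \<and> nu = lam \<and> k = 1)
     \<or> (\<exists>r. lam = stair r \<and> 0 < length mu \<and> int (length mu) < int r - 1
            \<and> nu = remove_parts lam mu \<and> k = 1)
     \<or> (\<exists>p q r. 1 \<le> p \<and> 1 \<le> q \<and> 1 \<le> r \<and> lam = down_from_to (p + q + r) p \<and> mu = stair q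
            \<and> nu = down_from_to (p + q + r) (p + q + 1)
                   @ steps2 (p + q) (nat (max (int p - int q) (int q + 2 - int p)))
            \<and> k = 1)
     \<or> (\<exists>p q. 1 \<le> p \<and> 1 \<le> q \<and> lam = down_from_to (p + q) p \<and> mu = stair q
            \<and> nu = steps2 (p + q) (nat (max (int p - int q) (int q - int p + 2)))
            \<and> k = 1)
     \<or> (\<exists>r. 1 \<le> r \<and> lam = (r + 2) # stair r \<and> mu = [r + 1] \<and> nu = (r + 1) # stair (r - 1)
            \<and> k = 2))"
    (is "?Q \<longleftrightarrow> ?i \<or> ?ii \<or> ?iii \<or> ?iv \<or> ?v")
proof -
  note b = basic_height[OF assms(1-3)]
  have Q: "?Q \<longleftrightarrow> (\<forall>cs. chain_sum cs (height mu) (height lam) = real k * chain_sum cs (staircase 0) (height nu))"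
    unfolding skew_diagram_diagram[OF assms(1,2)] shifted_diagram_diagram[OF assms(4)]
    by (rule Qcoeff_eq_iff) (use b(1) staircase_zero skew.ah[OF skew_zero[OF height_fn_height]] in auto)
  have iii_iv: "?iii \<or> ?iv \<longleftrightarrow> (\<exists>p q r. 1 \<le> p \<and> 1 \<le> q \<and> lam = down_from_to (p + q + r) p \<and> mu = stair q \<and> nu = trapezoid_nu p q r \<and> k = 1)"
    (is "_ \<longleftrightarrow> ?t")
  proof -
    have e: "int q + 2 - int p = int q - int p + 2" for p q by simp
    have z: "trapezoid_nu p q 0 = steps2 (p + q) (nat (max (int p - int q) (int q - int p + 2)))" for p q
      unfolding trapezoid_nu_def e by (simp add: down_from_to_def)
    show ?thesis
    proof
      assume "?iii \<or> ?iv"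
      then show ?t
      proof
        assume ?iii then show ?t unfolding trapezoid_nu_def by blast
      next
        assume ?iv
        then obtain p q where "1 \<le> p" "1 \<le> q" "lam = down_from_to (p + q) p" "mu = stair q"
          "nu = steps2 (p + q) (nat (max (int p - int q) (int q - int p + 2)))" "k = 1" by blast
        then show ?t unfolding z[symmetric] by (intro exI[of _ p] exI[of _ q] exI[of _ 0]) simp
      qed
    next
      assume ?t
      then obtain p q r where t: "1 \<le> p" "1 \<le> q" "lam = down_from_to (p + q + r) p" "mu = stair q" "nu = trapezoid_nu p q r" "k = 1"
        by blast
      show "?iii \<or> ?iv"
      proof (cases r)
        case 0
        then have ?iv using t z[of p q] by (intro exI[of _ p] exI[of _ q]) simp
        then show ?thesis ..
      next
        case (Suc i)
        then have ?iii using t unfolding trapezoid_nu_def by (intro exI[of _ p] exI[of _ q] exI[of _ r]) simp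
        then show ?thesis ..
      qed
    qed
  qed
  show ?thesis
  proof
    assume ?Q
    then have e: "chain_sum cs (height mu) (height lam) = real k * chain_sum cs (staircase 0) (height nu)" for cs using Q by blast
    have sk: "skew (height mu) (height lam)" by unfold_locales (use b(1) in \<open>auto simp: le_fun_def\<close>)
    obtain cs where "chain_sum cs (height mu) (height lam) > 0" using chain_sum_nonzero[OF sk] by blast
    then have k: "real k > 0" using e[of cs] by (cases k) auto
    \<comment> \<open>The classification determines only \<open>lam\<close> and \<open>mu\<close>;
      \<open>nu\<close> and \<open>k\<close> follow by comparison with the identity proved for each
      family.\<close>
    have uniq: "nu = nu' \<and> k = k'" if "is_DP nu'" "k' > 0" "\<And>cs. chain_sum cs (height mu) (height lam) = real k' * chain_sum cs (staircase 0) (height nu')" for nu' k'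
    proof -
      have "real k * chain_sum cs (staircase 0) (height nu) = real k' * chain_sum cs (staircase 0) (height nu')" for cs using e[of cs] that(3)[of cs] by linarith
      from straight_unique[OF height_fn_height height_fn_height k _ this] that(2) show ?thesis using height_inj[OF assms(4) that(1)] by simp
    qed
    have "homog (real k) (height mu) (height lam) (staircase 0) (height nu)" using k e by (simp add: homog_def)
    then have "Q_like (height mu) (height lam)" unfolding Q_like_def using sk rows_zero[OF height_fn_height] by blast
    then interpret basic_Q "height mu" "height lam"
      by (intro basic_Q.intro sk basic_Q_axioms.intro b(2,3)) auto
    have trap: ?t if "1 \<le> q" "1 \<le> p" "mu = stair q" "lam = down_from_to (p + q + r) p" for p q r
      using uniq[OF DP_trapezoid_nu[OF that(2,1)], of 1 r] trapezoid_identity[OF that(2,1), of _ r] that by auto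
    from classification obtain n where cl: "height mu = staircase 0 \<or> height lam = staircase n \<or>
      (\<exists>q c. 1 \<le> q \<and> 1 \<le> c \<and> q + c < n \<and> height mu = staircase q \<and> height lam = complement n (staircase c)) \<or>
      n \<ge> 1 \<and> height mu = row (Suc n) \<and> height lam = complement (n + 2) (row (Suc n))" by blast
    then consider "height mu = staircase 0" | "height mu \<noteq> staircase 0" "height lam = staircase n"
      | q c where "1 \<le> q" "1 \<le> c" "q + c < n" "height mu = staircase q" "height lam = complement n (staircase c)"
      | "n \<ge> 1" "height mu = row (Suc n)" "height lam = complement (n + 2) (row (Suc n))" by blast
    then show "?i \<or> ?ii \<or> ?iii \<or> ?iv \<or> ?v"
    proof cases
      case 1
      then have "mu = []" using height_inj[OF assms(2), of "[]"] height_Nil by (simp add: is_DP_def)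
      then show ?thesis using uniq[OF assms(1), of 1] height_Nil by simp
    next
      case 2
      then have lam: "lam = stair n" using height_inj[OF assms(1) DP_stair, of n] by (simp add: height_stair)
      have "mu \<noteq> []" using 2 height_Nil by auto
      have len: "length mu < n" using b(2) height_0[OF assms(2)] unfolding 2(2) staircase_def by simp
      show ?thesis
      proof (cases "length mu < n - 1")
        case True
        have "nu = remove_parts lam mu \<and> k = 1"
          by (rule uniq[OF DP_remove[OF assms(1)]]) (use remove_identity[OF assms(2), of n] b(1) 2 lam in auto)
        then show ?thesis using lam True \<open>mu \<noteq> []\<close> by auto
      next
        case False
        then have lm: "length mu = n - 1" "n \<ge> 2" using len \<open>mu \<noteq> []\<close> by (cases mu; auto)+
        \<comment> \<open>All n - 1 parts of \<open>mu\<close> are below n because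
          \<open>lam\<close> exceeds \<open>mu\<close> in every row, which leaves only
          \<open>stair (n - 1)\<close>. This boundary case belongs to the fourth family with p = 1
          and q = n - 1.\<close>
        have "set mu \<subseteq> {1..n - 1}"
        proof
          fix x assume x: "x \<in> set mu"
          then obtain i where i: "i < length mu" "x = mu ! i" by (metis in_set_conv_nth)
          have "part lam (i + 1) > part mu (i + 1)" using assms(3) i unfolding basic_def by auto
          moreover have "part lam (i + 1) \<le> n"
          proof (rule ccontr)
            assume "\<not> part lam (i + 1) \<le> n"
            then have "i + 1 \<le> height lam n" using part_iff[OF assms(1), of "i + 1" n] by simp
            then show False unfolding 2(2) staircase_def by simp
          qed
          ultimately have "x < n" using i by (simp add: part_def)
          then show "x \<in> {1..n - 1}" using DP_pos[OF assms(2) x] by auto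
        qed
        moreover have "card (set mu) = card {1..n - 1}" using distinct_card[OF DP_distinct[OF assms(2)]] lm by simp
        ultimately have "set mu = {1..n - 1}" by (intro card_subset_eq) auto
        then have "mu = stair (n - 1)" by (intro DP_set_eq[OF assms(2) DP_stair]) (simp add: set_stair)
        moreover have "lam = down_from_to (1 + (n - 1) + 0) 1" using lam lm by (simp add: stair_def down_from_to_def)
        ultimately have ?t using trap[of "n - 1" 1 0] lm by simp
        then show ?thesis using iii_iv by blast
      qed
    next
      case 3
      define r where "r = n - q - c - 1"
      have nq: "n = Suc c + q + r" using 3 by (simp add: r_def)
      have "mu = stair q" using height_inj[OF assms(2) DP_stair, of q] 3 by (simp add: height_stair)
      moreover have "height lam = height (down_from_to n (Suc c))" using height_down[of "Suc c" q r] 3 nq by simp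
      then have "lam = down_from_to n (Suc c)" using height_inj[OF assms(1) DP_down[of "Suc c" n]] by simp
      ultimately have ?t using trap[of q "Suc c" r] 3 nq by simp
      then show ?thesis using iii_iv by blast
    next
      case 4
      note hb = height_box[OF 4(1)]
      have D: "is_DP ((n + 2) # stair n)" "is_DP [n + 1]" "is_DP ((n + 1) # stair (n - 1))" 
        using DP_stair by (auto simp: DP_Cons set_stair) (simp add: is_DP_def)
      have "lam = (n + 2) # stair n" using height_inj[OF assms(1) D(1)] hb(1) 4(3) by simp
      moreover have "mu = [n + 1]" using height_inj[OF assms(2) D(2)] hb(2) 4(2) by simp
      moreover have "nu = (n + 1) # stair (n - 1) \<and> k = 2"
        by (rule uniq[OF D(3)]) (use chain_sum_box_staircase[OF 4(1)] 4 hb in auto)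
      ultimately show ?thesis using 4(1) by blast
    qed
  next
    assume R: "?i \<or> ?ii \<or> ?iii \<or> ?iv \<or> ?v"
    then consider ?i | ?ii | ?t | ?v using iii_iv by blast
    then have "\<forall>cs. chain_sum cs (height mu) (height lam) = real k * chain_sum cs (staircase 0) (height nu)"
    proof cases
      case 1 then show ?thesis by (simp add: height_Nil)
    next
      case 2
      then obtain r where "lam = stair r" "nu = remove_parts lam mu" "k = 1" by blast
      then show ?thesis using remove_identity[OF assms(2), of r] b(1) height_stair by simp
    next
      case 3 then show ?thesis using trapezoid_identity by auto
    next
      case 4
      then obtain r where r: "1 \<le> r" "lam = (r + 2) # stair r" "mu = [r + 1]" "nu = (r + 1) # stair (r - 1)" "k = 2" by blast
      show ?thesis unfolding r(2-5) height_box[OF r(1)] using chain_sum_box_staircase[OF r(1)] by simp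
    qed
    then show ?Q using Q by blast
  qed
qed

end
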